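(* For any $i,j\in I$, we have $$\dim_{q,t}e_i\bar I_j=q^{-d_j}t\sum_{u=0}^{rh^\vee}\sum_{v=0}^{h}\widetilde c_{ij}(u,-v)\,q^ut^{-v}.$$
   Context: Lie data: $\mathfrak g$ is a complex finite-dimensional simple Lie algebra with Cartan matrix $C=(c_{ij})_{i,j\in I}$. Write $i\sim j$ if $i\neq j$ and $c_{ij}<0$. $r\in\{1,2,3\}$ is the lacing number ($1$ for types ADE, $2$ for B, C, F$_4$, $3$ for G$_2$). $(d_i)_{i\in I}$ is the unique tuple of mutually coprime positive integers with $d_ic_{ij}=d_jc_{ji}$ (so $d_i\in\{1,r\}$ and $c_{ij}=-\lceil d_j/d_i\rceil$ if $i\sim j$). $h$ and $h^\vee$ are the Coxeter and dual Coxeter numbers. $(q,t)$-deformed Cartan matrix: $[k]_q=(q^k-q^{-k})/(q-q^{-1})$; $C(q,t)$ has entries $C_{ii}(q,t)=q^{d_i}t^{-1}+q^{-d_i}t$ and $C_{ij}(q,t)=[c_{ij}]_q$ for $i\neq j$. It is invertible in $GL_I(\mathbb Z[\![q,t^{-1}]\!][(qt^{-1})^{-1}])$, with inverse $\widetilde C(q,t)$, and $\widetilde C_{ij}(q,t)=\sum_{u,v\in\mathbb Z}\widetilde c_{ij}(u,v)q^ut^v$ with $\widetilde c_{ij}(u,v)\in\mathbb Z$. Algebra: $\Bbbk$ is an arbitrary field. $\widetilde Q$ is the quiver with vertex set $I$, arrows $\alpha_{ij}\colon j\to i$ for each $(i,j)$ with $i\sim j$, and loops $\varepsilon_i\colon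 i\to i$; $e_i$ is the idempotent at $i$, and $\alpha=e_{t(\alpha)}\alpha e_{s(\alpha)}$ for an arrow $\alpha$ with source $s(\alpha)$ and target $t(\alpha)$. Bigrading: $\deg\alpha_{ij}=(-\max(d_i,d_j),1)$, $\deg\varepsilon_i=(2d_i,0)$. Fix signs $\omega_{ij}=-\omega_{ji}\in\{\pm1\}$ for $i\sim j$. $\widetilde\Pi$ is the quotient of $\Bbbk\widetilde Q$ by (R1) $\varepsilon_i^{-c_{ij}}\alpha_{ij}=\alpha_{ij}\varepsilon_j^{-c_{ji}}$ for $i\sim j$, and (R2) $\sum_{j\sim i}\sum_{k=0}^{-c_{ij}-1}\omega_{ij}\varepsilon_i^k\alpha_{ij}\alpha_{ji}\varepsilon_i^{-c_{ij}-1-k}=0$ for each $i$. Modules: left modules. For a bigraded vector space $V$, $\dim_{q,t}V=\sum_{u,v}(\dim_\Bbbk V_{u,v})q^ut^v$, and $\mathbb D(V)_{u,v}=\mathrm{Hom}_\Bbbk(V_{-u,-v},\Bbbk)$. The dual of a left $\widetilde\Pi$-module is a left $\widetilde\Pi$-module via the anti-involution $e_i\mapsto e_i$, $\alpha_{ij}\mapsto\alpha_{ji}$, $\varepsilon_i\mapsto\varepsilon_i$. $\bar I_i=\mathbb D((\widetilde\Pi/\widetilde\Pi\varepsilon_i)e_i)$, a finite-dimensional bigraded module. *)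

theory Defs
  imports
    "HOL-Analysis.Cartesian_Space"
    "HOL-Computational_Algebra.Formal_Laurent_Series"
    "HOL-Library.Poly_Mapping"
    "HOL-Library.Function_Algebras"
    "HOL-Algebra.QuotRing"
    "HOL-Algebra.Module"
begin

no_notation fps_nth (infixl \<open>$\<close> 75)

section \<open>Cartan matrices of finite type\<close>

definition adj :: "int^'i^'i \<Rightarrow> 'i \<Rightarrow> 'i \<Rightarrow> bool" where
  "adj C i j \<longleftrightarrow> i \<noteq> j \<and> C $ i $ j < 0"

text \<open>By the Cartan--Killing classification and Serre's theorem, the matrices satisfying the
  following predicate are exactly the Cartan matrices of finite-dimensional complex simple Lie
  algebras.  The entry \<open>C $ i $ j\<close> is the value of the simple root \<open>\<alpha>\<^sub>j\<close> on the simple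
  coroot of \<open>\<alpha>\<^sub>i\<close>.\<close>

definition cartan_matrix_of_simple_type :: "int^'i::finite^'i \<Rightarrow> bool" where
  "cartan_matrix_of_simple_type C \<longleftrightarrow>
     (\<forall>i. C $ i $ i = 2) \<and>
     (\<forall>i j. i \<noteq> j \<longrightarrow> C $ i $ j \<le> 0) \<and>
     (\<forall>i j. C $ i $ j = 0 \<longleftrightarrow> C $ j $ i = 0) \<and>
     (\<exists>D :: 'i \<Rightarrow> real.
        (\<forall>i. D i > 0) \<and>
        (\<forall>i j. D i * of_int (C $ i $ j) = D j * of_int (C $ j $ i)) \<and>
        (\<forall>x :: real^'i. x \<noteq> 0 \<longrightarrow>
           (\<Sum>i\<in>UNIV. \<Sum>j\<in>UNIV. x $ i * (D i * of_int (C $ i $ j)) * x $ j) > 0)) \<and>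
     (\<forall>S. S \<noteq> {} \<longrightarrow> S \<noteq> UNIV \<longrightarrow> (\<exists>i\<in>S. \<exists>j\<in>-S. C $ i $ j \<noteq> 0))"

text \<open>``Mutually coprime'' is meant jointly, i.e. the greatest common divisor of all the \<open>d i\<close>
  is 1; in type B, for instance, several of them equal 2.\<close>

definition coprime_symmetrizer :: "int^'i::finite^'i \<Rightarrow> ('i \<Rightarrow> nat) \<Rightarrow> bool" where
  "coprime_symmetrizer C d \<longleftrightarrow>
     (\<forall>i. d i > 0) \<and> Gcd (range d) = 1 \<and>
     (\<forall>i j. int (d i) * C $ i $ j = int (d j) * C $ j $ i)"

definition lacing_number :: "int^'i::finite^'i \<Rightarrow> nat" where
  "lacing_number C = nat (Max (insert 1 {C $ i $ j * C $ j $ i | i j. adj C i j}))"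

text \<open>Reflections on the root lattice (coordinates with respect to the simple roots) and on
  the coroot lattice (coordinates with respect to the simple coroots).\<close>

definition simple_reflection :: "int^'i::finite^'i \<Rightarrow> 'i \<Rightarrow> int^'i \<Rightarrow> int^'i" where
  "simple_reflection C i x = x - axis i ((C *v x) $ i)"

definition simple_coreflection :: "int^'i::finite^'i \<Rightarrow> 'i \<Rightarrow> int^'i \<Rightarrow> int^'i" where
  "simple_coreflection C i y = y - axis i ((y v* C) $ i)"

definition coxeter_element :: "int^'i::finite^'i \<Rightarrow> 'i list \<Rightarrow> int^'i \<Rightarrow> int^'i" where
  "coxeter_element C is = foldr (\<lambda>i w. simple_reflection C i \<circ> w) is id"

text \<open>All Coxeter elements are conjugate, so they have the same order.\<close>

definition coxeter_number :: "int^'i::finite^'i \<Rightarrow> nat" where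
  "coxeter_number C =
     (LEAST n. 0 < n \<and> (\<forall>is. distinct is \<and> set is = UNIV \<longrightarrow> coxeter_element C is ^^ n = id))"

text \<open>\<open>root_coroot C \<beta> \<gamma>\<close>: the vector \<open>\<beta>\<close> is a root and \<open>\<gamma>\<close> is its coroot.\<close>

inductive root_coroot :: "int^'i::finite^'i \<Rightarrow> int^'i \<Rightarrow> int^'i \<Rightarrow> bool" for C where
  simple: "root_coroot C (axis i 1) (axis i 1)"
| reflect: "root_coroot C \<beta> \<gamma> \<Longrightarrow>
    root_coroot C (simple_reflection C i \<beta>) (simple_coreflection C i \<gamma>)"

text \<open>The dual Coxeter number is 1 plus the value of the Weyl vector on the coroot of the highest
  root, i.e. 1 plus the sum of the coordinates of that coroot.\<close>

definition dual_coxeter_number :: "int^'i::finite^'i \<Rightarrow> nat" where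
  "dual_coxeter_number C = nat (1 + (THE m. \<exists>\<theta> \<gamma>. root_coroot C \<theta> \<gamma> \<and>
     (\<forall>\<beta> \<gamma>'. root_coroot C \<beta> \<gamma>' \<longrightarrow> (\<forall>k. \<beta> $ k \<le> \<theta> $ k)) \<and> m = (\<Sum>k\<in>UNIV. \<gamma> $ k)))"


section \<open>The deformed Cartan matrix\<close>

text \<open>The type \<open>int fls fls\<close> is the ring \<open>\<int>((q))((t\<^sup>-\<^sup>1))\<close>: the inner variable is \<open>q\<close>, the outer
  one is the inverse of \<open>t\<close>.  It contains \<open>\<int>[[q, t\<^sup>-\<^sup>1]][(q t\<^sup>-\<^sup>1)\<^sup>-\<^sup>1]\<close> as a subring; an inverse
  of the deformed Cartan matrix over this subring is its unique inverse over the larger ring.\<close>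

type_synonym qt_ring = "int fls fls"

definition qpow :: "int \<Rightarrow> qt_ring" where
  "qpow u = fls_const (fls_X_intpow u)"

definition tpow :: "int \<Rightarrow> qt_ring" where
  "tpow v = fls_X_intpow (- v)"

definition qt_coeff :: "qt_ring \<Rightarrow> int \<Rightarrow> int \<Rightarrow> int" where
  "qt_coeff f u v = fls_nth (fls_nth f (- v)) u"

lemma qt_coeff_monom: "qt_coeff (qpow a * tpow b) u v = (if u = a \<and> v = b then 1 else 0)"
  by (auto simp: qt_coeff_def qpow_def tpow_def fls_X_intpow_times_conv_shift)

definition qint :: "int \<Rightarrow> qt_ring" where
  "qint k = of_int (sgn k) * (\<Sum>m<nat \<bar>k\<bar>. qpow (\<bar>k\<bar> - 1 - 2 * int m))"

lemma qpow_add: "qpow (a + b) = qpow a * qpow b"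
  by (simp add: qpow_def fls_const_mult_const fls_X_intpow_times_fls_X_intpow)

lemma qint_times: "qint k * (qpow 1 - qpow (- 1)) = qpow k - qpow (- k)"
proof -
  have aux: "(\<Sum>m<n. qpow (N - 1 - 2 * int m)) * (qpow 1 - qpow (- 1))
      = qpow N - qpow (N - 2 * int n)" for n N
  proof (induction n)
    case (Suc n)
    then show ?case
      by (simp add: distrib_right right_diff_distrib flip: qpow_add) (simp add: algebra_simps)
  qed simp
  have "(\<Sum>m<nat \<bar>k\<bar>. qpow (\<bar>k\<bar> - 1 - 2 * int m)) * (qpow 1 - qpow (- 1))
      = qpow \<bar>k\<bar> - qpow (- \<bar>k\<bar>)"
    using aux[where N = "\<bar>k\<bar>" and n = "nat \<bar>k\<bar>"] by simp
  then show ?thesis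
    by (cases "k > 0"; cases "k = 0") (simp_all add: qint_def mult.assoc)
qed

definition deformed_cartan :: "int^'i::finite^'i \<Rightarrow> ('i \<Rightarrow> nat) \<Rightarrow> qt_ring^'i^'i" where
  "deformed_cartan C d = (\<chi> i j.
     if i = j then qpow (int (d i)) * tpow (- 1) + qpow (- int (d i)) * tpow 1
     else qint (C $ i $ j))"

definition ctilde :: "int^'i::finite^'i \<Rightarrow> ('i \<Rightarrow> nat) \<Rightarrow> 'i \<Rightarrow> 'i \<Rightarrow> int \<Rightarrow> int \<Rightarrow> int" where
  "ctilde C d i j u v = qt_coeff (matrix_inv (deformed_cartan C d) $ i $ j) u v"


section \<open>The path algebra\<close>

text \<open>\<open>Alpha i j\<close> is the arrow \<open>\<alpha>\<^sub>i\<^sub>j\<close> from \<open>j\<close> to \<open>i\<close>.  A path is a triple of its target, the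
  word of its arrows, and its source; words are read as products, so that in \<open>a # b # w\<close> the
  source of \<open>a\<close> is the target of \<open>b\<close>.\<close>

datatype 'i arrow = Alpha 'i 'i | Eps 'i

fun arrow_target :: "'i arrow \<Rightarrow> 'i" where
  "arrow_target (Alpha i j) = i"
| "arrow_target (Eps i) = i"

fun arrow_source :: "'i arrow \<Rightarrow> 'i" where
  "arrow_source (Alpha i j) = j"
| "arrow_source (Eps i) = i"

fun is_arrow :: "int^'i^'i \<Rightarrow> 'i arrow \<Rightarrow> bool" where
  "is_arrow C (Alpha i j) = adj C i j"
| "is_arrow C (Eps i) = True"

type_synonym 'i path = "'i \<times> 'i arrow list \<times> 'i"

fun is_walk :: "int^'i^'i \<Rightarrow> 'i \<Rightarrow> 'i arrow list \<Rightarrow> 'i \<Rightarrow> bool" where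
  "is_walk C i [] j \<longleftrightarrow> i = j"
| "is_walk C i (a # w) j \<longleftrightarrow> is_arrow C a \<and> arrow_target a = i \<and> is_walk C (arrow_source a) w j"

definition paths :: "int^'i^'i \<Rightarrow> 'i path set" where
  "paths C = {(i, w, j). is_walk C i w j}"

fun path_term :: "'i path \<Rightarrow> 'i path \<Rightarrow> 'k \<Rightarrow> ('i path \<Rightarrow>\<^sub>0 'k::zero)" where
  "path_term (i, w, j) (k, w', l) c =
     (if j = k then Poly_Mapping.single (i, w @ w', l) c else 0)"

definition path_mult ::
    "('i path \<Rightarrow>\<^sub>0 'k::field) \<Rightarrow> ('i path \<Rightarrow>\<^sub>0 'k) \<Rightarrow> ('i path \<Rightarrow>\<^sub>0 'k)" where
  "path_mult x y = (\<Sum>p\<in>Poly_Mapping.keys x. \<Sum>q\<in>Poly_Mapping.keys y.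
     path_term p q (Poly_Mapping.lookup x p * Poly_Mapping.lookup y q))"

definition path_scalar :: "'k \<Rightarrow> ('i::finite path \<Rightarrow>\<^sub>0 'k::field)" where
  "path_scalar c = (\<Sum>i\<in>UNIV. Poly_Mapping.single (i, [], i) c)"

definition path_algebra :: "int^'i::finite^'i \<Rightarrow> ('i path \<Rightarrow>\<^sub>0 'k::field) ring" where
  "path_algebra C =
     \<lparr>carrier = {x. Poly_Mapping.keys x \<subseteq> paths C}, mult = path_mult, one = path_scalar 1,
      zero = 0, add = (+)\<rparr>"

definition gen_e :: "'i \<Rightarrow> ('i path \<Rightarrow>\<^sub>0 'k::field)" where
  "gen_e i = Poly_Mapping.single (i, [], i) 1"

definition gen_alpha :: "'i \<Rightarrow> 'i \<Rightarrow> ('i path \<Rightarrow>\<^sub>0 'k::field)" where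
  "gen_alpha i j = Poly_Mapping.single (i, [Alpha i j], j) 1"

definition gen_eps :: "'i \<Rightarrow> ('i path \<Rightarrow>\<^sub>0 'k::field)" where
  "gen_eps i = Poly_Mapping.single (i, [Eps i], i) 1"

fun arrow_degree :: "('i \<Rightarrow> nat) \<Rightarrow> 'i arrow \<Rightarrow> int \<times> int" where
  "arrow_degree d (Alpha i j) = (- int (max (d i) (d j)), 1)"
| "arrow_degree d (Eps i) = (2 * int (d i), 0)"

fun path_degree :: "('i \<Rightarrow> nat) \<Rightarrow> 'i path \<Rightarrow> int \<times> int" where
  "path_degree d (i, w, j) =
     (\<Sum>a\<leftarrow>w. fst (arrow_degree d a), \<Sum>a\<leftarrow>w. snd (arrow_degree d a))"

definition path_algebra_component ::
    "int^'i::finite^'i \<Rightarrow> ('i \<Rightarrow> nat) \<Rightarrow> int \<Rightarrow> int \<Rightarrow> ('i path \<Rightarrow>\<^sub>0 'k::field) set" where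
  "path_algebra_component C d u v =
     {x \<in> carrier (path_algebra C). \<forall>p\<in>Poly_Mapping.keys x. path_degree d p = (u, v)}"

text \<open>The anti-involution of the path algebra reverses words and exchanges \<open>\<alpha>\<^sub>i\<^sub>j\<close> and \<open>\<alpha>\<^sub>j\<^sub>i\<close>.\<close>

fun opp_arrow :: "'i arrow \<Rightarrow> 'i arrow" where
  "opp_arrow (Alpha i j) = Alpha j i"
| "opp_arrow (Eps i) = Eps i"

fun opp_path :: "'i path \<Rightarrow> 'i path" where
  "opp_path (i, w, j) = (j, rev (map opp_arrow w), i)"

definition path_anti_involution ::
    "('i path \<Rightarrow>\<^sub>0 'k::field) \<Rightarrow> ('i path \<Rightarrow>\<^sub>0 'k)" where
  "path_anti_involution x = (\<Sum>p\<in>Poly_Mapping.keys x.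
     Poly_Mapping.single (opp_path p) (Poly_Mapping.lookup x p))"


section \<open>The generalized preprojective algebra\<close>

text \<open>The signs are taken in the ground field, where only their images matter.\<close>

definition sign_choice :: "int^'i^'i \<Rightarrow> ('i \<Rightarrow> 'i \<Rightarrow> 'k::field) \<Rightarrow> bool" where
  "sign_choice C \<omega> \<longleftrightarrow> (\<forall>i j. adj C i j \<longrightarrow> \<omega> i j \<in> {1, - 1} \<and> \<omega> i j = - \<omega> j i)"

definition relation1 :: "int^'i::finite^'i \<Rightarrow> 'i \<Rightarrow> 'i \<Rightarrow> ('i path \<Rightarrow>\<^sub>0 'k::field)" where
  "relation1 C i j = (let A = path_algebra C in
     gen_eps i [^]\<^bsub>A\<^esub> nat (- C $ i $ j) \<otimes>\<^bsub>A\<^esub> gen_alpha i j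
     - gen_alpha i j \<otimes>\<^bsub>A\<^esub> gen_eps j [^]\<^bsub>A\<^esub> nat (- C $ j $ i))"

definition relation2 ::
    "int^'i::finite^'i \<Rightarrow> ('i \<Rightarrow> 'i \<Rightarrow> 'k) \<Rightarrow> 'i \<Rightarrow> ('i path \<Rightarrow>\<^sub>0 'k::field)" where
  "relation2 C \<omega> i = (let A = path_algebra C in
     \<Sum>j | adj C j i. \<Sum>k<nat (- C $ i $ j).
       path_scalar (\<omega> i j) \<otimes>\<^bsub>A\<^esub> gen_eps i [^]\<^bsub>A\<^esub> k \<otimes>\<^bsub>A\<^esub> gen_alpha i j \<otimes>\<^bsub>A\<^esub> gen_alpha j i
         \<otimes>\<^bsub>A\<^esub> gen_eps i [^]\<^bsub>A\<^esub> (nat (- C $ i $ j) - 1 - k))"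

definition relations ::
    "int^'i::finite^'i \<Rightarrow> ('i \<Rightarrow> 'i \<Rightarrow> 'k) \<Rightarrow> ('i path \<Rightarrow>\<^sub>0 'k::field) set" where
  "relations C \<omega> = {relation1 C i j | i j. adj C i j} \<union> range (relation2 C \<omega>)"

definition relation_ideal ::
    "int^'i::finite^'i \<Rightarrow> ('i \<Rightarrow> 'i \<Rightarrow> 'k) \<Rightarrow> ('i path \<Rightarrow>\<^sub>0 'k::field) set" where
  "relation_ideal C \<omega> = genideal (path_algebra C) (relations C \<omega>)"

definition preproj ::
    "int^'i::finite^'i \<Rightarrow> ('i \<Rightarrow> 'i \<Rightarrow> 'k) \<Rightarrow> ('i path \<Rightarrow>\<^sub>0 'k::field) set ring" where
  "preproj C \<omega> = path_algebra C Quot relation_ideal C \<omega>"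

definition preproj_class ::
    "int^'i::finite^'i \<Rightarrow> ('i \<Rightarrow> 'i \<Rightarrow> 'k) \<Rightarrow> ('i path \<Rightarrow>\<^sub>0 'k::field) \<Rightarrow> ('i path \<Rightarrow>\<^sub>0 'k) set" where
  "preproj_class C \<omega> x = relation_ideal C \<omega> +>\<^bsub>path_algebra C\<^esub> x"


section \<open>Bigraded modules\<close>

text \<open>A left module is recorded by the fields \<open>carrier\<close>, \<open>add\<close>, \<open>zero\<close> and \<open>smult\<close>; the fields
  \<open>mult\<close> and \<open>one\<close>, inherited from the library's record of modules, play no role.\<close>

record ('a, 'm) bigraded_module = "('a, 'm) module" +
  component :: "int \<Rightarrow> int \<Rightarrow> 'm set"

text \<open>Linear functionals on a left module over a \<open>'k\<close>-algebra with structure map \<open>\<iota>\<close>, extended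
  by 0 outside the carrier.\<close>

definition functionals ::
    "('k::field \<Rightarrow> 'a) \<Rightarrow> ('a, 'm) bigraded_module \<Rightarrow> ('m \<Rightarrow> 'k) set" where
  "functionals \<iota> V = {f.
     (\<forall>x\<in>carrier V. \<forall>y\<in>carrier V. f (x \<oplus>\<^bsub>V\<^esub> y) = f x + f y) \<and>
     (\<forall>c. \<forall>x\<in>carrier V. f (\<iota> c \<odot>\<^bsub>V\<^esub> x) = c * f x) \<and>
     (\<forall>x. x \<notin> carrier V \<longrightarrow> f x = 0)}"

text \<open>The graded dual.  A functional on \<open>V\<^sub>-\<^sub>u\<^sub>,\<^sub>-\<^sub>v\<close> is identified with its extension to \<open>V\<close> by 0 on
  the other homogeneous components.  The algebra acts through its anti-involution \<open>\<sigma>\<close>.\<close>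

definition graded_dual ::
    "('k::field \<Rightarrow> 'a) \<Rightarrow> ('a \<Rightarrow> 'a) \<Rightarrow> ('a, 'm) bigraded_module
      \<Rightarrow> ('a, 'm \<Rightarrow> 'k) bigraded_module" where
  "graded_dual \<iota> \<sigma> V =
     \<lparr>carrier = {f \<in> functionals \<iota> V. finite {(u, v). \<exists>x\<in>component V u v. f x \<noteq> 0}},
      mult = undefined, one = undefined, zero = (\<lambda>_. 0), add = (\<lambda>f g x. f x + g x),
      smult = (\<lambda>a f x. if x \<in> carrier V then f (\<sigma> a \<odot>\<^bsub>V\<^esub> x) else 0),
      component = (\<lambda>u v. {f \<in> functionals \<iota> V.
        \<forall>u' v'. (u', v') \<noteq> (- u, - v) \<longrightarrow> (\<forall>x\<in>component V u' v'. f x = 0)})\<rparr>"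

text \<open>For a homogeneous element \<open>a\<close> of degree 0, the homogeneous components of \<open>a V\<close>.\<close>

definition image_component ::
    "'a \<Rightarrow> ('a, 'm) bigraded_module \<Rightarrow> int \<Rightarrow> int \<Rightarrow> 'm set" where
  "image_component a V u v = (\<lambda>x. a \<odot>\<^bsub>V\<^esub> x) ` component V u v"

text \<open>The bigraded dimension, as the coefficient function of the formal sum.\<close>

definition qt_dim :: "(int \<Rightarrow> int \<Rightarrow> ('m \<Rightarrow> 'k::field) set) \<Rightarrow> int \<Rightarrow> int \<Rightarrow> int" where
  "qt_dim W u v = int (vector_space.dim (\<lambda>c f x. c * f x) (W u v))"


section \<open>The dual modules\<close>

definition eps_left_ideal ::
    "int^'i::finite^'i \<Rightarrow> ('i \<Rightarrow> 'i \<Rightarrow> 'k) \<Rightarrow> 'i \<Rightarrow> ('i path \<Rightarrow>\<^sub>0 'k::field) set set" where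
  "eps_left_ideal C \<omega> i =
     (\<lambda>x. x \<otimes>\<^bsub>preproj C \<omega>\<^esub> preproj_class C \<omega> (gen_eps i)) ` carrier (preproj C \<omega>)"

text \<open>Right multiplication by the idempotent at \<open>i\<close> preserves the left ideal generated by the loop
  at \<open>i\<close>, so the quotient by this left ideal can be multiplied by the idempotent on the right.\<close>

definition eps_quotient ::
    "int^'i::finite^'i \<Rightarrow> ('i \<Rightarrow> nat) \<Rightarrow> ('i \<Rightarrow> 'i \<Rightarrow> 'k) \<Rightarrow> 'i
      \<Rightarrow> (('i path \<Rightarrow>\<^sub>0 'k::field) set, ('i path \<Rightarrow>\<^sub>0 'k) set set) bigraded_module" where
  "eps_quotient C d \<omega> i =
     (let P = preproj C \<omega>; L = eps_left_ideal C \<omega> i; cl = preproj_class C \<omega> in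
      \<lparr>carrier = {L +>\<^bsub>P\<^esub> (x \<otimes>\<^bsub>P\<^esub> cl (gen_e i)) | x. x \<in> carrier P},
       mult = undefined, one = undefined, zero = L, add = set_add P,
       smult = (\<lambda>a X. \<Union>y\<in>X. L +>\<^bsub>P\<^esub> (a \<otimes>\<^bsub>P\<^esub> y)),
       component = (\<lambda>u v. {L +>\<^bsub>P\<^esub> (cl x \<otimes>\<^bsub>P\<^esub> cl (gen_e i)) | x.
         x \<in> path_algebra_component C d u v})\<rparr>)"

definition Ibar ::
    "int^'i::finite^'i \<Rightarrow> ('i \<Rightarrow> nat) \<Rightarrow> ('i \<Rightarrow> 'i \<Rightarrow> 'k) \<Rightarrow> 'i
      \<Rightarrow> (('i path \<Rightarrow>\<^sub>0 'k::field) set, ('i path \<Rightarrow>\<^sub>0 'k) set set \<Rightarrow> 'k) bigraded_module" where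
  "Ibar C d \<omega> i = graded_dual (\<lambda>c. preproj_class C \<omega> (path_scalar c))
     (\<lambda>X. path_anti_involution ` X) (eps_quotient C d \<omega> i)"

end

theory Submission
  imports Defs
begin

text \<open>The part at vertex \<open>i\<close> of the dual module is a space of functions on the walks from \<open>j\<close> to
  \<open>i\<close> that kill the relations; let its level be the number of arrows \<open>\<alpha>\<close>.  Without the second
  relation to the left of the first \<open>\<alpha>\<close>, the space of level \<open>a + 2\<close> is a direct sum of spaces of
  level \<open>a + 1\<close>, and that relation is a map \<open>\<Psi>\<close> from it to level \<open>a\<close>, whose kernel is level \<open>a + 2\<close>.
  Hence, as long as the maps \<open>\<Psi>\<close> are surjective, the graded dimensions obey the three-term recursion
  of the coefficients of \<open>t\<^sup>-\<^sup>v\<close> in the inverse of the deformed Cartan matrix.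

  If \<open>\<Psi>\<close> fails to be surjective onto level \<open>a\<close>, a functional on the cokernel and a socle vector give an
  endomorphism of that level of rank one.  Since endomorphisms are scalar, level \<open>a + 1\<close> vanishes.  At
  \<open>q = 1\<close> the recursion runs through positive vectors until it first vanishes, at \<open>v = h\<close>; so \<open>\<Psi>\<close> is
  surjective in the range needed, the coefficients with \<open>v \<le> h\<close> are nonnegative, and the levels from
  \<open>h - 1\<close> on vanish.

  The coefficients with \<open>v = h - 1\<close> then form a permutation matrix times powers of \<open>q\<close>.  These powers
  are found by differentiating the recursion at \<open>q = 1\<close>: they are sums over the positive roots, which
  pairing with the highest root evaluates in terms of \<open>h\<^sup>\<or>\<close>.  The recursion read backwards from
  \<open>v = h\<close> is symmetric, and this bounds all degrees in \<open>q\<close> by \<open>r h\<^sup>\<or>\<close>.\<close>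

text \<open>Nothing is read off from the classification: constants come from positive definiteness,
  and the nonnegativity that the degree argument needs comes from the modules. The module is
  dualised because killing relations is a linear condition on functions on words; graded pieces are
  then kernels of maps, and no basis of the algebra has to be exhibited, over any field. Why
  differentiate: for \<open>v = h - 1\<close> the value at \<open>q = 1\<close> shows that an entry
  is a power of \<open>q\<close>, and the derivative is its exponent. Along a reduced word of the
  longest element each letter adds a multiple of a simple root to the derivative; paired with a
  fixed vector, the total becomes the sum of (x, \<beta>)(y, \<beta>) over the positive roots
  \<beta>. So the exponent plus d_j is the ratio of this form to the invariant form. For the highest
  root \<theta> every pairing with a positive \<beta> \<noteq> \<theta> is 0 or (\<theta>,
  \<theta>)/2, so the squares become linear in \<beta>, and the positive roots add up to 2 \<rho>.
  The Coxeter number enters because two consecutive coefficients at \<open>q = 1\<close> add up to a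
  root in an orbit of alternating bipartite reflections; that roots have a sign keeps the sequence
  positive until it vanishes.\<close>

lemma adj_iff: "adj C i j \<longleftrightarrow> i \<noteq> j \<and> C $ i $ j < 0"
  by (simp add: adj_def)

section \<open>Cartan matrices: symmetrizer and connectedness\<close>

locale simple_cartan =
  fixes C :: "int^'i::finite^'i" and d :: "'i \<Rightarrow> nat"
  assumes cartan: "cartan_matrix_of_simple_type C"
    and coprime_symm: "coprime_symmetrizer C d"
begin

definition D :: "'i \<Rightarrow> int" where "D i = int (d i)"

lemma diag [simp]: "C $ i $ i = 2"
  using cartan by (simp add: cartan_matrix_of_simple_type_def)

lemma offdiag_le: "i \<noteq> j \<Longrightarrow> C $ i $ j \<le> 0"
  using cartan by (simp add: cartan_matrix_of_simple_type_def)

lemma D_pos [simp]: "D i > 0"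
  using coprime_symm by (simp add: coprime_symmetrizer_def D_def)

lemma D_nz [simp]: "D i \<noteq> 0"
  using D_pos[of i] by linarith

lemma D_symm: "D i * C $ i $ j = D j * C $ j $ i"
  using coprime_symm by (simp add: coprime_symmetrizer_def D_def)

lemma Gcd_d: "Gcd (range d) = 1"
  using coprime_symm by (simp add: coprime_symmetrizer_def)

lemma zero_sym: "C $ i $ j = 0 \<longleftrightarrow> C $ j $ i = 0"
  using cartan by (simp add: cartan_matrix_of_simple_type_def)

lemma adj_neg: "adj C i j \<Longrightarrow> C $ i $ j < 0"
  by (simp add: adj_def)

lemma not_adj_zero: "\<not> adj C i j \<Longrightarrow> i \<noteq> j \<Longrightarrow> C $ i $ j = 0"
  using offdiag_le[of i j] by (auto simp: adj_def)

lemma adj_sym: "adj C i j \<longleftrightarrow> adj C j i"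
  using zero_sym[of i j] offdiag_le[of i j] offdiag_le[of j i]
  by (auto simp: adj_def order.strict_iff_order)

lemma adj_irrefl [simp]: "\<not> adj C i i"
  by (simp add: adj_def)

text \<open>Irreducibility of \<open>C\<close>, as an induction principle along the edges of the
  Dynkin diagram.\<close>

lemma connected:
  assumes "i \<in> S" and "\<And>k l. k \<in> S \<Longrightarrow> adj C k l \<Longrightarrow> l \<in> S"
  shows "l \<in> S"
proof (rule ccontr)
  assume "l \<notin> S"
  then have "S \<noteq> {}" "S \<noteq> UNIV" using assms(1) by auto
  then obtain a b where ab: "a \<in> S" "b \<notin> S" "C $ a $ b \<noteq> 0"
    using cartan unfolding cartan_matrix_of_simple_type_def by (meson ComplD)
  then have "adj C a b" using offdiag_le[of a b] by (metis adj_iff order.not_eq_order_implies_strict)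
  then show False using assms(2) ab by blast
qed

lemma connected_eq:
  assumes "\<And>k l. adj C k l \<Longrightarrow> f k = f l"
  shows "f i = f j"
proof -
  have "j \<in> {k. f k = f i}"
  proof (rule connected[of i])
    fix k l assume "k \<in> {k. f k = f i}" and "adj C k l"
    then show "l \<in> {k. f k = f i}" using assms[of k l] by (metis mem_Collect_eq)
  qed simp
  then show ?thesis by simp
qed

subsection \<open>The symmetrized form\<close>

text \<open>The Weyl-invariant form on the root lattice, normalised so that the simple root at
  \<open>i\<close> has norm \<open>2 * D i\<close>.\<close>

definition B :: "int^'i \<Rightarrow> int^'i \<Rightarrow> int" where
  "B x y = (\<Sum>i\<in>UNIV. \<Sum>j\<in>UNIV. x $ i * (D i * C $ i $ j) * y $ j)"

text \<open>Positive definiteness is given for some real symmetrizer \<open>E\<close>. As the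
  diagram is connected, two symmetrizers differ by a positive factor, so it carries over to
  \<open>D\<close>.\<close>

lemma posdef_real:
  fixes x :: "real^'i"
  assumes "x \<noteq> 0"
  shows "(\<Sum>i\<in>UNIV. \<Sum>j\<in>UNIV. x $ i * real_of_int (D i * C $ i $ j) * x $ j) > 0"
proof -
  have "\<exists>E :: 'i \<Rightarrow> real. (\<forall>i. E i > 0) \<and>
      (\<forall>i j. E i * of_int (C $ i $ j) = E j * of_int (C $ j $ i)) \<and>
      (\<forall>x :: real^'i. x \<noteq> 0 \<longrightarrow>
           (\<Sum>i\<in>UNIV. \<Sum>j\<in>UNIV. x $ i * (E i * of_int (C $ i $ j)) * x $ j) > 0)"
    using cartan unfolding cartan_matrix_of_simple_type_def by (elim conjE)
  then obtain E :: "'i \<Rightarrow> real" where E0: "\<forall>i. E i > 0"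
    "\<forall>i j. E i * of_int (C $ i $ j) = E j * of_int (C $ j $ i)"
    "\<forall>x :: real^'i. x \<noteq> 0 \<longrightarrow>
       (\<Sum>i\<in>UNIV. \<Sum>j\<in>UNIV. x $ i * (E i * of_int (C $ i $ j)) * x $ j) > 0"
    by (elim exE conjE) (rule that)
  note E = E0(1,2)[rule_format] E0(3)[rule_format, OF assms]
  have ratio: "real_of_int (D i) / E i = real_of_int (D j) / E j" for i j
  proof (rule connected_eq)
    fix k l assume "adj C k l"
    then have nz: "real_of_int (C $ k $ l) \<noteq> 0" by (simp add: adj_def)
    have 1: "real_of_int (D k) * real_of_int (C $ k $ l) = real_of_int (D l) * real_of_int (C $ l $ k)"
      using D_symm[of k l] by (metis of_int_mult)
    have 2: "E k * real_of_int (C $ k $ l) = E l * real_of_int (C $ l $ k)" by (rule E)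
    have "(real_of_int (D k) * E l) * real_of_int (C $ l $ k) = real_of_int (D k) * (E k * real_of_int (C $ k $ l))"
      using 2 by simp
    also have "\<dots> = (real_of_int (D k) * real_of_int (C $ k $ l)) * E k" by (simp only: ac_simps)
    also have "\<dots> = (real_of_int (D l) * E k) * real_of_int (C $ l $ k)" unfolding 1 by (simp only: ac_simps)
    finally have "(real_of_int (D k) * E l) * real_of_int (C $ l $ k) = (real_of_int (D l) * E k) * real_of_int (C $ l $ k)" .
    moreover have "real_of_int (C $ l $ k) \<noteq> 0" using nz zero_sym by simp
    ultimately have "real_of_int (D k) * E l = real_of_int (D l) * E k" by simp
    then show "real_of_int (D k) / E k = real_of_int (D l) / E l" using E(1) by (simp add: field_simps less_imp_neq[symmetric])
  qed
  obtain k :: 'i where True by blast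
  define r where "r = real_of_int (D k) / E k"
  have r: "r > 0" using E(1) by (simp add: r_def)
  have DE: "real_of_int (D i) = r * E i" for i
    using ratio[of i k] E(1)[of i] by (simp add: r_def field_simps)
  have "(\<Sum>i\<in>UNIV. \<Sum>j\<in>UNIV. x $ i * real_of_int (D i * C $ i $ j) * x $ j)
    = r * (\<Sum>i\<in>UNIV. \<Sum>j\<in>UNIV. x $ i * (E i * of_int (C $ i $ j)) * x $ j)"
    by (simp add: DE sum_distrib_left algebra_simps)
  then show ?thesis using E(3) r by simp
qed

lemma B_pos:
  assumes "x \<noteq> 0" shows "B x x > 0"
proof -
  define z :: "real^'i" where "z = (\<chi> i. real_of_int (x $ i))"
  have "z \<noteq> 0" using assms by (auto simp: z_def vec_eq_iff)
  from posdef_real[OF this] have "real_of_int (B x x) > 0"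
    by (simp add: B_def z_def)
  then show ?thesis by simp
qed

lemma B_sym: "B x y = B y x"
proof -
  have "x $ i * (D i * C $ i $ j) * y $ j = y $ j * (D j * C $ j $ i) * x $ i" for i j
    using D_symm[of i j] by simp
  then have "B x y = (\<Sum>i\<in>UNIV. \<Sum>j\<in>UNIV. y $ j * (D j * C $ j $ i) * x $ i)"
    unfolding B_def by (intro sum.cong refl) blast
  also have "\<dots> = B y x"
    unfolding B_def by (rule sum.swap)
  finally show ?thesis .
qed

lemma B_add: "B x (y + z) = B x y + B x z"
  by (simp add: B_def algebra_simps sum.distrib)

lemma B_diff: "B x (y - z) = B x y - B x z"
  by (simp add: B_def algebra_simps sum_subtractf)

lemma B_minus: "B x (- y) = - B x y"
  by (simp add: B_def sum_negf)

lemma B_scale: "B x (a *s y) = a * B x y"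
  by (simp add: B_def sum_distrib_left algebra_simps)

lemma B_zero: "B x 0 = 0"
  by (simp add: B_def)

lemma B_add': "B (y + z) x = B y x + B z x" by (simp only: B_sym[of _ x] B_add)
lemma B_diff': "B (y - z) x = B y x - B z x" by (simp only: B_sym[of _ x] B_diff)
lemma B_scale': "B (a *s y) x = a * B y x" by (simp only: B_sym[of _ x] B_scale)

lemma B_sum: "finite S \<Longrightarrow> B x (\<Sum>s\<in>S. f s) = (\<Sum>s\<in>S. B x (f s))"
  by (induction S rule: finite_induct) (simp_all add: B_zero B_add)

lemma B_axis: "B (axis i 1) x = D i * (C *v x) $ i"
proof -
  have "B (axis i 1) x = (\<Sum>k\<in>UNIV. if k = i then \<Sum>j\<in>UNIV. D i * C $ i $ j * x $ j else 0)"
    unfolding B_def by (intro sum.cong refl) (auto simp: axis_def)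
  then show ?thesis by (simp add: matrix_vector_mult_def sum_distrib_left mult.assoc)
qed

lemma C_axis: "(C *v axis j 1) $ i = C $ i $ j"
  by (simp add: matrix_vector_mult_def axis_def if_distrib cong: if_cong)

lemma B_axis_axis: "B (axis i 1) (axis j 1) = D i * C $ i $ j"
  unfolding B_axis C_axis ..

lemma vec_sum_axis: "x = (\<Sum>i\<in>UNIV. x $ i *s axis i (1::int))" for x :: "int^'i"
  by (simp add: vec_eq_iff axis_def if_distrib cong: if_cong)

lemma B_coord: "B x y = (\<Sum>i\<in>UNIV. x $ i * B (axis i 1) y)"
  unfolding B_axis by (simp add: B_def matrix_vector_mult_def sum_distrib_left mult.assoc)

section \<open>The Dynkin diagram: bonds, leaves, two-colouring\<close>

lemma prod_lt_4:
  assumes "i \<noteq> j" shows "C $ i $ j * C $ j $ i < 4"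
proof -
  define a where "a = C $ i $ j"
  define b where "b = C $ j $ i"
  \<comment> \<open>Up to a factor 2 this minimises the form on the j-th simple root plus multiples
    of the i-th; its norm is \<open>2 * D j * (4 - a * b)\<close>.\<close>
  define x :: "int^'i" where "x = (- a) *s axis i 1 + 2 *s axis j 1"
  have "x $ j = 2" using assms by (simp add: x_def axis_def)
  then have "x \<noteq> 0" by auto
  then have "B x x > 0" by (rule B_pos)
  moreover have "B x x = a * a * (D i * 2) - 4 * a * (D i * a) + 4 * (D j * 2)"
    unfolding x_def using D_symm[of i j]
    by (simp add: B_add B_add' B_scale B_scale' B_axis_axis B_minus algebra_simps
        flip: a_def)
  ultimately have "D i * a * a < 4 * D j" by (simp add: algebra_simps)
  then have "D j * (b * a) < D j * 4" using D_symm[of i j] by (simp add: a_def b_def algebra_simps)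
  then show ?thesis using D_pos[of j] by (simp add: a_def b_def mult.commute)
qed

lemma one_of_two:
  assumes "adj C i j" shows "C $ i $ j = -1 \<or> C $ j $ i = -1"
proof (rule ccontr)
  assume "\<not> ?thesis"
  moreover have "C $ i $ j < 0" "C $ j $ i < 0" using assms adj_sym[of i j] adj_neg[of i j] adj_neg[of j i] by auto
  ultimately have "- (C $ i $ j) \<ge> 2" "- (C $ j $ i) \<ge> 2" by auto
  then have "2 * 2 \<le> - (C $ i $ j) * - (C $ j $ i)" by (intro mult_mono) auto
  moreover have "i \<noteq> j" using assms by (simp add: adj_def)
  ultimately show False using prod_lt_4[of i j] by simp
qed

text \<open>If every vertex of a set had two neighbours in it, the vector with entries
  \<open>1 / sqrt (D i)\<close> on that set would contradict positive definiteness.\<close>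

lemma leaf_exists:
  assumes "S \<noteq> {}"
  shows "\<exists>l\<in>S. card {k \<in> S. adj C l k} \<le> 1"
proof (rule ccontr)
  assume neg: "\<not> ?thesis"
  have deg: "card {k \<in> S. adj C l k} \<ge> 2" if "l \<in> S" for l
  proof -
    have "\<not> card {k \<in> S. adj C l k} \<le> 1" using neg that by blast
    then show ?thesis by simp
  qed
  define x :: "real^'i" where "x = (\<chi> i. if i \<in> S then 1 / sqrt (D i) else 0)"
  obtain s where s: "s \<in> S" using assms by auto
  have "x $ s \<noteq> 0" using s by (simp add: x_def less_imp_neq[symmetric])
  then have "x \<noteq> 0" by auto
  then have pos: "(\<Sum>i\<in>UNIV. \<Sum>j\<in>UNIV. x $ i * real_of_int (D i * C $ i $ j) * x $ j) > 0"
    by (rule posdef_real)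
  have entry: "x $ i * real_of_int (D i * C $ i $ j) * x $ j \<le>
      (if i \<in> S then (if j = i then 2 else 0) - (if j \<in> {k \<in> S. adj C i k} then 1 else 0) else 0)" for i j
  proof (cases "i \<in> S \<and> j \<in> S")
    case True
    have Dpos: "real_of_int (D i) > 0" "real_of_int (D j) > 0" by simp_all
    show ?thesis
    proof (cases "i = j")
      case True
      have "x $ i * (D i * C $ i $ i) * x $ i = 2 * (D i / (sqrt (D i) * sqrt (D i)))"
        using \<open>i \<in> S \<and> j \<in> S\<close> by (simp add: x_def)
      also have "\<dots> = 2" using Dpos(1) by (simp add: abs_of_pos less_imp_neq[OF Dpos(1), symmetric])
      finally show ?thesis using True \<open>i \<in> S \<and> j \<in> S\<close> by simp
    next
      case False
      show ?thesis
      proof (cases "adj C i j")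
        case True
        define a where "a = - (C $ i $ j)"
        define b where "b = - (C $ j $ i)"
        have ab: "a \<ge> 1" "b \<ge> 1" using True adj_sym[of i j] adj_neg[of i j] adj_neg[of j i] by (auto simp: a_def b_def)
        \<comment> \<open>The entry to be bounded is \<open>- D i * a / sqrt (D i * D j)\<close>,
          which by symmetry is minus the square root of \<open>a * b\<close>, hence at most
          -1.\<close>
        have "D i * a = D j * b" using D_symm[of i j] by (simp add: a_def b_def)
        then have "(D i * a) * (D i * a) = (D i * a) * (D j * b)" by simp
        also have "\<dots> = (D i * D j) * (a * b)" by (simp only: ac_simps)
        finally have "(D i * a) * (D i * a) = (D i * D j) * (a * b)" .
        moreover have "a * b \<ge> 1" using ab mult_mono[of 1 a 1 b] by simp
        then have "D i * D j * 1 \<le> D i * D j * (a * b)"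
          by (intro mult_left_mono) (simp_all add: less_imp_le)
        ultimately have "D i * D j \<le> (D i * a) * (D i * a)" by linarith
        then have "real_of_int (D i * D j) \<le> (real_of_int (D i * a))\<^sup>2"
          by (simp add: power2_eq_square del: of_int_mult flip: of_int_mult)
        then have "sqrt (real_of_int (D i * D j)) \<le> real_of_int (D i * a)"
          using ab by (intro real_le_lsqrt) (auto intro!: mult_nonneg_nonneg simp: less_imp_le)
        then have "sqrt (D i) * sqrt (D j) \<le> D i * real_of_int a"
          by (simp add: real_sqrt_mult)
        then have "1 \<le> D i * real_of_int a / (sqrt (D i) * sqrt (D j))"
          using Dpos by (simp add: le_divide_eq)
        moreover have "x $ i * real_of_int (D i * C $ i $ j) * x $ j = - (D i * real_of_int a / (sqrt (D i) * sqrt (D j)))"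
          using \<open>i \<in> S \<and> j \<in> S\<close> by (simp add: x_def a_def)
        ultimately show ?thesis using True False \<open>i \<in> S \<and> j \<in> S\<close> by simp
      qed (use False not_adj_zero \<open>i \<in> S \<and> j \<in> S\<close> in auto)
    qed
  qed (auto simp: x_def)
  have "(\<Sum>i\<in>UNIV. \<Sum>j\<in>UNIV. x $ i * real_of_int (D i * C $ i $ j) * x $ j)
     \<le> (\<Sum>i\<in>UNIV. \<Sum>j\<in>UNIV. (if i \<in> S then (if j = i then 2 else 0) - (if j \<in> {k \<in> S. adj C i k} then 1 else 0) else 0))"
    by (intro sum_mono entry)
  also have "\<dots> = (\<Sum>i\<in>UNIV. if i \<in> S then 2 - real (card {k \<in> S. adj C i k}) else 0)"
    by (intro sum.cong refl) (simp add: sum_subtractf flip: sum.inter_filter)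
  also have "\<dots> \<le> (\<Sum>i\<in>(UNIV::'i set). 0)"
    by (intro sum_mono) (use deg in force)
  finally show False using pos by simp
qed

text \<open>Remove a leaf, colour the rest, and give the leaf the colour opposite to that of its
  only neighbour.\<close>

lemma coloring_exists: "\<exists>colour :: 'i \<Rightarrow> bool. \<forall>i j. adj C i j \<longrightarrow> colour i \<noteq> colour j"
proof -
  have "\<exists>colour :: 'i \<Rightarrow> bool. \<forall>i\<in>S. \<forall>j\<in>S. adj C i j \<longrightarrow> colour i \<noteq> colour j" for S
  proof (induction "card S" arbitrary: S)
    case 0
    then show ?case by auto
  next
    case (Suc n)
    then have "S \<noteq> {}" by auto
    then obtain l where l: "l \<in> S" "card {k \<in> S. adj C l k} \<le> 1" using leaf_exists by blast
    have "card (S - {l}) = n" using Suc l by simp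
    from Suc(1)[OF this[symmetric]] obtain colour :: "'i \<Rightarrow> bool" where
      colour: "\<forall>i\<in>S - {l}. \<forall>j\<in>S - {l}. adj C i j \<longrightarrow> colour i \<noteq> colour j" by auto
    define b where "b = (\<not> (\<exists>k\<in>S. adj C l k \<and> colour k))"
    have b: "b \<noteq> colour k" if "k \<in> S" "adj C l k" for k
    proof (cases "\<exists>k'\<in>S. adj C l k' \<and> colour k'")
      case True
      then obtain k' where "k' \<in> S" "adj C l k'" "colour k'" by auto
      then have "k = k'" using l(2) that by (simp add: card_le_Suc0_iff_eq)
      then show ?thesis using \<open>colour k'\<close> True by (simp add: b_def)
    qed (use that in \<open>auto simp: b_def\<close>)
    have "\<forall>i\<in>S. \<forall>j\<in>S. adj C i j \<longrightarrow> (colour(l := b)) i \<noteq> (colour(l := b)) j"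
      using colour b adj_sym[of l] by (metis Diff_iff adj_irrefl fun_upd_apply singletonD)
    then show ?case by blast
  qed
  from this[of UNIV] show ?thesis by simp
qed

section \<open>Reflections and the signs of roots\<close>

lemma reflection_nth:
  "simple_reflection C i x $ k = (if k = i then x $ i - (C *v x) $ i else x $ k)"
  by (simp add: simple_reflection_def axis_def)

lemma reflection_alt: "simple_reflection C i x = x - (C *v x) $ i *s axis i 1"
  by (simp add: simple_reflection_def vec_eq_iff axis_def)

lemma C_add: "C *v (x + y) = C *v x + C *v y" by (simp add: matrix_vector_right_distrib)
lemma C_diff: "C *v (x - y) = C *v x - C *v y"
  by (simp add: vec_eq_iff matrix_vector_mult_def right_diff_distrib sum_subtractf)
lemma C_scale: "C *v (a *s x) = a *s (C *v x)"
  by (simp add: vec_eq_iff matrix_vector_mult_def sum_distrib_left ac_simps)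
lemma C_minus: "C *v (- x) = - (C *v x)"
  by (simp add: vec_eq_iff matrix_vector_mult_def sum_negf)

lemma B_axis': "B x (axis i 1) = D i * (C *v x) $ i"
  by (simp only: B_sym[of x] B_axis)

lemma B_reflection: "B (simple_reflection C i x) (simple_reflection C i y) = B x y"
  unfolding reflection_alt
  by (simp add: B_diff B_diff' B_scale B_scale' B_axis B_axis' C_axis C_scale C_diff algebra_simps)

text \<open>A root and its sign are controlled by its norm and a divisibility condition, which expresses
  that the coordinates of its coroot are integers.\<close>

definition root_like :: "'i \<Rightarrow> int^'i \<Rightarrow> bool" where
  "root_like k x \<longleftrightarrow> B x x = 2 * D k \<and> (\<forall>l. D k dvd D l * x $ l)"

lemma root_like_axis: "root_like k (axis k 1)"
  by (auto simp: root_like_def B_axis_axis) (simp add: axis_def)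

lemma root_like_reflection:
  assumes "root_like k x" shows "root_like k (simple_reflection C i x)"
proof -
  have "D k dvd D i * (C *v x) $ i"
  proof -
    have "D i * (C *v x) $ i = (\<Sum>l\<in>UNIV. C $ l $ i * (D l * x $ l))"
      unfolding matrix_vector_mult_def
      by (simp add: sum_distrib_left, intro sum.cong refl)
        (metis D_symm mult.assoc mult.commute)
    then show ?thesis using assms by (simp add: root_like_def dvd_sum)
  qed
  then show ?thesis using assms
    by (auto simp: root_like_def B_reflection reflection_nth right_diff_distrib)
qed

text \<open>Adding the coordinates one at a time, every cross term occurs twice and every diagonal
  entry carries a factor 2; each of these terms also contains a factor
  \<open>D i * x $ i\<close>.\<close>

lemma norm_divisible:
  assumes "\<And>l. D k dvd D l * x $ l"
  shows "2 * D k dvd B x x"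
proof -
  define xS where "xS S = (\<chi> l. if l \<in> S then x $ l else 0)" for S
  have dv: "D k dvd D l * xS S $ l" for S l using assms by (simp add: xS_def)
  have "2 * D k dvd B (xS S) (xS S)" if "finite S" for S
    using that
  proof (induction S rule: finite_induct)
    case empty
    have "xS {} = 0" by (simp add: xS_def vec_eq_iff)
    then show ?case by (simp add: B_zero)
  next
    case (insert i S)
    have "xS (insert i S) = xS S + x $ i *s axis i 1"
      using insert(2) by (auto simp: xS_def vec_eq_iff axis_def)
    then have "B (xS (insert i S)) (xS (insert i S))
      = B (xS S) (xS S) + 2 * (x $ i * B (axis i 1) (xS S)) + 2 * ((D i * x $ i) * x $ i)"
      by (simp add: B_add B_add' B_scale B_scale' B_axis B_axis' C_axis C_scale C_add algebra_simps)
    moreover have "D k dvd x $ i * B (axis i 1) (xS S)"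
    proof -
      have "x $ i * B (axis i 1) (xS S) = (\<Sum>l\<in>UNIV. (D i * x $ i) * (C $ i $ l * xS S $ l))"
        unfolding B_axis matrix_vector_mult_def by (simp add: sum_distrib_left ac_simps)
      then show ?thesis using assms by (simp add: dvd_sum)
    qed
    moreover have "D k dvd (D i * x $ i) * x $ i" using assms by simp
    ultimately show ?case using insert.IH by (auto intro!: dvd_add mult_dvd_mono)
  qed
  from this[of UNIV] show ?thesis by (simp add: xS_def)
qed

definition nonneg_vec :: "int^'i \<Rightarrow> bool" where "nonneg_vec x \<longleftrightarrow> (\<forall>k. 0 \<le> x $ k)"

text \<open>The positive part \<open>p\<close> and the negative part \<open>n\<close> inherit the
  divisibility, so each, if nonzero, has norm at least \<open>2 * D k\<close>. As
  \<open>B p n\<close> is not positive, a vector of mixed sign would have norm at least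
  \<open>4 * D k\<close>.\<close>

lemma root_like_sign:
  assumes "root_like k x" shows "nonneg_vec x \<or> nonneg_vec (- x)"
proof (rule ccontr)
  assume neg: "\<not> ?thesis"
  define p where "p = (\<chi> l. max 0 (x $ l))"
  define n where "n = (\<chi> l. max 0 (- x $ l))"
  have pnz: "p \<noteq> 0"
  proof
    assume "p = 0"
    then have "nonneg_vec (- x)" by (simp add: p_def nonneg_vec_def vec_eq_iff max_def) (metis linorder_le_cases)
    then show False using neg by simp
  qed
  have nnz: "n \<noteq> 0"
  proof
    assume "n = 0"
    have "0 \<le> x $ l" for l
    proof -
      have "n $ l = 0" using \<open>n = 0\<close> by simp
      then show ?thesis by (simp add: n_def max_def split: if_splits)
    qed
    then have "nonneg_vec x" by (simp add: nonneg_vec_def)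
    then show False using neg by simp
  qed
  have dvp: "D k dvd D l * p $ l" and dvn: "D k dvd D l * n $ l" for l
    using assms by (auto simp: root_like_def p_def n_def max_def)
  have "B p n \<le> 0"
    unfolding B_def
  proof (intro sum_nonpos)
    fix i j
    show "p $ i * (D i * C $ i $ j) * n $ j \<le> 0"
    proof (cases "i = j")
      case True
      then show ?thesis by (simp add: p_def n_def max_def)
    next
      case False
      then have "D i * C $ i $ j \<le> 0" using offdiag_le[of i j] by (simp add: mult_nonneg_nonpos less_imp_le)
      moreover have "p $ i \<ge> 0" "n $ j \<ge> 0" by (simp_all add: p_def n_def)
      ultimately show ?thesis by (simp add: mult_nonneg_nonpos mult_nonpos_nonneg)
    qed
  qed
  have "x = p - n" by (auto simp: vec_eq_iff p_def n_def max_def)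
  then have "B x x = B p p + B n n - 2 * B p n"
    using B_sym[of n p] by (simp add: B_diff B_diff')
  then have "B p p + B n n \<le> 2 * D k" using assms \<open>B p n \<le> 0\<close> by (simp add: root_like_def)
  moreover have "2 * D k \<le> B p p" using zdvd_imp_le[OF norm_divisible[OF dvp] B_pos[OF pnz]] by simp
  moreover have "2 * D k \<le> B n n" using zdvd_imp_le[OF norm_divisible[OF dvn] B_pos[OF nnz]] by simp
  moreover have "D k > 0" by simp
  ultimately show False by linarith
qed

lemma root_like_nz: "root_like k x \<Longrightarrow> x \<noteq> 0"
  by (auto simp: root_like_def B_zero)

lemma nonneg_vec_antisym: "nonneg_vec x \<Longrightarrow> nonneg_vec (- x) \<Longrightarrow> x = 0"
  by (simp add: nonneg_vec_def vec_eq_iff) (blast intro: order.antisym)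

text \<open>On pairwise non-adjacent vertices the form is diagonal, and by divisibility one nonzero
  coordinate already contributes the whole norm \<open>2 * D k\<close>; so there is only one, and it
  equals 1.\<close>

lemma root_like_independent:
  assumes "root_like k x" "nonneg_vec x" and ind: "\<And>a b. x $ a \<noteq> 0 \<Longrightarrow> x $ b \<noteq> 0 \<Longrightarrow> \<not> adj C a b"
  obtains l where "x = axis l 1" "D l = D k"
proof -
  have "B x x = (\<Sum>i\<in>UNIV. 2 * (D i * x $ i * x $ i))"
    unfolding B_def
  proof (rule sum.cong)
    fix i
    have "(\<Sum>j\<in>UNIV. x $ i * (D i * C $ i $ j) * x $ j)
      = (\<Sum>j\<in>UNIV. if j = i then 2 * (D i * x $ i * x $ i) else 0)"
    proof (rule sum.cong)
      fix j
      show "x $ i * (D i * C $ i $ j) * x $ j = (if j = i then 2 * (D i * x $ i * x $ i) else 0)"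
        using ind[of i j] not_adj_zero[of i j] by auto
    qed simp
    then show "(\<Sum>j\<in>UNIV. x $ i * (D i * C $ i $ j) * x $ j) = 2 * (D i * x $ i * x $ i)" by simp
  qed simp
  then have total: "(\<Sum>i\<in>UNIV. D i * x $ i * x $ i) = D k"
    using assms(1) by (simp add: root_like_def flip: sum_distrib_left)
  have nonneg: "D i * x $ i * x $ i \<ge> 0" for i
    using assms(2) by (simp add: nonneg_vec_def less_imp_le)
  obtain l where l: "x $ l \<noteq> 0" using root_like_nz[OF assms(1)] by (auto simp: vec_eq_iff)
  then have xl: "x $ l \<ge> 1" using assms(2) unfolding nonneg_vec_def by (metis int_one_le_iff_zero_less order.not_eq_order_implies_strict)
  have "0 < D l * x $ l" using xl by simp
  moreover have "D k dvd D l * x $ l" using assms(1) by (simp add: root_like_def)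
  ultimately have ge: "D k \<le> D l * x $ l" by (rule zdvd_imp_le[rotated])
  have "D k * x $ l \<le> D l * x $ l * x $ l" using ge xl by (intro mult_right_mono) auto
  moreover have "D k * 1 \<le> D k * x $ l" using xl by (intro mult_left_mono) (auto simp: less_imp_le)
  moreover have split: "(\<Sum>i\<in>UNIV. D i * x $ i * x $ i) = D l * x $ l * x $ l + (\<Sum>i\<in>UNIV - {l}. D i * x $ i * x $ i)"
    by (simp add: sum.remove)
  moreover have rest: "(\<Sum>i\<in>UNIV - {l}. D i * x $ i * x $ i) \<ge> 0"
    by (intro sum_nonneg nonneg)
  ultimately have eq: "D l * x $ l * x $ l = D k" "D k * x $ l = D k" and z: "(\<Sum>i\<in>UNIV - {l}. D i * x $ i * x $ i) = 0"
    using total by linarith+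
  have xl1: "x $ l = 1" using eq(2) by simp
  have "x $ i = 0" if "i \<noteq> l" for i
  proof -
    have "D i * x $ i * x $ i = 0"
      using z that nonneg by (subst (asm) sum_nonneg_eq_0_iff) auto
    then show ?thesis by simp
  qed
  then have "x = axis l 1" using xl1 by (auto simp: vec_eq_iff axis_def)
  moreover have "D l = D k" using eq xl1 by simp
  ultimately show ?thesis by (rule that)
qed

subsection \<open>The bipartite Coxeter steps\<close>

definition colour :: "'i \<Rightarrow> bool" where
  "colour = (SOME f. \<forall>i j. adj C i j \<longrightarrow> f i \<noteq> f j)"

lemma colour: "adj C i j \<Longrightarrow> colour i \<noteq> colour j"
  using someI_ex[OF coloring_exists] unfolding colour_def by blast

text \<open>The product of the commuting simple reflections at the vertices of colour
  \<open>e\<close>; the two half steps compose to a bipartite Coxeter element.\<close>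

definition half_step :: "bool \<Rightarrow> int^'i \<Rightarrow> int^'i" where
  "half_step e x = (\<chi> k. if colour k = e then x $ k - (C *v x) $ k else x $ k)"

lemma C_mult_cong:
  assumes "\<And>l. C $ i $ l \<noteq> 0 \<Longrightarrow> x $ l = z $ l"
  shows "(C *v x) $ i = (C *v z) $ i"
  unfolding matrix_vector_mult_def
  by (simp, intro sum.cong refl) (metis assms mult_eq_0_iff)

lemma coxeter_Cons: "coxeter_element C (i # xs) x = simple_reflection C i (coxeter_element C xs x)"
  by (simp add: coxeter_element_def)

lemma coxeter_Nil [simp]: "coxeter_element C [] x = x"
  by (simp add: coxeter_element_def)

lemma coxeter_append: "coxeter_element C (xs @ ys) x = coxeter_element C xs (coxeter_element C ys x)"
  by (induction xs) (simp_all add: coxeter_Cons)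

text \<open>Vertices of one colour are not adjacent, so the reflections made before do not change
  the amount subtracted at the next vertex.\<close>

lemma coxeter_monochrome:
  assumes "distinct xs" "\<And>k. k \<in> set xs \<Longrightarrow> colour k = e"
  shows "coxeter_element C xs x $ k = (if k \<in> set xs then x $ k - (C *v x) $ k else x $ k)"
  using assms
proof (induction xs arbitrary: k)
  case (Cons i xs)
  then have IH: "coxeter_element C xs x $ k = (if k \<in> set xs then x $ k - (C *v x) $ k else x $ k)" for k
    by simp
  have "(C *v coxeter_element C xs x) $ i = (C *v x) $ i"
  proof (rule C_mult_cong)
    fix l assume l: "C $ i $ l \<noteq> 0"
    have "l \<notin> set xs"
    proof
      assume "l \<in> set xs"
      then have "colour l = colour i" "l \<noteq> i" using Cons.prems by auto
      then show False using l not_adj_zero[of i l] colour[of i l] by auto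
    qed
    then show "coxeter_element C xs x $ l = x $ l" by (simp add: IH)
  qed
  then show ?case using Cons.prems(1) by (auto simp: coxeter_Cons reflection_nth IH)
qed simp

lemma coxeter_eq_half_step:
  assumes "distinct xs" "set xs = {k. colour k = e}"
  shows "coxeter_element C xs = half_step e"
proof
  fix x
  have "coxeter_element C xs x $ k = half_step e x $ k" for k
    by (subst coxeter_monochrome[of xs e]) (use assms in \<open>simp_all add: half_step_def\<close>)
  then show "coxeter_element C xs x = half_step e x" by (simp add: vec_eq_iff)
qed

lemma half_step_induct:
  assumes "P x" and "\<And>i x. P x \<Longrightarrow> P (simple_reflection C i x)"
  shows "P (half_step e x)"
proof -
  obtain xs where xs: "set xs = {k. colour k = e}" "distinct xs"
    using finite_distinct_list[of "{k. colour k = e}"] by auto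
  have "P (coxeter_element C ys x)" for ys
    by (induction ys) (simp_all add: assms coxeter_Cons)
  from this[of xs] show ?thesis unfolding coxeter_eq_half_step[OF xs(2,1)] .
qed

lemma root_like_half_step: "root_like k x \<Longrightarrow> root_like k (half_step e x)"
  by (rule half_step_induct[where P = "root_like k"]) (auto intro: root_like_reflection)

lemma B_half_step: "B (half_step e x) (half_step e y) = B x y"
proof -
  obtain xs where xs: "set xs = {k. colour k = e}" "distinct xs"
    using finite_distinct_list[of "{k. colour k = e}"] by auto
  have "B (coxeter_element C ys x) (coxeter_element C ys y) = B x y" for ys
    by (induction ys) (simp_all add: coxeter_Cons B_reflection)
  from this[of xs] show ?thesis unfolding coxeter_eq_half_step[OF xs(2,1)] .
qed

lemma half_step_add: "half_step e (x + y) = half_step e x + half_step e y" by (simp add: half_step_def vec_eq_iff C_add)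
lemma half_step_minus: "half_step e (- x) = - half_step e x" by (simp add: half_step_def vec_eq_iff C_minus)
lemma half_step_scale: "half_step e (a *s x) = a *s half_step e x"
  by (simp add: half_step_def vec_eq_iff C_scale algebra_simps)
lemma half_step_zero: "half_step e 0 = 0" by (simp add: half_step_def vec_eq_iff)

text \<open>Multiplication by \<open>2 - C\<close>, the nonnegative weighted adjacency matrix of the
  diagram.\<close>

definition neighbour_sum :: "int^'i \<Rightarrow> int^'i" where "neighbour_sum x = x + x - C *v x"

lemma neighbour_sum_add: "neighbour_sum (x + y) = neighbour_sum x + neighbour_sum y" by (simp add: neighbour_sum_def C_add)
lemma neighbour_sum_diff: "neighbour_sum (x - y) = neighbour_sum x - neighbour_sum y" by (simp add: neighbour_sum_def C_diff)
lemma neighbour_sum_scale: "neighbour_sum (a *s x) = a *s neighbour_sum x"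
  by (simp add: neighbour_sum_def C_scale vec_eq_iff algebra_simps)
lemma neighbour_sum_minus: "neighbour_sum (- x) = - neighbour_sum x" by (simp add: neighbour_sum_def C_minus)
lemma neighbour_sum_zero [simp]: "neighbour_sum 0 = 0" by (simp add: neighbour_sum_def)
lemma neighbour_sum_sum: "finite S \<Longrightarrow> neighbour_sum (\<Sum>s\<in>S. f s) = (\<Sum>s\<in>S. neighbour_sum (f s))"
  by (induction S rule: finite_induct) (simp_all add: neighbour_sum_add)

lemma neighbour_sum_axis: "neighbour_sum (axis j 1) $ k = (if k = j then 0 else - C $ k $ j)"
  by (simp add: neighbour_sum_def C_axis) (simp add: axis_def)

lemma neighbour_sum_nth: "neighbour_sum x $ k = (\<Sum>l | adj C k l. - C $ k $ l * x $ l)"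
proof -
  have "(C *v x) $ k = (\<Sum>l\<in>UNIV. C $ k $ l * x $ l)" by (simp add: matrix_vector_mult_def)
  also have "\<dots> = 2 * x $ k + (\<Sum>l\<in>UNIV - {k}. C $ k $ l * x $ l)"
    by (simp add: sum.remove[of UNIV k])
  also have "(\<Sum>l\<in>UNIV - {k}. C $ k $ l * x $ l) = (\<Sum>l | adj C k l. C $ k $ l * x $ l)"
    by (rule sum.mono_neutral_right) (auto simp: not_adj_zero)
  finally show ?thesis by (simp add: neighbour_sum_def sum_negf)
qed

text \<open>The value at \<open>q = 1\<close> of the coefficient of \<open>t\<^sup>-\<^sup>v\<close> in the \<open>j\<close>-th column of the inverse of the
  deformed Cartan matrix.\<close>

fun level_vec :: "nat \<Rightarrow> 'i \<Rightarrow> int^'i" where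
  "level_vec 0 j = 0"
| "level_vec (Suc 0) j = axis j 1"
| "level_vec (Suc (Suc v)) j = neighbour_sum (level_vec (Suc v) j) - level_vec v j"

lemma neighbour_sum_supported:
  assumes "\<And>k. x $ k \<noteq> 0 \<Longrightarrow> colour k = e" "neighbour_sum x $ k \<noteq> 0" shows "colour k \<noteq> e"
proof -
  obtain l where "adj C k l" "x $ l \<noteq> 0"
    using assms(2) unfolding neighbour_sum_nth by (metis (mono_tags, lifting) mem_Collect_eq mult_zero_right sum.not_neutral_contains_not_neutral)
  then show ?thesis using assms(1)[of l] colour[of k l] by blast
qed

lemma level_vec_supported: "level_vec v j $ k \<noteq> 0 \<Longrightarrow> colour k = (colour j = odd v)"
proof (induction v j arbitrary: k rule: level_vec.induct)
  case (2 j)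
  then show ?case by (auto simp: axis_def split: if_splits)
next
  case (3 v j)
  from 3(3) have "neighbour_sum (level_vec (Suc v) j) $ k \<noteq> 0 \<or> level_vec v j $ k \<noteq> 0" by auto
  then show ?case
  proof
    assume "neighbour_sum (level_vec (Suc v) j) $ k \<noteq> 0"
    from neighbour_sum_supported[OF 3(1) this] show ?thesis by auto
  qed (use 3(2) in auto)
qed simp

text \<open>Consecutive levels live on opposite colours, so both can be recovered from the sum, and
  the sum is a root although its summands need not be.\<close>

definition level_sum :: "nat \<Rightarrow> 'i \<Rightarrow> int^'i" where "level_sum b j = level_vec b j + level_vec (Suc b) j"

lemma level_sum_0 [simp]: "level_sum 0 j = axis j 1" by (simp add: level_sum_def)

text \<open>On the reflected colour level \<open>Suc b\<close> vanishes, and the reflection formula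
  becomes the three-term recursion that replaces level \<open>b\<close> by level
  \<open>b + 2\<close>. On the other colour only level \<open>Suc b\<close> is present, and it
  stays.\<close>

lemma level_sum_Suc: "level_sum (Suc b) j = half_step (colour j = odd b) (level_sum b j)"
proof (rule vec_eq_iff[THEN iffD2], rule allI)
  fix k
  show "level_sum (Suc b) j $ k = half_step (colour j = odd b) (level_sum b j) $ k"
  proof (cases "colour k = (colour j = odd b)")
    case True
    have 1: "level_vec (Suc b) j $ k = 0" using level_vec_supported[of "Suc b" j k] True by auto
    have 2: "neighbour_sum (level_vec b j) $ k = 0"
      using neighbour_sum_supported[of "level_vec b j" "colour j = odd b" k] level_vec_supported[of b j] True by blast
    have "half_step (colour j = odd b) (level_sum b j) $ k = level_sum b j $ k - (C *v level_sum b j) $ k"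
      using True by (simp add: half_step_def)
    also have "\<dots> = neighbour_sum (level_sum b j) $ k - level_sum b j $ k" by (simp add: neighbour_sum_def)
    also have "\<dots> = neighbour_sum (level_vec (Suc b) j) $ k - level_vec b j $ k" using 1 2 by (simp add: level_sum_def neighbour_sum_add)
    also have "\<dots> = level_sum (Suc b) j $ k" using 1 by (simp add: level_sum_def)
    finally show ?thesis ..
  next
    case False
    then have "level_vec b j $ k = 0" "level_vec (Suc (Suc b)) j $ k = 0"
      using level_vec_supported[of b j k] level_vec_supported[of "Suc (Suc b)" j k] by auto
    then show ?thesis using False
      unfolding half_step_def vec_lambda_beta Eq_FalseI[OF False] if_False
      by (simp add: level_sum_def del: level_vec.simps)
  qed
qed

lemma root_like_level_sum: "root_like j (level_sum b j)"
  by (induction b) (simp_all add: root_like_axis root_like_half_step level_sum_Suc)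

text \<open>The two levels have disjoint supports, so both inherit the sign of the root-like vector
  \<open>level_sum b j\<close>.\<close>

lemma level_vec_sign:
  "nonneg_vec (level_vec b j) \<and> nonneg_vec (level_vec (Suc b) j) \<or> nonneg_vec (- level_vec b j) \<and> nonneg_vec (- level_vec (Suc b) j)"
proof -
  have disj: "level_vec b j $ k = 0 \<or> level_vec (Suc b) j $ k = 0" for k
    using level_vec_supported[of b j k] level_vec_supported[of "Suc b" j k] by auto
  have *: "level_vec b j $ k = (if level_vec (Suc b) j $ k = 0 then level_sum b j $ k else 0)"
    "level_vec (Suc b) j $ k = (if level_vec b j $ k = 0 then level_sum b j $ k else 0)" for k
    using disj[of k] by (auto simp: level_sum_def)
  from root_like_sign[OF root_like_level_sum[of j b]] show ?thesis
    unfolding nonneg_vec_def vector_uminus_component by (metis * neg_0_le_iff_le order_refl)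
qed

subsection \<open>The Coxeter number\<close>

text \<open>The Weyl vector \<rho> in coordinates of simple roots; it exists because the form is
  nondegenerate. For its positive and negative parts \<open>p\<close> and \<open>n\<close>, (n, n) =
  (n, p) - (n, \<rho>) is at most 0, so \<open>n\<close> vanishes.\<close>

lemma rho_exists:
  obtains z :: "'i \<Rightarrow> real" where "\<And>i. (\<Sum>j\<in>UNIV. real_of_int (C $ i $ j) * z j) = 1" "\<And>i. z i \<ge> 0"
proof -
  define M :: "real^'i^'i" where "M = (\<chi> i j. real_of_int (C $ i $ j))"
  have form: "(\<Sum>i\<in>UNIV. \<Sum>j\<in>UNIV. x $ i * real_of_int (D i * C $ i $ j) * y $ j)
     = (\<Sum>i\<in>UNIV. x $ i * real_of_int (D i) * (M *v y) $ i)" for x y :: "real^'i"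
    by (simp add: M_def matrix_vector_mult_def sum_distrib_left ac_simps)
  have "x = 0" if "M *v x = 0" for x
  proof (rule ccontr)
    assume "x \<noteq> 0"
    from posdef_real[OF this] show False using that unfolding form by simp
  qed
  then have "inj ((*v) M)"
    using linear_injective_0[OF matrix_vector_mul_linear[of M]] by blast
  then have "surj ((*v) M)"
    using linear_injective_imp_surjective[of "(*v) M"] by (simp add: matrix_vector_mul_linear)
  then obtain z where z: "(\<chi> i. 1) = M *v z" by (meson surjD)
  define p :: "real^'i" where "p = (\<chi> l. max 0 (z $ l))"
  define n :: "real^'i" where "n = (\<chi> l. max 0 (- z $ l))"
  have zpn: "p = n + z" by (auto simp: vec_eq_iff p_def n_def max_def)
  have "n = 0"
  proof (rule ccontr)
    assume "n \<noteq> 0"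
    from posdef_real[OF this]
    have pos: "0 < (\<Sum>i\<in>UNIV. n $ i * real_of_int (D i) * (M *v n) $ i)" unfolding form .
    have "(\<Sum>i\<in>UNIV. n $ i * real_of_int (D i) * (M *v z) $ i) \<ge> 0"
      unfolding z[symmetric] by (intro sum_nonneg) (simp add: n_def less_imp_le)
    moreover have "(\<Sum>i\<in>UNIV. \<Sum>j\<in>UNIV. n $ i * real_of_int (D i * C $ i $ j) * p $ j) \<le> 0"
    proof (intro sum_nonpos)
      fix i j
      show "n $ i * real_of_int (D i * C $ i $ j) * p $ j \<le> 0"
      proof (cases "i = j")
        case True
        then show ?thesis by (simp add: p_def n_def max_def)
      next
        case False
        then have "D i * C $ i $ j \<le> 0" using offdiag_le[of i j] by (simp add: mult_nonneg_nonpos less_imp_le)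
        then have "real_of_int (D i * C $ i $ j) \<le> 0" using of_int_le_0_iff by blast
        moreover have "n $ i \<ge> 0" "p $ j \<ge> 0" by (simp_all add: p_def n_def)
        ultimately show ?thesis by (simp only: mult_nonneg_nonpos mult_nonpos_nonneg)
      qed
    qed
    moreover have "M *v p = M *v n + M *v z" unfolding zpn by (simp add: matrix_vector_right_distrib)
    ultimately show False using pos unfolding form by (simp add: distrib_left sum.distrib)
  qed
  have "z $ i \<ge> 0" for i
  proof -
    have "n $ i = 0" using \<open>n = 0\<close> by simp
    then show ?thesis by (simp add: n_def max_def split: if_splits)
  qed
  moreover have "(\<Sum>j\<in>UNIV. real_of_int (C $ i $ j) * z $ j) = 1" for i
  proof -
    have "(M *v z) $ i = 1" using z by (metis vec_lambda_beta)
    then show ?thesis by (simp add: M_def matrix_vector_mult_def)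
  qed
  ultimately show ?thesis by (intro that[of "\<lambda>i. z $ i"])
qed

text \<open>Pairing the sequence with \<open>\<rho>\<close> gives a strictly concave sequence of numbers, which cannot
  stay nonnegative.\<close>

lemma level_vec_not_positive: "\<exists>v\<ge>1. \<not> (nonneg_vec (level_vec v j) \<and> level_vec v j \<noteq> 0)"
proof (rule ccontr)
  assume "\<not> ?thesis"
  then have pos: "nonneg_vec (level_vec v j)" "level_vec v j \<noteq> 0" if "v \<ge> 1" for v using that by auto
  obtain z :: "'i \<Rightarrow> real" where z: "\<And>i. (\<Sum>j\<in>UNIV. real_of_int (C $ i $ j) * z j) = 1" "\<And>i. z i \<ge> 0"
    using rho_exists by blast
  define f where "f v = (\<Sum>k\<in>UNIV. real_of_int (D k) * z k * real_of_int (level_vec v j $ k))" for v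
  have nonneg: "level_vec v j $ k \<ge> 0" for v k
    using pos(1)[of v] by (cases v) (auto simp: nonneg_vec_def)
  have fpos: "f v \<ge> 0" for v
    unfolding f_def using z(2) nonneg by (intro sum_nonneg mult_nonneg_nonneg) (auto simp: less_imp_le)
  \<comment> \<open>By the recursion the second difference is minus the pairing of \<rho> with
    \<open>x\<close>. Since \<open>C\<close> sends \<rho> to the all-ones vector, this is minus the
    sum of the \<open>D l * x $ l\<close>, a positive integer.\<close>
  have conc: "f (Suc (Suc v)) - 2 * f (Suc v) + f v \<le> - 1" for v
  proof -
    define x where "x = level_vec (Suc v) j"
    have "f (Suc (Suc v)) - 2 * f (Suc v) + f v
      = (\<Sum>k\<in>UNIV. real_of_int (D k) * z k * real_of_int (level_vec (Suc (Suc v)) j $ k - 2 * level_vec (Suc v) j $ k + level_vec v j $ k))"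
      unfolding f_def by (simp add: algebra_simps sum.distrib sum_subtractf sum_distrib_left del: level_vec.simps)
    also have "\<dots> = (\<Sum>k\<in>UNIV. real_of_int (D k) * z k * - real_of_int ((C *v x) $ k))"
      by (intro sum.cong refl) (simp add: x_def neighbour_sum_def)
    also have "\<dots> = (\<Sum>k\<in>UNIV. \<Sum>l\<in>UNIV. - (real_of_int (D k * C $ k $ l) * z k * real_of_int (x $ l)))"
      by (simp add: matrix_vector_mult_def sum_distrib_left sum_negf ac_simps)
    also have "\<dots> = (\<Sum>l\<in>UNIV. \<Sum>k\<in>UNIV. - (real_of_int (D k * C $ k $ l) * z k * real_of_int (x $ l)))"
      by (rule sum.swap)
    also have "\<dots> = (\<Sum>l\<in>UNIV. - (real_of_int (D l * x $ l) * (\<Sum>k\<in>UNIV. real_of_int (C $ l $ k) * z k)))"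
      by (intro sum.cong refl) (simp add: sum_distrib_left sum_negf D_symm[of _ l for l] ac_simps)
    also have "\<dots> = - real_of_int (\<Sum>l\<in>UNIV. D l * x $ l)" by (simp add: z sum_negf)
    also have "\<dots> \<le> - 1"
    proof -
      obtain l where l: "x $ l \<noteq> 0" using pos(2)[of "Suc v"] by (auto simp: x_def vec_eq_iff)
      then have "x $ l > 0" using nonneg[of "Suc v" l] by (simp add: x_def)
      then have "0 < D l * x $ l" by simp
      also have "\<dots> \<le> (\<Sum>l\<in>UNIV. D l * x $ l)"
        by (rule member_le_sum) (auto simp: x_def nonneg less_imp_le)
      finally have "1 \<le> (\<Sum>l\<in>UNIV. D l * x $ l)" by simp
      then have "real_of_int 1 \<le> real_of_int (\<Sum>l\<in>UNIV. D l * x $ l)"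
        unfolding of_int_le_iff .
      then show ?thesis by simp
    qed
    finally show ?thesis .
  qed
  define g where "g v = f (Suc v) - f v" for v
  have g: "g v \<le> g 0 - v" for v
  proof (induction v)
    case (Suc v)
    then show ?case using conc[of v] by (simp add: g_def)
  qed simp
  have f0: "f 0 = 0" by (simp add: f_def)
  have f: "f v \<le> v * g 0 - v * (real v - 1) / 2" for v
  proof (induction v)
    case (Suc v)
    have "f (Suc v) = f v + g v" by (simp add: g_def)
    also have "\<dots> \<le> v * g 0 - v * (real v - 1) / 2 + (g 0 - v)" using Suc g[of v] by simp
    also have "\<dots> = Suc v * g 0 - Suc v * (real (Suc v) - 1) / 2" by (simp add: field_simps)
    finally show ?case .
  qed (simp add: f0)
  obtain v :: nat where v: "real v > 2 * g 0 + 1" "v > 0" by (metis reals_Archimedean2 gt_ex less_trans of_nat_less_iff max_less_iff_conj not_gr_zero less_max_iff_disj of_nat_0_less_iff zero_less_one linorder_less_linear)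
  have "f v \<le> v * (g 0 - (real v - 1) / 2)" using f[of v] by (simp add: algebra_simps)
  also have "\<dots> < 0" using v by (intro mult_pos_neg) auto
  finally show False using fpos[of v] by simp
qed

definition first_zero :: "'i \<Rightarrow> nat" where "first_zero j = (LEAST v. v \<ge> 1 \<and> level_vec v j = 0)"

text \<open>At the first level that is not nonnegative and nonzero, the preceding level is, so
  \<open>level_vec_sign\<close> still makes this one nonnegative; hence it is 0.\<close>

lemma level_vec_first_zero:
  "\<exists>m\<ge>2. level_vec m j = 0 \<and> (\<forall>v. 1 \<le> v \<and> v < m \<longrightarrow> nonneg_vec (level_vec v j) \<and> level_vec v j \<noteq> 0)"
proof -
  define m where "m = (LEAST v. v \<ge> 1 \<and> \<not> (nonneg_vec (level_vec v j) \<and> level_vec v j \<noteq> 0))"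
  have m: "m \<ge> 1" "\<not> (nonneg_vec (level_vec m j) \<and> level_vec m j \<noteq> 0)"
    using LeastI_ex[of "\<lambda>v. v \<ge> 1 \<and> \<not> (nonneg_vec (level_vec v j) \<and> level_vec v j \<noteq> 0)"] level_vec_not_positive[of j]
    unfolding m_def by blast+
  have less: "nonneg_vec (level_vec v j) \<and> level_vec v j \<noteq> 0" if "1 \<le> v" "v < m" for v
    using not_less_Least[of v "\<lambda>v. v \<ge> 1 \<and> \<not> (nonneg_vec (level_vec v j) \<and> level_vec v j \<noteq> 0)"] that
    unfolding m_def by blast
  have "nonneg_vec (level_vec 1 j)" by (simp add: nonneg_vec_def axis_def)
  moreover have "level_vec 1 j \<noteq> 0" by simp
  ultimately have "m \<noteq> 1" using m(2) by metis
  then have m2: "m \<ge> 2" using m(1) by simp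
  then obtain b where b: "m = Suc b" "b \<ge> 1" by (cases m) auto
  then have "nonneg_vec (level_vec b j)" "level_vec b j \<noteq> 0" using less[of b] by auto
  then have "nonneg_vec (level_vec m j)" using level_vec_sign[of b j] nonneg_vec_antisym[of "level_vec b j"] b(1) by auto
  then have "level_vec m j = 0" using m(2) by blast
  then show ?thesis using m2 less by blast
qed

lemma first_zero: "first_zero j \<ge> 2" "level_vec (first_zero j) j = 0" "\<And>v. 1 \<le> v \<Longrightarrow> v < first_zero j \<Longrightarrow> nonneg_vec (level_vec v j)"
  "\<And>v. 1 \<le> v \<Longrightarrow> v < first_zero j \<Longrightarrow> level_vec v j \<noteq> 0"
proof -
  obtain m where m: "m \<ge> 2" "level_vec m j = 0" "\<And>v. 1 \<le> v \<Longrightarrow> v < m \<Longrightarrow> nonneg_vec (level_vec v j) \<and> level_vec v j \<noteq> 0"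
    using level_vec_first_zero[of j] by blast
  have "first_zero j = m" unfolding first_zero_def
  proof (rule Least_equality)
    fix v assume "1 \<le> v \<and> level_vec v j = 0"
    then show "m \<le> v" using m(3)[of v] by (meson not_le)
  qed (use m in simp)
  then show "first_zero j \<ge> 2" "level_vec (first_zero j) j = 0" "\<And>v. 1 \<le> v \<Longrightarrow> v < first_zero j \<Longrightarrow> nonneg_vec (level_vec v j)"
    "\<And>v. 1 \<le> v \<Longrightarrow> v < first_zero j \<Longrightarrow> level_vec v j \<noteq> 0" using m by auto
qed

text \<open>The matrix with columns \<open>level_vec v j\<close> is a Chebyshev polynomial in
  \<open>2 - C\<close> and therefore commutes with it.\<close>

lemma neighbour_sum_level_vec: "neighbour_sum (level_vec v j) = (\<Sum>k\<in>UNIV. neighbour_sum (axis j 1) $ k *s level_vec v k)"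
proof (induction v j rule: level_vec.induct)
  case (2 j)
  show ?case using vec_sum_axis[of "neighbour_sum (axis j 1)"] by simp
next
  case (3 v j)
  have "neighbour_sum (level_vec (Suc (Suc v)) j) = neighbour_sum (\<Sum>k\<in>UNIV. neighbour_sum (axis j 1) $ k *s level_vec (Suc v) k)
     - (\<Sum>k\<in>UNIV. neighbour_sum (axis j 1) $ k *s level_vec v k)"
    using 3 by (simp add: neighbour_sum_diff)
  also have "\<dots> = (\<Sum>k\<in>UNIV. neighbour_sum (axis j 1) $ k *s level_vec (Suc (Suc v)) k)"
    by (simp add: neighbour_sum_sum neighbour_sum_scale vec_eq_iff algebra_simps sum_subtractf)
  finally show ?case .
qed simp

text \<open>Let \<open>a\<close> attain the minimum \<open>M\<close>. By the commutation, level
  \<open>M\<close> of \<open>a\<close> being 0 makes a nonnegative combination of the levels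
  \<open>M\<close> of its neighbours vanish, so each of these vanishes as well.\<close>

lemma first_zero_const: "first_zero j = first_zero k"
proof -
  define M where "M = Min (range first_zero)"
  have Mle: "M \<le> first_zero k" for k by (simp add: M_def)
  have "Min (range first_zero) \<in> range first_zero" by (rule Min_in) auto
  then obtain j0 where j0: "first_zero j0 = M" unfolding M_def by (metis rangeE)
  have "k \<in> {k. first_zero k = M}" for k
  proof (rule connected[of j0])
    fix a b assume "a \<in> {k. first_zero k = M}" and adj: "adj C a b"
    then have a: "first_zero a = M" by simp
    have nnM: "nonneg_vec (level_vec M k)" for k
      using Mle[of k] first_zero(3)[of M k] first_zero(1)[of a] first_zero(2)[of k] a by (cases "M = first_zero k") (auto simp: nonneg_vec_def)
    have coef: "neighbour_sum (axis a 1) $ k \<ge> 0" for k using offdiag_le[of k a] by (auto simp: neighbour_sum_axis)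
    have "(\<Sum>k\<in>UNIV. neighbour_sum (axis a 1) $ k *s level_vec M k) = 0"
      using neighbour_sum_level_vec[of M a] first_zero(2)[of a] a by simp
    then have sum0: "(\<Sum>k\<in>UNIV. neighbour_sum (axis a 1) $ k * level_vec M k $ l) = 0" for l
      by (metis (mono_tags, lifting) sum.cong sum_component vector_smult_component zero_index)
    have "neighbour_sum (axis a 1) $ b * level_vec M b $ l = 0" for l
    proof -
      have "\<forall>k\<in>UNIV. neighbour_sum (axis a 1) $ k * level_vec M k $ l = 0"
        using sum0[of l] coef nnM by (subst (asm) sum_nonneg_eq_0_iff) (auto simp: nonneg_vec_def)
      then show ?thesis by simp
    qed
    moreover have "neighbour_sum (axis a 1) $ b \<noteq> 0"
      using adj adj_sym[of a b] adj_neg[of b a] by (auto simp: neighbour_sum_axis)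
    ultimately have "level_vec M b = 0" by (simp add: vec_eq_iff)
    then have "\<not> M < first_zero b" using first_zero(4)[of M b] first_zero(1)[of a] a by auto
    then show "b \<in> {k. first_zero k = M}" using Mle[of b] by simp
  qed (simp add: j0)
  then show ?thesis by simp
qed

text \<open>By \<open>first_zero_const\<close> any vertex gives the same number, which turns out to
  be the Coxeter number.\<close>

definition cox :: nat where "cox = first_zero (SOME j. True)"

lemma cox: "cox \<ge> 2" "level_vec cox j = 0" "\<And>v. v < cox \<Longrightarrow> nonneg_vec (level_vec v j)"
  "\<And>v. 1 \<le> v \<Longrightarrow> v < cox \<Longrightarrow> level_vec v j \<noteq> 0"
proof -
  have "cox = first_zero j" unfolding cox_def by (rule first_zero_const)
  then show "cox \<ge> 2" "level_vec cox j = 0" "\<And>v. 1 \<le> v \<Longrightarrow> v < cox \<Longrightarrow> level_vec v j \<noteq> 0"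
    using first_zero by auto
  fix v assume "v < cox"
  then show "nonneg_vec (level_vec v j)" using first_zero(3)[of v j] \<open>cox = first_zero j\<close> by (cases v) (auto simp: nonneg_vec_def)
qed

text \<open>As level \<open>cox\<close> is 0, level \<open>cox - 1\<close> is itself root-like; it
  is supported on one colour, hence on pairwise non-adjacent vertices.\<close>

lemma sigma_exists: "\<exists>l. level_vec (cox - 1) j = axis l 1 \<and> D l = D j"
proof -
  have "Suc (cox - 1) = cox" using cox(1) by simp
  then have v: "level_sum (cox - 1) j = level_vec (cox - 1) j" using cox(2) by (simp add: level_sum_def)
  have "root_like j (level_vec (cox - 1) j)" using root_like_level_sum[of j "cox - 1"] v by simp
  moreover have "nonneg_vec (level_vec (cox - 1) j)" using cox(1,3) by simp
  moreover have "\<not> adj C a b" if "level_vec (cox - 1) j $ a \<noteq> 0" "level_vec (cox - 1) j $ b \<noteq> 0" for a b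
    using level_vec_supported[OF that(1)] level_vec_supported[OF that(2)] colour[of a b] by auto
  ultimately show ?thesis using root_like_independent by metis
qed

text \<open>The diagram automorphism induced by minus the longest Weyl group element; compare
  \<open>iter_steps_cox\<close>.\<close>

definition cox_involution :: "'i \<Rightarrow> 'i" where "cox_involution j = (SOME l. level_vec (cox - 1) j = axis l 1 \<and> D l = D j)"

lemma cox_involution: "level_vec (cox - 1) j = axis (cox_involution j) 1" "D (cox_involution j) = D j"
  using someI_ex[OF sigma_exists[of j]] unfolding cox_involution_def by auto

text \<open>The recursion is the same in both directions, and read downwards from \<open>cox\<close>
  it starts with 0 and the simple root at \<open>cox_involution j\<close>.\<close>

lemma level_vec_reverse: "v \<le> cox \<Longrightarrow> level_vec (cox - v) j = level_vec v (cox_involution j)"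
proof (induction v "cox_involution j" rule: level_vec.induct)
  case 1
  then show ?case using cox(2) by simp
next
  case 2
  then show ?case using cox_involution by simp
next
  case (3 v)
  define u where "u = cox - Suc (Suc v)"
  have u: "cox - Suc v = Suc u" "cox - v = Suc (Suc u)" using 3(3) by (auto simp: u_def)
  have "level_vec (Suc (Suc u)) j = level_vec v (cox_involution j)" "level_vec (Suc u) j = level_vec (Suc v) (cox_involution j)"
    using 3 u by auto
  then show ?case unfolding u_def[symmetric] by simp (metis add_diff_cancel_left' diff_add_cancel diff_diff_eq2 minus_diff_eq uminus_add_conv_diff)
qed

text \<open>Beyond \<open>cox\<close> the recursion restarts with 0 and the negative of a simple
  root.\<close>

lemma level_vec_shift: "level_vec (cox + v) j = - level_vec v (cox_involution j)"
proof (induction v "cox_involution j" rule: level_vec.induct)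
  case 1
  then show ?case using cox(2) by simp
next
  case 2
  obtain b where b: "cox = Suc b" using cox(1) by (cases cox) auto
  have "level_vec (Suc (Suc b)) j = - axis (cox_involution j) 1"
    using cox(2)[of j] cox_involution(1)[of j] b by simp
  then show ?case using b by simp
next
  case (3 v)
  then show ?case by (simp add: neighbour_sum_minus)
qed

lemma cox_involution_cox_involution [simp]: "cox_involution (cox_involution j) = j"
proof -
  have "level_vec (cox - (cox - 1)) j = level_vec (cox - 1) (cox_involution j)" by (rule level_vec_reverse) simp
  moreover have "cox - (cox - 1) = Suc 0" using cox(1) by simp
  ultimately have "axis j 1 = (axis (cox_involution (cox_involution j)) 1 :: int^'i)" using cox_involution(1)[of "cox_involution j"] by simp
  then show ?thesis by (metis axis_eq_axis zero_neq_one)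
qed

lemma level_vec_period: "level_vec (2 * cox + v) j = level_vec v j"
  using level_vec_shift[of "cox + v" j] level_vec_shift[of v "cox_involution j"] by (simp add: mult_2 add.assoc)

text \<open>Two orderings of the vertices of a forest are related by exchanging adjacent commuting
  reflections and by rotations; the latter conjugate the Coxeter element.\<close>

inductive exchange_equiv :: "'i list \<Rightarrow> 'i list \<Rightarrow> bool" where
  same: "exchange_equiv xs xs"
| chain: "exchange_equiv xs ys \<Longrightarrow> exchange_equiv ys zs \<Longrightarrow> exchange_equiv xs zs"
| swap: "\<not> adj C a b \<Longrightarrow> exchange_equiv (us @ a # b # vs) (us @ b # a # vs)"
| rot: "exchange_equiv (a # vs) (vs @ [a])"
| rot': "exchange_equiv (vs @ [a]) (a # vs)"

lemma exchange_equiv_sym: "exchange_equiv xs ys \<Longrightarrow> exchange_equiv ys xs"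
proof (induction rule: exchange_equiv.induct)
  case (swap a b us vs)
  then show ?case using exchange_equiv.swap[of b a us vs] adj_sym[of a b] by simp
qed (auto intro: exchange_equiv.intros)

lemma exchange_equiv_set: "exchange_equiv xs ys \<Longrightarrow> set xs = set ys \<and> (distinct xs \<longleftrightarrow> distinct ys)"
  by (induction rule: exchange_equiv.induct) auto

lemma reflection_involution: "simple_reflection C i (simple_reflection C i x) = x"
  unfolding reflection_alt by (simp add: vec_eq_iff C_diff C_scale C_axis)

lemma reflection_commute:
  assumes "\<not> adj C a b"
  shows "simple_reflection C a (simple_reflection C b x) = simple_reflection C b (simple_reflection C a x)"
proof (cases "a = b")
  case False
  then have "C $ a $ b = 0" "C $ b $ a = 0" using assms not_adj_zero zero_sym by blast+
  then show ?thesis unfolding reflection_alt by (simp add: vec_eq_iff C_diff C_scale C_axis)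
qed simp

lemma exchange_equiv_power:
  assumes "exchange_equiv xs ys" shows "coxeter_element C xs ^^ n = id \<longleftrightarrow> coxeter_element C ys ^^ n = id"
  using assms
proof (induction rule: exchange_equiv.induct)
  case (swap a b us vs)
  then have "coxeter_element C (us @ a # b # vs) = coxeter_element C (us @ b # a # vs)"
    by (simp add: coxeter_append coxeter_Cons fun_eq_iff reflection_commute[of a b])
  then show ?case by simp
next
  have *: "coxeter_element C (a # vs) ^^ n = id \<longleftrightarrow> coxeter_element C (vs @ [a]) ^^ n = id" for a vs
  proof -
    let ?s = "simple_reflection C a"
    have 1: "(coxeter_element C (a # vs) ^^ n) (?s x) = ?s ((coxeter_element C (vs @ [a]) ^^ n) x)" for x
      by (induction n) (simp_all add: coxeter_Cons coxeter_append)
    show ?thesis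
    proof
      assume "coxeter_element C (a # vs) ^^ n = id"
      then have "(coxeter_element C (vs @ [a]) ^^ n) x = x" for x
        using arg_cong[OF 1[of x], of ?s] by (simp add: reflection_involution)
      then show "coxeter_element C (vs @ [a]) ^^ n = id" by auto
    next
      assume "coxeter_element C (vs @ [a]) ^^ n = id"
      then have "(coxeter_element C (a # vs) ^^ n) x = x" for x
        using 1[of "?s x"] by (simp add: reflection_involution)
      then show "coxeter_element C (a # vs) ^^ n = id" by auto
    qed
  qed
  { case rot show ?case by (rule *) }
  { case rot' show ?case using * by blast }
qed simp_all

lemma exchange_equiv_move_left:
  assumes "\<And>a. a \<in> set A \<Longrightarrow> \<not> adj C l a" shows "exchange_equiv (A @ l # qmono) (l # A @ qmono)"
  using assms
proof (induction A arbitrary: qmono rule: rev_induct)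
  case (snoc a A)
  have "exchange_equiv (A @ a # l # qmono) (A @ l # a # qmono)" using snoc.prems[of a] adj_sym[of a l] by (intro exchange_equiv.swap) auto
  moreover have "exchange_equiv (A @ l # a # qmono) (l # A @ a # qmono)" by (rule snoc.IH) (use snoc.prems in auto)
  ultimately show ?case by (auto intro: exchange_equiv.chain)
qed (auto intro: exchange_equiv.same)

text \<open>A leaf commutes with everything on one of its sides: it moves left directly, or it moves
  to the right end and is rotated to the front.\<close>

lemma exchange_equiv_move_front:
  assumes "\<And>a b. a \<in> set (A @ qmono) \<Longrightarrow> b \<in> set (A @ qmono) \<Longrightarrow> adj C l a \<Longrightarrow> adj C l b \<Longrightarrow> a = b"
    and "set A \<inter> set qmono = {}"
  shows "exchange_equiv (A @ l # qmono) (l # A @ qmono)"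
proof (cases "\<exists>a\<in>set A. adj C l a")
  case True
  then have nb: "\<not> adj C l b" if "b \<in> set qmono" for b
    using assms that by (metis IntI UnCI empty_iff set_append)
  have "exchange_equiv (A @ l # qmono) (A @ qmono @ [l])"
    using nb
  proof (induction qmono arbitrary: A)
    case (Cons b qmono)
    have "exchange_equiv (A @ l # b # qmono) (A @ b # l # qmono)" using Cons.prems by (intro exchange_equiv.swap) auto
    moreover have "exchange_equiv ((A @ [b]) @ l # qmono) ((A @ [b]) @ qmono @ [l])" by (rule Cons.IH) (use Cons.prems in auto)
    ultimately show ?case by (auto intro: exchange_equiv.chain)
  qed (auto intro: exchange_equiv.same)
  moreover have "exchange_equiv ((A @ qmono) @ [l]) (l # (A @ qmono))" by (rule exchange_equiv.rot')
  ultimately show ?thesis by (auto intro: exchange_equiv.chain)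
qed (auto intro: exchange_equiv_move_left)

text \<open>Only rotations of the tail are a problem, when the rotated letter \<open>a\<close> is
  the neighbour of the leaf \<open>l\<close>. Then rotate \<open>l\<close> to the end, move it left
  up to just behind \<open>a\<close>, and rotate \<open>a\<close> to the end.\<close>

lemma exchange_equiv_Cons:
  assumes "exchange_equiv L L'" "distinct L"
    "\<And>a b. a \<in> set L \<Longrightarrow> b \<in> set L \<Longrightarrow> adj C l a \<Longrightarrow> adj C l b \<Longrightarrow> a = b"
  shows "exchange_equiv (l # L) (l # L')"
  using assms
proof (induction rule: exchange_equiv.induct)
  case (chain xs ys zs)
  have "exchange_equiv (l # xs) (l # ys)" by (rule chain.IH(1)) (use chain.prems in auto)
  moreover have "exchange_equiv (l # ys) (l # zs)"
    by (rule chain.IH(2)) (use chain.prems exchange_equiv_set[OF chain.hyps(1)] in auto)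
  ultimately show ?case by (rule exchange_equiv.chain)
next
  case (swap a b us vs)
  show ?case using exchange_equiv.swap[OF swap.hyps, of "l # us" vs] by simp
next
  have *: "exchange_equiv (l # a # vs) (l # vs @ [a])" if "distinct (a # vs)"
    "\<And>x y. x \<in> set (a # vs) \<Longrightarrow> y \<in> set (a # vs) \<Longrightarrow> adj C l x \<Longrightarrow> adj C l y \<Longrightarrow> x = y" for a vs
  proof (cases "adj C l a")
    case True
    then have "\<not> adj C l x" if "x \<in> set vs" for x using that \<open>distinct (a # vs)\<close>
      \<open>\<And>x y. x \<in> set (a # vs) \<Longrightarrow> y \<in> set (a # vs) \<Longrightarrow> adj C l x \<Longrightarrow> adj C l y \<Longrightarrow> x = y\<close>[of a x] by auto
    then have "exchange_equiv (vs @ l # []) (l # vs @ [])" by (rule exchange_equiv_move_left)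
    then have m: "exchange_equiv (vs @ [l]) (l # vs)" by simp
    have "exchange_equiv (l # a # vs) (a # vs @ [l])" using exchange_equiv.rot[of l "a # vs"] by simp
    moreover have "exchange_equiv (a # vs @ [l]) (a # l # vs)"
    proof -
      have "\<not> adj C l x" if "x \<in> set vs" for x
        using \<open>\<And>x. x \<in> set vs \<Longrightarrow> \<not> adj C l x\<close> that .
      then have "exchange_equiv ((a # A) @ l # qmono) ((a # l # A) @ qmono)" if "set A \<subseteq> set vs" for A qmono
        using that
      proof (induction A arbitrary: qmono rule: rev_induct)
        case (snoc x A)
        have "exchange_equiv ((a # A) @ x # l # qmono) ((a # A) @ l # x # qmono)"
          by (rule exchange_equiv.swap) (use snoc.prems adj_sym[of l x] in auto)
        moreover have "exchange_equiv ((a # A) @ l # x # qmono) ((a # l # A) @ x # qmono)"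
          by (rule snoc.IH) (use snoc.prems in auto)
        ultimately show ?case by (auto intro: exchange_equiv.chain)
      qed (auto intro: exchange_equiv.same)
      from this[of vs "[]"] show ?thesis by simp
    qed
    moreover have "exchange_equiv (a # l # vs) (l # vs @ [a])" using exchange_equiv.rot[of a "l # vs"] by simp
    ultimately show ?thesis by (blast intro: exchange_equiv.chain)
  next
    case False
    have "exchange_equiv (l # a # vs) (a # l # vs)" using exchange_equiv.swap[of l a "[]" vs] False by simp
    moreover have "exchange_equiv (a # l # vs) (l # vs @ [a])" using exchange_equiv.rot[of a "l # vs"] by simp
    ultimately show ?thesis by (rule exchange_equiv.chain)
  qed
  { case (rot a vs) show ?case by (rule *[OF rot.prems]) }
  { case (rot' vs a)
    have d: "distinct (a # vs)" using rot'.prems(1) by simp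
    have "set (a # vs) = set (vs @ [a])" by simp
    then have "exchange_equiv (l # a # vs) (l # vs @ [a])" by (intro *[OF d] rot'.prems(2)) simp_all
    then show ?case by (rule exchange_equiv_sym) }
qed (auto intro: exchange_equiv.same)

text \<open>Bring the same leaf to the front of both orderings and use induction for the remaining
  forest.\<close>

lemma exchange_equiv_all:
  assumes "distinct xs" "distinct ys" "set xs = set ys" shows "exchange_equiv xs ys"
  using assms
proof (induction "card (set xs)" arbitrary: xs ys)
  case 0
  then have "xs = []" "ys = []" by auto
  then show ?case by (simp add: exchange_equiv.same)
next
  case (Suc n)
  have "set xs \<noteq> {}" using Suc(2) by auto
  then obtain l where l: "l \<in> set xs" "card {k \<in> set xs. adj C l k} \<le> 1" using leaf_exists by blast
  have uniq: "a = b" if "a \<in> set xs" "b \<in> set xs" "adj C l a" "adj C l b" for a b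
    using l(2) that by (simp add: card_le_Suc0_iff_eq)
  obtain A qmono where PQ: "xs = A @ l # qmono" using l(1) by (meson split_list)
  obtain A' Q' where PQ': "ys = A' @ l # Q'" using l(1) Suc.prems(3) by (metis split_list)
  have sets: "set (A @ qmono) = set xs - {l}" "set (A' @ Q') = set xs - {l}"
    "distinct (A @ qmono)" "distinct (A' @ Q')"
    using Suc.prems unfolding PQ PQ' by auto
  have "exchange_equiv xs (l # A @ qmono)" unfolding PQ
    by (rule exchange_equiv_move_front, rule uniq) (use sets(1,3) in auto)
  moreover
  have AQ: "exchange_equiv (A @ qmono) (A' @ Q')"
    by (rule Suc.hyps(1)) (use sets Suc.hyps(2) l(1) in auto)
  have "exchange_equiv (l # A @ qmono) (l # A' @ Q')"
    by (rule exchange_equiv_Cons[OF AQ sets(3)], rule uniq) (use sets(1) in auto)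
  moreover have "exchange_equiv ys (l # A' @ Q')" unfolding PQ'
    by (rule exchange_equiv_move_front, rule uniq) (use sets(2,4) in auto)
  ultimately show ?case by (meson exchange_equiv.chain exchange_equiv_sym)
qed

section \<open>The order of the bipartite Coxeter element\<close>

lemma bipartite_power: "((half_step (colour j) \<circ> half_step (\<not> colour j)) ^^ n) (axis j 1) = level_sum (2 * n) j"
  by (induction n) (simp_all add: level_sum_Suc)

lemma half_step_axis: "half_step (colour j) (axis j 1) = - axis j 1"
proof -
  have "half_step (colour j) (axis j 1) $ k = - axis j 1 $ k" for k
  proof (cases "k = j")
    case True
    then show ?thesis by (simp add: half_step_def C_axis)
  next
    case False
    then show ?thesis using not_adj_zero[of k j] colour[of k j]
      by (auto simp: half_step_def C_axis) (auto simp: axis_def)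
  qed
  then show ?thesis by (simp add: vec_eq_iff)
qed

text \<open>When the first half step has the colour of \<open>j\<close>, it merely negates the
  simple root; hence the sign and the loss of one index.\<close>

lemma bipartite_power':
  "((half_step (\<not> colour j) \<circ> half_step (colour j)) ^^ Suc n) (axis j 1) = - level_sum (Suc (2 * n)) j"
  by (induction n) (simp_all add: level_sum_Suc half_step_axis half_step_minus)

text \<open>By linearity it is enough to test simple roots. Their orbits are, up to sign, the
  vectors \<open>level_sum\<close>, which have period \<open>2 * cox\<close>.\<close>

lemma bipartite_order: "(half_step e \<circ> half_step (\<not> e)) ^^ cox = id"
proof
  fix x :: "int^'i"
  let ?f = "half_step e \<circ> half_step (\<not> e)"
  have ax: "(?f ^^ cox) (axis j 1) = axis j 1" for j
  proof (cases "e = colour j")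
    case True
    then show ?thesis using bipartite_power[of cox j] level_vec_period[of 0 j] level_vec_period[of 1 j]
      by (simp add: level_sum_def)
  next
    case False
    obtain b where b: "cox = Suc b" using cox(1) by (cases cox) auto
    have "level_vec (Suc (2 * b)) j = - axis j 1"
      using level_vec_shift[of b j] cox_involution(1)[of "cox_involution j"] b by (simp add: mult_2)
    moreover have "level_vec (Suc (Suc (2 * b))) j = 0" using level_vec_period[of 0 j] b by simp
    ultimately show ?thesis using bipartite_power'[of b j] False b
      by (simp add: level_sum_def del: level_vec.simps funpow.simps)
  qed
  have add: "(?f ^^ n) (u + v) = (?f ^^ n) u + (?f ^^ n) v" for n u v
    by (induction n) (simp_all add: half_step_add)
  have sc: "(?f ^^ n) (a *s u) = a *s (?f ^^ n) u" for n u a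
    by (induction n) (simp_all add: half_step_scale)
  have z: "(?f ^^ n) 0 = 0" for n by (induction n) (simp_all add: half_step_zero)
  have sm: "finite S \<Longrightarrow> (?f ^^ cox) (\<Sum>s\<in>S. g s) = (\<Sum>s\<in>S. (?f ^^ cox) (g s))" for S :: "'i set" and g
    by (induction S rule: finite_induct) (simp_all only: sum.empty sum.insert add z not_False_eq_True)
  have "(?f ^^ cox) (\<Sum>i\<in>UNIV. x $ i *s axis i 1) = (\<Sum>i\<in>UNIV. x $ i *s axis i 1)"
    by (simp only: sm finite_class.finite_UNIV sc ax)
  then show "(?f ^^ cox) x = id x" using vec_sum_axis[of x] by simp
qed

text \<open>If the power \<open>n\<close> is the identity, level \<open>2 * n\<close> vanishes by
  colours. For \<open>0 < n < cox\<close> this forces \<open>2 * n = cox\<close>, but then the next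
  level is the negative of a simple root instead of the simple root at \<open>j\<close>.\<close>

lemma bipartite_order_ge:
  assumes "n > 0" "((half_step (colour j) \<circ> half_step (\<not> colour j)) ^^ n) = id" shows "n \<ge> cox"
proof (rule ccontr)
  assume "\<not> n \<ge> cox"
  have v: "level_vec (2 * n) j + level_vec (Suc (2 * n)) j = axis j 1"
    using bipartite_power[of n j] assms(2) by (simp add: level_sum_def)
  have "level_vec (2 * n) j $ k = 0" for k
  proof (rule ccontr)
    assume nz: "level_vec (2 * n) j $ k \<noteq> 0"
    then have k: "colour k \<noteq> colour j" using level_vec_supported[of "2 * n" j k] by simp
    then have "level_vec (Suc (2 * n)) j $ k = 0" using level_vec_supported[of "Suc (2 * n)" j k] by auto
    then have "axis j (1::int) $ k \<noteq> 0" using nz v by (metis add.right_neutral vector_add_component)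
    then show False using k by (auto simp: axis_def split: if_splits)
  qed
  then have z: "level_vec (2 * n) j = 0" by (simp add: vec_eq_iff)
  then have one: "level_vec (Suc (2 * n)) j = axis j 1" using v by simp
  have "2 * n \<ge> cox" using z cox(4)[of "2 * n" j] assms(1) by force
  then obtain w where w: "2 * n = cox + w" using le_Suc_ex by blast
  then have "level_vec w (cox_involution j) = 0" using z level_vec_shift[of w j] by simp
  moreover have "w < cox" using w \<open>\<not> n \<ge> cox\<close> by simp
  ultimately have "w = 0" using cox(4)[of w "cox_involution j"] by (cases w) auto
  then have "Suc (2 * n) = cox + 1" using w by simp
  then have "axis j (1::int) = - axis (cox_involution j) 1" using one level_vec_shift[of 1 j] by simp
  then have "axis j (1::int) $ j = - axis (cox_involution j) 1 $ j" by simp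
  then show False by (auto simp: axis_def split: if_splits)
qed

theorem coxeter_number_eq: "coxeter_number C = cox"
  unfolding coxeter_number_def
proof (rule Least_equality)
  obtain xs where xs: "set xs = {k. colour k = True}" "distinct xs"
    using finite_distinct_list[of "{k. colour k = True}"] by auto
  obtain ys where ys: "set ys = {k. colour k = False}" "distinct ys"
    using finite_distinct_list[of "{k. colour k = False}"] by auto
  have cx: "coxeter_element C (xs @ ys) = half_step True \<circ> half_step False"
    using coxeter_eq_half_step[OF xs(2,1)] coxeter_eq_half_step[OF ys(2,1)] by (auto simp: fun_eq_iff coxeter_append)
  have cy: "coxeter_element C (ys @ xs) = half_step False \<circ> half_step True"
    using coxeter_eq_half_step[OF xs(2,1)] coxeter_eq_half_step[OF ys(2,1)] by (auto simp: fun_eq_iff coxeter_append)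
  have d: "distinct (xs @ ys)" "set (xs @ ys) = UNIV" "distinct (ys @ xs)" "set (ys @ xs) = UNIV"
    using xs ys by auto
  show "0 < cox \<and> (\<forall>is. distinct is \<and> set is = UNIV \<longrightarrow> coxeter_element C is ^^ cox = id)"
  proof (intro conjI allI impI)
    show "0 < cox" using cox(1) by simp
    fix zs :: "'i list" assume zs: "distinct zs \<and> set zs = UNIV"
    then have "exchange_equiv zs (xs @ ys)" using d by (intro exchange_equiv_all) auto
    then show "coxeter_element C zs ^^ cox = id"
      using exchange_equiv_power[of zs "xs @ ys" cox] bipartite_order[of True] by (simp add: cx)
  qed
  fix n assume n: "0 < n \<and> (\<forall>is. distinct is \<and> set is = UNIV \<longrightarrow> coxeter_element C is ^^ n = id)"
  then have 1: "(half_step True \<circ> half_step False) ^^ n = id" "(half_step False \<circ> half_step True) ^^ n = id"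
    using d cx cy by metis+
  obtain j :: 'i where True by blast
  show "cox \<le> n"
    by (rule bipartite_order_ge[of n j]) (use n 1 in \<open>cases "colour j"; simp\<close>)+
qed

subsection \<open>Roots\<close>

definition root :: "int^'i \<Rightarrow> bool" where "root x \<longleftrightarrow> (\<exists>y. root_coroot C x y)"

lemma root_axis: "root (axis i 1)"
  unfolding root_def using root_coroot.simple by blast

lemma root_reflection: "root x \<Longrightarrow> root (simple_reflection C i x)"
  unfolding root_def using root_coroot.reflect by blast

lemma root_induct [consumes 1, case_names axis reflection]:
  assumes "root x" "\<And>i. P (axis i 1)" "\<And>x i. root x \<Longrightarrow> P x \<Longrightarrow> P (simple_reflection C i x)"
  shows "P x"
proof -
  obtain y where "root_coroot C x y" using assms(1) root_def by blast
  then show ?thesis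
  proof (induction rule: root_coroot.induct)
    case (reflect b g i)
    then have "root b" unfolding root_def by blast
    then show ?case using reflect by (intro assms(3))
  qed (rule assms(2))
qed

lemma D_symm_mult: "D i * (C $ i $ l * a) = D l * a * C $ l $ i"
proof -
  have "D i * (C $ i $ l * a) = (D i * C $ i $ l) * a" by simp
  also have "\<dots> = D l * a * C $ l $ i" unfolding D_symm[of i l] by simp
  finally show ?thesis .
qed

text \<open>Identifying the simple coroot at \<open>l\<close> with the simple root divided by
  \<open>D l\<close>, the coroot of \<open>x\<close> is \<open>2 x / (x, x)\<close>.\<close>

lemma coroot_scale:
  assumes "root_coroot C x y"
  shows "\<exists>k. root_like k x \<and> (\<forall>l. D l * x $ l = D k * y $ l)"
  using assms
proof (induction rule: root_coroot.induct)
  case (simple i)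
  have "\<forall>l. D l * axis i 1 $ l = D i * axis i 1 $ l" by (simp add: axis_def)
  then show ?case using root_like_axis by blast
next
  case (reflect b g i)
  then obtain k where k: "root_like k b" "\<And>l. D l * b $ l = D k * g $ l" by blast
  have "D i * (C *v b) $ i = (\<Sum>l\<in>UNIV. D l * b $ l * C $ l $ i)"
    unfolding matrix_vector_mult_def
    by (simp add: sum_distrib_left D_symm_mult)
  also have "\<dots> = (\<Sum>l\<in>UNIV. D k * g $ l * C $ l $ i)" by (simp only: k(2))
  also have "\<dots> = D k * (g v* C) $ i"
    unfolding vector_matrix_mult_def by (simp add: sum_distrib_left ac_simps)
  finally have i: "D i * (C *v b) $ i = D k * (g v* C) $ i" .
  have "D l * simple_reflection C i b $ l = D k * simple_coreflection C i g $ l" for l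
    using k(2)[of l] i by (auto simp: reflection_nth simple_coreflection_def axis_def right_diff_distrib)
  then show ?case using root_like_reflection[OF k(1)] by blast
qed

lemma root_root_like: "root x \<Longrightarrow> \<exists>k. root_like k x"
  unfolding root_def using coroot_scale by blast

lemma root_sign: "root x \<Longrightarrow> nonneg_vec x \<or> nonneg_vec (- x)"
  using root_root_like root_like_sign by blast

lemma root_nz: "root x \<Longrightarrow> x \<noteq> 0"
  using root_root_like root_like_nz by blast

lemma root_norm_pos: "root x \<Longrightarrow> B x x > 0"
  using root_nz B_pos by blast

lemma reflection_minus: "simple_reflection C i (- x) = - simple_reflection C i x"
  unfolding reflection_alt by (simp add: C_minus vec_eq_iff)

lemma root_minus: "root x \<Longrightarrow> root (- x)"
proof (induction rule: root_induct)
  case (axis i)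
  have "simple_reflection C i (axis i 1) = - axis i 1"
    unfolding reflection_alt by (simp add: C_axis vec_eq_iff)
  then show ?case using root_reflection[OF root_axis[of i], of i] by simp
next
  case (reflection x i)
  then show ?case using root_reflection[of "- x" i] by (simp add: reflection_minus)
qed

lemma root_half_step: "root x \<Longrightarrow> root (half_step e x)"
  by (rule half_step_induct[where P = root]) (auto intro: root_reflection)

lemma root_level_sum: "root (level_sum b j)"
  by (induction b) (simp_all add: root_axis root_half_step level_sum_Suc)

lemma B_reflection_left: "B (simple_reflection C i x) y = B x (simple_reflection C i y)"
  using B_reflection[of i x "simple_reflection C i y"] by (simp add: reflection_involution)

lemma reflection_diff: "simple_reflection C i (x - y) = simple_reflection C i x - simple_reflection C i y"
  unfolding reflection_alt by (simp add: C_diff vec_eq_iff algebra_simps)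

lemma reflection_scale: "simple_reflection C i (a *s x) = a *s simple_reflection C i x"
  unfolding reflection_alt by (simp add: C_scale vec_eq_iff algebra_simps)

text \<open>Integrality of the pairing and stability under the reflection in \<open>b\<close> hold
  for simple \<open>b\<close> and are carried along by conjugation with simple reflections.\<close>

lemma root_reflect_root:
  assumes "root b" "root x"
  shows "\<exists>n. 2 * B b x = n * B b b \<and> root (x - n *s b)"
  using assms
proof (induction arbitrary: x rule: root_induct)
  case (axis i)
  have "2 * B (axis i 1) x = (C *v x) $ i * B (axis i 1) (axis i 1)"
    by (simp add: B_axis C_axis)
  moreover have "root (x - (C *v x) $ i *s axis i 1)"
    using root_reflection[OF axis, of i] by (simp add: reflection_alt)
  ultimately show ?case by blast
next
  case (reflection b i)
  obtain n where n: "2 * B b (simple_reflection C i x) = n * B b b"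
    "root (simple_reflection C i x - n *s b)"
    using reflection.IH[OF root_reflection[OF reflection.prems]] by blast
  have "root (simple_reflection C i (simple_reflection C i x - n *s b))"
    using n(2) by (rule root_reflection)
  then have "root (x - n *s simple_reflection C i b)"
    by (simp add: reflection_diff reflection_scale reflection_involution)
  then show ?case using n(1) by (auto simp: B_reflection_left reflection_involution)
qed

lemma norm_diff: "B (x - y) (x - y) = B x x + B y y - 2 * B x y"
  using B_sym[of y x] by (simp add: B_diff B_diff')

text \<open>Both Cartan integers are positive; were both at least 2, the norm of
  \<open>x - y\<close> would not be positive. So one of them is 1, and the difference is a reflected
  root up to sign.\<close>

lemma root_diff:
  assumes "root x" "root y" "B x y > 0" "x \<noteq> y"
  shows "root (x - y) \<and> (2 * B x y = B x x \<or> 2 * B x y = B y y)"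
proof -
  obtain n where n: "2 * B x y = n * B x x" "root (y - n *s x)"
    using root_reflect_root[OF assms(1,2)] by blast
  obtain m where m: "2 * B y x = m * B y y" "root (x - m *s y)"
    using root_reflect_root[OF assms(2,1)] by blast
  have pos: "B x x > 0" "B y y > 0" using assms root_norm_pos by auto
  have np: "n > 0" using n(1) assms(3) pos(1) by (metis zero_less_mult_pos2 mult_pos_pos zero_less_numeral)
  have mp: "m > 0" using m(1) assms(3) pos(2) B_sym[of y x] by (metis zero_less_mult_pos2 mult_pos_pos zero_less_numeral)
  have "n = 1 \<or> m = 1"
  proof (rule ccontr)
    assume "\<not> ?thesis"
    then have "n \<ge> 2" "m \<ge> 2" using np mp by auto
    then have "2 * B x x \<le> n * B x x" "2 * B y y \<le> m * B y y" using pos by (auto intro: mult_right_mono)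
    then have "B (x - y) (x - y) \<le> 0" using n(1) m(1) B_sym[of y x] by (simp add: norm_diff)
    then show False using B_pos[of "x - y"] assms(4) by simp
  qed
  then show ?thesis
  proof
    assume "n = 1"
    then show ?thesis using n root_minus[of "y - x"] by simp
  next
    assume "m = 1"
    then show ?thesis using m B_sym[of y x] by simp
  qed
qed

text \<open>Simple reflections are invertible over the integers and so preserve divisibility by
  2.\<close>

lemma root_primitive:
  assumes "root x" shows "\<not> (\<forall>l. 2 dvd x $ l)"
  using assms
proof (induction rule: root_induct)
  case (axis i)
  show ?case by (auto simp: axis_def intro!: exI[of _ i])
next
  case (reflection x i)
  show ?case
  proof
    assume a: "\<forall>l. 2 dvd simple_reflection C i x $ l"
    have "2 dvd (C *v simple_reflection C i x) $ i"
      unfolding matrix_vector_mult_def using a by (auto intro!: dvd_sum)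
    then have "\<forall>l. 2 dvd simple_reflection C i (simple_reflection C i x) $ l"
      using a reflection_nth[of i "simple_reflection C i x"] by auto
    then show False using reflection.IH by (simp add: reflection_involution)
  qed
qed

text \<open>The norm of \<open>y - 2 x\<close> is \<open>(4 - n) * B x x\<close>. For
  \<open>n\<close> at least 4 it forces \<open>y = 2 x\<close>, against
  \<open>root_primitive\<close>.\<close>

lemma root_norm_ratio:
  assumes "root x" "root y" "2 * B x y = B y y" "B y y = n * B x x"
  shows "n \<le> 3"
proof (rule ccontr)
  assume "\<not> n \<le> 3"
  have pos: "B x x > 0" using assms root_norm_pos by auto
  have "B (y - 2 *s x) (y - 2 *s x) = (4 - n) * B x x"
    using assms(3,4) B_sym[of y x] by (simp add: norm_diff B_scale B_scale' algebra_simps)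
  then have "B (y - 2 *s x) (y - 2 *s x) \<le> 0"
    using \<open>\<not> n \<le> 3\<close> pos by (simp add: mult_le_0_iff)
  then have "y - 2 *s x = 0" using B_pos[of "y - 2 *s x"] by fastforce
  then have "y = 2 *s x" by simp
  then have "\<forall>l. 2 dvd y $ l" by simp
  then show False using root_primitive[OF assms(2)] by blast
qed

subsection \<open>Enumeration of the positive roots\<close>

text \<open>Alternating half steps, beginning with colour \<open>e\<close>; after \<open>cox\<close>
  of them the longest Weyl group element is reached.\<close>

primrec iter_steps :: "bool \<Rightarrow> nat \<Rightarrow> int^'i \<Rightarrow> int^'i" where
  "iter_steps e 0 x = x"
| "iter_steps e (Suc b) x = half_step (e = even b) (iter_steps e b x)"

lemma B_iter_steps: "B (iter_steps e b x) (iter_steps e b y) = B x y"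
  by (induction b) (simp_all add: B_half_step)

lemma iter_steps_add: "iter_steps e b (x + y) = iter_steps e b x + iter_steps e b y" by (induction b) (simp_all add: half_step_add)
lemma iter_steps_minus: "iter_steps e b (- x) = - iter_steps e b x" by (induction b) (simp_all add: half_step_minus)
lemma iter_steps_scale: "iter_steps e b (a *s x) = a *s iter_steps e b x" by (induction b) (simp_all add: half_step_scale)
lemma iter_steps_zero: "iter_steps e b 0 = 0" by (induction b) (simp_all add: half_step_zero)
lemma iter_steps_sum: "finite S \<Longrightarrow> iter_steps e b (\<Sum>s\<in>S. f s) = (\<Sum>s\<in>S. iter_steps e b (f s))"
  by (induction S rule: finite_induct) (simp_all add: iter_steps_zero iter_steps_add)

lemma iter_steps_inj: "iter_steps e b x = iter_steps e b y \<Longrightarrow> x = y"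
proof -
  assume "iter_steps e b x = iter_steps e b y"
  then have "iter_steps e b (x - y) = 0" using iter_steps_add[of e b x "- y"] by (simp add: iter_steps_minus)
  then have "B (x - y) (x - y) = 0" using B_iter_steps[of e b "x - y" "x - y"] by (simp add: B_zero)
  then show ?thesis using B_pos[of "x - y"] by fastforce
qed

lemma root_iter_steps: "root x \<Longrightarrow> root (iter_steps e b x)"
  by (induction b) (simp_all add: root_half_step)

lemma iter_steps_axis_other: "colour j \<noteq> e \<Longrightarrow> iter_steps e b (axis j 1) = level_sum b j"
proof (induction b)
  case (Suc b)
  have "(e = even b) = (colour j = odd b)" using Suc.prems by auto
  then show ?case using Suc by (simp add: level_sum_Suc)
qed simp

lemma iter_steps_axis_same: "colour j = e \<Longrightarrow> iter_steps e (Suc b) (axis j 1) = - level_sum b j"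
proof (induction b)
  case 0
  then show ?case using half_step_axis[of j] by simp
next
  case (Suc b)
  have "(e = even (Suc b)) = (colour j = odd b)" using Suc.prems by auto
  moreover have "iter_steps e (Suc (Suc b)) (axis j 1) = half_step (e = even (Suc b)) (iter_steps e (Suc b) (axis j 1))"
    by (rule iter_steps.simps)
  ultimately show ?case using Suc by (simp add: level_sum_Suc half_step_minus del: iter_steps.simps)
qed

lemma iter_steps_cox_axis: "iter_steps e cox (axis j 1) = - axis (cox_involution j) 1"
proof (cases "colour j = e")
  case True
  obtain b where b: "cox = Suc b" using cox(1) by (cases cox) auto
  show ?thesis unfolding b iter_steps_axis_same[OF True] using cox_involution(1)[of j] cox(2)[of j] b
    by (simp add: level_sum_def)
next
  case False
  show ?thesis using iter_steps_axis_other[OF False, of cox] level_vec_shift[of 0 j] level_vec_shift[of 1 j]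
    by (simp add: level_sum_def)
qed

lemma iter_steps_cox: "iter_steps e cox x $ k = - x $ cox_involution k"
proof -
  have "iter_steps e cox x = iter_steps e cox (\<Sum>i\<in>UNIV. x $ i *s axis i 1)" using vec_sum_axis[of x] by simp
  also have "\<dots> = (\<Sum>i\<in>UNIV. x $ i *s (- axis (cox_involution i) 1))"
    by (simp only: iter_steps_sum finite_class.finite_UNIV iter_steps_scale iter_steps_cox_axis)
  finally have "iter_steps e cox x $ k = (\<Sum>i\<in>UNIV. x $ i * (- axis (cox_involution i) 1 $ k))" by simp
  also have "\<dots> = (\<Sum>i\<in>UNIV. if i = cox_involution k then - x $ i else 0)"
    by (intro sum.cong refl) (auto simp: axis_def)
  finally show ?thesis by simp
qed

lemma half_step_half_step: "half_step e (half_step e x) = x"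
proof -
  obtain xs where xs: "set xs = {k. colour k = e}" "distinct xs"
    using finite_distinct_list[of "{k. colour k = e}"] by auto
  have "coxeter_element C ys (coxeter_element C (rev ys) x) = x" for ys x
    by (induction ys arbitrary: x) (simp_all add: coxeter_Cons coxeter_append reflection_involution)
  then have "coxeter_element C xs (coxeter_element C (rev xs) x) = x" .
  then show ?thesis
    using coxeter_eq_half_step[of xs e] coxeter_eq_half_step[of "rev xs" e] xs by simp
qed

lemma iter_steps_front: "iter_steps e (Suc b) x = iter_steps (\<not> e) b (half_step e x)"
proof (induction b)
  case (Suc b)
  have "iter_steps e (Suc (Suc b)) x = half_step (e = even (Suc b)) (iter_steps (\<not> e) b (half_step e x))"
    using Suc by simp
  also have "(e = even (Suc b)) = ((\<not> e) = even b)" by auto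
  finally show ?case by simp
qed simp

text \<open>So \<open>level_sum b i\<close> is the root that has become the simple root at
  \<open>i\<close> just before step \<open>b\<close> negates it: the usual list of inversions along
  a reduced word.\<close>

lemma iter_steps_level_sum: "colour i = (e = even b) \<Longrightarrow> iter_steps e b (level_sum b i) = axis i 1"
proof (induction b arbitrary: e)
  case (Suc b)
  have "(colour i = odd b) = e" using Suc.prems by auto
  then have "half_step e (level_sum (Suc b) i) = level_sum b i" by (simp add: level_sum_Suc half_step_half_step)
  moreover have "iter_steps (\<not> e) b (level_sum b i) = axis i 1" by (rule Suc.IH) (use Suc.prems in auto)
  ultimately show ?case unfolding iter_steps_front by simp
qed simp

lemma nonneg_vec_level_sum: "b < cox \<Longrightarrow> nonneg_vec (level_sum b j)"
  using cox(3)[of b j] cox(2)[of j] cox(3)[of "Suc b" j]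
  by (cases "Suc b = cox") (auto simp: level_sum_def nonneg_vec_def)

text \<open>A half step leaves the other colour unchanged, so a positive root that becomes negative
  is supported on colour \<open>e\<close>, an independent set of vertices, and is therefore
  simple.\<close>

lemma half_step_crossing:
  assumes "root z" "nonneg_vec z" "\<not> nonneg_vec (half_step e z)"
  obtains l where "z = axis l 1" "colour l = e"
proof -
  have neg: "nonneg_vec (- half_step e z)" using root_sign[OF root_half_step[OF assms(1)]] assms(3) by blast
  have supported: "colour k = e" if "z $ k \<noteq> 0" for k
  proof (rule ccontr)
    assume "colour k \<noteq> e"
    then have "half_step e z $ k = z $ k" by (simp add: half_step_def)
    then have "z $ k \<le> 0" using neg unfolding nonneg_vec_def by (metis neg_0_le_iff_le vector_uminus_component)
    then show False using assms(2) that unfolding nonneg_vec_def by (metis order_antisym)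
  qed
  obtain k where "root_like k z" using root_root_like[OF assms(1)] by blast
  moreover have "\<not> adj C a b" if "z $ a \<noteq> 0" "z $ b \<noteq> 0" for a b
    using supported[OF that(1)] supported[OF that(2)] colour[of a b] by blast
  ultimately obtain l where l: "z = axis l 1" using root_like_independent[of k z] assms(2) by metis
  then have "z $ l \<noteq> 0" by simp
  then show ?thesis using that l supported by blast
qed

text \<open>The letters of a reduced word of the longest element: vertex \<open>i\<close> is
  reflected at step \<open>b\<close>.\<close>

definition steps :: "bool \<Rightarrow> (nat \<times> 'i) set" where
  "steps e = {(b, i). b < cox \<and> colour i = (e = even b)}"

lemma finite_steps [simp]: "finite (steps e)"
  by (rule finite_subset[of _ "{..<cox} \<times> UNIV"]) (auto simp: steps_def)

text \<open>After \<open>cox\<close> steps the positive root \<open>x\<close> is negative. Just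
  before its first change of sign it is a simple root, which determines the pair.\<close>

lemma positive_root_unique_step:
  assumes "root x" "nonneg_vec x"
  shows "\<exists>!p. p \<in> steps e \<and> level_sum (fst p) (snd p) = x"
proof -
  have "\<not> nonneg_vec (iter_steps e cox x)"
  proof
    assume "nonneg_vec (iter_steps e cox x)"
    then have "x $ cox_involution k \<le> 0" for k unfolding nonneg_vec_def iter_steps_cox by (metis neg_0_le_iff_le)
    then have "nonneg_vec (- x)" unfolding nonneg_vec_def by (metis cox_involution_cox_involution neg_0_le_iff_le vector_uminus_component)
    then show False using nonneg_vec_antisym[OF assms(2)] root_nz[OF assms(1)] by simp
  qed
  moreover have "nonneg_vec (iter_steps e 0 x)" using assms by simp
  ultimately obtain b where b: "b < cox" "\<not> nonneg_vec (iter_steps e (Suc b) x)" "nonneg_vec (iter_steps e b x)"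
    using ex_least_nat_less[of "\<lambda>b. \<not> nonneg_vec (iter_steps e b x)" cox] by blast
  obtain l where l: "iter_steps e b x = axis l 1" "colour l = (e = even b)"
    using half_step_crossing[OF root_iter_steps[OF assms(1)] b(3), of "e = even b"] b(2) by auto
  have "x = level_sum b l" using iter_steps_inj[of e b x "level_sum b l"] iter_steps_level_sum[OF l(2)] l(1) by simp
  then have ex: "(b, l) \<in> steps e \<and> level_sum (fst (b, l)) (snd (b, l)) = x" using b l by (simp add: steps_def)
  \<comment> \<open>There is no way back: if \<open>- iter_steps e c x\<close> lost its sign at step
    \<open>c\<close>, then \<open>- x\<close> would be the nonnegative vector
    \<open>level_sum c m\<close>.\<close>
  have after: "nonneg_vec (- iter_steps e c x)" if p: "(b, i) \<in> steps e" "level_sum b i = x" "b < c" "c \<le> cox" for b i c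
    using p(3,4)
  proof (induction c)
    case (Suc c)
    show ?case
    proof (cases "c = b")
      case True
      have c: "colour i = (e = even b)" using p(1) by (simp add: steps_def)
      have "iter_steps e (Suc b) x = - axis i 1" using iter_steps_level_sum[OF c] half_step_axis[of i] p(2) c by simp
      then show ?thesis using True by (simp add: nonneg_vec_def axis_def)
    next
      case False
      then have IH: "nonneg_vec (- iter_steps e c x)" using Suc by simp
      show ?thesis
      proof (rule ccontr)
        assume n: "\<not> nonneg_vec (- iter_steps e (Suc c) x)"
        obtain m where m: "- iter_steps e c x = axis m 1" "colour m = (e = even c)"
          using half_step_crossing[OF root_minus[OF root_iter_steps[OF assms(1)]] IH, of "e = even c"] n by (auto simp: half_step_minus)
        then have "iter_steps e c (- x) = iter_steps e c (level_sum c m)" using iter_steps_level_sum[OF m(2)] by (simp add: iter_steps_minus)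
        then have "- x = level_sum c m" by (rule iter_steps_inj)
        then have "nonneg_vec (- x)" using nonneg_vec_level_sum[of c m] Suc.prems by simp
        then show False using nonneg_vec_antisym[OF assms(2)] root_nz[OF assms(1)] by simp
      qed
    qed
  qed simp
  have less: "\<not> b < b'" if "(b, i) \<in> steps e" "level_sum b i = x" "(b', i') \<in> steps e" "level_sum b' i' = x" for b i b' i'
  proof
    assume "b < b'"
    then have "nonneg_vec (- iter_steps e b' x)" using after[OF that(1,2)] that(3) by (simp add: steps_def)
    moreover have "iter_steps e b' x = axis i' 1" using iter_steps_level_sum[of i' e b'] that(3,4) by (simp add: steps_def)
    ultimately have "(0::int) \<le> - axis i' 1 $ i'" unfolding nonneg_vec_def by (metis vector_uminus_component)
    then show False by simp
  qed
  show ?thesis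
  proof (rule ex1I[where a = "(b, l)"])
    show "(b, l) \<in> steps e \<and> level_sum (fst (b, l)) (snd (b, l)) = x" by (rule ex)
  next
    fix p assume p: "p \<in> steps e \<and> level_sum (fst p) (snd p) = x"
    obtain b' i' where q: "p = (b', i')" by (cases p)
    have "b' = b" using less[of b l b' i'] less[of b' i' b l] p ex unfolding q by simp
    moreover have "axis i' (1::int) = axis l 1"
      using iter_steps_level_sum[of i' e b'] iter_steps_level_sum[of l e b] p ex \<open>b' = b\<close> unfolding q by (simp add: steps_def)
    then have "i' = l" by (metis axis_eq_axis zero_neq_one)
    ultimately show "p = (b, l)" using q by simp
  qed
qed

lemma finite_roots: "finite {x. root x}"
proof -
  have "{x. root x} \<subseteq> (\<lambda>p. level_sum (fst p) (snd p)) ` steps True \<union> uminus ` (\<lambda>p. level_sum (fst p) (snd p)) ` steps True"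
  proof
    fix x assume "x \<in> {x. root x}"
    then have x: "root x" by simp
    from root_sign[OF x] show "x \<in> (\<lambda>p. level_sum (fst p) (snd p)) ` steps True \<union> uminus ` (\<lambda>p. level_sum (fst p) (snd p)) ` steps True"
    proof
      assume "nonneg_vec x"
      then show ?thesis using positive_root_unique_step[OF x, of True] by blast
    next
      assume "nonneg_vec (- x)"
      then obtain p where "p \<in> steps True" "level_sum (fst p) (snd p) = - x"
        using positive_root_unique_step[OF root_minus[OF x], of True] by blast
      then have "x = - level_sum (fst p) (snd p)" by simp
      then show ?thesis using \<open>p \<in> steps True\<close> by blast
    qed
  qed
  then show ?thesis by (rule finite_subset) simp
qed

subsection \<open>The highest root\<close>

definition dominant :: "int^'i \<Rightarrow> bool" where
  "dominant x \<longleftrightarrow> (\<forall>i. 0 \<le> (C *v x) $ i)"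

definition height :: "int^'i \<Rightarrow> int" where "height x = (\<Sum>k\<in>UNIV. x $ k)"

lemma dominant_root_nonneg_vec:
  assumes "root x" "dominant x" shows "nonneg_vec x"
proof (rule ccontr)
  assume "\<not> nonneg_vec x"
  then have "nonneg_vec (- x)" using root_sign assms by blast
  then have "x $ i * (D i * (C *v x) $ i) \<le> 0" for i
    using assms(2) unfolding nonneg_vec_def dominant_def
    by (metis mult_nonneg_nonneg mult_nonpos_nonneg D_pos less_imp_le neg_0_le_iff_le vector_uminus_component)
  then have "B x x \<le> 0" by (subst B_coord) (simp add: B_axis sum_nonpos)
  then show False using root_norm_pos[OF assms(1)] by simp
qed

text \<open>A zero coordinate next to a positive one would make the value on the corresponding
  coroot negative; now use connectedness.\<close>

lemma dominant_root_full:
  assumes "root x" "dominant x" shows "x $ k > 0"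
proof -
  have nnx: "x $ k \<ge> 0" for k using dominant_root_nonneg_vec[OF assms] by (simp add: nonneg_vec_def)
  obtain i where i: "x $ i \<noteq> 0" using root_nz[OF assms(1)] by (auto simp: vec_eq_iff)
  have "k \<in> {k. x $ k > 0}"
  proof (rule connected[of i])
    show "i \<in> {k. x $ k > 0}" using i nnx[of i] by simp
    fix a b assume "a \<in> {k. x $ k > 0}" and adj: "adj C a b"
    then have a: "x $ a > 0" by simp
    show "b \<in> {k. x $ k > 0}"
    proof (rule ccontr)
      assume "b \<notin> {k. x $ k > 0}"
      then have "x $ b = 0" using nnx[of b] by simp
      then have "(C *v x) $ b = - neighbour_sum x $ b" by (simp add: neighbour_sum_def)
      also have "\<dots> = (\<Sum>l | adj C b l. C $ b $ l * x $ l)" by (simp add: neighbour_sum_nth sum_negf)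
      also have "\<dots> \<le> C $ b $ a * x $ a + (\<Sum>l\<in>{l. adj C b l} - {a}. C $ b $ l * x $ l)"
        using adj adj_sym[of a b] by (subst sum.remove[of _ a]) auto
      also have "\<dots> < 0"
      proof -
        have "C $ b $ a * x $ a < 0" using a adj adj_sym[of a b] adj_neg[of b a] by (simp add: mult_neg_pos)
        moreover have "(\<Sum>l\<in>{l. adj C b l} - {a}. C $ b $ l * x $ l) \<le> 0"
          by (intro sum_nonpos mult_nonpos_nonneg nnx) (auto simp: adj_def)
        ultimately show ?thesis by simp
      qed
      finally show False using assms(2) by (simp add: dominant_def not_less[symmetric])
    qed
  qed
  then show ?thesis by simp
qed

lemma dominant_roots_pos:
  assumes "root x" "dominant x" "root y" "dominant y" shows "B x y > 0"
proof -
  have t: "x $ i * B (axis i 1) y \<ge> 0" for i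
    using assms(4) dominant_root_full[OF assms(1,2), of i] by (simp add: B_axis dominant_def less_imp_le)
  have "\<exists>i. B (axis i 1) y \<noteq> 0"
  proof (rule ccontr)
    assume "\<not> ?thesis"
    then have "B y y = 0" by (subst B_coord) simp
    then show False using root_norm_pos[OF assms(3)] by simp
  qed
  then obtain i where "B (axis i 1) y \<noteq> 0" by blast
  then have "x $ i * B (axis i 1) y > 0"
    using t[of i] dominant_root_full[OF assms(1,2), of i] by (simp add: order.strict_iff_order)
  also have "x $ i * B (axis i 1) y \<le> B x y"
    by (subst B_coord, rule member_le_sum) (use t in auto)
  finally show ?thesis .
qed

text \<open>Reflecting where the coroot value is negative raises the height.\<close>

lemma max_height_dominant:
  assumes "S \<noteq> {}" "\<And>x. x \<in> S \<Longrightarrow> root x"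
    "\<And>x i. x \<in> S \<Longrightarrow> (C *v x) $ i < 0 \<Longrightarrow> simple_reflection C i x \<in> S"
  obtains x where "x \<in> S" "dominant x" "\<And>y. y \<in> S \<Longrightarrow> height y \<le> height x"
proof -
  have fin: "finite S" by (rule finite_subset[OF _ finite_roots]) (use assms(2) in auto)
  define M where "M = Max (height ` S)"
  have "M \<in> height ` S" unfolding M_def using fin assms(1) by (intro Max_in) auto
  then obtain x where x: "x \<in> S" "M = height x" by blast
  have le: "height y \<le> height x" if "y \<in> S" for y
    using that fin unfolding x(2)[symmetric] M_def by (intro Max_ge) auto
  have "0 \<le> (C *v x) $ i" for i
  proof (rule ccontr)
    assume "\<not> 0 \<le> (C *v x) $ i"
    then have neg: "(C *v x) $ i < 0" by simp
    have "height (simple_reflection C i x) = height x - (C *v x) $ i"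
    proof -
      have "simple_reflection C i x $ k = x $ k - (if k = i then (C *v x) $ i else 0)" for k
        by (simp add: reflection_nth)
      then show ?thesis by (simp add: height_def sum_subtractf)
    qed
    then show False using le[OF assms(3)[OF x(1) neg]] neg by simp
  qed
  then show ?thesis using that x(1) le by (auto simp: dominant_def)
qed

text \<open>Let \<open>t\<close> have maximal height and \<open>z\<close> maximal height among the
  roots above \<open>y\<close>; both are dominant. If they differ, \<open>z - t\<close> is a root
  and has a sign: \<open>z\<close> above \<open>t\<close> contradicts the choice of
  \<open>t\<close>, while \<open>z\<close> below \<open>t\<close> puts \<open>t\<close> above
  \<open>y\<close> and contradicts the choice of \<open>z\<close>.\<close>

lemma highest_root_exists:
  "\<exists>x. root x \<and> dominant x \<and> (\<forall>y. root y \<longrightarrow> nonneg_vec (x - y))"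
proof -
  obtain t where t: "root t" "dominant t" "\<And>y. root y \<Longrightarrow> height y \<le> height t"
    by (rule max_height_dominant[of "{x. root x}"]) (use root_axis root_reflection in auto)
  have "nonneg_vec (t - y)" if y: "root y" for y
  proof -
    obtain z where z: "z \<in> {x. root x \<and> nonneg_vec (x - y)}" "dominant z"
      "\<And>x. x \<in> {x. root x \<and> nonneg_vec (x - y)} \<Longrightarrow> height x \<le> height z"
    proof (rule max_height_dominant[of "{x. root x \<and> nonneg_vec (x - y)}"])
      show "{x. root x \<and> nonneg_vec (x - y)} \<noteq> {}" using y by (auto simp: nonneg_vec_def intro!: exI[of _ y])
      fix x i assume "x \<in> {x. root x \<and> nonneg_vec (x - y)}" and neg: "(C *v x) $ i < 0"
      then have x: "root x" "\<And>k. 0 \<le> x $ k - y $ k" by (simp_all add: nonneg_vec_def)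
      have "0 \<le> simple_reflection C i x $ k - y $ k" for k
        using x(2)[of k] neg by (auto simp: reflection_nth)
      then show "simple_reflection C i x \<in> {x. root x \<and> nonneg_vec (x - y)}"
        using root_reflection[OF x(1), of i] by (simp add: nonneg_vec_def)
    qed auto
    then have zr: "root z" and zy: "nonneg_vec (z - y)" by auto
    have "z = t"
    proof (rule ccontr)
      assume "z \<noteq> t"
      then have r: "root (z - t)" using root_diff[OF zr t(1) dominant_roots_pos[OF zr z(2) t(1,2)]] by blast
      have htd: "height (z - t) = height z - height t" "height (t - z) = height t - height z" by (simp_all add: height_def sum_subtractf)
      have pos: "height u > 0" if u: "nonneg_vec u" "u \<noteq> 0" for u
      proof -
        obtain k where "u $ k \<noteq> 0" using u(2) by (auto simp: vec_eq_iff)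
        then have "u $ k > 0" using u(1) by (simp add: nonneg_vec_def order.strict_iff_order)
        also have "u $ k \<le> height u" unfolding height_def by (rule member_le_sum) (use u(1) in \<open>auto simp: nonneg_vec_def\<close>)
        finally show ?thesis .
      qed
      from root_sign[OF r] show False
      proof
        assume "nonneg_vec (z - t)"
        then have "height (z - t) > 0" using root_nz[OF r] by (rule pos)
        then show False using t(3)[OF zr] htd by simp
      next
        assume n: "nonneg_vec (- (z - t))"
        then have n: "nonneg_vec (t - z)" by simp
        have "y $ k \<le> t $ k" for k
        proof -
          have "0 \<le> (t - z) $ k" "0 \<le> (z - y) $ k" using n zy by (simp_all only: nonneg_vec_def)
          then show ?thesis by simp
        qed
        then have "nonneg_vec (t - y)" by (simp add: nonneg_vec_def)
        then have "height t \<le> height z" using z(3) t(1) by simp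
        moreover have "height (t - z) > 0" using n \<open>z \<noteq> t\<close> by (intro pos) auto
        ultimately show False using htd by simp
      qed
    qed
    then show ?thesis using zy by simp
  qed
  then show ?thesis using t by blast
qed

definition highest_root :: "int^'i" where
  "highest_root = (SOME x. root x \<and> dominant x \<and> (\<forall>y. root y \<longrightarrow> nonneg_vec (x - y)))"

lemma highest_root: "root highest_root" "dominant highest_root" "\<And>y. root y \<Longrightarrow> nonneg_vec (highest_root - y)"
  using someI_ex[OF highest_root_exists] unfolding highest_root_def by blast+

lemma highest_root_unique: "root x \<Longrightarrow> (\<And>y. root y \<Longrightarrow> nonneg_vec (x - y)) \<Longrightarrow> x = highest_root"
  using nonneg_vec_antisym[of "x - highest_root"] highest_root by (metis minus_diff_eq right_minus_eq)

lemma highest_coroot_sum: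
  assumes "root_coroot C highest_root y"
  shows "2 * (\<Sum>l\<in>UNIV. D l * highest_root $ l) = B highest_root highest_root * (\<Sum>l\<in>UNIV. y $ l)"
proof -
  obtain k where k: "root_like k highest_root" "\<And>l. D l * highest_root $ l = D k * y $ l"
    using coroot_scale[OF assms] by blast
  have "B highest_root highest_root = 2 * D k" using k(1) by (simp add: root_like_def)
  then show ?thesis by (simp add: k(2) flip: sum_distrib_left)
qed

text \<open>For the highest root \<theta> this reads (\<theta>, \<theta> + 2 \<rho>) = (\<theta>,
  \<theta>) h^\<or>, since \<rho> pairs with the simple root at \<open>l\<close> to
  \<open>D l\<close>.\<close>

lemma dual_coxeter_number_eq:
  "B highest_root highest_root * int (dual_coxeter_number C) = B highest_root highest_root + 2 * (\<Sum>l\<in>UNIV. D l * highest_root $ l)"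
proof -
  obtain y where y: "root_coroot C highest_root y" using highest_root(1) by (auto simp: root_def)
  have pos: "B highest_root highest_root > 0" using root_norm_pos highest_root(1) by blast
  have "(THE m. \<exists>\<theta> \<gamma>. root_coroot C \<theta> \<gamma> \<and>
     (\<forall>\<beta> \<gamma>'. root_coroot C \<beta> \<gamma>' \<longrightarrow> (\<forall>k. \<beta> $ k \<le> \<theta> $ k)) \<and> m = (\<Sum>k\<in>UNIV. \<gamma> $ k)) = (\<Sum>k\<in>UNIV. y $ k)"
  proof (rule the_equality)
    show "\<exists>\<theta> \<gamma>. root_coroot C \<theta> \<gamma> \<and>
     (\<forall>\<beta> \<gamma>'. root_coroot C \<beta> \<gamma>' \<longrightarrow> (\<forall>k. \<beta> $ k \<le> \<theta> $ k)) \<and> (\<Sum>k\<in>UNIV. y $ k) = (\<Sum>k\<in>UNIV. \<gamma> $ k)"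
    proof (intro exI conjI allI impI)
      show "root_coroot C highest_root y" by (rule y)
      fix b g k assume "root_coroot C b g"
      then have "root b" by (auto simp: root_def)
      then show "b $ k \<le> highest_root $ k" using highest_root(3)[of b] by (simp add: nonneg_vec_def)
    qed simp
  next
    fix m assume "\<exists>\<theta> \<gamma>. root_coroot C \<theta> \<gamma> \<and>
     (\<forall>\<beta> \<gamma>'. root_coroot C \<beta> \<gamma>' \<longrightarrow> (\<forall>k. \<beta> $ k \<le> \<theta> $ k)) \<and> m = (\<Sum>k\<in>UNIV. \<gamma> $ k)"
    then obtain x g where x: "root_coroot C x g" "\<And>b g' k. root_coroot C b g' \<Longrightarrow> b $ k \<le> x $ k"
      "m = (\<Sum>k\<in>UNIV. g $ k)" by blast
    have "x = highest_root"
    proof (rule highest_root_unique)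
      show "root x" using x(1) by (auto simp: root_def)
      fix y assume "root y"
      then show "nonneg_vec (x - y)" using x(2) by (auto simp: root_def nonneg_vec_def)
    qed
    then have "root_coroot C highest_root g" using x(1) by simp
    then have "B highest_root highest_root * m = B highest_root highest_root * (\<Sum>k\<in>UNIV. y $ k)"
      using highest_coroot_sum[OF y] highest_coroot_sum[of g] x(3) by simp
    then show "m = (\<Sum>k\<in>UNIV. y $ k)" using pos by simp
  qed
  then have d: "dual_coxeter_number C = nat (1 + (\<Sum>k\<in>UNIV. y $ k))"
    unfolding dual_coxeter_number_def by simp
  have "(\<Sum>l\<in>UNIV. D l * highest_root $ l) \<ge> 0"
    by (intro sum_nonneg mult_nonneg_nonneg) (use dominant_root_full[OF highest_root(1,2)] in \<open>auto simp: less_imp_le\<close>)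
  then have "0 \<le> B highest_root highest_root * (\<Sum>l\<in>UNIV. y $ l)" using highest_coroot_sum[OF y] by simp
  then have "(\<Sum>l\<in>UNIV. y $ l) \<ge> 0" using pos by (simp add: zero_le_mult_iff)
  then show ?thesis using highest_coroot_sum[OF y] d by (simp add: distrib_left)
qed

text \<open>If the Cartan integer \<open>n\<close> is at least 2, then \<open>n \<theta> - x\<close>
  is a root, hence at most \<theta>, so that \<open>x\<close> is at least
  \<open>(n - 1) \<theta>\<close> and equals \<theta>.\<close>

lemma highest_root_pairing:
  assumes "root x" "nonneg_vec x" "x \<noteq> highest_root"
  shows "B highest_root x = 0 \<or> 2 * B highest_root x = B highest_root highest_root"
proof -
  obtain n where n: "2 * B highest_root x = n * B highest_root highest_root" "root (x - n *s highest_root)"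
    using root_reflect_root[OF highest_root(1) assms(1)] by blast
  have pos: "B highest_root highest_root > 0" using root_norm_pos highest_root(1) by blast
  have "B x highest_root \<ge> 0"
    by (subst B_coord) (use assms(2) highest_root(2) in \<open>auto simp: B_axis nonneg_vec_def dominant_def less_imp_le intro!: sum_nonneg\<close>)
  then have "0 \<le> n * B highest_root highest_root" using n(1) B_sym[of x highest_root] by simp
  then have n0: "n \<ge> 0" using pos by (simp add: zero_le_mult_iff)
  have "\<not> n \<ge> 2"
  proof
    assume n2: "n \<ge> 2"
    have "x $ k = highest_root $ k" for k
    proof -
      have "(n *s highest_root - x) $ k \<le> highest_root $ k"
        using highest_root(3)[OF root_minus[OF n(2)]] by (simp add: nonneg_vec_def)
      then have 1: "n * highest_root $ k - highest_root $ k \<le> x $ k" by simp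
      have "2 * highest_root $ k \<le> n * highest_root $ k" using n2 dominant_root_full[OF highest_root(1,2), of k] by (intro mult_right_mono) auto
      moreover have "x $ k \<le> highest_root $ k" using highest_root(3)[OF assms(1)] by (simp add: nonneg_vec_def)
      ultimately show ?thesis using 1 by simp
    qed
    then show False using assms(3) by (simp add: vec_eq_iff)
  qed
  then have "n = 0 \<or> n = 1" using n0 by linarith
  then show ?thesis using n(1) by auto
qed

section \<open>Root lengths and the lacing number\<close>

lemma dominant_root_of_length:
  obtains x where "root x" "dominant x" "B x x = 2 * D i"
proof -
  obtain x where x: "x \<in> {x. root x \<and> B x x = 2 * D i}" "dominant x"
    by (rule max_height_dominant[of "{x. root x \<and> B x x = 2 * D i}"])
      (use root_axis[of i] in \<open>auto simp: root_reflection B_reflection B_axis_axis intro!: exI[of _ "axis i 1"]\<close>)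
  then show ?thesis using that by blast
qed

text \<open>The largest of the \<open>D i\<close>, as \<open>long_half_norm_ratio\<close> and the
  norm of a root show.\<close>

definition long_half_norm :: int where "long_half_norm = B highest_root highest_root div 2"

lemma long_half_norm: "B highest_root highest_root = 2 * long_half_norm" "long_half_norm > 0"
proof -
  obtain k where "root_like k highest_root" using root_root_like[OF highest_root(1)] by blast
  then show "B highest_root highest_root = 2 * long_half_norm" by (simp add: long_half_norm_def root_like_def)
  then show "long_half_norm > 0" using root_norm_pos[OF highest_root(1)] by simp
qed

text \<open>A dominant root of norm \<open>2 * D i\<close> pairs positively with the highest root,
  and then \<open>highest_root_pairing\<close> turns the Cartan integer into the ratio of the
  norms.\<close>

lemma long_half_norm_ratio: "\<exists>n. 1 \<le> n \<and> n \<le> 3 \<and> long_half_norm = n * D i"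
proof -
  obtain x where x: "root x" "dominant x" "B x x = 2 * D i" by (rule dominant_root_of_length)
  show ?thesis
  proof (cases "x = highest_root")
    case True
    then have "long_half_norm = 1 * D i" using x(3) long_half_norm by simp
    then show ?thesis by (intro exI[of _ 1]) simp
  next
    case False
    have p: "B highest_root x > 0" by (rule dominant_roots_pos) (use highest_root x in auto)
    then have e: "2 * B highest_root x = B highest_root highest_root" using highest_root_pairing[OF x(1) dominant_root_nonneg_vec[OF x(1,2)] False] by simp
    obtain n where n: "2 * B x highest_root = n * B x x" using root_reflect_root[OF x(1) highest_root(1)] by blast
    then have ln: "long_half_norm = n * D i" "B highest_root highest_root = n * B x x" using e x(3) long_half_norm B_sym[of x highest_root] by simp_all
    have "n \<le> 3" by (rule root_norm_ratio[OF x(1) highest_root(1)]) (use e B_sym[of x highest_root] ln in auto)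
    moreover have "n > 0" using ln long_half_norm(2) D_pos[of i] by (metis less_imp_le zero_less_mult_pos2)
    ultimately show ?thesis using ln by (intro exI[of _ n]) auto
  qed
qed

text \<open>Two different lengths below the long one would again have an integral ratio of at least
  2, by pairing dominant roots; the long length would then be at least 4 times the shortest.\<close>

lemma length_ratio:
  assumes "D i < long_half_norm" "D j < long_half_norm" shows "D i = D j"
proof -
  have *: "D i \<le> D j" if "D i < long_half_norm" "D j < long_half_norm" for i j
  proof (rule ccontr)
    assume nle: "\<not> D i \<le> D j"
    obtain x where x: "root x" "dominant x" "B x x = 2 * D i" by (rule dominant_root_of_length)
    obtain y where y: "root y" "dominant y" "B y y = 2 * D j" by (rule dominant_root_of_length)
    have p: "B x y > 0" by (rule dominant_roots_pos) (use x y in auto)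
    have ne: "x \<noteq> y" using x y nle by auto
    have e: "2 * B x y = B x x \<or> 2 * B x y = B y y" using root_diff[OF x(1) y(1) p ne] by blast
    obtain n where n: "2 * B y x = n * B y y" using root_reflect_root[OF y(1) x(1)] by blast
    obtain m where m: "2 * B x y = m * B x x" using root_reflect_root[OF x(1) y(1)] by blast
    have "2 * B x y \<noteq> B y y"
    proof
      assume "2 * B x y = B y y"
      then have "D j = m * D i" using m x(3) y(3) by simp
      moreover then have "m > 0" using D_pos[of i] D_pos[of j] by (metis zero_less_mult_pos2)
      ultimately show False using nle D_pos[of i] by (metis mult_le_cancel_right1 int_one_le_iff_zero_less D_pos order.asym)
    qed
    then have Di: "D i = n * D j" using e n x(3) y(3) B_sym[of x y] by simp
    have n2: "n \<ge> 2"
    proof (rule ccontr)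
      assume "\<not> n \<ge> 2"
      then have "n * D j \<le> 1 * D j" by (intro mult_right_mono) (auto simp: less_imp_le)
      then show False using Di nle by simp
    qed
    obtain u where u: "1 \<le> u" "long_half_norm = u * D i" using long_half_norm_ratio by blast
    have "u \<noteq> 1" using u that by auto
    then have u2: "u \<ge> 2" using u by simp
    obtain v where v: "v \<le> 3" "long_half_norm = v * D j" using long_half_norm_ratio by blast
    have "v * D j = (u * n) * D j" using u(2) v(2) Di by simp
    then have "v = u * n" by simp
    moreover have "2 * 2 \<le> u * n" using u2 n2 by (intro mult_mono) auto
    ultimately show False using v(1) by simp
  qed
  show ?thesis using *[OF assms] *[OF assms(2,1)] by simp
qed

text \<open>There are only two lengths and the long one is a multiple of the short one, so the short
  \<open>D i\<close> divides all of them; their gcd is 1.\<close>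

lemma D_one:
  assumes "D i < D j" shows "D i = 1"
proof -
  have iL: "D i < long_half_norm"
  proof -
    obtain n where "1 \<le> n" "long_half_norm = n * D j" using long_half_norm_ratio by blast
    then have "D j \<le> long_half_norm" using mult_right_mono[of 1 n "D j"] by (simp add: less_imp_le)
    then show ?thesis using assms by simp
  qed
  have "D i dvd D k" for k
  proof (cases "D k < long_half_norm")
    case True
    then show ?thesis using length_ratio[OF iL] by simp
  next
    case False
    obtain n where n: "1 \<le> n" "long_half_norm = n * D k" using long_half_norm_ratio by blast
    then have "D k \<le> long_half_norm" using mult_right_mono[of 1 n "D k"] by (simp add: less_imp_le)
    then have "D k = long_half_norm" using False by simp
    moreover obtain m where "long_half_norm = m * D i" using long_half_norm_ratio by blast
    ultimately show ?thesis by simp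
  qed
  then have "d i dvd d k" for k by (simp add: D_def)
  then have "d i dvd Gcd (range d)" by (intro Gcd_greatest) auto
  then show ?thesis using Gcd_d by (simp add: D_def)
qed

lemma D_one_of_multiple:
  assumes "adj C i j" "C $ i $ j \<noteq> -1" shows "D i = 1" "C $ j $ i = -1" "D j = - C $ i $ j"
proof -
  show ji: "C $ j $ i = -1" using one_of_two assms by blast
  have "C $ i $ j \<le> -2" using assms adj_neg[of i j] by simp
  then have "D i * 1 < D i * (- C $ i $ j)" by (intro mult_strict_left_mono) auto
  also have "\<dots> = D j" using D_symm[of i j] ji by simp
  finally have "D i < D j" by simp
  then show "D i = 1" by (rule D_one)
  then show "D j = - C $ i $ j" using D_symm[of i j] ji by simp
qed

text \<open>Across an edge with \<open>D a < D b\<close> the product of the two Cartan entries is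
  \<open>D b\<close>, the long length. Without such an edge all \<open>D i\<close> agree and are 1
  by coprimality.\<close>

lemma long_half_norm_le_lacing: "long_half_norm \<le> int (lacing_number C)"
proof -
  let ?S = "insert 1 {C $ i $ j * C $ j $ i | i j. adj C i j}"
  have fin: "finite ?S"
  proof -
    have "{C $ i $ j * C $ j $ i | i j. adj C i j} \<subseteq> (\<lambda>(i, j). C $ i $ j * C $ j $ i) ` UNIV" by auto
    then have "finite {C $ i $ j * C $ j $ i | i j. adj C i j}" by (rule finite_subset) simp
    then show ?thesis by simp
  qed
  have ge: "a \<le> int (lacing_number C)" if "a \<in> ?S" for a
  proof -
    have "a \<le> Max ?S" using fin that by (rule Max_ge)
    also have "\<dots> \<le> int (lacing_number C)" unfolding lacing_number_def by linarith
    finally show ?thesis .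
  qed
  show ?thesis
  proof (cases "\<exists>a b. adj C a b \<and> D a \<noteq> D b")
    case True
    then obtain a b where "adj C a b" "D a \<noteq> D b" by blast
    then obtain a b where ab: "adj C a b" "D a < D b" using adj_sym[of a b] by (metis linorder_neqE)
    then have a1: "D a = 1" by (rule_tac D_one)
    have "C $ a $ b \<noteq> -1"
    proof
      assume "C $ a $ b = -1"
      then have "D b * - C $ b $ a = D a" using D_symm[of a b] by simp
      moreover have "- C $ b $ a \<ge> 1" using ab(1) adj_sym[of a b] adj_neg[of b a] by simp
      ultimately have "D b \<le> D a" using mult_left_mono[of 1 "- C $ b $ a" "D b"] by (simp add: less_imp_le)
      then show False using ab by simp
    qed
    from D_one_of_multiple[OF ab(1) this] have Db: "D b = C $ a $ b * C $ b $ a" by simp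
    then have "D b \<in> ?S" using ab(1) by blast
    then have "D b \<le> int (lacing_number C)" by (rule ge)
    moreover have "long_half_norm = D b"
    proof (rule ccontr)
      assume "long_half_norm \<noteq> D b"
      obtain n where n: "1 \<le> n" "long_half_norm = n * D b" using long_half_norm_ratio by blast
      then have "D b \<le> long_half_norm" using mult_right_mono[of 1 n "D b"] by (simp add: less_imp_le)
      then have "D b < long_half_norm" using \<open>long_half_norm \<noteq> D b\<close> by simp
      then show False using length_ratio[of a b] ab by simp
    qed
    ultimately show ?thesis by simp
  next
    case False
    then have c: "D a = D b" for a b using connected_eq[of D] by blast
    obtain k :: 'i where True by blast
    have "d k dvd Gcd (range d)"
    proof (rule Gcd_greatest)
      fix x assume "x \<in> range d"
      then obtain b where "x = d b" by blast
      then show "d k dvd x" using c[of k b] by (simp add: D_def)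
    qed
    then have Dk: "D k = 1" using Gcd_d by (simp add: D_def)
    obtain l where "root_like l highest_root" using root_root_like[OF highest_root(1)] by blast
    then have "long_half_norm = D l" using long_half_norm by (simp add: root_like_def)
    then have "long_half_norm = 1" using c[of l k] Dk by simp
    then show ?thesis using ge[of 1] by simp
  qed
qed

subsection \<open>Sums over the positive roots\<close>

lemma B_iter_steps_axis:
  assumes "(b, i) \<in> steps e" shows "B (iter_steps e b x) (axis i 1) = B x (level_sum b i)"
  using B_iter_steps[of e b x "level_sum b i"] iter_steps_level_sum[of i e b] assms by (simp add: steps_def)

lemma sum_steps: "(\<Sum>p\<in>steps e. f (fst p) (snd p)) = (\<Sum>b<cox. \<Sum>i | colour i = (e = even b). f b i)"
proof -
  have "steps e = (SIGMA b:{..<cox}. {i. colour i = (e = even b)})" by (auto simp: steps_def)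
  then show ?thesis by (simp add: sum.Sigma case_prod_beta)
qed

text \<open>The positive roots add up to \<open>2 \<rho>\<close>. The functional \<open>R\<close> is
  the pairing with \<rho>: each half step lowers it by the pairings with the reflected simple roots,
  and the longest element negates it in total.\<close>

lemma sum_pairing_linear:
  "(\<Sum>p\<in>steps e. B x (level_sum (fst p) (snd p))) = 2 * (\<Sum>l\<in>UNIV. D l * x $ l)"
proof -
  define R where "R x = (\<Sum>l\<in>UNIV. D l * x $ l)" for x
  have R_stp: "R (half_step c x) = R x - (\<Sum>i | colour i = c. B x (axis i 1))" for c x
  proof -
    have "R (half_step c x) = (\<Sum>l\<in>UNIV. D l * x $ l - (if colour l = c then D l * (C *v x) $ l else 0))"
      unfolding R_def by (intro sum.cong) (auto simp: half_step_def right_diff_distrib)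
    also have "\<dots> = R x - (\<Sum>l\<in>UNIV. if colour l = c then D l * (C *v x) $ l else 0)"
      by (simp add: R_def sum_subtractf)
    also have "(\<Sum>l\<in>UNIV. if colour l = c then D l * (C *v x) $ l else 0) = (\<Sum>l | colour l = c. D l * (C *v x) $ l)"
      by (simp flip: sum.inter_filter)
    finally show ?thesis by (simp add: B_axis')
  qed
  have Rm: "R (iter_steps e m x) = R x - (\<Sum>b<m. \<Sum>i | colour i = (e = even b). B (iter_steps e b x) (axis i 1))" for m
    by (induction m) (simp_all add: R_stp)
  have "R (iter_steps e cox x) = - R x"
  proof -
    have "R (iter_steps e cox x) = - (\<Sum>l\<in>UNIV. D (cox_involution l) * x $ cox_involution l)" by (simp add: R_def iter_steps_cox sum_negf cox_involution(2))
    also have "(\<Sum>l\<in>UNIV. D (cox_involution l) * x $ cox_involution l) = R x"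
      unfolding R_def by (rule sum.reindex_bij_witness[of _ cox_involution cox_involution]) auto
    finally show ?thesis .
  qed
  then have "(\<Sum>b<cox. \<Sum>i | colour i = (e = even b). B (iter_steps e b x) (axis i 1)) = 2 * R x"
    using Rm[of cox] by linarith
  moreover have "(\<Sum>p\<in>steps e. B x (level_sum (fst p) (snd p))) = (\<Sum>p\<in>steps e. B (iter_steps e (fst p) x) (axis (snd p) 1))"
    by (intro sum.cong refl) (simp add: B_iter_steps_axis)
  ultimately show ?thesis unfolding sum_steps[of "\<lambda>b i. B (iter_steps e b x) (axis i 1)" e] R_def by simp
qed

lemma sum_pairing_square:
  "(\<Sum>p\<in>steps e. (B highest_root (level_sum (fst p) (snd p)))\<^sup>2) = 2 * long_half_norm * long_half_norm * int (dual_coxeter_number C)"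
proof -
  have "\<exists>!p. p \<in> steps e \<and> level_sum (fst p) (snd p) = highest_root"
    using positive_root_unique_step highest_root(1) dominant_root_nonneg_vec[OF highest_root(1,2)] by blast
  then obtain p where p: "p \<in> steps e" "level_sum (fst p) (snd p) = highest_root"
    "\<And>q. q \<in> steps e \<Longrightarrow> level_sum (fst q) (snd q) = highest_root \<Longrightarrow> q = p" by blast
  \<comment> \<open>With L for \<open>long_half_norm\<close> the pairings are 0 or L, except 2 L for
    the highest root itself; the correction is \<open>4 L^2 - L * 2 L\<close>.\<close>
  have val: "(B highest_root (level_sum (fst q) (snd q)))\<^sup>2 = long_half_norm * B highest_root (level_sum (fst q) (snd q)) + (if q = p then 2 * long_half_norm * long_half_norm else 0)"
    if "q \<in> steps e" for q
  proof (cases "q = p")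
    case True
    then show ?thesis using p(2) long_half_norm(1) by (simp add: power2_eq_square)
  next
    case False
    then have "level_sum (fst q) (snd q) \<noteq> highest_root" using p(3) that by blast
    moreover have "nonneg_vec (level_sum (fst q) (snd q))" using that by (intro nonneg_vec_level_sum) (auto simp: steps_def)
    ultimately have "B highest_root (level_sum (fst q) (snd q)) = 0 \<or> 2 * B highest_root (level_sum (fst q) (snd q)) = B highest_root highest_root"
      using highest_root_pairing[OF root_level_sum] by blast
    then show ?thesis using False long_half_norm(1) by (auto simp: power2_eq_square)
  qed
  have "(\<Sum>q\<in>steps e. (B highest_root (level_sum (fst q) (snd q)))\<^sup>2)
    = (\<Sum>q\<in>steps e. long_half_norm * B highest_root (level_sum (fst q) (snd q)) + (if q = p then 2 * long_half_norm * long_half_norm else 0))"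
    by (rule sum.cong[OF refl val])
  also have "\<dots> = long_half_norm * (2 * (\<Sum>l\<in>UNIV. D l * highest_root $ l)) + 2 * long_half_norm * long_half_norm"
    using p(1) by (simp add: sum.distrib flip: sum_distrib_left sum_pairing_linear[of highest_root e])
  also have "\<dots> = long_half_norm * (B highest_root highest_root * int (dual_coxeter_number C))"
    unfolding dual_coxeter_number_eq using long_half_norm(1) by (simp add: algebra_simps)
  finally show ?thesis using long_half_norm(1) by simp
qed

end

subsection \<open>Laurent polynomials among Laurent series\<close>

definition qmono :: "int \<Rightarrow> int fls" where "qmono a = fls_X_intpow a"

lemma nth_qmono_times: "fls_nth (qmono a * f) u = fls_nth f (u - a)"
  unfolding qmono_def by (simp add: fls_X_intpow_times_conv_shift)

lemma nth_qmono: "fls_nth (qmono a) u = (if u = a then 1 else 0)"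
  using nth_qmono_times[of a 1 u] by auto

definition laurent_poly :: "int fls \<Rightarrow> bool" where "laurent_poly f \<longleftrightarrow> finite {u. fls_nth f u \<noteq> 0}"

definition eval_one :: "int fls \<Rightarrow> int" where "eval_one f = (\<Sum>u | fls_nth f u \<noteq> 0. fls_nth f u)"

definition deriv_one :: "int fls \<Rightarrow> int" where "deriv_one f = (\<Sum>u | fls_nth f u \<noteq> 0. u * fls_nth f u)"

lemma eval_one_superset: "finite S \<Longrightarrow> {u. fls_nth f u \<noteq> 0} \<subseteq> S \<Longrightarrow> eval_one f = (\<Sum>u\<in>S. fls_nth f u)"
  unfolding eval_one_def by (rule sum.mono_neutral_left) auto

lemma deriv_one_superset: "finite S \<Longrightarrow> {u. fls_nth f u \<noteq> 0} \<subseteq> S \<Longrightarrow> deriv_one f = (\<Sum>u\<in>S. u * fls_nth f u)"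
  unfolding deriv_one_def by (rule sum.mono_neutral_left) auto

lemma laurent_poly_0 [simp]: "laurent_poly 0" and eval_one_0 [simp]: "eval_one 0 = 0" and deriv_one_0 [simp]: "deriv_one 0 = 0"
  by (simp_all add: laurent_poly_def eval_one_def deriv_one_def)

lemma laurent_poly_add: "laurent_poly f \<Longrightarrow> laurent_poly g \<Longrightarrow> laurent_poly (f + g)"
  unfolding laurent_poly_def by (rule finite_subset[of _ "{u. fls_nth f u \<noteq> 0} \<union> {u. fls_nth g u \<noteq> 0}"]) auto

lemma laurent_poly_diff: "laurent_poly f \<Longrightarrow> laurent_poly g \<Longrightarrow> laurent_poly (f - g)"
  unfolding laurent_poly_def by (rule finite_subset[of _ "{u. fls_nth f u \<noteq> 0} \<union> {u. fls_nth g u \<noteq> 0}"]) auto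

lemma eval_one_deriv_one_add:
  assumes "laurent_poly f" "laurent_poly g" shows "eval_one (f + g) = eval_one f + eval_one g" "deriv_one (f + g) = deriv_one f + deriv_one g"
proof -
  let ?S = "{u. fls_nth f u \<noteq> 0} \<union> {u. fls_nth g u \<noteq> 0}"
  have S: "finite ?S" using assms by (simp add: laurent_poly_def)
  show "eval_one (f + g) = eval_one f + eval_one g"
    by (subst (1 2 3) eval_one_superset[OF S]) (auto simp: sum.distrib)
  show "deriv_one (f + g) = deriv_one f + deriv_one g"
    by (subst (1 2 3) deriv_one_superset[OF S]) (auto simp: sum.distrib distrib_left)
qed

lemma eval_one_deriv_one_diff:
  assumes "laurent_poly f" "laurent_poly g" shows "eval_one (f - g) = eval_one f - eval_one g" "deriv_one (f - g) = deriv_one f - deriv_one g"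
  using eval_one_deriv_one_add[OF laurent_poly_diff[OF assms] assms(2)] by simp_all

lemma laurent_poly_sum:
  assumes "finite S" "\<And>s. s \<in> S \<Longrightarrow> laurent_poly (f s)"
  shows "laurent_poly (\<Sum>s\<in>S. f s)" "eval_one (\<Sum>s\<in>S. f s) = (\<Sum>s\<in>S. eval_one (f s))" "deriv_one (\<Sum>s\<in>S. f s) = (\<Sum>s\<in>S. deriv_one (f s))"
proof -
  have "laurent_poly (\<Sum>s\<in>S. f s) \<and> eval_one (\<Sum>s\<in>S. f s) = (\<Sum>s\<in>S. eval_one (f s)) \<and> deriv_one (\<Sum>s\<in>S. f s) = (\<Sum>s\<in>S. deriv_one (f s))"
    using assms by (induction S rule: finite_induct) (auto simp: laurent_poly_add eval_one_deriv_one_add)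
  then show "laurent_poly (\<Sum>s\<in>S. f s)" "eval_one (\<Sum>s\<in>S. f s) = (\<Sum>s\<in>S. eval_one (f s))" "deriv_one (\<Sum>s\<in>S. f s) = (\<Sum>s\<in>S. deriv_one (f s))" by auto
qed

lemma supported_qmono_times: "{u. fls_nth (qmono a * f) u \<noteq> 0} = (\<lambda>u. u + a) ` {u. fls_nth f u \<noteq> 0}"
proof (intro equalityI subsetI)
  fix u assume "u \<in> {u. fls_nth (qmono a * f) u \<noteq> 0}"
  then have "u - a \<in> {u. fls_nth f u \<noteq> 0}" by (simp add: nth_qmono_times)
  then show "u \<in> (\<lambda>u. u + a) ` {u. fls_nth f u \<noteq> 0}" by (intro image_eqI[of _ _ "u - a"]) simp_all
qed (auto simp: nth_qmono_times)

lemma laurent_poly_qmono_times: "laurent_poly f \<Longrightarrow> laurent_poly (qmono a * f)"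
  unfolding laurent_poly_def supported_qmono_times by simp

lemma eval_one_qmono_times: "eval_one (qmono a * f) = eval_one f"
  unfolding eval_one_def supported_qmono_times by (subst sum.reindex) (auto simp: inj_on_def nth_qmono_times)

lemma deriv_one_qmono_times: "deriv_one (qmono a * f) = deriv_one f + a * eval_one f"
proof -
  have "deriv_one (qmono a * f) = (\<Sum>u | fls_nth f u \<noteq> 0. (u + a) * fls_nth f u)"
    unfolding deriv_one_def supported_qmono_times by (subst sum.reindex) (auto simp: inj_on_def nth_qmono_times)
  then show ?thesis by (simp add: deriv_one_def eval_one_def distrib_right sum.distrib sum_distrib_left)
qed

lemma supported_qmono: "{u. fls_nth (qmono a) u \<noteq> 0} = {a}" by (auto simp: nth_qmono)

lemma laurent_poly_qmono: "laurent_poly (qmono a)" and eval_one_qmono: "eval_one (qmono a) = 1" and deriv_one_qmono: "deriv_one (qmono a) = a"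
  unfolding laurent_poly_def eval_one_def deriv_one_def supported_qmono by (simp_all add: nth_qmono)

lemma nonneg_eval_one_zero:
  assumes "laurent_poly f" "\<And>u. fls_nth f u \<ge> 0" "eval_one f = 0" shows "f = 0"
proof (rule fls_eqI)
  fix u
  let ?S = "{u. fls_nth f u \<noteq> 0}"
  have fin: "finite ?S" and sum: "(\<Sum>u\<in>?S. fls_nth f u) = 0"
    using assms(1,3) by (simp_all only: laurent_poly_def eval_one_def)
  have "\<forall>u\<in>?S. fls_nth f u = 0"
    using sum_nonneg_eq_0_iff[OF fin, of "fls_nth f"] assms(2) sum by blast
  then show "fls_nth f u = fls_nth 0 u" by auto
qed

lemma nonneg_eval_one_one:
  assumes "laurent_poly f" "\<And>u. fls_nth f u \<ge> 0" "eval_one f = 1" shows "\<exists>a. f = qmono a"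
proof -
  let ?S = "{u. fls_nth f u \<noteq> 0}"
  have fin: "finite ?S" using assms by (simp add: laurent_poly_def)
  have "?S \<noteq> {}"
  proof
    assume "?S = {}"
    then have "eval_one f = 0" unfolding eval_one_def by simp
    then show False using assms(3) by simp
  qed
  then obtain a where a: "a \<in> ?S" by blast
  have "1 = fls_nth f a + (\<Sum>u\<in>?S - {a}. fls_nth f u)"
    using assms(3) a fin by (simp add: eval_one_def sum.remove)
  moreover have "fls_nth f a \<ge> 1" using a assms(2)[of a] by simp
  moreover have ge: "(\<Sum>u\<in>?S - {a}. fls_nth f u) \<ge> 0" by (intro sum_nonneg assms(2))
  ultimately have "fls_nth f a = 1" "(\<Sum>u\<in>?S - {a}. fls_nth f u) = 0" by auto
  moreover have "\<forall>u\<in>?S - {a}. fls_nth f u = 0"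
    using sum_nonneg_eq_0_iff[of "?S - {a}" "fls_nth f"] fin assms(2) calculation(2) by blast
  ultimately have v: "fls_nth f a = 1" "\<And>u. u \<noteq> a \<Longrightarrow> fls_nth f u = 0" by blast+
  have "fls_nth f u = fls_nth (qmono a) u" for u
    using v by (cases "u = a") (simp_all add: nth_qmono)
  then show ?thesis by (blast intro: fls_eqI)
qed

context simple_cartan
begin

subsection \<open>The deformed recursion\<close>

definition bond :: "'i \<Rightarrow> 'i \<Rightarrow> nat" where "bond i k = nat (- C $ i $ k)"

lemma int_bond: "adj C i k \<Longrightarrow> int (bond i k) = - C $ i $ k"
  using adj_neg[of i k] by (simp add: bond_def)

text \<open>The quantum integer of \<open>- C $ i $ k\<close>, without the factor
  \<open>qmono (D i)\<close>.\<close>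

definition qbond :: "'i \<Rightarrow> 'i \<Rightarrow> int fls" where
  "qbond i k = (\<Sum>n<bond i k. qmono (int (bond i k) - 1 - 2 * int n))"

text \<open>The coefficient of \<open>t\<^sup>-\<^sup>v\<close> in the inverse of the deformed Cartan matrix; the recursion expresses
  that the product with the deformed Cartan matrix is the identity.\<close>

fun qlevel :: "nat \<Rightarrow> 'i \<Rightarrow> 'i \<Rightarrow> int fls" where
  "qlevel 0 i j = 0"
| "qlevel (Suc 0) i j = (if i = j then qmono (D j) else 0)"
| "qlevel (Suc (Suc v)) i j = qmono (D i) * (\<Sum>k | adj C i k. qbond i k * qlevel (Suc v) k j) - qmono (2 * D i) * qlevel v i j"

lemma qbond_times:
  assumes "laurent_poly f"
  shows "laurent_poly (qbond i k * f)" "eval_one (qbond i k * f) = int (bond i k) * eval_one f" "deriv_one (qbond i k * f) = int (bond i k) * deriv_one f"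
proof -
  have K: "qbond i k * f = (\<Sum>n<bond i k. qmono (int (bond i k) - 1 - 2 * int n) * f)"
    by (simp add: qbond_def sum_distrib_right)
  \<comment> \<open>A quantum integer is invariant under inversion of \<open>q\<close>, so its
    derivative at \<open>q = 1\<close> is 0.\<close>
  have z: "(\<Sum>n<m. int m - 1 - 2 * int n) = 0" for m
  proof -
    have "2 * (\<Sum>n<m. int n) = int m * (int m - 1)" by (induction m) (simp_all add: algebra_simps)
    moreover have "(\<Sum>n<m. int m - 1 - 2 * int n) = int m * (int m - 1) - 2 * (\<Sum>n<m. int n)"
      by (simp add: sum_subtractf sum_distrib_left)
    ultimately show ?thesis by simp
  qed
  show "laurent_poly (qbond i k * f)" "eval_one (qbond i k * f) = int (bond i k) * eval_one f"
    unfolding K using assms by (simp_all add: laurent_poly_sum laurent_poly_qmono_times eval_one_qmono_times)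
  have "deriv_one (qbond i k * f) = (\<Sum>n<bond i k. deriv_one f + (int (bond i k) - 1 - 2 * int n) * eval_one f)"
    unfolding K using assms by (simp add: laurent_poly_sum laurent_poly_qmono_times deriv_one_qmono_times)
  also have "\<dots> = int (bond i k) * deriv_one f + (\<Sum>n<bond i k. int (bond i k) - 1 - 2 * int n) * eval_one f"
    by (simp add: sum.distrib sum_distrib_right)
  finally show "deriv_one (qbond i k * f) = int (bond i k) * deriv_one f" by (simp only: z)
qed

lemma laurent_poly_qlevel: "laurent_poly (qlevel v i j)"
  by (induction v i j rule: qlevel.induct) (auto intro!: laurent_poly_diff laurent_poly_qmono_times laurent_poly_sum qbond_times laurent_poly_qmono)

lemma eval_one_qlevel: "eval_one (qlevel v i j) = level_vec v j $ i"
proof (induction v i j rule: qlevel.induct)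
  case (2 i j)
  then show ?case by (simp add: eval_one_qmono axis_def)
next
  case (3 v i j)
  have "eval_one (qlevel (Suc (Suc v)) i j) = (\<Sum>k | adj C i k. int (bond i k) * eval_one (qlevel (Suc v) k j)) - eval_one (qlevel v i j)"
    by (simp add: eval_one_deriv_one_diff laurent_poly_qmono_times laurent_poly_sum qbond_times laurent_poly_qlevel eval_one_qmono_times)
  also have "\<dots> = neighbour_sum (level_vec (Suc v) j) $ i - level_vec v j $ i"
    unfolding neighbour_sum_nth 3(2) using 3(1) by (simp add: int_bond)
  finally show ?case by simp
qed simp

definition level_deriv :: "nat \<Rightarrow> 'i \<Rightarrow> int^'i" where "level_deriv v j = (\<chi> i. deriv_one (qlevel v i j))"

lemma level_deriv_0: "level_deriv 0 j = 0" by (simp add: level_deriv_def vec_eq_iff)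
lemma level_deriv_1: "level_deriv (Suc 0) j = D j *s axis j 1" by (auto simp: level_deriv_def vec_eq_iff deriv_one_qmono axis_def)

lemma level_deriv_rec: "level_deriv (Suc (Suc v)) j $ i
  = neighbour_sum (level_deriv (Suc v) j) $ i - level_deriv v j $ i + D i * (level_vec (Suc (Suc v)) j $ i - level_vec v j $ i)"
proof -
  let ?S = "\<Sum>k | adj C i k. qbond i k * qlevel (Suc v) k j"
  have S: "laurent_poly ?S" "eval_one ?S = neighbour_sum (level_vec (Suc v) j) $ i" "deriv_one ?S = neighbour_sum (level_deriv (Suc v) j) $ i"
    unfolding neighbour_sum_nth by (simp_all add: laurent_poly_sum qbond_times laurent_poly_qlevel eval_one_qlevel int_bond level_deriv_def)
  have "level_deriv (Suc (Suc v)) j $ i = deriv_one ?S + D i * eval_one ?S - (deriv_one (qlevel v i j) + 2 * D i * eval_one (qlevel v i j))"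
    by (simp add: level_deriv_def eval_one_deriv_one_diff laurent_poly_qmono_times S(1) laurent_poly_qlevel deriv_one_qmono_times)
  then show ?thesis by (simp add: S eval_one_qlevel level_deriv_def algebra_simps)
qed

lemma level_deriv_supported: "level_deriv v j $ k \<noteq> 0 \<Longrightarrow> colour k = (colour j = odd v)"
proof (induction v arbitrary: k rule: less_induct)
  case (less v)
  consider "v = 0" | "v = Suc 0" | w where "v = Suc (Suc w)" by (metis not0_implies_Suc)
  then show ?case
  proof cases
    case 1 then show ?thesis using less by (simp add: level_deriv_0)
  next
    case 2 then show ?thesis using less by (simp add: level_deriv_1 axis_def split: if_splits)
  next
    case 3
    consider "neighbour_sum (level_deriv (Suc w) j) $ k \<noteq> 0" | "level_deriv w j $ k \<noteq> 0" | "level_vec (Suc (Suc w)) j $ k \<noteq> 0" | "level_vec w j $ k \<noteq> 0"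
      using less.prems unfolding 3 level_deriv_rec by fastforce
    then show ?thesis
    proof cases
      case 1
      have "colour l = (colour j = odd (Suc w))" if "level_deriv (Suc w) j $ l \<noteq> 0" for l
        using less.IH[of "Suc w" l] 3 that by simp
      from neighbour_sum_supported[OF this 1] show ?thesis using 3 by auto
    next
      case 2 then show ?thesis using less.IH[of w k] 3 by simp
    next
      case c: 3 then show ?thesis using level_vec_supported[OF c] 3 by simp
    next
      case 4 then show ?thesis using level_vec_supported[OF 4] 3 by simp
    qed
  qed
qed

text \<open>Corrected by a multiple of \<open>level_sum\<close>, the derivatives of consecutive levels evolve by
  inhomogeneous bipartite reflections.\<close>

definition deriv_defect :: "nat \<Rightarrow> 'i \<Rightarrow> int^'i" where "deriv_defect b j = level_deriv b j + level_deriv (Suc b) j - D j *s level_sum b j"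

text \<open>The inhomogeneous term is minus the pairing of \<open>v\<close> with the k-th simple
  root; this is the source of the pairings in \<open>B_iter_deriv\<close>.\<close>

definition half_step_deriv :: "bool \<Rightarrow> int^'i \<Rightarrow> int^'i \<Rightarrow> int^'i" where
  "half_step_deriv e v g = (\<chi> k. if colour k = e then g $ k - (C *v g) $ k - D k * (C *v v) $ k else g $ k)"

text \<open>The subtracted multiple of \<open>level_sum\<close> obeys the homogeneous recursion; its
  factor \<open>D j\<close> is chosen to give this initial value.\<close>

lemma deriv_defect_0: "deriv_defect 0 j = 0" by (simp add: deriv_defect_def level_deriv_0 level_deriv_1)

lemma deriv_defect_Suc: "deriv_defect (Suc b) j = half_step_deriv (colour j = odd b) (level_sum b j) (deriv_defect b j)"
proof (rule vec_eq_iff[THEN iffD2], rule allI)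
  fix k
  have Cx: "(C *v x) $ k = 2 * x $ k - neighbour_sum x $ k" for x by (simp add: neighbour_sum_def)
  show "deriv_defect (Suc b) j $ k = half_step_deriv (colour j = odd b) (level_sum b j) (deriv_defect b j) $ k"
  proof (cases "colour k = (colour j = odd b)")
    case True
    have z: "level_vec (Suc b) j $ k = 0" "level_deriv (Suc b) j $ k = 0" "neighbour_sum (level_vec b j) $ k = 0" "neighbour_sum (level_deriv b j) $ k = 0"
      using level_vec_supported[of "Suc b" j k] level_deriv_supported[of "Suc b" j k] True
        neighbour_sum_supported[of "level_vec b j" "colour j = odd b" k] level_vec_supported[of b j]
        neighbour_sum_supported[of "level_deriv b j" "colour j = odd b" k] level_deriv_supported[of b j] by auto
    have v1: "level_sum b j $ k = level_vec b j $ k" "level_sum (Suc b) j $ k = level_vec (Suc (Suc b)) j $ k"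
      "neighbour_sum (level_sum b j) $ k = neighbour_sum (level_vec (Suc b) j) $ k" using z by (simp_all add: level_sum_def neighbour_sum_add del: level_vec.simps)
    have "half_step_deriv (colour j = odd b) (level_sum b j) (deriv_defect b j) $ k = neighbour_sum (deriv_defect b j) $ k - deriv_defect b j $ k + D k * (neighbour_sum (level_sum b j) $ k - 2 * level_sum b j $ k)"
      using True by (simp add: half_step_deriv_def Cx algebra_simps)
    also have "\<dots> = neighbour_sum (level_deriv (Suc b) j) $ k - D j * neighbour_sum (level_vec (Suc b) j) $ k - level_deriv b j $ k + D j * level_vec b j $ k
         + D k * (neighbour_sum (level_vec (Suc b) j) $ k - 2 * level_vec b j $ k)"
      using z v1 by (simp add: deriv_defect_def neighbour_sum_add neighbour_sum_diff neighbour_sum_scale)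
    also have "\<dots> = deriv_defect (Suc b) j $ k"
      using z v1 arg_cong[OF v1(2), of "\<lambda>a. D j * a"] by (simp add: deriv_defect_def level_deriv_rec algebra_simps)
    finally show ?thesis ..
  next
    case False
    have z: "level_vec b j $ k = 0" "level_deriv b j $ k = 0" "level_vec (Suc (Suc b)) j $ k = 0" "level_deriv (Suc (Suc b)) j $ k = 0"
      using level_vec_supported[of b j k] level_deriv_supported[of b j k] False
        level_vec_supported[of "Suc (Suc b)" j k] level_deriv_supported[of "Suc (Suc b)" j k] by auto
    have "half_step_deriv (colour j = odd b) (level_sum b j) (deriv_defect b j) $ k = deriv_defect b j $ k"
      unfolding half_step_deriv_def vec_lambda_beta Eq_FalseI[OF False] if_False ..
    then show ?thesis using z by (simp add: deriv_defect_def level_sum_def del: level_vec.simps)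
  qed
qed

lemma half_step_deriv_minus_shift: "half_step_deriv e (- v) (- (g + a *s v)) = - (half_step_deriv e v g + a *s half_step e v)"
  by (simp add: half_step_deriv_def half_step_def vec_eq_iff C_minus C_add C_scale algebra_simps)

text \<open>Unlike \<open>deriv_defect\<close>, the order of the colours does not depend on the
  starting vector, so that different vertices can be compared along one reduced word.\<close>

primrec iter_deriv :: "bool \<Rightarrow> nat \<Rightarrow> int^'i \<Rightarrow> int^'i" where
  "iter_deriv e 0 y = 0"
| "iter_deriv e (Suc b) y = half_step_deriv (e = even b) (iter_steps e b y) (iter_deriv e b y)"

lemma iter_deriv_other: "colour j \<noteq> e \<Longrightarrow> iter_deriv e b (axis j 1) = deriv_defect b j"
proof (induction b)
  case (Suc b)
  have "(e = even b) = (colour j = odd b)" using Suc.prems by auto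
  then show ?case using Suc by (simp add: deriv_defect_Suc iter_steps_axis_other)
qed (simp add: deriv_defect_0)

text \<open>The first step negates the simple root and contributes \<open>- 2 * D j\<close> times
  it; from then on the sequence runs as for the other colour, shifted by one.\<close>

lemma iter_deriv_same: "colour j = e \<Longrightarrow> iter_deriv e (Suc b) (axis j 1) = - (deriv_defect b j + (2 * D j) *s level_sum b j)"
proof (induction b)
  case 0
  have "half_step_deriv e (axis j 1) 0 $ k = - (2 * D j) * axis j 1 $ k" for k
  proof (cases "k = j")
    case True
    then show ?thesis using 0 by (simp add: half_step_deriv_def C_axis)
  next
    case False
    then have "axis j (1::int) $ k = 0" by (simp add: axis_def)
    then show ?thesis using 0 False not_adj_zero[of k j] colour[of k j] by (auto simp: half_step_deriv_def C_axis)
  qed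
  then show ?case by (simp add: deriv_defect_0 vec_eq_iff)
next
  case (Suc b)
  have e: "(e = even (Suc b)) = (colour j = odd b)" using Suc.prems by auto
  have "iter_deriv e (Suc (Suc b)) (axis j 1) = half_step_deriv (e = even (Suc b)) (iter_steps e (Suc b) (axis j 1)) (iter_deriv e (Suc b) (axis j 1))"
    by (rule iter_deriv.simps)
  also have "\<dots> = half_step_deriv (colour j = odd b) (- level_sum b j) (- (deriv_defect b j + (2 * D j) *s level_sum b j))"
    unfolding e iter_steps_axis_same[OF Suc.prems] Suc.IH[OF Suc.prems] ..
  also have "\<dots> = - (deriv_defect (Suc b) j + (2 * D j) *s level_sum (Suc b) j)"
    unfolding half_step_deriv_minus_shift deriv_defect_Suc level_sum_Suc ..
  finally show ?case .
qed

lemma half_step_deriv_alt: "half_step_deriv e v g = half_step e g - (\<Sum>i | colour i = e. (D i * (C *v v) $ i) *s axis i 1)"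
proof -
  have "(\<Sum>i | colour i = e. (D i * (C *v v) $ i) *s axis i 1) $ k = (if colour k = e then D k * (C *v v) $ k else 0)" for k
    by (simp add: axis_def if_distrib cong: if_cong)
  then show ?thesis by (simp add: vec_eq_iff half_step_deriv_def half_step_def)
qed

lemma half_step_axis_same: "colour i = e \<Longrightarrow> half_step e (axis i 1) = - axis i 1"
  using half_step_axis[of i] by simp

text \<open>Half steps preserve the form, so each step adds only its inhomogeneous term, paired with
  the half step of \<open>x\<close>. That half step negates the pairing with a reflected simple
  root, and the two signs cancel.\<close>

lemma B_iter_deriv: "B (iter_steps e m x) (iter_deriv e m y)
  = (\<Sum>b<m. \<Sum>i | colour i = (e = even b). B (iter_steps e b x) (axis i 1) * B (iter_steps e b y) (axis i 1))"
proof (induction m)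
  case (Suc m)
  let ?c = "e = even m"
  have neg: "B (half_step ?c x) (axis i 1) = - B x (axis i 1)" if "colour i = ?c" for i x
    using B_half_step[of ?c x "half_step ?c (axis i 1)"] half_step_axis_same[OF that] by (simp add: half_step_minus B_minus)
  have "B (iter_steps e (Suc m) x) (iter_deriv e (Suc m) y)
    = B (iter_steps e m x) (iter_deriv e m y) - (\<Sum>i | colour i = ?c. (D i * (C *v iter_steps e m y) $ i) * B (half_step ?c (iter_steps e m x)) (axis i 1))"
    by (simp add: half_step_deriv_alt B_diff B_half_step B_sum B_scale)
  also have "(\<Sum>i | colour i = ?c. (D i * (C *v iter_steps e m y) $ i) * B (half_step ?c (iter_steps e m x)) (axis i 1))
    = - (\<Sum>i | colour i = ?c. B (iter_steps e m x) (axis i 1) * B (iter_steps e m y) (axis i 1))"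
  proof (subst sum_negf[symmetric], rule sum.cong[OF refl])
    fix i assume "i \<in> {i. colour i = ?c}"
    then have i: "colour i = ?c" by simp
    show "(D i * (C *v iter_steps e m y) $ i) * B (half_step ?c (iter_steps e m x)) (axis i 1)
      = - (B (iter_steps e m x) (axis i 1) * B (iter_steps e m y) (axis i 1))"
      unfolding neg[OF i] by (simp add: B_axis')
  qed
  finally show ?case using Suc by simp
qed (simp add: B_zero)

section \<open>Degrees in \<open>q\<close> of the coefficients\<close>

lemma nth_qlevel_rec:
  "fls_nth (qlevel (Suc (Suc v)) i j) u = (\<Sum>k | adj C i k. \<Sum>n<bond i k.
      fls_nth (qlevel (Suc v) k j) (u - D i - (int (bond i k) - 1 - 2 * int n))) - fls_nth (qlevel v i j) (u - 2 * D i)"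
proof -
  have "fls_nth (qbond i k * f) u = (\<Sum>n<bond i k. fls_nth f (u - (int (bond i k) - 1 - 2 * int n)))" for k f u
    unfolding qbond_def sum_distrib_right fls_nth_sum nth_qmono_times ..
  then show ?thesis unfolding qlevel.simps fls_minus_nth nth_qmono_times fls_nth_sum by simp
qed

text \<open>The lowest exponent of \<open>qbond i k\<close> is \<open>1 - bond i k\<close>. A
  multiple bond has \<open>bond i k = D k\<close>, so a term beginning at \<open>D k\<close>
  compensates for it.\<close>

lemma qlevel_low: "fls_nth (qlevel v i j) u \<noteq> 0 \<Longrightarrow> D i \<le> u"
proof (induction v i j arbitrary: u rule: qlevel.induct)
  case (2 i j)
  then show ?case by (simp add: nth_qmono split: if_splits)
next
  case (3 v i j)
  from 3(3)[unfolded nth_qlevel_rec] consider "fls_nth (qlevel v i j) (u - 2 * D i) \<noteq> 0" |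
    "(\<Sum>k | adj C i k. \<Sum>n<bond i k. fls_nth (qlevel (Suc v) k j) (u - D i - (int (bond i k) - 1 - 2 * int n))) \<noteq> 0"
    by fastforce
  then show ?case
  proof cases
    case 1
    then have "D i \<le> u - 2 * D i" by (rule 3(2))
    then show ?thesis using D_pos[of i] by linarith
  next
    case 2
    then obtain k where k: "adj C i k" and "(\<Sum>n<bond i k. fls_nth (qlevel (Suc v) k j) (u - D i - (int (bond i k) - 1 - 2 * int n))) \<noteq> 0"
      by (metis (no_types, lifting) mem_Collect_eq sum.not_neutral_contains_not_neutral)
    then obtain n where n: "n < bond i k" "fls_nth (qlevel (Suc v) k j) (u - D i - (int (bond i k) - 1 - 2 * int n)) \<noteq> 0"
      by (metis (no_types, lifting) lessThan_iff sum.not_neutral_contains_not_neutral)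
    have "D k \<le> u - D i - (int (bond i k) - 1 - 2 * int n)" using 3(1) k n(2) by simp
    moreover have "int n \<le> int (bond i k) - 1" using n(1) by simp
    moreover have "int (bond i k) - 1 \<le> D k"
      using D_one_of_multiple(3)[OF k] int_bond[OF k] D_pos[of k] by (cases "C $ i $ k = -1") (auto simp: less_imp_le)
    ultimately show ?thesis by linarith
  qed
qed simp

text \<open>This assumption is supplied later by dimensions of graded pieces. It allows Laurent
  polynomials to be identified from their values at \<open>q = 1\<close>.\<close>

context
  assumes qlevel_nonneg: "\<And>v i j u. v \<le> cox \<Longrightarrow> fls_nth (qlevel v i j) u \<ge> 0"
begin

lemma qlevel_cox: "qlevel cox i j = 0"
  by (rule nonneg_eval_one_zero[OF laurent_poly_qlevel]) (simp_all add: qlevel_nonneg eval_one_qlevel cox(2))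

lemma qlevel_top_exists: "\<exists>a. \<forall>i. qlevel (cox - 1) i j = (if i = cox_involution j then qmono a else 0)"
proof -
  have "eval_one (qlevel (cox - 1) (cox_involution j) j) = 1" unfolding eval_one_qlevel cox_involution(1) by simp
  then obtain a where a: "qlevel (cox - 1) (cox_involution j) j = qmono a"
    using nonneg_eval_one_one[OF laurent_poly_qlevel qlevel_nonneg] by fastforce
  have "qlevel (cox - 1) i j = 0" if "i \<noteq> cox_involution j" for i
    by (rule nonneg_eval_one_zero[OF laurent_poly_qlevel], rule qlevel_nonneg, simp, unfold eval_one_qlevel cox_involution(1)) (use that in \<open>simp add: axis_def\<close>)
  then show ?thesis using a by auto
qed

definition top_degree :: "'i \<Rightarrow> int" where
  "top_degree j = (SOME a. \<forall>i. qlevel (cox - 1) i j = (if i = cox_involution j then qmono a else 0))"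

lemma qlevel_top: "qlevel (cox - 1) i j = (if i = cox_involution j then qmono (top_degree j) else 0)"
  using someI_ex[OF qlevel_top_exists[of j]] unfolding top_degree_def by blast

text \<open>Level \<open>cox\<close> is 0, level \<open>cox - 1\<close> is a power of
  \<open>q\<close> at one vertex, and the recursion gives minus that power times
  \<open>q^(2 * D j)\<close> one level further; so the final derivative is a multiple of the final
  vector.\<close>

lemma iter_deriv_cox: "iter_deriv e cox (axis j 1) = (top_degree j + D j) *s iter_steps e cox (axis j 1)"
proof -
  obtain b where b: "cox = Suc b" using cox(1) by (cases cox) auto
  have g1: "level_deriv b j = top_degree j *s axis (cox_involution j) 1"
    using qlevel_top[of _ j] b by (auto simp: level_deriv_def vec_eq_iff deriv_one_qmono axis_def)
  have g2: "level_deriv (Suc b) j = 0" using qlevel_cox b by (simp add: level_deriv_def vec_eq_iff)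
  have y: "level_vec b j = axis (cox_involution j) 1" "level_vec (Suc b) j = 0" "level_vec (Suc (Suc b)) j = - axis (cox_involution j) 1"
    using cox_involution(1)[of j] cox(2)[of j] level_vec_shift[of 1 j] b by simp_all
  have "level_deriv (Suc (Suc b)) j $ i = - (top_degree j + 2 * D j) * axis (cox_involution j) 1 $ i" for i
    unfolding level_deriv_rec g1 g2 y using cox_involution(2)[of j] by (auto simp: axis_def)
  then have g3: "level_deriv (Suc (Suc b)) j = (- (top_degree j + 2 * D j)) *s axis (cox_involution j) 1" by (simp add: vec_eq_iff)
  have Gb1: "deriv_defect b j = (top_degree j - D j) *s axis (cox_involution j) 1"
    unfolding deriv_defect_def g1 g2 level_sum_def y by (simp add: vec_eq_iff algebra_simps)
  have Gb2: "deriv_defect (Suc b) j = (- (top_degree j + D j)) *s axis (cox_involution j) 1"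
    unfolding deriv_defect_def g2 g3 level_sum_def y by (simp add: vec_eq_iff algebra_simps)
  show ?thesis
  proof (cases "colour j = e")
    case True
    show ?thesis unfolding iter_steps_cox_axis unfolding b iter_deriv_same[OF True] Gb1 level_sum_def y
      by (simp add: vec_eq_iff algebra_simps)
  next
    case False
    show ?thesis unfolding iter_steps_cox_axis unfolding b iter_deriv_other[OF False] Gb2 by (simp add: vec_eq_iff algebra_simps)
  qed
qed

text \<open>\<open>B_iter_deriv\<close> after all \<open>cox\<close> steps, where by
  \<open>iter_deriv_cox\<close> its left side is a multiple of the invariant form. The right side is
  symmetric in \<open>x\<close> and the simple root, which gives
  \<open>degree_const\<close>.\<close>

lemma degree_form:
  "(top_degree j + D j) * B x (axis j 1) = (\<Sum>p\<in>steps e. B x (level_sum (fst p) (snd p)) * B (axis j 1) (level_sum (fst p) (snd p)))"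
proof -
  have "(top_degree j + D j) * B x (axis j 1) = B (iter_steps e cox x) (iter_deriv e cox (axis j 1))"
    unfolding iter_deriv_cox B_scale B_iter_steps ..
  also have "\<dots> = (\<Sum>p\<in>steps e. B (iter_steps e (fst p) x) (axis (snd p) 1) * B (iter_steps e (fst p) (axis j 1)) (axis (snd p) 1))"
    unfolding B_iter_deriv sum_steps[of "\<lambda>b i. B (iter_steps e b x) (axis i 1) * B (iter_steps e b (axis j 1)) (axis i 1)"] ..
  also have "\<dots> = (\<Sum>p\<in>steps e. B x (level_sum (fst p) (snd p)) * B (axis j 1) (level_sum (fst p) (snd p)))"
    by (intro sum.cong refl) (simp add: B_iter_steps_axis)
  finally show ?thesis .
qed

lemma degree_const: "top_degree i + D i = top_degree j + D j"
proof (rule connected_eq)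
  fix k l assume adj: "adj C k l"
  have "(top_degree l + D l) * B (axis k 1) (axis l 1) = (top_degree k + D k) * B (axis l 1) (axis k 1)"
    unfolding degree_form[where e = True] by (simp add: mult.commute)
  moreover have "B (axis k 1) (axis l 1) \<noteq> 0" using adj by (simp add: B_axis_axis adj_def)
  ultimately show "top_degree k + D k = top_degree l + D l" by (simp add: B_sym[of "axis l 1"])
qed

text \<open>Since the factor does not depend on the vertex, the form identity extends to all
  vectors; it is evaluated at the highest root in both arguments.\<close>

lemma degree_eq: "top_degree j + D j = long_half_norm * int (dual_coxeter_number C)"
proof -
  let ?N = "top_degree j + D j"
  have "?N * B highest_root highest_root = (\<Sum>k\<in>UNIV. highest_root $ k * (?N * B (axis k 1) highest_root))"
    by (subst B_coord) (simp add: sum_distrib_left ac_simps)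
  also have "\<dots> = (\<Sum>k\<in>UNIV. highest_root $ k * ((top_degree k + D k) * B highest_root (axis k 1)))"
  proof (rule sum.cong[OF refl])
    fix k
    show "highest_root $ k * (?N * B (axis k 1) highest_root) = highest_root $ k * ((top_degree k + D k) * B highest_root (axis k 1))"
      unfolding degree_const[of k j] B_sym[of "axis k 1" highest_root] ..
  qed
  also have "\<dots> = (\<Sum>p\<in>steps True. \<Sum>k\<in>UNIV. B highest_root (level_sum (fst p) (snd p)) * (highest_root $ k * B (axis k 1) (level_sum (fst p) (snd p))))"
    unfolding degree_form[where e = True] by (subst sum.swap) (simp add: sum_distrib_left ac_simps)
  also have "\<dots> = (\<Sum>p\<in>steps True. (B highest_root (level_sum (fst p) (snd p)))\<^sup>2)"
    by (intro sum.cong refl)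
      (simp add: power2_eq_square sum_distrib_left[symmetric] B_coord[of highest_root, symmetric])
  also have "\<dots> = 2 * long_half_norm * long_half_norm * int (dual_coxeter_number C)" by (rule sum_pairing_square)
  finally show ?thesis using long_half_norm by simp
qed

text \<open>Solved for its last term, the recursion runs backwards with \<open>q\<close> inverted.
  The starting values match because the top exponent \<open>top_degree j\<close> lies
  \<open>D j\<close> below the total.\<close>

lemma qlevel_reverse: "v \<le> cox \<Longrightarrow> fls_nth (qlevel (cox - v) i j) (top_degree j + D j - u) = fls_nth (qlevel v i (cox_involution j)) u"
proof (induction v i "cox_involution j" arbitrary: u rule: qlevel.induct)
  case (1 i)
  then show ?case by (simp add: qlevel_cox)
next
  case (2 i)
  then show ?case using qlevel_top[of i j] cox_involution(2)[of j] by (auto simp: nth_qmono)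
next
  case (3 v i)
  define s where "s = cox - Suc (Suc v)"
  have s: "cox - Suc v = Suc s" "cox - v = Suc (Suc s)" using 3(3) by (auto simp: s_def)
  let ?N = "top_degree j + D j"
  have "fls_nth (qlevel (Suc (Suc s)) i j) (?N - (u - 2 * D i)) = (\<Sum>k | adj C i k. \<Sum>n<bond i k.
      fls_nth (qlevel (Suc s) k j) (?N - (u - 2 * D i) - D i - (int (bond i k) - 1 - 2 * int n))) - fls_nth (qlevel s i j) (?N - u)"
    unfolding nth_qlevel_rec by (simp add: algebra_simps)
  also have "fls_nth (qlevel (Suc (Suc s)) i j) (?N - (u - 2 * D i)) = fls_nth (qlevel v i (cox_involution j)) (u - 2 * D i)"
    using 3 s by simp
  also have "(\<Sum>k | adj C i k. \<Sum>n<bond i k. fls_nth (qlevel (Suc s) k j) (?N - (u - 2 * D i) - D i - (int (bond i k) - 1 - 2 * int n)))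
    = (\<Sum>k | adj C i k. \<Sum>n<bond i k. fls_nth (qlevel (Suc v) k (cox_involution j)) (u - D i - (int (bond i k) - 1 - 2 * int n)))"
  proof (rule sum.cong[OF refl])
    fix k assume "k \<in> {k. adj C i k}"
    then have IH: "fls_nth (qlevel (Suc s) k j) (?N - u) = fls_nth (qlevel (Suc v) k (cox_involution j)) u" for u
      using 3 s by simp
    have "(\<Sum>n<bond i k. fls_nth (qlevel (Suc s) k j) (?N - (u - 2 * D i) - D i - (int (bond i k) - 1 - 2 * int n)))
      = (\<Sum>n<bond i k. fls_nth (qlevel (Suc v) k (cox_involution j)) (u - D i + (int (bond i k) - 1 - 2 * int n)))"
      by (intro sum.cong refl, subst IH[symmetric]) (simp add: algebra_simps)
    \<comment> \<open>Invariance of the quantum integer under inversion of \<open>q\<close>.\<close>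
    also have "\<dots> = (\<Sum>n<bond i k. fls_nth (qlevel (Suc v) k (cox_involution j)) (u - D i - (int (bond i k) - 1 - 2 * int n)))"
      by (subst sum.nat_diff_reindex[symmetric], intro sum.cong refl) (simp add: of_nat_diff algebra_simps)
    finally show "(\<Sum>n<bond i k. fls_nth (qlevel (Suc s) k j) (?N - (u - 2 * D i) - D i - (int (bond i k) - 1 - 2 * int n)))
      = (\<Sum>n<bond i k. fls_nth (qlevel (Suc v) k (cox_involution j)) (u - D i - (int (bond i k) - 1 - 2 * int n)))" .
  qed
  finally show ?case unfolding nth_qlevel_rec s_def[symmetric] by simp
qed

lemma qlevel_bounds:
  assumes "v \<le> cox" "fls_nth (qlevel v i j) u \<noteq> 0"
  shows "0 \<le> u" "u \<le> int (lacing_number C * dual_coxeter_number C)"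
proof -
  show "0 \<le> u" using qlevel_low[OF assms(2)] D_pos[of i] by linarith
  have "fls_nth (qlevel (cox - v) i (cox_involution j)) (top_degree j + D j - u) \<noteq> 0"
    using qlevel_reverse[of "cox - v" i j "top_degree j + D j - u"] assms by simp
  then have "D i \<le> top_degree j + D j - u" by (rule qlevel_low)
  then have "u \<le> long_half_norm * int (dual_coxeter_number C)" using D_pos[of i] degree_eq[of j] by linarith
  also have "\<dots> \<le> int (lacing_number C) * int (dual_coxeter_number C)"
    by (intro mult_right_mono long_half_norm_le_lacing) simp
  finally show "u \<le> int (lacing_number C * dual_coxeter_number C)" by simp
qed

end

end

subsection \<open>The inverse of the deformed Cartan matrix\<close>

text \<open>The off-diagonal part \<open>F\<close> is arbitrary so that the construction also
  applies to the transposed matrix, which is how the left inverse is obtained.\<close>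

fun inv_coeff :: "('i::finite \<Rightarrow> 'i \<Rightarrow> int fls) \<Rightarrow> ('i \<Rightarrow> int) \<Rightarrow> nat \<Rightarrow> 'i \<Rightarrow> 'i \<Rightarrow> int fls" where
  "inv_coeff F p 0 i j = 0"
| "inv_coeff F p (Suc 0) i j = (if i = j then qmono (p i) else 0)"
| "inv_coeff F p (Suc (Suc v)) i j = qmono (p i) * (\<Sum>k\<in>UNIV. F i k * inv_coeff F p (Suc v) k j) - qmono (2 * p i) * inv_coeff F p v i j"

lemma qmono_add: "qmono (a + b) = qmono a * qmono b"
  unfolding qmono_def fls_X_intpow_times_fls_X_intpow ..

lemma qmono_0: "qmono 0 = 1" by (simp add: qmono_def)

definition band_matrix :: "('i::finite \<Rightarrow> 'i \<Rightarrow> int fls) \<Rightarrow> ('i \<Rightarrow> int) \<Rightarrow> qt_ring^'i^'i" where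
  "band_matrix F p = (\<chi> i j. (if i = j then fls_const (qmono (p i)) * tpow (- 1) + fls_const (qmono (- p i)) * tpow 1 else 0)
     - fls_const (F i j))"

definition inv_matrix :: "('i::finite \<Rightarrow> 'i \<Rightarrow> int fls) \<Rightarrow> ('i \<Rightarrow> int) \<Rightarrow> qt_ring^'i^'i" where
  "inv_matrix F p = (\<chi> i j. fps_to_fls (Abs_fps (\<lambda>v. inv_coeff F p v i j)))"

lemma nth_inv_matrix: "fls_nth (inv_matrix F p $ i $ j) v = (if v < 0 then 0 else inv_coeff F p (nat v) i j)"
  by (simp add: inv_matrix_def)

lemma nth_const_times: "fls_nth (fls_const c * f) n = c * fls_nth f n" for f :: qt_ring
  by (simp add: fls_mult_const_nth)

lemma nth_tpow_times: "fls_nth (tpow a * f) n = fls_nth f (n + a)"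
  unfolding tpow_def fls_X_intpow_times_conv_shift by simp

lemma band_matrix_right_inverse:
  fixes F :: "'i::finite \<Rightarrow> 'i \<Rightarrow> int fls"
  shows "band_matrix F p ** inv_matrix F p = mat 1"
proof -
  have "fls_nth ((band_matrix F p ** inv_matrix F p) $ i $ j) v = fls_nth ((mat 1 :: qt_ring^'i^'i) $ i $ j) v" for i j v
  proof -
    let ?g = "\<lambda>v k. if v < 0 then 0 else inv_coeff F p (nat v) k j"
    have "(band_matrix F p ** inv_matrix F p) $ i $ j = (\<Sum>k\<in>UNIV. band_matrix F p $ i $ k * inv_matrix F p $ k $ j)"
      by (simp add: matrix_matrix_mult_def)
    also have "\<dots> = (\<Sum>k\<in>UNIV. (if k = i then fls_const (qmono (p i)) * (tpow (- 1) * inv_matrix F p $ i $ j)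
        + fls_const (qmono (- p i)) * (tpow 1 * inv_matrix F p $ i $ j) else 0) - fls_const (F i k) * inv_matrix F p $ k $ j)"
      by (intro sum.cong refl) (simp add: band_matrix_def left_diff_distrib distrib_right mult.assoc)
    also have "\<dots> = fls_const (qmono (p i)) * (tpow (- 1) * inv_matrix F p $ i $ j)
        + fls_const (qmono (- p i)) * (tpow 1 * inv_matrix F p $ i $ j) - (\<Sum>k\<in>UNIV. fls_const (F i k) * inv_matrix F p $ k $ j)"
      by (simp add: sum_subtractf)
    finally have e: "fls_nth ((band_matrix F p ** inv_matrix F p) $ i $ j) v
      = qmono (p i) * ?g (v - 1) i + qmono (- p i) * ?g (v + 1) i - (\<Sum>k\<in>UNIV. F i k * ?g v k)"
      by (simp only: fls_plus_nth fls_minus_nth fls_nth_sum nth_const_times nth_tpow_times nth_inv_matrix)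
        (simp add: add.commute)
    \<comment> \<open>The indices -1 and 0 test the two initial values, positive indices the
      recursion.\<close>
    consider "v < - 1" | "v = - 1" | "v = 0" | "v > 0" by linarith
    then show ?thesis
    proof cases
      case 1
      then show ?thesis unfolding e by (simp add: mat_def)
    next
      case 2
      then show ?thesis unfolding e by (simp add: mat_def)
    next
      case 3
      have "qmono (- p i) * qmono (p i) = 1" unfolding qmono_add[symmetric] by (simp add: qmono_0)
      then show ?thesis using 3 unfolding e by (auto simp: mat_def)
    next
      case 4
      then obtain n where n: "v = int (Suc n)" using zero_less_imp_eq_int by (metis gr0_implies_Suc of_nat_0_less_iff)
      have nonneg_vec: "nat (v - 1) = n" "nat (v + 1) = Suc (Suc n)" "nat v = Suc n" using n by auto
      have Q1: "qmono (- p i) * (qmono (p i) * x) = x" for x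
        unfolding mult.assoc[symmetric] qmono_add[symmetric] by (simp add: qmono_0)
      have Q2: "qmono (- p i) * (qmono (2 * p i) * x) = qmono (p i) * x" for x
        unfolding mult.assoc[symmetric] qmono_add[symmetric] by simp
      have "qmono (- p i) * inv_coeff F p (Suc (Suc n)) i j = (\<Sum>k\<in>UNIV. F i k * inv_coeff F p (Suc n) k j) - qmono (p i) * inv_coeff F p n i j"
        by (simp add: right_diff_distrib Q1 Q2)
      then show ?thesis unfolding e using 4 nonneg_vec by (simp add: mat_def del: inv_coeff.simps)
    qed
  qed
  then have "(band_matrix F p ** inv_matrix F p) $ i $ j = (mat 1 :: qt_ring^'i^'i) $ i $ j" for i j
    by (rule fls_eqI)
  then show ?thesis by (simp add: vec_eq_iff)
qed

lemma transpose_band_matrix: "transpose (band_matrix F p) = band_matrix (\<lambda>i j. F j i) p"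
  by (auto simp: vec_eq_iff transpose_def band_matrix_def)

text \<open>Transposing the right inverse of the transpose gives a left inverse, which must agree
  with the right inverse.\<close>

lemma band_matrix_left_inverse: "inv_matrix F p ** band_matrix F p = mat 1"
proof -
  have "transpose (inv_matrix (\<lambda>i j. F j i) p) ** band_matrix F p = transpose (transpose (band_matrix F p) ** inv_matrix (\<lambda>i j. F j i) p)"
    by (simp add: matrix_transpose_mul)
  also have "\<dots> = mat 1" unfolding transpose_band_matrix band_matrix_right_inverse by (simp add: transpose_mat)
  finally have Y: "transpose (inv_matrix (\<lambda>i j. F j i) p) ** band_matrix F p = mat 1" .
  have "transpose (inv_matrix (\<lambda>i j. F j i) p) = transpose (inv_matrix (\<lambda>i j. F j i) p) ** (band_matrix F p ** inv_matrix F p)"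
    by (simp add: band_matrix_right_inverse)
  also have "\<dots> = inv_matrix F p" unfolding matrix_mul_assoc Y by simp
  finally show ?thesis using Y by simp
qed

lemma matrix_inv_band_matrix: "matrix_inv (band_matrix F p) = inv_matrix F p"
proof -
  have "band_matrix F p ** matrix_inv (band_matrix F p) = mat 1 \<and> matrix_inv (band_matrix F p) ** band_matrix F p = mat 1"
    unfolding matrix_inv_def by (rule someI) (use band_matrix_right_inverse band_matrix_left_inverse in blast)
  then have "matrix_inv (band_matrix F p) ** band_matrix F p = mat 1" by simp
  then have "inv_matrix F p = (matrix_inv (band_matrix F p) ** band_matrix F p) ** inv_matrix F p" by simp
  also have "\<dots> = matrix_inv (band_matrix F p)" by (simp add: band_matrix_right_inverse flip: matrix_mul_assoc)
  finally show ?thesis ..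
qed

context simple_cartan
begin

lemma qint_qbond: "adj C i k \<Longrightarrow> qint (C $ i $ k) = - fls_const (qbond i k)"
proof -
  assume a: "adj C i k"
  have s: "sgn (C $ i $ k) = -1" using adj_neg[OF a] by simp
  have m: "nat \<bar>C $ i $ k\<bar> = bond i k" "\<bar>C $ i $ k\<bar> = int (bond i k)" using int_bond[OF a] by auto
  have "fls_const (\<Sum>n\<in>S. f n) = (\<Sum>n\<in>S. fls_const (f n))" if "finite S" for S :: "nat set" and f :: "nat \<Rightarrow> int fls"
    using that by (induction S rule: finite_induct) (simp_all flip: fls_plus_const)
  then show ?thesis unfolding qint_def m s qbond_def qpow_def qmono_def by simp
qed

lemma deformed_cartan_band_matrix:
  "deformed_cartan C d = band_matrix (\<lambda>i k. if adj C i k then qbond i k else 0) D"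
proof -
  have "deformed_cartan C d $ i $ k = band_matrix (\<lambda>i k. if adj C i k then qbond i k else 0) D $ i $ k" for i k
  proof (cases "i = k")
    case True
    then show ?thesis by (simp add: deformed_cartan_def band_matrix_def qpow_def qmono_def D_def)
  next
    case False
    then show ?thesis
      using not_adj_zero[of i k] qint_qbond[of i k]
      by (cases "adj C i k") (simp_all add: deformed_cartan_def band_matrix_def qint_def)
  qed
  then show ?thesis by (simp add: vec_eq_iff)
qed

lemma inv_coeff_qlevel: "inv_coeff (\<lambda>i k. if adj C i k then qbond i k else 0) D v i j = qlevel v i j"
proof (induction v i j rule: qlevel.induct)
  case (3 v i j)
  have "(\<Sum>k\<in>UNIV. (if adj C i k then qbond i k else 0) * inv_coeff (\<lambda>i k. if adj C i k then qbond i k else 0) D (Suc v) k j)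
    = (\<Sum>k | adj C i k. qbond i k * inv_coeff (\<lambda>i k. if adj C i k then qbond i k else 0) D (Suc v) k j)"
    by (subst sum.mono_neutral_right[of UNIV "{k. adj C i k}"]) auto
  also have "\<dots> = (\<Sum>k | adj C i k. qbond i k * qlevel (Suc v) k j)"
    by (intro sum.cong refl) (simp add: 3(1) del: inv_coeff.simps qlevel.simps)
  finally show ?case using 3(2) by simp
qed simp_all

lemma ctilde_qlevel: "ctilde C d i j u (- int v) = fls_nth (qlevel v i j) u"
  unfolding ctilde_def deformed_cartan_band_matrix matrix_inv_band_matrix qt_coeff_def nth_inv_matrix inv_coeff_qlevel by simp

end

subsection \<open>Words\<close>

fun alpha_count :: "'i arrow list \<Rightarrow> nat" where
  "alpha_count [] = 0"
| "alpha_count (Alpha i j # w) = Suc (alpha_count w)"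
| "alpha_count (Eps i # w) = alpha_count w"

abbreviation eps_word :: "'i \<Rightarrow> nat \<Rightarrow> 'i arrow list" where "eps_word i n \<equiv> replicate n (Eps i)"

lemma alpha_count_append [simp]: "alpha_count (u @ w) = alpha_count u + alpha_count w"
  by (induction u rule: alpha_count.induct) simp_all

lemma alpha_count_eps_word [simp]: "alpha_count (eps_word i n) = 0"
  by (induction n) simp_all

lemma is_walk_append:
  "is_walk C i (u @ w) j \<longleftrightarrow> (\<exists>k. is_walk C i u k \<and> is_walk C k w j)"
  by (induction u arbitrary: i) auto

lemma is_walk_eps_word [simp]: "is_walk C i (eps_word i n) j \<longleftrightarrow> i = j"
  by (induction n) auto

lemma is_walk_eps_word_iff: "is_walk C i (eps_word k n) k \<longleftrightarrow> i = k"
  by (induction n arbitrary: i) auto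

lemma is_walk_eps_word_append [simp]: "is_walk C i (eps_word i n @ w) j \<longleftrightarrow> is_walk C i w j"
  by (induction n) auto

lemma walk_split:
  assumes "is_walk C i w j" "alpha_count w > 0"
  obtains N l w' where "w = eps_word i N @ Alpha i l # w'" "adj C i l" "is_walk C l w' j"
  using assms
proof (induction w arbitrary: thesis)
  case (Cons x w)
  show ?case
  proof (cases x)
    case (Alpha k l)
    then show ?thesis using Cons.prems(1)[of 0 l w] Cons.prems(2) by auto
  next
    case (Eps k)
    then have "k = i" "is_walk C i w j" "alpha_count w > 0" using Cons.prems by auto
    then obtain N l w' where "w = eps_word i N @ Alpha i l # w'" "adj C i l" "is_walk C l w' j"
      using Cons.IH by blast
    then show ?thesis using Cons.prems(1)[of "Suc N" l w'] Eps \<open>k = i\<close> by simp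
  qed
qed simp

lemma walk_no_alpha:
  assumes "is_walk C i w j" "alpha_count w = 0" shows "w = eps_word i (length w)" "i = j"
proof -
  have "w = eps_word i (length w) \<and> i = j" using assms
  proof (induction w)
    case (Cons x w)
    then show ?case by (cases x) auto
  qed simp
  then show "w = eps_word i (length w)" "i = j" by auto
qed

lemma word_cases:
  obtains (eps) N where "w = eps_word i N" | (other) N x w' where "w = eps_word i N @ x # w'" "x \<noteq> Eps i"
proof (induction w arbitrary: thesis)
  case Nil
  then show ?case using Nil(1)[of 0] by simp
next
  case (Cons x w)
  show ?case
  proof (cases "x = Eps i")
    case True
    show ?thesis
    proof (rule Cons.IH)
      fix N assume "w = eps_word i N"
      then show ?thesis using Cons.prems(1)[of "Suc N"] True by simp
    next
      fix N y w' assume "w = eps_word i N @ y # w'" "y \<noteq> Eps i"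
      then show ?thesis using Cons.prems(2)[of "Suc N" y w'] True by simp
    qed
  next
    case False
    then show ?thesis using Cons.prems(2)[of 0 x w] by simp
  qed
qed

section \<open>The dual modules as functions on words\<close>

locale word_module = simple_cartan C d for C :: "int^'i::finite^'i" and d :: "'i \<Rightarrow> nat" +
  fixes \<omega> :: "'i \<Rightarrow> 'i \<Rightarrow> 'k::field" and pt :: 'i
  assumes signs: "sign_choice C \<omega>"
begin

lemma omega_nz: "adj C i j \<Longrightarrow> \<omega> i j \<noteq> 0"
  using signs unfolding sign_choice_def by fastforce

lemma bond_pos: "adj C i j \<Longrightarrow> bond i j > 0"
  using int_bond[of i j] adj_neg[of i j] by simp

text \<open>The dual of the module \<open>(\<Pi>/\<Pi> \<epsilon>) e\<close> at the vertex \<open>pt\<close> is realised by functions on words: \<open>dual_level i a\<close>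
  consists of the functions on walks from \<open>pt\<close> to \<open>i\<close> with \<open>a\<close> arrows \<open>\<alpha>\<close> that kill the relations.
  In \<open>free_level i a\<close> the second relation is not imposed to the left of the first \<open>\<alpha>\<close>.\<close>

definition supported :: "'i \<Rightarrow> nat \<Rightarrow> ('i arrow list \<Rightarrow> 'k) \<Rightarrow> bool" where
  "supported i a f \<longleftrightarrow> (\<forall>w. f w \<noteq> 0 \<longrightarrow> is_walk C i w pt \<and> alpha_count w = a)"

text \<open>Vanishing on the left ideal generated by the loop at \<open>pt\<close>: words are read
  as products, so the loop is the last letter.\<close>

definition rel0 :: "('i arrow list \<Rightarrow> 'k) \<Rightarrow> bool" where
  "rel0 f \<longleftrightarrow> (\<forall>w. f (w @ [Eps pt]) = 0)"

definition rel1 :: "('i arrow list \<Rightarrow> 'k) \<Rightarrow> bool" where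
  "rel1 f \<longleftrightarrow> (\<forall>w w' k l. adj C k l \<longrightarrow>
     f (w @ eps_word k (bond k l) @ Alpha k l # w') = f (w @ Alpha k l # eps_word l (bond l k) @ w'))"

definition rel2_sum :: "'i \<Rightarrow> 'i arrow list \<Rightarrow> 'i arrow list \<Rightarrow> ('i arrow list \<Rightarrow> 'k) \<Rightarrow> 'k" where
  "rel2_sum k w w' f = (\<Sum>l | adj C l k. \<Sum>n<bond k l.
     \<omega> k l * f (w @ eps_word k n @ Alpha k l # Alpha l k # eps_word k (bond k l - 1 - n) @ w'))"

definition dual_level :: "'i \<Rightarrow> nat \<Rightarrow> ('i arrow list \<Rightarrow> 'k) set" where
  "dual_level i a = {f. supported i a f \<and> rel0 f \<and> rel1 f \<and> (\<forall>w w' k. rel2_sum k w w' f = 0)}"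

definition free_level :: "'i \<Rightarrow> nat \<Rightarrow> ('i arrow list \<Rightarrow> 'k) set" where
  "free_level i a = {f. supported i a f \<and> rel0 f \<and> rel1 f \<and> (\<forall>w w' k. alpha_count w > 0 \<longrightarrow> rel2_sum k w w' f = 0)}"

text \<open>The action on the dual module of the arrow opposite to \<open>x\<close>.\<close>

definition strip_arrow :: "'i arrow \<Rightarrow> ('i arrow list \<Rightarrow> 'k) \<Rightarrow> 'i arrow list \<Rightarrow> 'k" where
  "strip_arrow x f w = f (x # w)"

definition tail_comp :: "'i \<Rightarrow> 'i \<Rightarrow> nat \<Rightarrow> ('i arrow list \<Rightarrow> 'k) \<Rightarrow> 'i arrow list \<Rightarrow> 'k" where
  "tail_comp i l n f w = f (eps_word i n @ Alpha i l # w)"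

definition Psi :: "'i \<Rightarrow> ('i arrow list \<Rightarrow> 'k) \<Rightarrow> 'i arrow list \<Rightarrow> 'k" where
  "Psi i f w = rel2_sum i [] w f"

text \<open>The inverse of taking components after the first \<open>\<alpha>\<close>: the first relation moves all but
  \<open>N mod bond i l\<close> of the leading loops past that arrow.\<close>

definition glue :: "'i \<Rightarrow> ('i \<Rightarrow> nat \<Rightarrow> 'i arrow list \<Rightarrow> 'k) \<Rightarrow> 'i arrow list \<Rightarrow> 'k" where
  "glue i F w = (let N = length (takeWhile (\<lambda>x. x = Eps i) w) in
     case dropWhile (\<lambda>x. x = Eps i) w of
       Alpha k l # w' \<Rightarrow> if k = i \<and> adj C i l
         then F l (N mod bond i l) (eps_word l (N div bond i l * bond l i) @ w') else 0
     | _ \<Rightarrow> 0)"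

lemma dual_level_free_level: "f \<in> dual_level i a \<Longrightarrow> f \<in> free_level i a"
  by (simp add: dual_level_def free_level_def)

lemma rel2_sum_prefix: "rel2_sum k w w' (\<lambda>v. f (u @ v)) = rel2_sum k (u @ w) w' f"
  by (simp add: rel2_sum_def)

lemma rel2_sum_zero: "(\<And>u. f (w @ u) = 0) \<Longrightarrow> rel2_sum k w w' f = 0"
  by (simp add: rel2_sum_def)

lemma rel2_sum_add: "rel2_sum k w w' (\<lambda>v. f v + c * g v) = rel2_sum k w w' f + c * rel2_sum k w w' g"
  by (simp add: rel2_sum_def distrib_left sum.distrib sum_distrib_left ac_simps)

lemma dual_level_lin: "f \<in> dual_level i a \<Longrightarrow> g \<in> dual_level i a \<Longrightarrow> (\<lambda>w. f w + c * g w) \<in> dual_level i a"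
  unfolding dual_level_def supported_def rel0_def rel1_def
  by (simp add: rel2_sum_add) (metis add_0 mult_zero_right)

lemma free_level_lin: "f \<in> free_level i a \<Longrightarrow> g \<in> free_level i a \<Longrightarrow> (\<lambda>w. f w + c * g w) \<in> free_level i a"
  unfolding free_level_def supported_def rel0_def rel1_def
  by (simp add: rel2_sum_add) (metis add_0 mult_zero_right)

lemma dual_level_zero: "(\<lambda>w. 0) \<in> dual_level i a"
  by (simp add: dual_level_def supported_def rel0_def rel1_def rel2_sum_def)

lemma free_level_zero: "(\<lambda>w. 0) \<in> free_level i a"
  by (rule dual_level_free_level[OF dual_level_zero])

lemma dual_level_scale: "f \<in> dual_level i a \<Longrightarrow> (\<lambda>w. c * f w) \<in> dual_level i a"
  using dual_level_lin[OF dual_level_zero] by fastforce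

lemma glue_eps: "glue i F (eps_word i N) = 0"
  by (simp add: glue_def)

lemma glue_alpha: "glue i F (eps_word i N @ Alpha i l # w) =
   (if adj C i l then F l (N mod bond i l) (eps_word l (N div bond i l * bond l i) @ w) else 0)"
proof -
  have "takeWhile (\<lambda>x. x = Eps i) (eps_word i N @ Alpha i l # w) = eps_word i N"
    "dropWhile (\<lambda>x. x = Eps i) (eps_word i N @ Alpha i l # w) = Alpha i l # w"
    by (induction N) simp_all
  then show ?thesis by (simp add: glue_def)
qed

lemma glue_other:
  assumes "x \<noteq> Eps i" "\<And>l. x \<noteq> Alpha i l" shows "glue i F (eps_word i N @ x # w) = 0"
proof -
  have "dropWhile (\<lambda>x. x = Eps i) (eps_word i N @ x # w) = x # w"
    using assms(1) by (induction N) simp_all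
  then show ?thesis using assms by (simp add: glue_def Let_def split: arrow.split)
qed

lemma tail_comp_glue: "adj C i l \<Longrightarrow> n < bond i l \<Longrightarrow> tail_comp i l n (glue i F) = F l n"
  by (simp add: tail_comp_def glue_alpha fun_eq_iff)

lemma rel1_shift:
  assumes "rel1 f" "adj C i l"
  shows "f (eps_word i (n + t * bond i l) @ Alpha i l # w) = f (eps_word i n @ Alpha i l # eps_word l (t * bond l i) @ w)"
proof (induction t arbitrary: w)
  case (Suc t)
  have "f (eps_word i (n + Suc t * bond i l) @ Alpha i l # w)
    = f (eps_word i (n + t * bond i l) @ eps_word i (bond i l) @ Alpha i l # w)"
    by (simp add: replicate_add[symmetric] ac_simps flip: append_assoc)
  also have "\<dots> = f (eps_word i (n + t * bond i l) @ Alpha i l # eps_word l (bond l i) @ w)"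
    using assms unfolding rel1_def by blast
  also have "\<dots> = f (eps_word i n @ Alpha i l # eps_word l (t * bond l i) @ eps_word l (bond l i) @ w)" by (rule Suc)
  also have "\<dots> = f (eps_word i n @ Alpha i l # eps_word l (Suc t * bond l i) @ w)"
    by (simp add: replicate_add[symmetric] ac_simps flip: append_assoc)
  finally show ?case .
qed simp

lemma rel1_normal:
  assumes "rel1 f" "adj C i l"
  shows "f (eps_word i N @ Alpha i l # w) = tail_comp i l (N mod bond i l) f (eps_word l (N div bond i l * bond l i) @ w)"
  using rel1_shift[OF assms, of "N mod bond i l" "N div bond i l" w] by (simp add: tail_comp_def)

text \<open>Every walk of positive level is some loops, an arrow \<alpha> and a tail, and the first
  relation reduces the number of loops modulo \<open>bond i l\<close>.\<close>

lemma free_level_ext: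
  assumes "f \<in> free_level i (Suc a)" "g \<in> free_level i (Suc a)"
    and "\<And>l n. adj C i l \<Longrightarrow> n < bond i l \<Longrightarrow> tail_comp i l n f = tail_comp i l n g"
  shows "f = g"
proof
  fix w
  have sf: "supported i (Suc a) f" "rel1 f" "supported i (Suc a) g" "rel1 g" using assms by (auto simp: free_level_def)
  show "f w = g w"
  proof (cases "is_walk C i w pt \<and> alpha_count w = Suc a")
    case True
    then obtain N l w' where w: "w = eps_word i N @ Alpha i l # w'" "adj C i l"
      using walk_split[of C i w pt] by (metis zero_less_Suc)
    show ?thesis unfolding w(1) rel1_normal[OF sf(2) w(2)] rel1_normal[OF sf(4) w(2)]
      using assms(3)[OF w(2)] bond_pos[OF w(2)] by simp
  next
    case False
    then have "f w = 0" "g w = 0" using sf by (auto simp: supported_def)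
    then show ?thesis by simp
  qed
qed

text \<open>Within a tail there is always an \<alpha> further left, so there the second relation is
  imposed in \<open>free_level\<close> too.\<close>

lemma tail_comp_mem:
  assumes f: "f \<in> free_level i (Suc a)" and "adj C i l" shows "tail_comp i l n f \<in> dual_level l a"
proof -
  have c: "tail_comp i l n f = (\<lambda>v. f ((eps_word i n @ [Alpha i l]) @ v))" by (simp add: tail_comp_def fun_eq_iff)
  have "supported l a (tail_comp i l n f)"
    using assms by (auto simp: supported_def tail_comp_def free_level_def)
  moreover have "rel0 (tail_comp i l n f)"
  proof -
    have "f ((eps_word i n @ Alpha i l # w) @ [Eps pt]) = 0" for w using f by (simp only: free_level_def rel0_def) blast
    then show ?thesis by (simp add: rel0_def tail_comp_def)
  qed
  moreover have "rel1 (tail_comp i l n f)"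
  proof -
    have "f ((eps_word i n @ Alpha i l # w) @ eps_word k (bond k l') @ Alpha k l' # w') = f ((eps_word i n @ Alpha i l # w) @ Alpha k l' # eps_word l' (bond l' k) @ w')"
      if "adj C k l'" for w w' k l' using f that by (simp only: free_level_def rel1_def) blast
    then show ?thesis by (simp add: rel1_def tail_comp_def)
  qed
  moreover have "rel2_sum k w w' (tail_comp i l n f) = 0" for w w' k
    unfolding c rel2_sum_prefix using f by (simp add: free_level_def)
  ultimately show ?thesis by (simp add: dual_level_def)
qed

lemma strip_arrow_eps_free_level: "f \<in> free_level i a \<Longrightarrow> strip_arrow (Eps i) f \<in> free_level i a"
proof -
  assume f: "f \<in> free_level i a"
  have c: "strip_arrow (Eps i) f = (\<lambda>v. f ([Eps i] @ v))" by (simp add: strip_arrow_def fun_eq_iff)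
  have "supported i a (strip_arrow (Eps i) f)" using f by (auto simp: supported_def strip_arrow_def free_level_def)
  moreover have "rel0 (strip_arrow (Eps i) f)"
  proof -
    have "f ((Eps i # w) @ [Eps pt]) = 0" for w using f by (simp only: free_level_def rel0_def) blast
    then show ?thesis by (simp add: rel0_def strip_arrow_def)
  qed
  moreover have "rel1 (strip_arrow (Eps i) f)"
  proof -
    have "f ((Eps i # w) @ eps_word k (bond k l) @ Alpha k l # w') = f ((Eps i # w) @ Alpha k l # eps_word l (bond l k) @ w')"
      if "adj C k l" for w w' k l using f that by (simp only: free_level_def rel1_def) blast
    then show ?thesis by (simp add: rel1_def strip_arrow_def)
  qed
  moreover have "rel2_sum k w w' (strip_arrow (Eps i) f) = 0" if "alpha_count w > 0" for w w' k
    unfolding c rel2_sum_prefix using f that by (simp add: free_level_def)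
  ultimately show ?thesis by (simp add: free_level_def)
qed

lemma strip_arrow_eps_dual_level: "f \<in> dual_level i a \<Longrightarrow> strip_arrow (Eps i) f \<in> dual_level i a"
proof -
  assume f: "f \<in> dual_level i a"
  have c: "strip_arrow (Eps i) f = (\<lambda>v. f ([Eps i] @ v))" by (simp add: strip_arrow_def fun_eq_iff)
  have "rel2_sum k w w' (strip_arrow (Eps i) f) = 0" for w w' k
    unfolding c rel2_sum_prefix using f by (simp add: dual_level_def)
  then show ?thesis using strip_arrow_eps_free_level[OF dual_level_free_level[OF f]] by (simp add: dual_level_def free_level_def)
qed

text \<open>With \<open>tail_comp_glue\<close> and \<open>free_level_ext\<close> this is the direct
  sum decomposition, one summand \<open>dual_level l a\<close> for each neighbour \<open>l\<close>
  and each \<open>n < bond i l\<close>.\<close>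

lemma glue_mem:
  assumes F: "\<And>l n. adj C i l \<Longrightarrow> n < bond i l \<Longrightarrow> F l n \<in> dual_level l a"
  shows "glue i F \<in> free_level i (Suc a)"
proof -
  have FD: "F l (N mod bond i l) \<in> dual_level l a" if "adj C i l" for l N
    using F[OF that] bond_pos[OF that] by simp
  text \<open>Beyond the first arrow \<open>\<alpha>\<close> everything is inherited from \<open>F\<close>.\<close>
  have tail: "\<exists>g u. (\<forall>v. glue i F (w @ v) = g (u @ v)) \<and> ((\<exists>l. adj C i l \<and> g \<in> dual_level l a) \<or> g = (\<lambda>_. 0))"
    if "w = eps_word i N @ x # w1" "x \<noteq> Eps i" for w N x w1
  proof (cases "\<exists>l. x = Alpha i l \<and> adj C i l")
    case True
    then obtain l where x: "x = Alpha i l" "adj C i l" by blast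
    show ?thesis
      by (rule exI[of _ "F l (N mod bond i l)"], rule exI[of _ "eps_word l (N div bond i l * bond l i) @ w1"])
        (use x that FD[OF x(2)] glue_alpha[of i F N l] in auto)
  next
    case False
    have "glue i F (w @ v) = 0" for v
    proof (cases "\<exists>l. x = Alpha i l")
      case True
      then show ?thesis using False that glue_alpha[of i F N _ "w1 @ v"] by auto
    next
      case False
      then show ?thesis using that glue_other[of x i F N "w1 @ v"] by auto
    qed
    then show ?thesis by (intro exI[of _ "\<lambda>_. 0"] exI[of _ "[]"]) simp
  qed
  have "supported i (Suc a) (glue i F)"
    unfolding supported_def
  proof (intro allI impI)
    fix w assume nz: "glue i F w \<noteq> 0"
    show "is_walk C i w pt \<and> alpha_count w = Suc a"
    proof (cases rule: word_cases[of w i])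
      case (eps N)
      then show ?thesis using nz by (simp add: glue_eps)
    next
      case (other N x w')
      then obtain l where x: "x = Alpha i l" using nz glue_other[of x i F N w'] by blast
      then have l: "adj C i l" and "F l (N mod bond i l) (eps_word l (N div bond i l * bond l i) @ w') \<noteq> 0"
        using nz other glue_alpha[of i F N l w'] by (auto split: if_splits)
      then have "is_walk C l w' pt \<and> alpha_count w' = a"
        using FD[OF l, of N] by (auto simp: dual_level_def supported_def)
      then show ?thesis using other x l by simp
    qed
  qed
  moreover have "rel0 (glue i F)"
    unfolding rel0_def
  proof
    fix w
    show "glue i F (w @ [Eps pt]) = 0"
    proof (cases rule: word_cases[of w i])
      case (eps N)
      show ?thesis
      proof (cases "pt = i")
        case True
        then have "w @ [Eps pt] = eps_word i (Suc N)" using eps by (simp add: replicate_append_same)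
        then show ?thesis by (simp only: glue_eps)
      next
        case False
        then show ?thesis using glue_other[of "Eps pt" i F N "[]"] eps by simp
      qed
    next
      case (other N x w')
      obtain g u where g: "\<forall>v. glue i F (w @ v) = g (u @ v)"
        "(\<exists>l. adj C i l \<and> g \<in> dual_level l a) \<or> g = (\<lambda>_. 0)" using tail[OF other] by (elim exE conjE)
      have "rel0 g" using g(2) by (auto simp: dual_level_def rel0_def)
      then show ?thesis using g(1) by (simp add: rel0_def)
    qed
  qed
  moreover have "rel1 (glue i F)"
    unfolding rel1_def
  proof (intro allI impI)
    fix w w' k l assume kl: "adj C k l"
    show "glue i F (w @ eps_word k (bond k l) @ Alpha k l # w') = glue i F (w @ Alpha k l # eps_word l (bond l k) @ w')"
    proof (cases rule: word_cases[of w i])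
      case (eps N)
      show ?thesis
      proof (cases "k = i")
        case True
        have "w @ eps_word k (bond k l) @ Alpha k l # w' = eps_word i (N + bond i l) @ Alpha i l # w'"
          using True eps by (simp add: replicate_add)
        \<comment> \<open>A full block of \<open>bond i l\<close> loops keeps the remainder and
          raises the quotient by one, which inserts \<open>bond l i\<close> loops behind the
          arrow.\<close>
        moreover have "(N + bond i l) div bond i l = Suc (N div bond i l)"
          using bond_pos[OF kl] True by simp
        ultimately show ?thesis using True eps kl
          by (simp add: glue_alpha replicate_add[symmetric] ac_simps flip: append_assoc)
      next
        case False
        obtain m where m: "bond k l = Suc m" using bond_pos[OF kl] gr0_implies_Suc by blast
        have "glue i F (eps_word i N @ Eps k # eps_word k m @ Alpha k l # w') = 0" "glue i F (eps_word i N @ Alpha k l # eps_word l (bond l k) @ w') = 0"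
          using False by (auto intro!: glue_other)
        then show ?thesis using m eps by simp
      qed
    next
      case (other N x w1)
      obtain g u where g: "\<forall>v. glue i F (w @ v) = g (u @ v)"
        "(\<exists>l. adj C i l \<and> g \<in> dual_level l a) \<or> g = (\<lambda>_. 0)" using tail[OF other] by (elim exE conjE)
      have "rel1 g" using g(2) by (auto simp: dual_level_def rel1_def)
      then show ?thesis unfolding g(1)[rule_format] using kl by (simp add: rel1_def)
    qed
  qed
  moreover have "rel2_sum k w w' (glue i F) = 0" if "alpha_count w > 0" for w w' k
  proof (cases rule: word_cases[of w i])
    case (eps N)
    then show ?thesis using that by simp
  next
    case (other N x w1)
    obtain g u where g: "\<forall>v. glue i F (w @ v) = g (u @ v)"
      "(\<exists>l. adj C i l \<and> g \<in> dual_level l a) \<or> g = (\<lambda>_. 0)" using tail[OF other] by (elim exE conjE)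
    have "rel2_sum k w w' (glue i F) = rel2_sum k u w' g" using g(1) by (simp add: rel2_sum_def)
    also have "\<dots> = 0" using g(2) by (auto simp: dual_level_def rel2_sum_def)
    finally show ?thesis .
  qed
  ultimately show ?thesis by (simp add: free_level_def)
qed

lemma Psi_tail_comp: "Psi i f w = (\<Sum>l | adj C l i. \<Sum>n<bond i l. \<omega> i l * tail_comp i l n f (Alpha l i # eps_word i (bond i l - 1 - n) @ w))"
  by (simp add: Psi_def rel2_sum_def tail_comp_def)

lemma Psi_lin: "Psi i (\<lambda>w. f w + c * g w) = (\<lambda>w. Psi i f w + c * Psi i g w)"
  by (simp add: Psi_def rel2_sum_add fun_eq_iff)

text \<open>Each prefix \<open>?u\<close> inserted by \<open>Psi\<close> contains \<alpha>, so
  second relations to its right already hold.\<close>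

lemma Psi_mem:
  assumes f: "f \<in> free_level i (Suc (Suc a))" shows "Psi i f \<in> dual_level i a"
proof -
  let ?u = "\<lambda>l n. eps_word i n @ Alpha i l # Alpha l i # eps_word i (bond i l - 1 - n)"
  have P: "Psi i f w = (\<Sum>l | adj C l i. \<Sum>n<bond i l. \<omega> i l * f (?u l n @ w))" for w
    by (simp add: Psi_def rel2_sum_def)
  have "supported i a (Psi i f)"
    unfolding supported_def
  proof (intro allI impI)
    fix w assume "Psi i f w \<noteq> 0"
    then obtain l n where "adj C l i" "f (?u l n @ w) \<noteq> 0"
      unfolding P by (smt (verit) mem_Collect_eq mult_eq_0_iff sum.not_neutral_contains_not_neutral)
    then show "is_walk C i w pt \<and> alpha_count w = a"
      using f unfolding free_level_def supported_def by force
  qed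
  moreover have "rel0 (Psi i f)"
  proof -
    have "f ((?u l n @ w) @ [Eps pt]) = 0" for l n w using f by (simp only: free_level_def rel0_def) blast
    then show ?thesis unfolding rel0_def P by simp
  qed
  moreover have "rel1 (Psi i f)"
  proof -
    have "f ((?u l' n @ w) @ eps_word k (bond k l) @ Alpha k l # w') = f ((?u l' n @ w) @ Alpha k l # eps_word l (bond l k) @ w')"
      if "adj C k l" for l' n w w' k l using f that by (simp only: free_level_def rel1_def) blast
    then show ?thesis unfolding rel1_def P by simp
  qed
  moreover have "rel2_sum k w w' (Psi i f) = 0" for k w w'
  proof -
    have "rel2_sum k w w' (Psi i f) = (\<Sum>l | adj C l i. \<Sum>n<bond i l. \<omega> i l * rel2_sum k (?u l n @ w) w' f)"
    proof -
      have lin: "rel2_sum k w w' (\<lambda>v. \<Sum>s\<in>S. g s v) = (\<Sum>s\<in>S. rel2_sum k w w' (g s))" if "finite S" for S :: "'s set" and g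
        using that
      proof (induction S rule: finite_induct)
        case (insert x S)
        then show ?case using rel2_sum_add[of k w w' "g x" 1 "\<lambda>v. \<Sum>s\<in>S. g s v"] by simp
      qed (simp add: rel2_sum_def)
      have sc: "rel2_sum k w w' (\<lambda>v. c * g v) = c * rel2_sum k w w' g" for c g
        using rel2_sum_add[of k w w' "\<lambda>_. 0" c g] by (simp add: rel2_sum_def)
      have pre: "rel2_sum k w w' (\<lambda>v. f (?u l n @ v)) = rel2_sum k (?u l n @ w) w' f" for l n
        by (rule rel2_sum_prefix)
      show ?thesis unfolding P[abs_def] by (simp only: lin sc pre finite finite_lessThan)
    qed
    also have "\<dots> = 0"
      by (intro sum.neutral ballI) (use f in \<open>simp add: free_level_def\<close>)
    finally show ?thesis .
  qed
  ultimately show ?thesis by (simp add: dual_level_def)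
qed

definition eps_shift :: "'i \<Rightarrow> nat \<Rightarrow> ('i arrow list \<Rightarrow> 'k) \<Rightarrow> 'i arrow list \<Rightarrow> 'k" where
  "eps_shift i n f w = f (eps_word i n @ w)"

lemma eps_shift_0 [simp]: "eps_shift i 0 f = f" by (simp add: eps_shift_def fun_eq_iff)
lemma eps_shift_Suc: "eps_shift i (Suc n) f = strip_arrow (Eps i) (eps_shift i n f)"
  by (simp add: eps_shift_def strip_arrow_def fun_eq_iff) (metis append_Cons replicate_append_same append_assoc append_Nil)
lemma eps_shift_Suc': "eps_shift i (Suc n) f = eps_shift i n (strip_arrow (Eps i) f)"
  by (simp add: eps_shift_def strip_arrow_def fun_eq_iff)
lemma eps_shift_add: "eps_shift i (m + n) f = eps_shift i n (eps_shift i m f)"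
  by (simp add: eps_shift_def replicate_add fun_eq_iff)
lemma tail_comp_eps_shift: "tail_comp i l n f = strip_arrow (Alpha i l) (eps_shift i n f)"
  by (simp add: tail_comp_def strip_arrow_def eps_shift_def fun_eq_iff)

lemma eps_shift_free_level: "f \<in> free_level i a \<Longrightarrow> eps_shift i n f \<in> free_level i a"
  by (induction n) (simp_all add: eps_shift_Suc strip_arrow_eps_free_level)

lemma eps_shift_dual_level: "f \<in> dual_level i a \<Longrightarrow> eps_shift i n f \<in> dual_level i a"
  by (induction n) (simp_all add: eps_shift_Suc strip_arrow_eps_dual_level)

text \<open>Modulo the first relation, the loop commutes with the element defining the second one.\<close>

lemma Psi_eps:
  assumes f: "f \<in> free_level i a" shows "Psi i (strip_arrow (Eps i) f) = strip_arrow (Eps i) (Psi i f)"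
proof
  fix w
  have r1: "f (u @ eps_word k (bond k l) @ Alpha k l # u') = f (u @ Alpha k l # eps_word l (bond l k) @ u')"
    if "adj C k l" for u u' k l using f that by (simp only: free_level_def rel1_def) blast
  have "(\<Sum>n<bond i l. \<omega> i l * f (Eps i # eps_word i n @ Alpha i l # Alpha l i # eps_word i (bond i l - 1 - n) @ w))
    = (\<Sum>n<bond i l. \<omega> i l * f (eps_word i n @ Alpha i l # Alpha l i # eps_word i (bond i l - 1 - n) @ Eps i # w))"
    if l: "adj C l i" for l
  proof -
    \<comment> \<open>The two sums are sums of \<open>h\<close> over ranges shifted by one. The
      boundary terms agree because a full block of loops passes through both arrows by the first
      relation.\<close>
    define h where "h n = f (eps_word i n @ Alpha i l # Alpha l i # eps_word i (bond i l - n) @ w)" for n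
    have il: "adj C i l" using l adj_sym by blast
    have "h (bond i l) = f ([] @ eps_word i (bond i l) @ Alpha i l # (Alpha l i # w))" by (simp add: h_def)
    also have "\<dots> = f ([] @ Alpha i l # eps_word l (bond l i) @ (Alpha l i # w))" by (rule r1[OF il])
    also have "\<dots> = f ([Alpha i l] @ eps_word l (bond l i) @ Alpha l i # w)" by simp
    also have "\<dots> = f ([Alpha i l] @ Alpha l i # eps_word i (bond i l) @ w)" by (rule r1[OF l])
    also have "\<dots> = h 0" by (simp add: h_def)
    finally have h: "h (bond i l) = h 0" .
    have "(\<Sum>n<bond i l. h (Suc n)) + h 0 = (\<Sum>n<bond i l. h n) + h (bond i l)"
      by (metis sum.lessThan_Suc sum.lessThan_Suc_shift add.commute)
    then have eq: "(\<Sum>n<bond i l. h (Suc n)) = (\<Sum>n<bond i l. h n)" using h by simp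
    have "f (Eps i # eps_word i n @ Alpha i l # Alpha l i # eps_word i (bond i l - 1 - n) @ w) = h (Suc n)" for n
      by (simp add: h_def)
    moreover have "f (eps_word i n @ Alpha i l # Alpha l i # eps_word i (bond i l - 1 - n) @ Eps i # w) = h n" if "n < bond i l" for n
    proof -
      have "eps_word i (bond i l - 1 - n) @ Eps i # w = eps_word i (Suc (bond i l - 1 - n)) @ w"
        by (simp add: replicate_app_Cons_same)
      moreover have "Suc (bond i l - 1 - n) = bond i l - n" using that by simp
      ultimately have "eps_word i (bond i l - 1 - n) @ Eps i # w = eps_word i (bond i l - n) @ w" by metis
      then show ?thesis unfolding h_def by metis
    qed
    ultimately show ?thesis using eq by (simp add: sum_distrib_left[symmetric])
  qed
  then show "Psi i (strip_arrow (Eps i) f) w = strip_arrow (Eps i) (Psi i f) w"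
    unfolding Psi_def rel2_sum_def strip_arrow_def by - (rule sum.cong[OF refl], simp)
qed

lemma Psi_eps_shift: "f \<in> free_level i a \<Longrightarrow> Psi i (eps_shift i n f) = eps_shift i n (Psi i f)"
proof (induction n)
  case (Suc n)
  then show ?case using Psi_eps[OF eps_shift_free_level[OF Suc.prems]] by (simp add: eps_shift_Suc)
qed simp

text \<open>To the left of the first \<alpha> there are only loops at \<open>i\<close>, and
  \<open>Psi\<close> commutes with them, so it suffices to impose the second relation at the very
  beginning of a word.\<close>

lemma Psi_kernel:
  assumes f: "f \<in> free_level i a" and z: "\<And>w. Psi i f w = 0" shows "f \<in> dual_level i a"
proof -
  have sf: "supported i a f" using f by (simp add: free_level_def)
  have "rel2_sum k w w' f = 0" for k w w'
  proof (cases "alpha_count w > 0")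
    case True
    then show ?thesis using f by (simp add: free_level_def)
  next
    case False
    show ?thesis
    proof (cases rule: word_cases[of w i])
      case (eps N)
      show ?thesis
      proof (cases "k = i")
        case True
        have "rel2_sum k w w' f = Psi i (eps_shift i N f) w'"
          using rel2_sum_prefix[of i "[]" w' f "eps_word i N"] True eps by (simp add: Psi_def eps_shift_def[abs_def])
        then show ?thesis using Psi_eps_shift[OF f] z by (simp add: eps_shift_def)
      next
        case False
        have "\<not> is_walk C i (eps_word k n @ Alpha k l # v) pt" for n l v using False by (cases n) auto
        then have "f (eps_word i N @ eps_word k n @ Alpha k l # v) = 0" for n l v
          using sf unfolding supported_def by (metis is_walk_eps_word_append)
        then show ?thesis by (simp add: rel2_sum_def eps)
      qed
    next
      case (other N x w1)
      then obtain k' where x: "x = Eps k'" "k' \<noteq> i" using False by (cases x) auto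
      have "\<not> is_walk C i (w @ v) pt" for v using x other by simp
      then have "f (w @ v) = 0" for v using sf unfolding supported_def by blast
      then show ?thesis by (rule rel2_sum_zero)
    qed
  qed
  then show ?thesis using f by (simp add: dual_level_def free_level_def)
qed

lemma dual_level_Psi: "f \<in> dual_level i a \<Longrightarrow> Psi i f w = 0"
  by (simp add: dual_level_def Psi_def)

lemma free_level_1:
  assumes f: "f \<in> free_level i (Suc 0)" shows "f \<in> dual_level i (Suc 0)"
proof (rule Psi_kernel[OF f])
  fix w
  have "f (eps_word i n @ Alpha i l # Alpha l i # v) = 0" for n l v
    using f unfolding free_level_def supported_def by force
  then show "Psi i f w = 0" by (simp add: Psi_def rel2_sum_def)
qed

lemma dual_level_0: "f \<in> dual_level i 0 \<Longrightarrow> f w \<noteq> 0 \<Longrightarrow> i = pt \<and> w = []"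
proof -
  assume f: "f \<in> dual_level i 0" "f w \<noteq> 0"
  then have w: "is_walk C i w pt" "alpha_count w = 0" by (auto simp: dual_level_def supported_def)
  have "w = []"
  proof (rule ccontr)
    assume "w \<noteq> []"
    then have "w = butlast w @ [Eps pt]"
      using walk_no_alpha[OF w] by (metis append_butlast_last_id last_replicate length_0_conv)
    then show False using f by (metis (mono_tags, lifting) dual_level_def mem_Collect_eq rel0_def)
  qed
  then show ?thesis using walk_no_alpha[OF w] by simp
qed

text \<open>Preimage data for \<open>Psi\<close>: at the last index \<open>bond i j - 1\<close> no
  loops follow the second arrow, so \<open>Psi\<close> returns \<open>g\<close> with one arrow
  stripped. Hence the arrows \<alpha> always map into the image of \<open>Psi\<close>.\<close>

definition single_tail :: "'i \<Rightarrow> 'i \<Rightarrow> ('i arrow list \<Rightarrow> 'k) \<Rightarrow> 'i \<Rightarrow> nat \<Rightarrow> 'i arrow list \<Rightarrow> 'k" where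
  "single_tail i j g = (\<lambda>l n. if l = j \<and> n = bond i j - 1 then (\<lambda>w. inverse (\<omega> i j) * g w) else (\<lambda>w. 0))"

lemma single_tail_mem: "g \<in> dual_level j a \<Longrightarrow> single_tail i j g l n \<in> dual_level l a"
  by (auto simp: single_tail_def dual_level_zero intro: dual_level_scale)

lemma Psi_single_tail:
  assumes "adj C j i" shows "Psi i (glue i (single_tail i j g)) = strip_arrow (Alpha j i) g"
proof
  fix w
  have ij: "adj C i j" using assms adj_sym by blast
  have "Psi i (glue i (single_tail i j g)) w = (\<Sum>l | adj C l i. \<Sum>n<bond i l. \<omega> i l * single_tail i j g l n (Alpha l i # eps_word i (bond i l - 1 - n) @ w))"
    unfolding Psi_tail_comp
  proof (intro sum.cong refl)
    fix l n assume "l \<in> {l. adj C l i}" "n \<in> {..<bond i l}"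
    then have "adj C i l" "n < bond i l" using adj_sym[of l i] by auto
    then show "\<omega> i l * tail_comp i l n (glue i (single_tail i j g)) (Alpha l i # eps_word i (bond i l - 1 - n) @ w)
      = \<omega> i l * single_tail i j g l n (Alpha l i # eps_word i (bond i l - 1 - n) @ w)" by (simp add: tail_comp_glue)
  qed
  also have "\<dots> = (\<Sum>l | adj C l i. if l = j then \<Sum>n<bond i j. if n = bond i j - 1 then strip_arrow (Alpha j i) g w else 0 else 0)"
  proof (rule sum.cong[OF refl])
    fix l
    show "(\<Sum>n<bond i l. \<omega> i l * single_tail i j g l n (Alpha l i # eps_word i (bond i l - 1 - n) @ w))
      = (if l = j then \<Sum>n<bond i j. if n = bond i j - 1 then strip_arrow (Alpha j i) g w else 0 else 0)"
    proof (cases "l = j")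
      case True
      have "\<omega> i j * single_tail i j g j n (Alpha j i # eps_word i (bond i j - 1 - n) @ w)
        = (if n = bond i j - 1 then strip_arrow (Alpha j i) g w else 0)" for n
        using omega_nz[OF ij] by (simp add: single_tail_def strip_arrow_def)
      then show ?thesis using True by simp
    qed (simp add: single_tail_def)
  qed
  also have "\<dots> = strip_arrow (Alpha j i) g w" using assms bond_pos[OF ij] by simp
  finally show "Psi i (glue i (single_tail i j g)) w = strip_arrow (Alpha j i) g w" .
qed

text \<open>The component just outside the range, needed because stripping a loop raises the index
  by one.\<close>

lemma tail_comp_last:
  assumes "f \<in> free_level i (Suc a)" "adj C i l" shows "tail_comp i l (bond i l) f = eps_shift l (bond l i) (tail_comp i l 0 f)"
proof
  fix w
  have "f ([] @ eps_word i (bond i l) @ Alpha i l # w) = f ([] @ Alpha i l # eps_word l (bond l i) @ w)"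
    using assms by (simp only: free_level_def rel1_def) blast
  then show "tail_comp i l (bond i l) f w = eps_shift l (bond l i) (tail_comp i l 0 f) w" by (simp add: tail_comp_def eps_shift_def)
qed

definition surj_at :: "'i \<Rightarrow> nat \<Rightarrow> bool" where
  "surj_at i a \<longleftrightarrow> (\<forall>g\<in>dual_level i a. \<exists>f\<in>free_level i (Suc (Suc a)). Psi i f = g)"

subsection \<open>Endomorphisms are scalar\<close>

text \<open>An endomorphism of level \<open>a\<close> that extends to level \<open>a + 1\<close> descends through the surjections
  \<open>Psi\<close> to level 0, where it is scalar.\<close>

lemma endomorphism_scalar:
  fixes T :: "'i \<Rightarrow> ('i arrow list \<Rightarrow> 'k) \<Rightarrow> 'i arrow list \<Rightarrow> 'k"
  assumes "\<And>b i. b < a \<Longrightarrow> surj_at i b"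
    and "\<And>i f. f \<in> dual_level i a \<Longrightarrow> T i f \<in> dual_level i a"
    and "\<And>i f g c. f \<in> dual_level i a \<Longrightarrow> g \<in> dual_level i a \<Longrightarrow> T i (\<lambda>w. f w + c * g w) = (\<lambda>w. T i f w + c * T i g w)"
    and "\<And>i f. f \<in> dual_level i a \<Longrightarrow> T i (strip_arrow (Eps i) f) = strip_arrow (Eps i) (T i f)"
    and "\<And>i f. f \<in> dual_level i (Suc a) \<Longrightarrow>
       \<exists>g\<in>dual_level i (Suc a). \<forall>l n. adj C i l \<longrightarrow> n < bond i l \<longrightarrow> tail_comp i l n g = T l (tail_comp i l n f)"
  shows "\<exists>c. \<forall>i. \<forall>f\<in>dual_level i a. T i f = (\<lambda>w. c * f w)"
  using assms
proof (induction a arbitrary: T)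
  case 0
  note mem = 0(2) and lin = 0(3)
  have T0: "T i (\<lambda>w. 0) = (\<lambda>w. 0)" for i
    using lin[OF dual_level_zero dual_level_zero, of i "- 1"] by simp
  have Tsc: "T i (\<lambda>w. c * f w) = (\<lambda>w. c * T i f w)" if "f \<in> dual_level i 0" for i f c
    using lin[OF dual_level_zero that, of c] by (simp add: T0)
  show ?case
  proof (cases "\<exists>u\<in>dual_level pt 0. u [] \<noteq> 0")
    case True
    then obtain u where u: "u \<in> dual_level pt 0" "u [] \<noteq> 0" by blast
    define c where "c = T pt u [] / u []"
    have "T i f = (\<lambda>w. c * f w)" if f: "f \<in> dual_level i 0" for i f
    proof (cases "i = pt")
      case False
      then have "f w = 0" "T i f w = 0" for w using dual_level_0[OF f] dual_level_0[OF mem[OF f]] by blast+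
      then show ?thesis by (simp add: fun_eq_iff)
    next
      case True
      have fu: "f = (\<lambda>w. (f [] / u []) * u w)"
      proof
        fix w show "f w = (f [] / u []) * u w"
        proof (cases "w = []")
          case False
          then have "f w = 0" "u w = 0" using dual_level_0[OF f, of w] dual_level_0[OF u(1), of w] by blast+
          then show ?thesis by simp
        qed (use u(2) in simp)
      qed
      have "T pt f = (\<lambda>w. (f [] / u []) * T pt u w)" by (subst fu) (rule Tsc[OF u(1)])
      also have "\<dots> = (\<lambda>w. c * f w)"
      proof
        fix w show "(f [] / u []) * T pt u w = c * f w"
        proof (cases "w = []")
          case False
          then have "f w = 0" "T pt u w = 0" using dual_level_0[OF f, of w] dual_level_0[OF mem[OF u(1)], of w] by blast+
          then show ?thesis by simp
        qed (use u(2) in \<open>simp add: c_def\<close>)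
      qed
      finally show ?thesis using True by simp
    qed
    then show ?thesis by blast
  next
    case False
    have "f w = 0" "T i f w = 0" if "f \<in> dual_level i 0" for i f w
      using False dual_level_0[OF that, of w] dual_level_0[OF mem[OF that], of w] that mem[OF that] by auto
    then show ?thesis by (intro exI[of _ 0]) (auto simp: fun_eq_iff)
  qed
next
  case (Suc a)
  note surj = Suc.prems(1) and mem = Suc.prems(2) and lin = Suc.prems(3) and eps = Suc.prems(4) and ext = Suc.prems(5)
  have T0: "T i (\<lambda>w. 0) = (\<lambda>w. 0)" for i
    using lin[OF dual_level_zero dual_level_zero, of i "- 1"] by simp
  have Tsc: "T i (\<lambda>w. c * f w) = (\<lambda>w. c * T i f w)" if "f \<in> dual_level i (Suc a)" for i f c
    using lin[OF dual_level_zero that, of c] by (simp add: T0)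
  have Tshf: "T i (eps_shift i n f) = eps_shift i n (T i f)" if "f \<in> dual_level i (Suc a)" for i n f
    by (induction n) (simp_all add: eps_shift_Suc eps eps_shift_dual_level that)
  \<comment> \<open>\<open>T\<close> applied to all components of \<open>free_level\<close>, two
    levels above level \<open>a\<close>.\<close>
  define TT where "TT i f = glue i (\<lambda>l n. T l (tail_comp i l n f))" for i f
  have TT: "TT i f \<in> free_level i (Suc (Suc a))" if "f \<in> free_level i (Suc (Suc a))" for i f
    unfolding TT_def by (rule glue_mem) (rule mem[OF tail_comp_mem[OF that]])
  have cTT: "tail_comp i l n (TT i f) = T l (tail_comp i l n f)" if "adj C i l" "n < bond i l" for i l n f
    unfolding TT_def using that by (rule tail_comp_glue)
  have cTT_last: "tail_comp i l (bond i l) (TT i f) = T l (tail_comp i l (bond i l) f)" if "adj C i l" "f \<in> free_level i (Suc (Suc a))" for i l f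
    unfolding tail_comp_last[OF that(2,1)] tail_comp_last[OF TT[OF that(2)] that(1)] cTT[OF that(1) bond_pos[OF that(1)]]
    using Tshf[OF tail_comp_mem[OF that(2,1)]] by simp
  have TTlin: "TT i (\<lambda>w. f w + c * g w) = (\<lambda>w. TT i f w + c * TT i g w)"
    if fg: "f \<in> free_level i (Suc (Suc a))" "g \<in> free_level i (Suc (Suc a))" for i f g c
  proof (rule free_level_ext)
    fix l n assume ln: "adj C i l" "n < bond i l"
    have c: "tail_comp i l n (\<lambda>w. f w + c * g w) = (\<lambda>w. tail_comp i l n f w + c * tail_comp i l n g w)" for f g
      by (simp add: tail_comp_def fun_eq_iff)
    show "tail_comp i l n (TT i (\<lambda>w. f w + c * g w)) = tail_comp i l n (\<lambda>w. TT i f w + c * TT i g w)"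
      unfolding c cTT[OF ln] using lin[OF tail_comp_mem[OF fg(1) ln(1)] tail_comp_mem[OF fg(2) ln(1)]] by simp
  qed (use fg in \<open>auto intro: TT free_level_lin\<close>)
  \<comment> \<open>The extension hypothesis: \<open>TT\<close> preserves the kernel of
    \<open>Psi\<close>, so it descends to level \<open>a\<close>.\<close>
  have TTD: "TT i f \<in> dual_level i (Suc (Suc a))" if f: "f \<in> dual_level i (Suc (Suc a))" for i f
  proof -
    obtain g where g: "g \<in> dual_level i (Suc (Suc a))" "\<And>l n. adj C i l \<Longrightarrow> n < bond i l \<Longrightarrow> tail_comp i l n g = T l (tail_comp i l n f)"
      using ext[OF f] by blast
    have "TT i f = g" by (rule free_level_ext[OF TT[OF dual_level_free_level[OF f]] dual_level_free_level[OF g(1)]]) (simp add: cTT g(2))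
    then show ?thesis using g(1) by simp
  qed
  have well: "Psi i (TT i f) = Psi i (TT i g)"
    if fg: "f \<in> free_level i (Suc (Suc a))" "g \<in> free_level i (Suc (Suc a))" and e: "Psi i f = Psi i g" for i f g
  proof -
    have "(\<lambda>w. f w + (- 1) * g w) \<in> dual_level i (Suc (Suc a))"
      by (rule Psi_kernel[OF free_level_lin[OF fg]]) (use e in \<open>simp add: Psi_lin[of i f "- 1" g, simplified]\<close>)
    then have "Psi i (TT i (\<lambda>w. f w + (- 1) * g w)) w = 0" for w by (intro dual_level_Psi[OF TTD])
    then show ?thesis unfolding TTlin[OF fg] Psi_lin by (simp add: fun_eq_iff)
  qed
  \<comment> \<open>The map induced by \<open>TT\<close> on level \<open>a\<close>, the image of
    \<open>Psi\<close>; the choice of preimage is harmless by \<open>well\<close>.\<close>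
  define R where "R i g = Psi i (TT i (SOME f. f \<in> free_level i (Suc (Suc a)) \<and> Psi i f = g))" for i g
  have R: "R i (Psi i f) = Psi i (TT i f)" if f: "f \<in> free_level i (Suc (Suc a))" for i f
  proof -
    have "(SOME f'. f' \<in> free_level i (Suc (Suc a)) \<and> Psi i f' = Psi i f) \<in> free_level i (Suc (Suc a))
      \<and> Psi i (SOME f'. f' \<in> free_level i (Suc (Suc a)) \<and> Psi i f' = Psi i f) = Psi i f"
      by (rule someI[of "\<lambda>f'. f' \<in> free_level i (Suc (Suc a)) \<and> Psi i f' = Psi i f" f]) (simp add: f)
    then show ?thesis unfolding R_def using well f by blast
  qed
  have pre: "\<exists>f\<in>free_level i (Suc (Suc a)). g = Psi i f" if "g \<in> dual_level i a" for i g
    using surj[of a i] that unfolding surj_at_def by fastforce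
  have TTeps: "TT i (strip_arrow (Eps i) f) = strip_arrow (Eps i) (TT i f)" if f: "f \<in> free_level i (Suc (Suc a))" for i f
  proof (rule free_level_ext)
    fix l n assume ln: "adj C i l" "n < bond i l"
    have c: "tail_comp i l n (strip_arrow (Eps i) f) = tail_comp i l (Suc n) f" for f
      by (simp add: tail_comp_def strip_arrow_def fun_eq_iff)
    show "tail_comp i l n (TT i (strip_arrow (Eps i) f)) = tail_comp i l n (strip_arrow (Eps i) (TT i f))"
    proof (cases "Suc n = bond i l")
      case True
      then show ?thesis unfolding cTT[OF ln] c using cTT_last[OF ln(1) f] by simp
    next
      case False
      then show ?thesis unfolding cTT[OF ln] c using cTT[OF ln(1), of "Suc n" f] ln(2) by simp
    qed
  qed (use f in \<open>auto intro: TT strip_arrow_eps_free_level\<close>)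
  \<comment> \<open>By \<open>Psi_single_tail\<close>, \<open>R\<close> and \<open>T\<close>
    intertwine the arrows \<alpha> between levels \<open>a + 1\<close> and \<open>a\<close>; thus
    \<open>T\<close> is determined by \<open>R\<close>.\<close>
  have Ract: "R l (strip_arrow (Alpha i l) f) = strip_arrow (Alpha i l) (T i f)" if f: "f \<in> dual_level i (Suc a)" and il: "adj C i l" for i l f
  proof -
    have li: "adj C l i" using il adj_sym by blast
    have b: "glue l (single_tail l i f) \<in> free_level l (Suc (Suc a))" if "f \<in> dual_level i (Suc a)" for f
      by (rule glue_mem) (rule single_tail_mem[OF that])
    have "R l (strip_arrow (Alpha i l) f) = Psi l (TT l (glue l (single_tail l i f)))"
      using R[OF b[OF f]] Psi_single_tail[OF il] by simp
    also have "TT l (glue l (single_tail l i f)) = glue l (single_tail l i (T i f))"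
    proof (rule free_level_ext[OF TT[OF b[OF f]] b[OF mem[OF f]]])
      fix k n assume kn: "adj C l k" "n < bond l k"
      show "tail_comp l k n (TT l (glue l (single_tail l i f))) = tail_comp l k n (glue l (single_tail l i (T i f)))"
        unfolding cTT[OF kn] tail_comp_glue[OF kn] by (auto simp: single_tail_def T0 Tsc[OF f])
    qed
    also have "Psi l \<dots> = strip_arrow (Alpha i l) (T i f)" by (rule Psi_single_tail[OF il])
    finally show ?thesis .
  qed
  have Rcmp: "tail_comp i l n (T i f) = R l (tail_comp i l n f)" if f: "f \<in> dual_level i (Suc a)" and il: "adj C i l" for i l n f
    unfolding tail_comp_eps_shift using Ract[OF eps_shift_dual_level[OF f] il, of n] Tshf[OF f] by simp
  have "\<exists>c. \<forall>i. \<forall>f\<in>dual_level i a. R i f = (\<lambda>w. c * f w)"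
  proof (rule Suc.IH)
    show "surj_at i b" if "b < a" for b i using surj that by simp
    show "R i f \<in> dual_level i a" if g: "f \<in> dual_level i a" for i f
      using pre[OF g] R TT Psi_mem by metis
    show "R i (\<lambda>w. f w + c * g w) = (\<lambda>w. R i f w + c * R i g w)" if fg: "f \<in> dual_level i a" "g \<in> dual_level i a" for i f g c
    proof -
      obtain f' g' where p: "f' \<in> free_level i (Suc (Suc a))" "f = Psi i f'" "g' \<in> free_level i (Suc (Suc a))" "g = Psi i g'"
        using pre fg by meson
      show ?thesis unfolding p(2,4) Psi_lin[symmetric] R[OF free_level_lin[OF p(1,3)]] R[OF p(1)] R[OF p(3)]
        TTlin[OF p(1,3)] ..
    qed
    show "R i (strip_arrow (Eps i) f) = strip_arrow (Eps i) (R i f)" if g: "f \<in> dual_level i a" for i f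
    proof -
      obtain f' where p: "f' \<in> free_level i (Suc (Suc a))" "f = Psi i f'" using pre g by meson
      show ?thesis unfolding p(2) Psi_eps[OF p(1), symmetric] R[OF strip_arrow_eps_free_level[OF p(1)]] R[OF p(1)]
        TTeps[OF p(1)] Psi_eps[OF TT[OF p(1)]] ..
    qed
    \<comment> \<open>The required extension of \<open>R\<close> to the next level is
      \<open>T\<close> itself.\<close>
    show "\<exists>g\<in>dual_level i (Suc a). \<forall>l n. adj C i l \<longrightarrow> n < bond i l \<longrightarrow> tail_comp i l n g = R l (tail_comp i l n f)"
      if f: "f \<in> dual_level i (Suc a)" for i f
      by (rule bexI[of _ "T i f"]) (use Rcmp[OF f] mem[OF f] in auto)
  qed
  then obtain c where c: "\<And>i f. f \<in> dual_level i a \<Longrightarrow> R i f = (\<lambda>w. c * f w)" by blast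
  have "T i f = (\<lambda>w. c * f w)" if f: "f \<in> dual_level i (Suc a)" for i f
  proof (rule free_level_ext)
    show "T i f \<in> free_level i (Suc a)" "(\<lambda>w. c * f w) \<in> free_level i (Suc a)"
      using f by (auto intro: dual_level_free_level mem dual_level_scale)
    fix l n assume ln: "adj C i l" "n < bond i l"
    have "tail_comp i l n (\<lambda>w. c * f w) = (\<lambda>w. c * tail_comp i l n f w)" by (simp add: tail_comp_def fun_eq_iff)
    then show "tail_comp i l n (T i f) = tail_comp i l n (\<lambda>w. c * f w)"
      unfolding Rcmp[OF f ln(1)] using c[OF tail_comp_mem[OF dual_level_free_level[OF f] ln(1)]] by simp
  qed
  then show ?case by blast
qed

end

subsection \<open>Dimensions of spaces of functions\<close>

abbreviation fscale :: "'k::field \<Rightarrow> ('b \<Rightarrow> 'k) \<Rightarrow> 'b \<Rightarrow> 'k" where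
  "fscale \<equiv> (\<lambda>c f x. c * f x)"

interpretation fs: vector_space "fscale :: 'k::field \<Rightarrow> ('b \<Rightarrow> 'k) \<Rightarrow> 'b \<Rightarrow> 'k"
  by unfold_locales (simp_all add: fun_eq_iff algebra_simps)

definition fin_dim :: "('b \<Rightarrow> 'k::field) set \<Rightarrow> bool" where
  "fin_dim V \<longleftrightarrow> (\<exists>S. finite S \<and> V \<subseteq> fs.span S)"

lemma fin_dim_subset: "fin_dim V \<Longrightarrow> W \<subseteq> V \<Longrightarrow> fin_dim W"
  unfolding fin_dim_def by blast

lemma fin_dim_supported:
  fixes V :: "('b \<Rightarrow> 'k::field) set"
  assumes "finite A" "\<And>f x. f \<in> V \<Longrightarrow> f x \<noteq> 0 \<Longrightarrow> x \<in> A" shows "fin_dim V"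
proof -
  let ?S = "(\<lambda>a x. if x = a then (1::'k) else 0) ` A"
  have "f \<in> fs.span ?S" if f: "f \<in> V" for f
  proof -
    have "f = (\<Sum>a\<in>A. fscale (f a) (\<lambda>x. if x = a then 1 else 0))"
    proof
      fix x
      have "(\<Sum>a\<in>A. fscale (f a) (\<lambda>x. if x = a then 1 else 0)) x = (\<Sum>a\<in>A. if x = a then f a else 0)"
        by (induction A rule: infinite_finite_induct) auto
      then show "f x = (\<Sum>a\<in>A. fscale (f a) (\<lambda>x. if x = a then 1 else 0)) x"
        using assms(1) assms(2)[OF f, of x] by (cases "x \<in> A") auto
    qed
    also have "\<dots> \<in> fs.span ?S"
      by (intro fs.span_sum fs.span_scale fs.span_base) simp
    finally show ?thesis .
  qed
  then show ?thesis unfolding fin_dim_def using assms(1) by blast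
qed

lemma fs_subspaceI:
  assumes "(\<lambda>_. 0) \<in> V" "\<And>f g c. f \<in> V \<Longrightarrow> g \<in> V \<Longrightarrow> (\<lambda>x. f x + c * g x) \<in> V"
  shows "fs.subspace V"
proof (rule fs.subspaceI)
  show "0 \<in> V" using assms(1) by (simp add: zero_fun_def)
  show "f + g \<in> V" if "f \<in> V" "g \<in> V" for f g
    using assms(2)[OF that, of 1] by (simp add: plus_fun_def)
  show "fscale c f \<in> V" if "f \<in> V" for c f
    using assms(2)[OF assms(1) that, of c] by simp
qed

lemma fs_linearI:
  assumes "\<And>f g c. L (\<lambda>x. f x + c * g x) = (\<lambda>x. L f x + c * L g x)"
  shows "Vector_Spaces.linear fscale fscale L"
proof -
  have 0: "L (\<lambda>_. 0) = (\<lambda>_. 0)" using assms[of "\<lambda>_. 0" "-1" "\<lambda>_. 0"] by simp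
  show ?thesis
  proof (unfold_locales)
    show "L (f + g) = L f + L g" for f g using assms[of f 1 g] by (simp add: plus_fun_def)
    show "L (fscale c f) = fscale c (L f)" for c f
      using assms[of "\<lambda>_. 0" c f] by (simp add: 0)
  qed
qed

text \<open>The ambient function space is infinite-dimensional, so finiteness is asked of
  \<open>V\<close> only. The vectors extending a basis of the kernel to one of \<open>V\<close> are
  mapped injectively to a basis of the image.\<close>

lemma rank_nullity:
  assumes lin: "Vector_Spaces.linear fscale fscale L" and sub: "fs.subspace V" and fd: "fin_dim V"
  shows "fs.dim V = fs.dim {f \<in> V. L f = 0} + fs.dim (L ` V)"
proof -
  interpret L: Vector_Spaces.linear fscale fscale L by (rule lin)
  let ?K = "{f \<in> V. L f = 0}"
  obtain B1 where B1: "B1 \<subseteq> ?K" "fs.independent B1" "?K \<subseteq> fs.span B1"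
    by (rule fs.maximal_independent_subset)
  have B1V: "B1 \<subseteq> V" using B1(1) by blast
  obtain B where B: "B1 \<subseteq> B" "B \<subseteq> V" "fs.independent B" "V \<subseteq> fs.span B"
    by (rule fs.maximal_independent_subset_extend[OF B1V B1(2)])
  obtain S where S: "finite S" "V \<subseteq> fs.span S" using fd by (auto simp: fin_dim_def)
  have finB: "finite B" using fs.independent_span_bound[OF S(1) B(3)] B(2) S(2) by blast
  let ?B2 = "B - B1"
  have ind2: "fs.independent ?B2" using fs.independent_mono[OF B(3)] by blast
  have spV: "fs.span ?B2 \<subseteq> V" using fs.span_minimal[of ?B2 V] sub B(2) by blast
  have inj: "inj_on L (fs.span ?B2)"
  proof (subst L.inj_on_iff_eq_0[OF fs.subspace_span], intro ballI impI)
    fix x assume x: "x \<in> fs.span ?B2" "L x = 0"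
    then have "x \<in> fs.span B1" using spV B1(3) by blast
    then have "fs.representation B x = fs.representation B1 x" by (rule fs.representation_extend[OF B(3) _ B(1)])
    moreover have "fs.representation B x = fs.representation ?B2 x" by (rule fs.representation_extend[OF B(3) x(1)]) blast
    ultimately have "fs.representation B x b = 0" for b
      using fs.representation_ne_zero[of B1 x b] fs.representation_ne_zero[of ?B2 x b] by fastforce
    moreover have "x \<in> fs.span B" using x(1) fs.span_mono[of ?B2 B] by blast
    ultimately show "x = 0" using fs.sum_nonzero_representation_eq[OF B(3), of x] by simp
  qed
  have indL: "fs.independent (L ` ?B2)" by (rule L.independent_injective_image[OF ind2 inj])
  have spanL: "fs.span (L ` ?B2) = fs.span (L ` V)"
  proof (rule antisym)
    show "fs.span (L ` ?B2) \<subseteq> fs.span (L ` V)" using B(2) by (intro fs.span_mono) blast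
    have "L ` V \<subseteq> fs.span (L ` ?B2)"
    proof
      fix y assume "y \<in> L ` V"
      then obtain x where x: "x \<in> V" "y = L x" by blast
      have "x \<in> fs.span (B1 \<union> ?B2)" using x(1) B(1,4) by (metis Un_Diff_cancel subset_Un_eq in_mono)
      then obtain a b where ab: "x = a + b" "a \<in> fs.span B1" "b \<in> fs.span ?B2"
        unfolding fs.span_Un by blast
      have "a \<in> ?K"
        using ab(2) fs.span_minimal[OF B1(1)] fs.subspace_inter[OF sub L.subspace_kernel] by (auto simp: Int_def)
      then have "L x = L b" using ab(1) by (simp add: L.add)
      then show "y \<in> fs.span (L ` ?B2)" using ab(3) x(2) unfolding L.span_image by blast
    qed
    then show "fs.span (L ` V) \<subseteq> fs.span (L ` ?B2)" by (intro fs.span_minimal) auto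
  qed
  have "fs.dim V = card B" by (rule fs.basis_card_eq_dim[OF B(2,4,3), symmetric])
  moreover have "fs.dim ?K = card B1" by (rule fs.basis_card_eq_dim[OF B1(1,3,2), symmetric])
  moreover have "fs.dim (L ` V) = card ?B2"
  proof -
    have "fs.dim (L ` V) = card (L ` ?B2)" by (rule fs.dim_eq_card[OF spanL indL])
    also have "\<dots> = card ?B2" by (rule card_image) (rule inj_on_subset[OF inj fs.span_superset])
    finally show ?thesis .
  qed
  moreover have "card B = card B1 + card ?B2"
    using finB B(1) by (metis card_Diff_subset card_mono finite_subset le_add_diff_inverse)
  ultimately show ?thesis by simp
qed

lemma dim_trivial: "fs.dim {\<lambda>_ :: 'b. 0 :: 'k::field} = 0"
proof -
  have "fs.span {} = {\<lambda>_ :: 'b. 0 :: 'k}" by (simp add: zero_fun_def)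
  then have "fs.span {} = fs.span {\<lambda>_ :: 'b. 0 :: 'k}" using fs.span_span[of "{} :: ('b \<Rightarrow> 'k) set"] by simp
  then have "fs.dim {\<lambda>_ :: 'b. 0 :: 'k} = card ({} :: ('b \<Rightarrow> 'k) set)" by (rule fs.dim_eq_card) (rule fs.independent_empty)
  then show ?thesis by simp
qed

lemma dim_injective:
  assumes lin: "Vector_Spaces.linear fscale fscale L" and sub: "fs.subspace V" and fd: "fin_dim V"
    and inj: "\<And>f. f \<in> V \<Longrightarrow> L f = (\<lambda>_. 0) \<Longrightarrow> f = (\<lambda>_. 0)"
  shows "fs.dim (L ` V) = fs.dim V"
proof -
  interpret L: Vector_Spaces.linear fscale fscale L by (rule lin)
  have "f = 0" if "f \<in> V" "L f = 0" for f
    using inj[OF that(1)] that(2) by (simp only: zero_fun_def)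
  then have "{f \<in> V. L f = 0} = {0}" using fs.subspace_0[OF sub] L.zero by blast
  then have "{f \<in> V. L f = 0} = {\<lambda>_. 0}" by (simp only: zero_fun_def)
  then show ?thesis using rank_nullity[OF lin sub fd] dim_trivial by simp
qed

lemma dim_zero_imp:
  assumes "fs.dim V = 0" "fin_dim V" "f \<in> V" shows "f = (\<lambda>_. 0)"
proof -
  obtain B where B: "B \<subseteq> V" "fs.independent B" "V \<subseteq> fs.span B" "card B = fs.dim V"
    by (rule fs.basis_exists)
  obtain S where S: "finite S" "V \<subseteq> fs.span S" using assms(2) by (auto simp: fin_dim_def)
  have "finite B" using fs.independent_span_bound[OF S(1) B(2)] B(1) S(2) by blast
  then have "B = {}" using B(4) assms(1) by simp
  then show ?thesis using B(3) assms(3) by (auto simp: zero_fun_def)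
qed

lemma separating_functional:
  fixes W :: "('b \<Rightarrow> 'k::field) set"
  assumes sub: "fs.subspace W" and g: "g \<notin> W"
  obtains la where "\<And>f h c. la (\<lambda>x. f x + c * h x) = la f + c * (la h :: 'k)" "\<And>f. f \<in> W \<Longrightarrow> la f = 0" "la g = 1"
proof -
  have "vector_space ((*) :: 'k \<Rightarrow> 'k \<Rightarrow> 'k)"
    by (rule vector_space.intro) (simp_all only: distrib_left distrib_right mult.assoc mult_1_left)
  then interpret p: vector_space_pair "fscale :: 'k \<Rightarrow> ('b \<Rightarrow> 'k) \<Rightarrow> 'b \<Rightarrow> 'k" "(*) :: 'k \<Rightarrow> 'k \<Rightarrow> 'k"
    by (intro vector_space_pair.intro fs.vector_space_axioms)
  obtain B where B: "B \<subseteq> W" "fs.independent B" "W \<subseteq> fs.span B"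
    by (rule fs.maximal_independent_subset)
  have spB: "fs.span B = W" using B sub by (intro fs.span_subspace) auto
  have ind: "fs.independent (insert g B)" using fs.independent_insertI[of g B] B(2) g spB by blast
  obtain L where L: "Vector_Spaces.linear fscale (*) L" "\<forall>x\<in>insert g B. L x = (if x = g then 1 else 0)"
    using p.linear_independent_extend[OF ind, of "\<lambda>x. if x = g then 1 else 0"] by blast
  interpret L: Vector_Spaces.linear fscale "(*)" L by (rule L(1))
  show ?thesis
  proof (rule that)
    show "L (\<lambda>x. f x + c * h x) = L f + c * L h" for f h c
      using L.add[of f "fscale c h"] L.scale[of c h] by (simp add: plus_fun_def)
    show "L g = 1" using L(2) by simp
    fix f assume "f \<in> W"
    then have "f \<in> fs.span B" using spB by simp
    moreover have "L x = 0" if "x \<in> B" for x using L(2) that g B(1) by auto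
    ultimately show "L f = 0" by (rule L.eq_0_on_span[rotated])
  qed
qed

context word_module
begin

subsection \<open>Surjectivity of the maps \<open>Psi\<close>\<close>

lemma bond_le_3: "adj C i l \<Longrightarrow> bond i l \<le> 3"
proof -
  assume a: "adj C i l"
  have "C $ i $ l * C $ l $ i < 4" using a by (intro prod_lt_4) (auto simp: adj_def)
  moreover have "- C $ i $ l * 1 \<le> - C $ i $ l * - C $ l $ i"
    using a adj_sym[of i l] adj_neg[of i l] adj_neg[of l i] by (intro mult_left_mono) auto
  ultimately show ?thesis using int_bond[OF a] by simp
qed

lemma eps_shift_zero_mono: "eps_shift i n f = (\<lambda>_. 0) \<Longrightarrow> eps_shift i (n + k) f = (\<lambda>_. 0)"
  by (simp only: eps_shift_add) (simp add: eps_shift_def fun_eq_iff)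

text \<open>Past an arrow, each block of \<open>bond i l\<close> loops, at most 3, becomes at least
  one loop; so \<open>3 * N\<close> loops leave at least \<open>N\<close> behind it.\<close>

lemma eps_nilpotent: "\<exists>N. \<forall>i. \<forall>f\<in>dual_level i a. eps_shift i N f = (\<lambda>_. 0)"
proof (induction a)
  case 0
  have "eps_shift i 1 f w = 0" if "f \<in> dual_level i 0" for i f w
    using dual_level_0[OF that, of "Eps i # w"] by (auto simp: eps_shift_def)
  then show ?case by blast
next
  case (Suc a)
  then obtain N where N: "\<And>i f. f \<in> dual_level i a \<Longrightarrow> eps_shift i N f = (\<lambda>_. 0)" by blast
  have "eps_shift i (3 * N) f w = 0" if f: "f \<in> dual_level i (Suc a)" for i f w
  proof (rule ccontr)
    assume nz: "eps_shift i (3 * N) f w \<noteq> 0"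
    then have "is_walk C i w pt" "alpha_count w = Suc a" using f by (auto simp: eps_shift_def dual_level_def supported_def)
    then obtain M l w' where w: "w = eps_word i M @ Alpha i l # w'" "adj C i l"
      using walk_split[of C i w pt] by (metis zero_less_Suc)
    have r: "rel1 f" using f by (simp add: dual_level_def)
    let ?q = "(3 * N + M) div bond i l * bond l i"
    have "N \<le> 3 * N div bond i l"
      using bond_le_3[OF w(2)] bond_pos[OF w(2)] by (simp add: less_eq_div_iff_mult_less_eq mult.commute)
    also have "\<dots> \<le> (3 * N + M) div bond i l" by (rule div_le_mono) simp
    also have "\<dots> \<le> ?q" using bond_pos[of l i] w(2) adj_sym[of i l] by simp
    finally obtain k where k: "?q = N + k" using le_Suc_ex by blast
    have "f (eps_word i (3 * N + M) @ Alpha i l # w') \<noteq> 0" using nz w(1) by (simp add: eps_shift_def replicate_add)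
    then have "eps_shift l (N + k) (tail_comp i l ((3 * N + M) mod bond i l) f) w' \<noteq> 0"
      unfolding rel1_normal[OF r w(2)] k by (simp add: eps_shift_def)
    moreover have "eps_shift l (N + k) (tail_comp i l ((3 * N + M) mod bond i l) f) = (\<lambda>_. 0)"
      by (rule eps_shift_zero_mono[OF N[OF tail_comp_mem[OF dual_level_free_level[OF f] w(2)]]])
    ultimately show False by simp
  qed
  then show ?case by blast
qed

lemma eps_shift_lin: "eps_shift i n (\<lambda>w. f w + c * g w) = (\<lambda>w. eps_shift i n f w + c * eps_shift i n g w)"
  by (simp add: eps_shift_def fun_eq_iff)

text \<open>If \<open>Psi\<close> is not surjective, there is an endomorphism of rank 1 that factors through its
  cokernel and the socle; as it is scalar, the level is one-dimensional and the next one vanishes.\<close>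

lemma not_surj_next_zero:
  assumes surj: "\<And>b i. b < a \<Longrightarrow> surj_at i b" and "\<not> surj_at l a"
  shows "dual_level i (Suc a) = {\<lambda>_. 0}"
proof -
  \<comment> \<open>The image of the loop is added to that of \<open>Psi\<close>, so that a
    functional vanishing on \<open>?W\<close> gives a map compatible with the loop.\<close>
  let ?W = "{\<lambda>w. Psi l f w + strip_arrow (Eps l) g w | f g. f \<in> free_level l (Suc (Suc a)) \<and> g \<in> dual_level l a}"
  obtain N where N: "\<And>i f. f \<in> dual_level i a \<Longrightarrow> eps_shift i N f = (\<lambda>_. 0)" using eps_nilpotent by blast
  have Psi0: "Psi l (\<lambda>_. 0) = (\<lambda>_. 0)" by (simp add: Psi_def rel2_sum_def fun_eq_iff)
  have act0: "strip_arrow x (\<lambda>_. 0) = (\<lambda>_. 0)" for x by (simp add: strip_arrow_def fun_eq_iff)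
  have act_lin: "strip_arrow x (\<lambda>w. f w + c * g w) = (\<lambda>w. strip_arrow x f w + c * strip_arrow x g w)" for x f g c
    by (simp add: strip_arrow_def fun_eq_iff)
  have PW: "Psi l f \<in> ?W" if "f \<in> free_level l (Suc (Suc a))" for f
  proof -
    have "Psi l f = (\<lambda>w. Psi l f w + strip_arrow (Eps l) (\<lambda>_. 0) w)" by (simp add: act0)
    then show ?thesis using that dual_level_zero by blast
  qed
  have EW: "strip_arrow (Eps l) g \<in> ?W" if "g \<in> dual_level l a" for g
  proof -
    have "strip_arrow (Eps l) g = (\<lambda>w. Psi l (\<lambda>_. 0) w + strip_arrow (Eps l) g w)" by (simp add: Psi0)
    then show ?thesis using that free_level_zero by blast
  qed
  have subW: "fs.subspace ?W"
  proof (rule fs_subspaceI)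
    show "(\<lambda>_. 0) \<in> ?W" using PW[OF free_level_zero] Psi0 by simp
    fix f g c assume "f \<in> ?W" "g \<in> ?W"
    then obtain f1 f2 g1 g2 where fg: "f = (\<lambda>w. Psi l f1 w + strip_arrow (Eps l) f2 w)" "f1 \<in> free_level l (Suc (Suc a))" "f2 \<in> dual_level l a"
      "g = (\<lambda>w. Psi l g1 w + strip_arrow (Eps l) g2 w)" "g1 \<in> free_level l (Suc (Suc a))" "g2 \<in> dual_level l a" by blast
    have "(\<lambda>w. f w + c * g w) = (\<lambda>w. Psi l (\<lambda>w. f1 w + c * g1 w) w + strip_arrow (Eps l) (\<lambda>w. f2 w + c * g2 w) w)"
      unfolding fg(1,4) Psi_lin act_lin by (simp add: fun_eq_iff algebra_simps)
    then show "(\<lambda>w. f w + c * g w) \<in> ?W"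
      using free_level_lin[OF fg(2,5)] dual_level_lin[OF fg(3,6)] by blast
  qed
  \<comment> \<open>A Nakayama argument: if \<open>?W\<close> were everything, substituting
    repeatedly and nilpotency of the loop would make \<open>Psi\<close> surjective.\<close>
  have "\<exists>g\<in>dual_level l a. g \<notin> ?W"
  proof (rule ccontr)
    assume "\<not> ?thesis"
    then have all: "\<exists>f g'. g = (\<lambda>w. Psi l f w + strip_arrow (Eps l) g' w) \<and> f \<in> free_level l (Suc (Suc a)) \<and> g' \<in> dual_level l a"
      if "g \<in> dual_level l a" for g using that by blast
    have iter: "\<exists>f\<in>free_level l (Suc (Suc a)). \<exists>g'\<in>dual_level l a. g = (\<lambda>w. Psi l f w + 1 * eps_shift l n g' w)" if g: "g \<in> dual_level l a" for g n
    proof (induction n)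
      case 0
      have "g = (\<lambda>w. Psi l (\<lambda>_. 0) w + 1 * eps_shift l 0 g w)" by (simp add: Psi0)
      then show ?case using g free_level_zero by blast
    next
      case (Suc n)
      then obtain f g1 where f: "f \<in> free_level l (Suc (Suc a))" "g1 \<in> dual_level l a" "g = (\<lambda>w. Psi l f w + 1 * eps_shift l n g1 w)" by blast
      obtain f1 g2 where f1: "g1 = (\<lambda>w. Psi l f1 w + strip_arrow (Eps l) g2 w)" "f1 \<in> free_level l (Suc (Suc a))" "g2 \<in> dual_level l a"
        using all[OF f(2)] by blast
      have s: "eps_shift l n g1 = (\<lambda>w. Psi l (eps_shift l n f1) w + 1 * eps_shift l (Suc n) g2 w)"
        using eps_shift_lin[of l n "Psi l f1" 1 "strip_arrow (Eps l) g2"] f1(1) Psi_eps_shift[OF f1(2), of n] by (simp add: eps_shift_Suc')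
      have "g = (\<lambda>w. Psi l (\<lambda>w. f w + 1 * eps_shift l n f1 w) w + 1 * eps_shift l (Suc n) g2 w)"
        unfolding f(3) s Psi_lin by (simp add: fun_eq_iff)
      then show ?case using free_level_lin[OF f(1) eps_shift_free_level[OF f1(2)]] f1(3) by blast
    qed
    have "surj_at l a"
      unfolding surj_at_def
    proof
      fix g assume "g \<in> dual_level l a"
      then obtain f g' where "f \<in> free_level l (Suc (Suc a))" "g' \<in> dual_level l a" "g = (\<lambda>w. Psi l f w + 1 * eps_shift l N g' w)"
        using iter[of g N] by blast
      then have "Psi l f = g" using N[of g' l] by (simp add: fun_eq_iff)
      then show "\<exists>f\<in>free_level l (Suc (Suc a)). Psi l f = g" using \<open>f \<in> free_level l (Suc (Suc a))\<close> by blast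
    qed
    then show False using assms(2) by simp
  qed
  then obtain g0 where g0: "g0 \<in> dual_level l a" "g0 \<notin> ?W" by blast
  obtain la :: "('i arrow list \<Rightarrow> 'k) \<Rightarrow> 'k" where lam: "\<And>f h c. la (\<lambda>x. f x + c * h x) = la f + c * la h"
    "\<And>f. f \<in> ?W \<Longrightarrow> la f = 0" "la g0 = 1"
    using separating_functional[OF subW g0(2)] by blast
  have g0nz: "g0 \<noteq> (\<lambda>_. 0)" using g0(2) fs.subspace_0[OF subW] by (auto simp: zero_fun_def)
  \<comment> \<open>The socle vector is the last nonzero function among the iterates of the loop on
    \<open>g0\<close>.\<close>
  obtain s where s: "s \<in> dual_level l a" "s \<noteq> (\<lambda>_. 0)" "strip_arrow (Eps l) s = (\<lambda>_. 0)"
  proof -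
    define n where "n = (LEAST n. eps_shift l n g0 = (\<lambda>_. 0))"
    have n: "eps_shift l n g0 = (\<lambda>_. 0)" unfolding n_def by (rule LeastI) (rule N[OF g0(1)])
    then have "n \<noteq> 0" using g0nz by (intro notI) simp
    then obtain m where m: "n = Suc m" using not0_implies_Suc by blast
    have "eps_shift l m g0 \<noteq> (\<lambda>_. 0)" using not_less_Least[of m "\<lambda>n. eps_shift l n g0 = (\<lambda>_. 0)"] m n_def by simp
    then show ?thesis using that[of "eps_shift l m g0"] eps_shift_dual_level[OF g0(1)] n m by (simp add: eps_shift_Suc)
  qed
  define T where "T i f = (if i = l then (\<lambda>w. la f * s w) else (\<lambda>_. 0))" for i f
  have alpha_W: "strip_arrow (Alpha i l) g \<in> ?W" if g: "g \<in> dual_level i (Suc a)" and il: "adj C i l" for i g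
  proof -
    have "glue l (single_tail l i g) \<in> free_level l (Suc (Suc a))" by (rule glue_mem) (rule single_tail_mem[OF g])
    from PW[OF this] show ?thesis unfolding Psi_single_tail[OF il] .
  qed
  have cmp_W: "tail_comp i l n g \<in> ?W" if g: "g \<in> dual_level i (Suc a)" and il: "adj C i l" for i n g
    unfolding tail_comp_eps_shift by (rule alpha_W[OF eps_shift_dual_level[OF g] il])
  have "\<exists>c. \<forall>i. \<forall>f\<in>dual_level i a. T i f = (\<lambda>w. c * f w)"
  proof (rule endomorphism_scalar)
    show "surj_at i b" if "b < a" for b i using surj that .
    show "T i f \<in> dual_level i a" if "f \<in> dual_level i a" for i f
      using dual_level_scale[OF s(1)] dual_level_zero by (simp add: T_def)
    show "T i (\<lambda>w. f w + c * g w) = (\<lambda>w. T i f w + c * T i g w)" for i f g c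
      by (simp add: T_def lam(1) fun_eq_iff algebra_simps)
    show "T i (strip_arrow (Eps i) f) = strip_arrow (Eps i) (T i f)" if f: "f \<in> dual_level i a" for i f
    proof (cases "i = l")
      case True
      have "la (strip_arrow (Eps l) f) = 0" using lam(2)[OF EW] f True by simp
      moreover have "s (Eps l # w) = 0" for w using s(3) by (metis strip_arrow_def)
      ultimately show ?thesis using True by (simp add: T_def strip_arrow_def fun_eq_iff)
    qed (simp add: T_def act0)
    \<comment> \<open>\<open>T\<close> extends to the next level by zero: components of functions
      there at \<open>l\<close> lie in the image of \<open>Psi\<close>, on which the functional
      vanishes.\<close>
    show "\<exists>g\<in>dual_level i (Suc a). \<forall>k n. adj C i k \<longrightarrow> n < bond i k \<longrightarrow> tail_comp i k n g = T k (tail_comp i k n f)"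
      if f: "f \<in> dual_level i (Suc a)" for i f
    proof (rule bexI[of _ "\<lambda>_. 0"], intro allI impI)
      fix k n assume "adj C i k"
      then show "tail_comp i k n (\<lambda>_. 0) = T k (tail_comp i k n f)"
        using lam(2)[OF cmp_W[OF f, of n]] by (auto simp: T_def tail_comp_def fun_eq_iff)
    qed (rule dual_level_zero)
  qed
  then obtain c where c: "\<And>i f. f \<in> dual_level i a \<Longrightarrow> T i f = (\<lambda>w. c * f w)" by blast
  have cnz: "c \<noteq> 0"
  proof
    assume "c = 0"
    then have "s w = 0" for w using c[OF g0(1)] lam(3) by (simp add: T_def fun_eq_iff)
    then show False using s(2) by auto
  qed
  \<comment> \<open>\<open>T\<close> vanishes on \<open>?W\<close> and at the vertices other than
    \<open>l\<close>, but it is a nonzero scalar; so these contain nothing of level \<open>a\<close>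
    but 0.\<close>
  have other: "f = (\<lambda>_. 0)" if f: "f \<in> dual_level k a" and "k \<noteq> l \<or> f \<in> ?W" for k f
  proof -
    have "T k f = (\<lambda>_. 0)" using that lam(2)[of f] by (auto simp: T_def)
    then have "(\<lambda>w. c * f w) = (\<lambda>_. 0)" using c[OF f] by simp
    then show ?thesis using cnz by (simp add: fun_eq_iff)
  qed
  have "f = (\<lambda>_. 0)" if f: "f \<in> dual_level i (Suc a)" for f
  proof (rule free_level_ext[OF dual_level_free_level[OF f] free_level_zero])
    fix k n assume k: "adj C i k"
    have "tail_comp i k n f = (\<lambda>_. 0)"
      by (rule other[OF tail_comp_mem[OF dual_level_free_level[OF f] k]]) (use cmp_W[OF f] k in blast)
    then show "tail_comp i k n f = tail_comp i k n (\<lambda>_. 0)" by (simp add: tail_comp_def fun_eq_iff)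
  qed
  then show ?thesis using dual_level_zero by blast
qed

lemma dual_level_zero_Suc:
  assumes "\<And>i. dual_level i a = {\<lambda>_. 0}" shows "dual_level i (Suc a) = {\<lambda>_. 0}"
proof -
  have "f = (\<lambda>_. 0)" if f: "f \<in> dual_level i (Suc a)" for f
  proof (rule free_level_ext[OF dual_level_free_level[OF f] free_level_zero])
    fix k n assume k: "adj C i k"
    have "tail_comp i k n f = (\<lambda>_. 0)" using tail_comp_mem[OF dual_level_free_level[OF f] k] assms by blast
    then show "tail_comp i k n f = tail_comp i k n (\<lambda>_. 0)" by (simp add: tail_comp_def fun_eq_iff)
  qed
  then show ?thesis using dual_level_zero by blast
qed

lemma dual_level_zero_ge:
  assumes "\<And>i. dual_level i a = {\<lambda>_. 0}" "a \<le> b" shows "dual_level i b = {\<lambda>_. 0}"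
  using assms(2) by (induction b arbitrary: i rule: dec_induct) (auto simp only: assms(1) intro!: dual_level_zero_Suc)

end

lemma finite_arrows: "finite (UNIV :: 'i::finite arrow set)"
proof -
  have eq: "(UNIV :: 'i arrow set) = (\<lambda>(i, j). Alpha i j) ` UNIV \<union> range Eps"
  proof (intro equalityI subsetI)
    fix x :: "'i arrow"
    show "x \<in> (\<lambda>(i, j). Alpha i j) ` UNIV \<union> range Eps" by (cases x) auto
  qed simp
  show ?thesis by (subst eq) simp
qed

context word_module
begin

subsection \<open>Graded dimensions\<close>

definition q_degree :: "'i arrow list \<Rightarrow> int" where
  "q_degree w = (\<Sum>x\<leftarrow>w. fst (arrow_degree d x))"

lemma q_degree_simps [simp]: "q_degree [] = 0" "q_degree (Eps i # w) = 2 * D i + q_degree w"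
  "q_degree (Alpha i l # w) = - max (D i) (D l) + q_degree w" "q_degree (u @ w) = q_degree u + q_degree w"
  by (simp_all add: q_degree_def D_def)

lemma q_degree_eps_word [simp]: "q_degree (eps_word i n) = 2 * D i * int n"
  by (induction n) (simp_all add: algebra_simps)

lemma max_D: "adj C i l \<Longrightarrow> max (D i) (D l) = D i * int (bond i l)"
proof -
  assume a: "adj C i l"
  then have a': "adj C l i" using adj_sym by blast
  have e: "D i * int (bond i l) = D l * int (bond l i)"
    using D_symm[of i l] int_bond[OF a] int_bond[OF a'] by simp
  consider "bond i l = 1" | "bond l i = 1" using one_of_two[OF a] by (auto simp: bond_def)
  then show ?thesis
  proof cases
    case 1
    then have "D l * 1 \<le> D i" using e bond_pos[OF a'] mult_left_mono[of 1 "int (bond l i)" "D l"] by (simp add: less_imp_le)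
    then show ?thesis using 1 by simp
  next
    case 2
    then have "D i * 1 \<le> D l" using e bond_pos[OF a] mult_left_mono[of 1 "int (bond i l)" "D i"] by (simp add: less_imp_le)
    then show ?thesis using e 2 by simp
  qed
qed

lemma D_bond: "adj C i l \<Longrightarrow> D i * int (bond i l) = D l * int (bond l i)"
  using max_D[of i l] max_D[of l i] adj_sym[of i l] by (simp add: max.commute)

text \<open>Matches the degrees of the components after \<open>n\<close> loops and an arrow with the
  exponents in \<open>qmono (D i) * qbond i l\<close>.\<close>

lemma degree_shift: "adj C i l \<Longrightarrow> n < bond i l \<Longrightarrow>
  max (D i) (D l) - 2 * D i * int n = D i + (int (bond i l) - 1 - 2 * int n)"
proof -
  assume a: "adj C i l" "n < bond i l"
  show ?thesis
  proof (cases "C $ i $ l = -1")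
    case True
    then have "bond i l = 1" by (simp add: bond_def)
    then show ?thesis using a max_D[OF a(1)] by simp
  next
    case False
    then show ?thesis using max_D[OF a(1)] D_one_of_multiple(1)[OF a(1) False] by simp
  qed
qed

definition degree_part :: "int \<Rightarrow> ('i arrow list \<Rightarrow> 'k) \<Rightarrow> 'i arrow list \<Rightarrow> 'k" where
  "degree_part u f w = (if q_degree w = u then f w else 0)"

lemma rel2_sum_degree_part: "rel2_sum k w w' (degree_part u f) = (if q_degree w + q_degree w' - 2 * D k = u then rel2_sum k w w' f else 0)"
proof -
  have "q_degree (w @ eps_word k n @ Alpha k l # Alpha l k # eps_word k (bond k l - 1 - n) @ w') = q_degree w + q_degree w' - 2 * D k"
    if "adj C l k" "n < bond k l" for l n
  proof -
    have a: "adj C k l" using that adj_sym by blast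
    have "2 * D k * int n + 2 * D k * int (bond k l - 1 - n) = 2 * D k * (int n + int (bond k l - 1 - n))"
      by (simp add: distrib_left)
    also have "\<dots> = 2 * D k * (int (bond k l) - 1)" using that(2) by (simp add: of_nat_diff)
    finally show ?thesis using max_D[OF a] by (simp add: max.commute[of "D l"] algebra_simps)
  qed
  then show ?thesis by (auto simp: rel2_sum_def degree_part_def intro!: sum.neutral sum.cong)
qed

lemma rel1_degree_part: "rel1 f \<Longrightarrow> rel1 (degree_part u f)"
proof -
  assume r: "rel1 f"
  have "q_degree (w @ eps_word k (bond k l) @ Alpha k l # w') = q_degree (w @ Alpha k l # eps_word l (bond l k) @ w')" if "adj C k l" for w w' k l
    using D_bond[OF that] by (simp add: mult.assoc)
  then show ?thesis using r unfolding rel1_def degree_part_def by presburger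
qed

lemma degree_part_free_level: "f \<in> free_level i a \<Longrightarrow> degree_part u f \<in> free_level i a"
  by (auto simp: free_level_def rel2_sum_degree_part rel1_degree_part) (auto simp: degree_part_def supported_def rel0_def)

lemma degree_part_dual_level: "f \<in> dual_level i a \<Longrightarrow> degree_part u f \<in> dual_level i a"
  by (auto simp: dual_level_def rel2_sum_degree_part rel1_degree_part) (auto simp: degree_part_def supported_def rel0_def)

definition dual_part :: "'i \<Rightarrow> nat \<Rightarrow> int \<Rightarrow> ('i arrow list \<Rightarrow> 'k) set" where
  "dual_part i a u = {f \<in> dual_level i a. \<forall>w. f w \<noteq> 0 \<longrightarrow> q_degree w = u}"

definition free_part :: "'i \<Rightarrow> nat \<Rightarrow> int \<Rightarrow> ('i arrow list \<Rightarrow> 'k) set" where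
  "free_part i a u = {f \<in> free_level i a. \<forall>w. f w \<noteq> 0 \<longrightarrow> q_degree w = u}"

lemma degree_part_dual_part: "f \<in> dual_level i a \<Longrightarrow> degree_part u f \<in> dual_part i a u"
  using degree_part_dual_level[of f i a u] by (auto simp: dual_part_def degree_part_def split: if_splits)

lemma degree_part_free_part: "f \<in> free_level i a \<Longrightarrow> degree_part u f \<in> free_part i a u"
  using degree_part_free_level[of f i a u] by (auto simp: free_part_def degree_part_def split: if_splits)

lemma degree_part_id: "(\<And>w. f w \<noteq> 0 \<Longrightarrow> q_degree w = u) \<Longrightarrow> degree_part u f = f"
  by (auto simp: degree_part_def fun_eq_iff)

lemma subspace_dual_part: "fs.subspace (dual_part i a u)"
proof (rule fs_subspaceI)
  fix f g c assume "f \<in> dual_part i a u" "g \<in> dual_part i a u"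
  then show "(\<lambda>w. f w + c * g w) \<in> dual_part i a u"
    unfolding dual_part_def using dual_level_lin[of f i a g c] by auto (metis add_0 mult_zero_right)
qed (simp add: dual_part_def dual_level_zero)

lemma subspace_free_part: "fs.subspace (free_part i a u)"
proof (rule fs_subspaceI)
  fix f g c assume "f \<in> free_part i a u" "g \<in> free_part i a u"
  then show "(\<lambda>w. f w + c * g w) \<in> free_part i a u"
    unfolding free_part_def using free_level_lin[of f i a g c] by auto (metis add_0 mult_zero_right)
qed (simp add: free_part_def free_level_zero)

text \<open>Counting \<open>M + 1\<close> extra for every \<alpha>, each letter has weight at least
  1. Hence only finitely many words share a level and a degree.\<close>

lemma length_bound:
  assumes "\<And>i. D i \<le> M" shows "int (length w) \<le> q_degree w + int (alpha_count w) * (M + 1)"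
proof (induction w)
  case (Cons x w)
  show ?case
  proof (cases x)
    case (Alpha i l)
    have "max (D i) (D l) \<le> M" using assms by simp
    moreover have "q_degree (x # w) + int (alpha_count (x # w)) * (M + 1) = q_degree w + int (alpha_count w) * (M + 1) + (M + 1) - max (D i) (D l)"
      using Alpha by (simp add: algebra_simps)
    ultimately show ?thesis using Cons by (simp del: max.bounded_iff)
  next
    case (Eps i)
    then have "int (length (x # w)) \<le> 1 + (q_degree w + int (alpha_count w) * (M + 1))"
      "q_degree (x # w) + int (alpha_count (x # w)) * (M + 1) = 2 * D i + (q_degree w + int (alpha_count w) * (M + 1))"
      using Cons by simp_all
    then show ?thesis using D_pos[of i] by linarith
  qed
qed simp

lemma finite_words: "finite {w. alpha_count w = a \<and> q_degree w = u}"
proof -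
  define M where "M = Max (range D)"
  have M: "D i \<le> M" for i by (simp add: M_def)
  have "{w. alpha_count w = a \<and> q_degree w = u} \<subseteq> {w. set w \<subseteq> UNIV \<and> length w \<le> nat (u + int a * (M + 1))}"
  proof
    fix w assume "w \<in> {w. alpha_count w = a \<and> q_degree w = u}"
    then have "int (length w) \<le> u + int a * (M + 1)" using length_bound[OF M, of w] by simp
    then show "w \<in> {w. set w \<subseteq> UNIV \<and> length w \<le> nat (u + int a * (M + 1))}" by simp
  qed
  then show ?thesis by (rule finite_subset) (rule finite_lists_length_le[OF finite_arrows])
qed

lemma fin_dim_free_part: "fin_dim (free_part i a u)"
  by (rule fin_dim_supported[OF finite_words[of a u]]) (auto simp: free_part_def free_level_def supported_def)

lemma fin_dim_dual_part: "fin_dim (dual_part i a u)"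
  by (rule fin_dim_subset[OF fin_dim_free_part[of i a u]]) (auto simp: dual_part_def free_part_def dual_level_free_level)

lemma linear_Psi: "Vector_Spaces.linear fscale fscale (Psi i)"
  by (rule fs_linearI) (rule Psi_lin)

lemma linear_tail_comp: "Vector_Spaces.linear fscale fscale (tail_comp i l n)"
  by (rule fs_linearI) (simp add: tail_comp_def fun_eq_iff)

lemma Psi_degree_part: "Psi i (degree_part u f) = degree_part (u + 2 * D i) (Psi i f)"
  by (auto simp: Psi_def rel2_sum_degree_part degree_part_def fun_eq_iff)

lemma dim_Psi:
  assumes "surj_at i a"
  shows "fs.dim (free_part i (Suc (Suc a)) u) = fs.dim (dual_part i (Suc (Suc a)) u) + fs.dim (dual_part i a (u + 2 * D i))"
proof -
  have "{f \<in> free_part i (Suc (Suc a)) u. Psi i f = 0} = dual_part i (Suc (Suc a)) u"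
    using Psi_kernel[of _ i "Suc (Suc a)"] dual_level_Psi[of _ i "Suc (Suc a)"] dual_level_free_level[of _ i "Suc (Suc a)"]
    by (auto simp: free_part_def dual_part_def zero_fun_def fun_eq_iff)
  moreover have "Psi i ` free_part i (Suc (Suc a)) u = dual_part i a (u + 2 * D i)"
  proof (intro equalityI subsetI)
    fix g assume "g \<in> Psi i ` free_part i (Suc (Suc a)) u"
    then obtain f where f: "f \<in> free_level i (Suc (Suc a))" "degree_part u f = f" "g = Psi i f"
      using degree_part_id by (auto simp: free_part_def)
    then have "g = degree_part (u + 2 * D i) (Psi i f)" using Psi_degree_part[of i u f] by simp
    then show "g \<in> dual_part i a (u + 2 * D i)" using degree_part_dual_part[OF Psi_mem[OF f(1)]] by simp
  next
    fix g assume g: "g \<in> dual_part i a (u + 2 * D i)"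
    then obtain f where f: "f \<in> free_level i (Suc (Suc a))" "Psi i f = g"
      using assms by (auto simp: surj_at_def dual_part_def)
    have "Psi i (degree_part u f) = g" unfolding Psi_degree_part f(2) using g by (intro degree_part_id) (auto simp: dual_part_def)
    then show "g \<in> Psi i ` free_part i (Suc (Suc a)) u" using degree_part_free_part[OF f(1)] by blast
  qed
  moreover have "fs.dim (free_part i (Suc (Suc a)) u)
    = fs.dim {f \<in> free_part i (Suc (Suc a)) u. Psi i f = 0} + fs.dim (Psi i ` free_part i (Suc (Suc a)) u)"
    by (rule rank_nullity[OF linear_Psi subspace_free_part fin_dim_free_part])
  ultimately show ?thesis by simp
qed

lemma tail_comp_degree_part: "tail_comp i l n (degree_part u f) = degree_part (u - 2 * D i * int n + max (D i) (D l)) (tail_comp i l n f)"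
  by (auto simp: tail_comp_def degree_part_def fun_eq_iff)

lemma dim_free_part:
  "fs.dim (free_part i (Suc a) u) = (\<Sum>l | adj C i l. \<Sum>n<bond i l. fs.dim (dual_part l a (u - 2 * D i * int n + max (D i) (D l))))"
proof -
  let ?P = "SIGMA l:{l. adj C i l}. {..<bond i l}"
  let ?d = "\<lambda>p. fs.dim (dual_part (fst p) a (u - 2 * D i * int (snd p) + max (D i) (D (fst p))))"
  \<comment> \<open>Components are switched on one at a time; each adds the dimension of its target
    by rank-nullity.\<close>
  define V where "V S = {f \<in> free_part i (Suc a) u. \<forall>p\<in>?P - S. tail_comp i (fst p) (snd p) f = (\<lambda>_. 0)}" for S
  have finP: "finite ?P" by simp
  have V: "V S \<subseteq> free_part i (Suc a) u" "fs.subspace (V S)" for S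
  proof -
    show "V S \<subseteq> free_part i (Suc a) u" by (auto simp: V_def)
    show "fs.subspace (V S)"
    proof (rule fs_subspaceI)
      show "(\<lambda>_. 0) \<in> V S" by (simp add: V_def free_part_def free_level_zero tail_comp_def fun_eq_iff)
      fix f g c assume fg: "f \<in> V S" "g \<in> V S"
      have "(\<lambda>w. f w + c * g w) \<in> free_part i (Suc a) u"
        using fg fs.subspace_add[OF subspace_free_part, of f i "Suc a" u "fscale c g"] fs.subspace_scale[OF subspace_free_part, of g i "Suc a" u c]
        by (simp add: V_def plus_fun_def)
      then show "(\<lambda>w. f w + c * g w) \<in> V S" using fg by (simp add: V_def tail_comp_def fun_eq_iff)
    qed
  qed
  have step: "fs.dim (V (insert p S)) = ?d p + fs.dim (V S)" if p: "p \<in> ?P" "p \<notin> S" for p S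
  proof -
    obtain l n where ln: "p = (l, n)" "adj C i l" "n < bond i l" using p(1) by auto
    let ?u = "u - 2 * D i * int n + max (D i) (D l)"
    have "{f \<in> V (insert p S). tail_comp i l n f = 0} = V S"
    proof (intro equalityI subsetI)
      fix f assume "f \<in> {f \<in> V (insert p S). tail_comp i l n f = 0}"
      then have f: "f \<in> free_part i (Suc a) u" "tail_comp i l n f = (\<lambda>_. 0)"
        "\<And>q. q \<in> ?P - insert p S \<Longrightarrow> tail_comp i (fst q) (snd q) f = (\<lambda>_. 0)"
        by (auto simp: V_def zero_fun_def)
      have "tail_comp i (fst q) (snd q) f = (\<lambda>_. 0)" if "q \<in> ?P - S" for q
        using f(2) f(3)[of q] that ln(1) by (cases "q = p") auto
      then show "f \<in> V S" using f(1) unfolding V_def by blast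
    next
      fix f assume f: "f \<in> V S"
      have "p \<in> ?P - S" using p by blast
      then have "tail_comp i (fst p) (snd p) f = (\<lambda>_. 0)" using f unfolding V_def by blast
      moreover have "f \<in> V (insert p S)" using f unfolding V_def by blast
      ultimately show "f \<in> {f \<in> V (insert p S). tail_comp i l n f = 0}" using ln(1) by (simp add: zero_fun_def)
    qed
    moreover have "tail_comp i l n ` V (insert p S) = dual_part l a ?u"
    proof (intro equalityI subsetI)
      fix g assume "g \<in> tail_comp i l n ` V (insert p S)"
      then obtain f where f: "f \<in> free_level i (Suc a)" "degree_part u f = f" "g = tail_comp i l n f"
        using degree_part_id by (auto simp: V_def free_part_def)
      then have "g = degree_part ?u (tail_comp i l n f)" using tail_comp_degree_part[of i l n u f] by simp
      then show "g \<in> dual_part l a ?u" using degree_part_dual_part[OF tail_comp_mem[OF f(1) ln(2)]] by simp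
    next
      fix g assume g: "g \<in> dual_part l a ?u"
      define F where "F l' n' = (if (l', n') = p then g else (\<lambda>_. 0))" for l' n'
      have bG: "glue i F \<in> free_level i (Suc a)"
        by (rule glue_mem) (use g ln in \<open>auto simp: F_def dual_part_def dual_level_zero\<close>)
      have c: "tail_comp i l' n' (degree_part u (glue i F)) = F l' n'" if "(l', n') \<in> ?P" for l' n'
      proof -
        have "tail_comp i l' n' (glue i F) = F l' n'" using that by (intro tail_comp_glue) auto
        moreover have "degree_part (u - 2 * D i * int n' + max (D i) (D l')) (F l' n') = F l' n'"
          by (rule degree_part_id) (use g ln in \<open>auto simp: F_def dual_part_def split: if_splits\<close>)
        ultimately show ?thesis unfolding tail_comp_degree_part by simp
      qed
      have "degree_part u (glue i F) \<in> V (insert p S)"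
        unfolding V_def using degree_part_free_part[OF bG] c by (auto simp: F_def)
      moreover have "tail_comp i l n (degree_part u (glue i F)) = g" using c[of l n] ln p(1) by (simp add: F_def)
      ultimately show "g \<in> tail_comp i l n ` V (insert p S)" by blast
    qed
    moreover have "fs.dim (V (insert p S))
      = fs.dim {f \<in> V (insert p S). tail_comp i l n f = 0} + fs.dim (tail_comp i l n ` V (insert p S))"
      by (rule rank_nullity[OF linear_tail_comp V(2) fin_dim_subset[OF fin_dim_free_part V(1)]])
    ultimately show ?thesis using ln by simp
  qed
  have "fs.dim (V S) = (\<Sum>p\<in>S. ?d p)" if "finite S" "S \<subseteq> ?P" for S
    using that
  proof (induction S rule: finite_induct)
    case empty
    have "f = (\<lambda>_. 0)" if "f \<in> V {}" for f
      by (rule free_level_ext[OF _ free_level_zero]) (use that in \<open>auto simp: V_def free_part_def tail_comp_def fun_eq_iff\<close>)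
    moreover have "(\<lambda>_. 0) \<in> V {}" using fs.subspace_0[OF V(2), of "{}"] by (simp add: zero_fun_def)
    ultimately have "V {} = {\<lambda>_. 0}" by blast
    then show ?case by (simp add: dim_trivial)
  next
    case (insert p S)
    then show ?case using step[of p S] by simp
  qed
  from this[OF finP order_refl] have "fs.dim (V ?P) = (\<Sum>p\<in>?P. ?d p)" .
  moreover have "V ?P = free_part i (Suc a) u" by (auto simp: V_def)
  ultimately show ?thesis by (simp add: sum.Sigma case_prod_beta)
qed

lemma dual_part_1: "dual_part i (Suc 0) u = free_part i (Suc 0) u"
  by (auto simp: dual_part_def free_part_def free_level_1 dual_level_free_level)

lemma dim_dual_part_0: "fs.dim (dual_part i 0 u) = (if i = pt \<and> u = 0 then 1 else 0)"
proof (cases "i = pt \<and> u = 0")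
  case True
  let ?e = "\<lambda>w :: 'i arrow list. if w = [] then (1::'k) else 0"
  have e: "?e \<in> dual_part pt 0 0"
    by (auto simp: dual_part_def dual_level_def supported_def rel0_def rel1_def rel2_sum_def)
  have "dual_part pt 0 0 = fs.span {?e}"
  proof (intro equalityI subsetI)
    fix f assume f: "f \<in> dual_part pt 0 0"
    have "f = fscale (f []) ?e"
    proof
      fix w
      show "f w = f [] * ?e w"
      proof (cases "w = []")
        case False
        then have "f w = 0" using dual_level_0[of f pt w] f by (auto simp: dual_part_def)
        then show ?thesis using False by simp
      qed simp
    qed
    then show "f \<in> fs.span {?e}" unfolding fs.span_singleton by blast
  next
    fix f assume "f \<in> fs.span {?e}"
    then show "f \<in> dual_part pt 0 0" using fs.span_minimal[of "{?e}" "dual_part pt 0 0"] subspace_dual_part e by blast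
  qed
  moreover have "fs.independent {?e}" by (auto simp: fs.dependent_single fun_eq_iff)
  ultimately have "fs.dim (dual_part pt 0 0) = card {?e}" using fs.dim_span_eq_card_independent by metis
  then show ?thesis using True by simp
next
  case False
  have "f = (\<lambda>_. 0)" if f: "f \<in> dual_part i 0 u" for f
  proof
    fix w
    show "f w = 0"
    proof (rule ccontr)
      assume nz: "f w \<noteq> 0"
      then have "i = pt" "w = []" "q_degree w = u" using f dual_level_0[of f i w] by (auto simp: dual_part_def)
      then show False using False by simp
    qed
  qed
  moreover have "(\<lambda>_. 0) \<in> dual_part i 0 u" by (simp add: dual_part_def dual_level_zero)
  ultimately have "dual_part i 0 u = {\<lambda>_. 0}" by blast
  then show ?thesis using False by (simp add: dim_trivial)
qed

text \<open>Dualising negates degrees, and the recursion starts with \<open>qmono (D pt)\<close>; so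
  word degree \<open>u\<close> belongs to the exponent \<open>D pt - u\<close>.\<close>

lemma dim_dual_part_qlevel:
  assumes "\<And>b i. Suc (Suc b) \<le> a \<Longrightarrow> surj_at i b"
  shows "fls_nth (qlevel (Suc a) i pt) (D pt - u) = int (fs.dim (dual_part i a u))"
  using assms
proof (induction a arbitrary: i u rule: less_induct)
  case (less a)
  have G: "(\<Sum>k | adj C i k. \<Sum>n<bond i k. fls_nth (qlevel (Suc b) k pt) (D pt - u - D i - (int (bond i k) - 1 - 2 * int n)))
     = int (fs.dim (free_part i (Suc b) u))" if b: "a = Suc b" for b
    unfolding dim_free_part of_nat_sum
  proof (intro sum.cong refl)
    fix k n assume "k \<in> {k. adj C i k}" "n \<in> {..<bond i k}"
    then have k: "adj C i k" "n < bond i k" by auto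
    have e: "D pt - u - D i - (int (bond i k) - 1 - 2 * int n) = D pt - (u - 2 * D i * int n + max (D i) (D k))"
      using degree_shift[OF k] by simp
    show "fls_nth (qlevel (Suc b) k pt) (D pt - u - D i - (int (bond i k) - 1 - 2 * int n))
      = int (fs.dim (dual_part k b (u - 2 * D i * int n + max (D i) (D k))))"
      unfolding e by (rule less.IH) (use b less.prems in auto)
  qed
  consider "a = 0" | "a = Suc 0" | b where "a = Suc (Suc b)" by (metis not0_implies_Suc)
  then show ?case
  proof cases
    case 1
    then show ?thesis by (auto simp: dim_dual_part_0 nth_qmono)
  next
    case 2
    then show ?thesis using G[of 0] unfolding 2 nth_qlevel_rec dual_part_1 by simp
  next
    case (3 b)
    have "fls_nth (qlevel (Suc b) i pt) (D pt - u - 2 * D i) = int (fs.dim (dual_part i b (u + 2 * D i)))"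
      using less.IH[of b i "u + 2 * D i"] less.prems 3 by (simp add: algebra_simps)
    then show ?thesis using G[of "Suc b"] 3 dim_Psi[of i b u] less.prems[of b i] unfolding 3 nth_qlevel_rec[of "Suc b"] by simp
  qed
qed

text \<open>Surjectivity below \<open>b\<close> already gives the dimensions at level
  \<open>b + 1\<close>. A failure at \<open>b\<close> makes that level 0, hence
  \<open>level_vec (b + 2)\<close> as well, which is too early.\<close>

lemma surj_below: "Suc (Suc b) < cox \<Longrightarrow> surj_at i b"
proof (induction b arbitrary: i rule: less_induct)
  case (less b)
  show ?case
  proof (rule ccontr)
    assume "\<not> surj_at i b"
    then have z: "dual_level k (Suc b) = {\<lambda>_. 0}" for k
      using not_surj_next_zero[of b i k] less by simp
    have "level_vec (Suc (Suc b)) pt $ k = 0" for k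
    proof -
      have "fls_nth (qlevel (Suc (Suc b)) k pt) (D pt - (D pt - u)) = int (fs.dim (dual_part k (Suc b) (D pt - u)))" for u
        by (rule dim_dual_part_qlevel) (use less in auto)
      moreover have "dual_part k (Suc b) u = {\<lambda>_. 0}" for u using z[of k] by (auto simp: dual_part_def)
      ultimately have "fls_nth (qlevel (Suc (Suc b)) k pt) u = 0" for u using dim_trivial by simp
      then have "qlevel (Suc (Suc b)) k pt = 0" by (intro fls_eqI) (simp del: qlevel.simps)
      then show ?thesis using eval_one_qlevel[of "Suc (Suc b)" k pt] by (simp del: level_vec.simps qlevel.simps)
    qed
    then have "level_vec (Suc (Suc b)) pt = 0" by (simp add: vec_eq_iff del: level_vec.simps)
    then show False using cox(4)[of "Suc (Suc b)" pt] less.prems by simp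
  qed
qed

lemma dim_dual_part: "a < cox \<Longrightarrow> int (fs.dim (dual_part i a u)) = fls_nth (qlevel (Suc a) i pt) (D pt - u)"
  by (rule dim_dual_part_qlevel[symmetric]) (auto intro: surj_below)

lemma qlevel_nonneg_pt: "v \<le> cox \<Longrightarrow> fls_nth (qlevel v i pt) u \<ge> 0"
  using dim_dual_part[of "v - 1" i "D pt - u"] by (cases v) auto

lemma dual_part_top: "cox \<le> Suc a \<Longrightarrow> dual_part i a u = {\<lambda>_. 0}"
proof -
  assume a: "cox \<le> Suc a"
  obtain b where b: "cox = Suc b" using cox(1) by (cases cox) auto
  have "qlevel cox i pt = 0" for i
    by (rule nonneg_eval_one_zero[OF laurent_poly_qlevel]) (simp_all add: qlevel_nonneg_pt eval_one_qlevel cox(2))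
  then have d: "fs.dim (dual_part i b u) = 0" for i u using dim_dual_part[of b i u] b by simp
  have "f = (\<lambda>_. 0)" if f: "f \<in> dual_level i b" for i f
  proof
    fix w
    have "degree_part (q_degree w) f = (\<lambda>_. 0)" using dim_zero_imp[OF d fin_dim_dual_part] degree_part_dual_part[OF f] by blast
    then have "degree_part (q_degree w) f w = 0" by simp
    then show "f w = 0" by (simp add: degree_part_def)
  qed
  then have "dual_level i b = {\<lambda>_. 0}" for i using dual_level_zero by blast
  then have "dual_level i a = {\<lambda>_. 0}" using dual_level_zero_ge[of b a i] a b by simp
  then show ?thesis by (auto simp: dual_part_def)
qed

end

subsection \<open>The path algebra\<close>

abbreviation path_single :: "'i path \<Rightarrow> 'k::zero \<Rightarrow> ('i path \<Rightarrow>\<^sub>0 'k)" where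
  "path_single \<equiv> Poly_Mapping.single"

lemma path_single_sum: "x = (\<Sum>p\<in>Poly_Mapping.keys x. path_single p (Poly_Mapping.lookup x p))"
  for x :: "'i path \<Rightarrow>\<^sub>0 'k::comm_monoid_add"
proof (rule poly_mapping_eqI)
  fix q
  have "(\<Sum>p\<in>Poly_Mapping.keys x. Poly_Mapping.lookup (path_single p (Poly_Mapping.lookup x p)) q)
    = (\<Sum>p\<in>Poly_Mapping.keys x. if p = q then Poly_Mapping.lookup x q else 0)"
    by (intro sum.cong refl) (auto simp: lookup_single)
  then show "Poly_Mapping.lookup x q = Poly_Mapping.lookup (\<Sum>p\<in>Poly_Mapping.keys x. path_single p (Poly_Mapping.lookup x p)) q"
    by (simp add: lookup_sum in_keys_iff)
qed

lemma path_single_induct [case_names zero single add]: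
  fixes x :: "'i path \<Rightarrow>\<^sub>0 'k::comm_monoid_add"
  assumes "P 0" "\<And>p c. P (path_single p c)" "\<And>x y. P x \<Longrightarrow> P y \<Longrightarrow> P (x + y)"
  shows "P x"
proof -
  have "P (\<Sum>p\<in>S. path_single p (Poly_Mapping.lookup x p))" if "finite S" for S
    using that by (induction S rule: finite_induct) (simp_all add: assms)
  then show ?thesis using path_single_sum[of x] by (metis finite_keys)
qed

lemma path_term_zero [simp]: "path_term p q 0 = 0"
  by (cases p; cases q) simp

lemma path_term_add: "path_term p q (a + b) = path_term p q a + path_term p q b"
  for a b :: "'k::field"
  by (cases p; cases q) (simp add: single_add)

lemma path_mult_superset:
  assumes "finite S" "Poly_Mapping.keys x \<subseteq> S" "finite T" "Poly_Mapping.keys y \<subseteq> T"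
  shows "path_mult x y = (\<Sum>p\<in>S. \<Sum>q\<in>T. path_term p q (Poly_Mapping.lookup x p * Poly_Mapping.lookup y q))"
proof -
  have "path_mult x y = (\<Sum>p\<in>Poly_Mapping.keys x. \<Sum>q\<in>T. path_term p q (Poly_Mapping.lookup x p * Poly_Mapping.lookup y q))"
    unfolding path_mult_def
    by (intro sum.cong refl sum.mono_neutral_left) (use assms in \<open>auto simp: in_keys_iff\<close>)
  also have "\<dots> = (\<Sum>p\<in>S. \<Sum>q\<in>T. path_term p q (Poly_Mapping.lookup x p * Poly_Mapping.lookup y q))"
    by (intro sum.mono_neutral_left) (use assms in \<open>auto simp: in_keys_iff\<close>)
  finally show ?thesis .
qed

lemma path_mult_add_left: "path_mult (x + y) z = path_mult x z + path_mult y z"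
proof -
  let ?S = "Poly_Mapping.keys x \<union> Poly_Mapping.keys y"
  have "Poly_Mapping.keys (x + y) \<subseteq> ?S" by (rule keys_add)
  then show ?thesis
    by (subst (1 2 3) path_mult_superset[of ?S _ "Poly_Mapping.keys z"])
      (auto simp: lookup_add distrib_right path_term_add sum.distrib)
qed

lemma path_mult_add_right: "path_mult z (x + y) = path_mult z x + path_mult z y"
proof -
  let ?S = "Poly_Mapping.keys x \<union> Poly_Mapping.keys y"
  have "Poly_Mapping.keys (x + y) \<subseteq> ?S" by (rule keys_add)
  then show ?thesis
    by (subst (1 2 3) path_mult_superset[of "Poly_Mapping.keys z" _ ?S])
      (auto simp: lookup_add distrib_left path_term_add sum.distrib)
qed

lemma path_mult_zero [simp]: "path_mult 0 x = 0" "path_mult x 0 = 0"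
  by (simp_all add: path_mult_def)

lemma path_mult_uminus: "path_mult (- x) y = - path_mult x y" "path_mult y (- x) = - path_mult y x"
  using path_mult_add_left[of x "- x" y] path_mult_add_right[of y x "- x"]
  by (simp_all add: eq_neg_iff_add_eq_0 add.commute)

lemma path_mult_diff: "path_mult (x - y) z = path_mult x z - path_mult y z" "path_mult z (x - y) = path_mult z x - path_mult z y"
  using path_mult_add_left[of x "- y" z] path_mult_add_right[of z x "- y"] by (simp_all add: path_mult_uminus)

lemma path_mult_sum_left: "path_mult (\<Sum>s\<in>S. f s) y = (\<Sum>s\<in>S. path_mult (f s) y)"
  by (induction S rule: infinite_finite_induct) (simp_all add: path_mult_add_left)

lemma path_mult_sum_right: "path_mult y (\<Sum>s\<in>S. f s) = (\<Sum>s\<in>S. path_mult y (f s))"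
  by (induction S rule: infinite_finite_induct) (simp_all add: path_mult_add_right)

lemma path_mult_single: "path_mult (path_single p a) (path_single q b) = path_term p q (a * b)"
  by (subst path_mult_superset[of "{p}" _ "{q}"]) (simp_all add: lookup_single split: if_splits)

lemma path_term_single: "path_term (i, w, j) (k, w', l) c = (if j = k then path_single (i, w @ w', l) c else 0)"
  by simp

lemma path_mult_assoc: "path_mult (path_mult x y) z = path_mult x (path_mult y z)"
proof (induction x rule: path_single_induct)
  case (single p a)
  show ?case
  proof (induction y rule: path_single_induct)
    case (single q b)
    show ?case
    proof (induction z rule: path_single_induct)
      case (single r c)
      obtain i w j k w' l m w'' n where "p = (i, w, j)" "q = (k, w', l)" "r = (m, w'', n)" by (metis prod_cases3)
      then show ?case by (auto simp: path_mult_single mult.assoc)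
    qed (simp_all add: path_mult_add_right)
  qed (simp_all add: path_mult_add_right path_mult_add_left)
qed (simp_all add: path_mult_add_left)

lemma path_scalar_single:
  fixes c a :: "'k::field"
  shows "path_mult (path_scalar c) (path_single (p :: 'i::finite path) a) = path_single p (c * a)"
    "path_mult (path_single p a) (path_scalar c) = path_single p (a * c)"
proof -
  obtain i w j where p: "p = (i, w, j)" by (metis prod_cases3)
  show "path_mult (path_scalar c) (path_single p a) = path_single p (c * a)" "path_mult (path_single p a) (path_scalar c) = path_single p (a * c)"
    unfolding path_scalar_def path_mult_sum_left path_mult_sum_right path_mult_single p by simp_all
qed

lemma path_scalar_one_left: "path_mult (path_scalar 1) x = x"
  by (induction x rule: path_single_induct) (simp_all add: path_scalar_single path_mult_add_right)

lemma path_scalar_one_right: "path_mult x (path_scalar 1) = x"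
  by (induction x rule: path_single_induct) (simp_all add: path_scalar_single path_mult_add_left)

lemma path_algebra_simps [simp]:
  "mult (path_algebra C) = path_mult" "one (path_algebra C) = path_scalar 1"
  "zero (path_algebra C) = 0" "add (path_algebra C) = (+)"
  by (simp_all add: path_algebra_def)

lemma carrier_path_algebra: "x \<in> carrier (path_algebra C) \<longleftrightarrow> Poly_Mapping.keys x \<subseteq> paths C"
  by (simp add: path_algebra_def)

lemma carrier_zero: "0 \<in> carrier (path_algebra C)"
  by (simp add: carrier_path_algebra)

lemma carrier_add: "x \<in> carrier (path_algebra C) \<Longrightarrow> y \<in> carrier (path_algebra C) \<Longrightarrow> x + y \<in> carrier (path_algebra C)"
  unfolding carrier_path_algebra using keys_add[of x y] by blast

lemma carrier_uminus: "x \<in> carrier (path_algebra C) \<Longrightarrow> - x \<in> carrier (path_algebra C)"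
  unfolding carrier_path_algebra by (auto simp: in_keys_iff)

lemma carrier_diff: "x \<in> carrier (path_algebra C) \<Longrightarrow> y \<in> carrier (path_algebra C) \<Longrightarrow> x - y \<in> carrier (path_algebra C)"
  using carrier_add[OF _ carrier_uminus, of x C y] by simp

lemma carrier_sum: "(\<And>s. s \<in> S \<Longrightarrow> f s \<in> carrier (path_algebra C)) \<Longrightarrow> (\<Sum>s\<in>S. f s) \<in> carrier (path_algebra C)"
  by (induction S rule: infinite_finite_induct) (auto intro: carrier_zero carrier_add)

lemma carrier_single: "p \<in> paths C \<Longrightarrow> path_single p c \<in> carrier (path_algebra C)"
  by (auto simp: carrier_path_algebra)

lemma carrier_term:
  "p \<in> paths C \<Longrightarrow> q \<in> paths C \<Longrightarrow> path_term p q (c :: 'k::field) \<in> carrier (path_algebra C)"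
proof -
  assume pq: "p \<in> paths C" "q \<in> paths C"
  obtain i w j k w' l where e: "p = (i, w, j)" "q = (k, w', l)" by (metis prod_cases3)
  show ?thesis
  proof (cases "j = k")
    case True
    then have "(i, w @ w', l) \<in> paths C" using pq e by (auto simp: paths_def is_walk_append)
    then show ?thesis using True e carrier_single by simp
  next
    case False
    then show ?thesis using e carrier_zero by simp
  qed
qed

lemma carrier_mult:
  "x \<in> carrier (path_algebra C) \<Longrightarrow> y \<in> carrier (path_algebra C) \<Longrightarrow> path_mult x y \<in> carrier (path_algebra C)"
  unfolding path_mult_def
  by (intro carrier_sum carrier_term) (auto simp: carrier_path_algebra)

lemma carrier_scalar: "path_scalar c \<in> carrier (path_algebra C)"
  unfolding path_scalar_def by (intro carrier_sum carrier_single) (simp add: paths_def)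

lemma ring_path_algebra: "ring (path_algebra (C :: int^'i::finite^'i) :: ('i path \<Rightarrow>\<^sub>0 'k::field) ring)"
proof (rule ringI)
  show "abelian_group (path_algebra C)"
  proof (rule abelian_groupI)
    fix x assume "x \<in> carrier (path_algebra C)"
    then show "\<exists>y\<in>carrier (path_algebra C). y \<oplus>\<^bsub>path_algebra C\<^esub> x = \<zero>\<^bsub>path_algebra C\<^esub>"
      by (intro bexI[of _ "- x"]) (simp_all add: carrier_uminus)
  qed (auto intro: carrier_zero carrier_add simp: add.assoc add.commute)
  show "Group.monoid (path_algebra C)"
    by (rule monoidI) (auto intro: carrier_mult carrier_scalar simp: path_mult_assoc path_scalar_one_left path_scalar_one_right)
qed (simp_all add: path_mult_add_left path_mult_add_right)

subsection \<open>Linear functionals on the path algebra\<close>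

definition lin_ext :: "('i path \<Rightarrow> 'k::field) \<Rightarrow> ('i path \<Rightarrow>\<^sub>0 'k) \<Rightarrow> 'k" where
  "lin_ext \<phi> x = (\<Sum>p\<in>Poly_Mapping.keys x. Poly_Mapping.lookup x p * \<phi> p)"

lemma lin_ext_superset:
  "finite S \<Longrightarrow> Poly_Mapping.keys x \<subseteq> S \<Longrightarrow> lin_ext \<phi> x = (\<Sum>p\<in>S. Poly_Mapping.lookup x p * \<phi> p)"
  unfolding lin_ext_def by (rule sum.mono_neutral_left) (auto simp: in_keys_iff)

lemma lin_ext_zero [simp]: "lin_ext \<phi> 0 = 0"
  by (simp add: lin_ext_def)

lemma lin_ext_add: "lin_ext \<phi> (x + y) = lin_ext \<phi> x + lin_ext \<phi> y"
proof -
  let ?S = "Poly_Mapping.keys x \<union> Poly_Mapping.keys y"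
  have "Poly_Mapping.keys (x + y) \<subseteq> ?S" by (rule keys_add)
  then show ?thesis
    by (subst (1 2 3) lin_ext_superset[of ?S]) (auto simp: lookup_add distrib_right sum.distrib)
qed

lemma lin_ext_uminus: "lin_ext \<phi> (- x) = - lin_ext \<phi> x"
  using lin_ext_add[of \<phi> x "- x"] by (simp add: eq_neg_iff_add_eq_0 add.commute)

lemma lin_ext_diff: "lin_ext \<phi> (x - y) = lin_ext \<phi> x - lin_ext \<phi> y"
  using lin_ext_add[of \<phi> x "- y"] by (simp add: lin_ext_uminus)

lemma lin_ext_sum: "lin_ext \<phi> (\<Sum>s\<in>S. f s) = (\<Sum>s\<in>S. lin_ext \<phi> (f s))"
  by (induction S rule: infinite_finite_induct) (simp_all add: lin_ext_add)

lemma lin_ext_single [simp]: "lin_ext \<phi> (path_single p c) = c * \<phi> p"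
  by (subst lin_ext_superset[of "{p}"]) simp_all

lemma lin_ext_term: "lin_ext \<phi> (path_term p q c) = c * lin_ext \<phi> (path_term p q 1)"
proof -
  obtain i w j k w' l where "p = (i, w, j)" "q = (k, w', l)" by (metis prod_cases3)
  then show ?thesis by simp
qed

lemma lin_ext_scale_left: "lin_ext \<phi> (path_mult (path_single p c) x) = c * lin_ext \<phi> (path_mult (path_single p 1) x)"
proof (induction x rule: path_single_induct)
  case (single q b)
  have "lin_ext \<phi> (path_term p q (c * b)) = c * lin_ext \<phi> (path_term p q b)"
    by (subst (1 2) lin_ext_term) simp
  then show ?case by (simp add: path_mult_single)
qed (simp_all add: path_mult_add_right lin_ext_add distrib_left)

lemma lin_ext_scale_right: "lin_ext \<phi> (path_mult x (path_single p c)) = c * lin_ext \<phi> (path_mult x (path_single p 1))"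
proof (induction x rule: path_single_induct)
  case (single q b)
  have "lin_ext \<phi> (path_term q p (b * c)) = c * lin_ext \<phi> (path_term q p b)"
    by (subst (1 2) lin_ext_term) simp
  then show ?case by (simp add: path_mult_single)
qed (simp_all add: path_mult_add_left lin_ext_add distrib_left)

text \<open>Turns the vanishing of a functional on the relation ideal into a check on generators: it
  is a two-sided ideal, so it contains the relation ideal once it contains the relations.\<close>

definition path_ann :: "int^'i::finite^'i \<Rightarrow> ('i path \<Rightarrow> 'k::field) \<Rightarrow> ('i path \<Rightarrow>\<^sub>0 'k) set" where
  "path_ann C \<phi> = {x \<in> carrier (path_algebra C). \<forall>p q. lin_ext \<phi> (path_mult (path_single p 1) (path_mult x (path_single q 1))) = 0}"

lemma path_ann_ideal:
  fixes \<phi> :: "'i::finite path \<Rightarrow> 'k::field"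
  shows "ideal (path_ann C \<phi>) (path_algebra C)"
proof (rule idealI[OF ring_path_algebra])
  show "subgroup (path_ann C \<phi>) (add_monoid (path_algebra C))"
  proof (unfold_locales)
    show "path_ann C \<phi> \<subseteq> carrier (add_monoid (path_algebra C))" by (auto simp: path_ann_def)
    show "x \<otimes>\<^bsub>add_monoid (path_algebra C)\<^esub> y \<in> path_ann C \<phi>" if "x \<in> path_ann C \<phi>" "y \<in> path_ann C \<phi>" for x y
      using that by (auto simp: path_ann_def carrier_add path_mult_add_left path_mult_add_right lin_ext_add)
    show "\<one>\<^bsub>add_monoid (path_algebra C)\<^esub> \<in> path_ann C \<phi>"
      by (simp add: path_ann_def carrier_zero)
    show "inv\<^bsub>add_monoid (path_algebra C)\<^esub> x \<in> path_ann C \<phi>" if x: "x \<in> path_ann C \<phi>" for x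
    proof -
      interpret A: ring "path_algebra C" by (rule ring_path_algebra)
      have xc: "x \<in> carrier (path_algebra C)" using x by (simp add: path_ann_def)
      have "\<ominus>\<^bsub>path_algebra C\<^esub> x = - x"
        by (rule A.minus_equality) (use xc carrier_uminus in auto)
      then have "inv\<^bsub>add_monoid (path_algebra C)\<^esub> x = - x" by (simp add: a_inv_def)
      then show ?thesis using x by (auto simp: path_ann_def carrier_uminus path_mult_uminus lin_ext_uminus)
    qed
  qed
next
  fix x a :: "'i path \<Rightarrow>\<^sub>0 'k"
  assume x: "x \<in> path_ann C \<phi>" and a: "a \<in> carrier (path_algebra C)"
  have k: "lin_ext \<phi> (path_mult (path_single p 1) (path_mult x (path_single q 1))) = 0" for p q
    using x unfolding path_ann_def by blast
  have "lin_ext \<phi> (path_mult b (path_mult x (path_single q 1))) = 0" for b q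
  proof -
    have "path_mult b (path_mult x (path_single q 1)) = (\<Sum>p\<in>Poly_Mapping.keys b. path_mult (path_single p (Poly_Mapping.lookup b p)) (path_mult x (path_single q 1)))"
      by (subst path_single_sum[of b]) (rule path_mult_sum_left)
    moreover have "lin_ext \<phi> (path_mult (path_single p c) (path_mult x (path_single q 1))) = 0" for p c
      by (subst lin_ext_scale_left) (simp only: k mult_zero_right)
    ultimately show ?thesis by (simp only: lin_ext_sum sum.neutral_const)
  qed
  then have "lin_ext \<phi> (path_mult (path_single p 1) (path_mult (path_mult a x) (path_single q 1))) = 0" for p q
    by (metis path_mult_assoc)
  then show "a \<otimes>\<^bsub>path_algebra C\<^esub> x \<in> path_ann C \<phi>" using x a by (simp add: path_ann_def carrier_mult)
  have "lin_ext \<phi> (path_mult (path_mult (path_single p 1) x) b) = 0" for b p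
  proof -
    have "path_mult (path_mult (path_single p 1) x) b = (\<Sum>q\<in>Poly_Mapping.keys b. path_mult (path_mult (path_single p 1) x) (path_single q (Poly_Mapping.lookup b q)))"
      by (subst path_single_sum[of b]) (rule path_mult_sum_right)
    moreover have "lin_ext \<phi> (path_mult (path_mult (path_single p 1) x) (path_single q c)) = 0" for q c
      by (subst lin_ext_scale_right) (simp only: path_mult_assoc k mult_zero_right)
    ultimately show ?thesis by (simp only: lin_ext_sum sum.neutral_const)
  qed
  then have "lin_ext \<phi> (path_mult (path_single p 1) (path_mult (path_mult x a) (path_single q 1))) = 0" for p q
    by (metis path_mult_assoc)
  then show "x \<otimes>\<^bsub>path_algebra C\<^esub> a \<in> path_ann C \<phi>" using x a by (simp add: path_ann_def carrier_mult)
qed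

subsection \<open>The relations and the anti-involution\<close>

lemma eps_pow_left:
  "path_mult (gen_eps i [^]\<^bsub>path_algebra (C :: int^'i::finite^'i)\<^esub> (n::nat)) (path_single (i, w, j) (c :: 'k::field)) = path_single (i, replicate n (Eps i) @ w, j) c"
proof (induction n arbitrary: w)
  case 0
  have "gen_eps i [^]\<^bsub>path_algebra C\<^esub> (0::nat) = (path_scalar 1 :: 'i path \<Rightarrow>\<^sub>0 'k)" by (simp add: nat_pow_def)
  then show ?case by (simp add: path_scalar_one_left)
next
  case (Suc n)
  have "gen_eps i [^]\<^bsub>path_algebra C\<^esub> Suc n = path_mult (gen_eps i [^]\<^bsub>path_algebra C\<^esub> n) (gen_eps i :: 'i path \<Rightarrow>\<^sub>0 'k)"
    by (simp add: nat_pow_def)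
  then have "path_mult (gen_eps i [^]\<^bsub>path_algebra C\<^esub> Suc n) (path_single (i, w, j) c)
    = path_mult (gen_eps i [^]\<^bsub>path_algebra C\<^esub> n) (path_mult (gen_eps i) (path_single (i, w, j) c))"
    by (simp only: path_mult_assoc)
  also have "path_mult (gen_eps i) (path_single (i, w, j) c) = path_single (i, Eps i # w, j) c"
    by (simp add: gen_eps_def path_mult_single)
  also have "path_mult (gen_eps i [^]\<^bsub>path_algebra C\<^esub> n) (path_single (i, Eps i # w, j) c) = path_single (i, replicate (Suc n) (Eps i) @ w, j) c"
    unfolding Suc.IH by (simp add: replicate_app_Cons_same)
  finally show ?case .
qed

lemma eps_pow_right:
  "path_mult (path_single (i, w, j) (c :: 'k::field)) (gen_eps j [^]\<^bsub>path_algebra (C :: int^'i::finite^'i)\<^esub> (n::nat)) = path_single (i, w @ replicate n (Eps j), j) c"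
proof (induction n)
  case 0
  have "gen_eps j [^]\<^bsub>path_algebra C\<^esub> (0::nat) = (path_scalar 1 :: 'i path \<Rightarrow>\<^sub>0 'k)" by (simp add: nat_pow_def)
  then show ?case by (simp add: path_scalar_one_right)
next
  case (Suc n)
  have "gen_eps j [^]\<^bsub>path_algebra C\<^esub> Suc n = path_mult (gen_eps j [^]\<^bsub>path_algebra C\<^esub> n) (gen_eps j :: 'i path \<Rightarrow>\<^sub>0 'k)"
    by (simp add: nat_pow_def)
  then have "path_mult (path_single (i, w, j) c) (gen_eps j [^]\<^bsub>path_algebra C\<^esub> Suc n)
    = path_mult (path_mult (path_single (i, w, j) c) (gen_eps j [^]\<^bsub>path_algebra C\<^esub> n)) (gen_eps j)"
    by (simp only: path_mult_assoc)
  then show ?case unfolding Suc.IH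
    by (simp add: gen_eps_def path_mult_single replicate_append_same)
qed

lemma relation1_eq:
  "relation1 C i j = (path_single (i, replicate (nat (- C $ i $ j)) (Eps i) @ [Alpha i j], j) 1
    - path_single (i, Alpha i j # replicate (nat (- C $ j $ i)) (Eps j), j) 1 :: 'i::finite path \<Rightarrow>\<^sub>0 'k::field)"
  unfolding relation1_def Let_def path_algebra_simps gen_alpha_def eps_pow_left eps_pow_right by simp

lemma relation2_eq:
  "relation2 C \<omega> i = (\<Sum>j | adj C j i. \<Sum>k<nat (- C $ i $ j).
     path_single (i, replicate k (Eps i) @ [Alpha i j, Alpha j i] @ replicate (nat (- C $ i $ j) - 1 - k) (Eps i), i) (\<omega> i j))"
  for \<omega> :: "'i::finite \<Rightarrow> 'i \<Rightarrow> 'k::field"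
  unfolding relation2_def Let_def path_algebra_simps
proof (intro sum.cong refl)
  fix j k
  let ?e = "gen_eps i :: 'i path \<Rightarrow>\<^sub>0 'k"
  have "path_mult (path_mult (path_mult (path_mult (path_scalar (\<omega> i j)) (?e [^]\<^bsub>path_algebra C\<^esub> k)) (gen_alpha i j)) (gen_alpha j i))
      (?e [^]\<^bsub>path_algebra C\<^esub> (nat (- C $ i $ j) - 1 - k))
    = path_mult (path_scalar (\<omega> i j)) (path_mult (path_mult (path_mult (?e [^]\<^bsub>path_algebra C\<^esub> k) (gen_alpha i j)) (gen_alpha j i))
      (?e [^]\<^bsub>path_algebra C\<^esub> (nat (- C $ i $ j) - 1 - k)))"
    by (simp only: path_mult_assoc)
  also have "\<dots> = path_mult (path_scalar (\<omega> i j)) (path_single (i, replicate k (Eps i) @ [Alpha i j, Alpha j i] @ replicate (nat (- C $ i $ j) - 1 - k) (Eps i), i) 1)"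
    unfolding gen_alpha_def eps_pow_left path_mult_single path_term_single by (simp add: eps_pow_right)
  finally show "path_mult (path_mult (path_mult (path_mult (path_scalar (\<omega> i j)) (?e [^]\<^bsub>path_algebra C\<^esub> k)) (gen_alpha i j)) (gen_alpha j i))
      (?e [^]\<^bsub>path_algebra C\<^esub> (nat (- C $ i $ j) - 1 - k))
    = path_single (i, replicate k (Eps i) @ [Alpha i j, Alpha j i] @ replicate (nat (- C $ i $ j) - 1 - k) (Eps i), i) (\<omega> i j)"
    by (simp add: path_scalar_single)
qed

lemma anti_superset:
  assumes "finite S" "Poly_Mapping.keys x \<subseteq> S"
  shows "path_anti_involution x = (\<Sum>p\<in>S. path_single (opp_path p) (Poly_Mapping.lookup x p))"
  unfolding path_anti_involution_def
  by (rule sum.mono_neutral_left) (use assms in \<open>auto simp: in_keys_iff\<close>)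

lemma anti_add: "path_anti_involution (x + y) = path_anti_involution x + path_anti_involution y"
proof -
  let ?S = "Poly_Mapping.keys x \<union> Poly_Mapping.keys y"
  have "Poly_Mapping.keys (x + y) \<subseteq> ?S" by (rule keys_add)
  then show ?thesis
    by (subst (1 2 3) anti_superset[of ?S]) (auto simp: lookup_add single_add sum.distrib)
qed

lemma anti_zero [simp]: "path_anti_involution 0 = 0"
  by (simp add: path_anti_involution_def)

lemma anti_uminus: "path_anti_involution (- x) = - path_anti_involution x"
  using anti_add[of x "- x"] by (simp add: eq_neg_iff_add_eq_0 add.commute)

lemma anti_diff: "path_anti_involution (x - y) = path_anti_involution x - path_anti_involution y"
  using anti_add[of x "- y"] by (simp add: anti_uminus)

lemma anti_sum: "path_anti_involution (\<Sum>s\<in>S. f s) = (\<Sum>s\<in>S. path_anti_involution (f s))"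
  by (induction S rule: infinite_finite_induct) (simp_all add: anti_add)

lemma anti_single [simp]: "path_anti_involution (path_single p c) = path_single (opp_path p) c"
  by (subst anti_superset[of "{p}"]) simp_all

lemma opp_opp: "opp_arrow (opp_arrow x) = x"
  by (cases x) simp_all

lemma opp_path_opp: "opp_path (opp_path p) = p"
proof -
  obtain i w j where "p = (i, w, j)" by (metis prod_cases3)
  then show ?thesis by (simp add: rev_map opp_opp comp_def)
qed

lemma anti_anti: "path_anti_involution (path_anti_involution x) = x"
  by (induction x rule: path_single_induct) (simp_all add: anti_add opp_path_opp)

lemma anti_mult: "path_anti_involution (path_mult x y) = path_mult (path_anti_involution y) (path_anti_involution x)"
proof (induction x rule: path_single_induct)
  case (single p a)
  show ?case
  proof (induction y rule: path_single_induct)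
    case (single q b)
    obtain i w j k w' l where "p = (i, w, j)" "q = (k, w', l)" by (metis prod_cases3)
    then show ?case by (auto simp: path_mult_single mult.commute)
  qed (simp_all add: path_mult_add_right path_mult_add_left anti_add)
qed (simp_all add: path_mult_add_left path_mult_add_right anti_add)

context word_module
begin

abbreviation "A \<equiv> path_algebra C :: ('i path \<Rightarrow>\<^sub>0 'k) ring"
abbreviation "RI \<equiv> relation_ideal C \<omega>"
abbreviation "PA \<equiv> preproj C \<omega>"
abbreviation "cl \<equiv> preproj_class C \<omega>"
abbreviation "LI \<equiv> eps_left_ideal C \<omega> pt"
abbreviation "MV \<equiv> eps_quotient C d \<omega> pt"
abbreviation "ee0 \<equiv> (gen_e pt :: 'i path \<Rightarrow>\<^sub>0 'k)"
abbreviation "ep0 \<equiv> (gen_eps pt :: 'i path \<Rightarrow>\<^sub>0 'k)"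

subsection \<open>The preprojective algebra\<close>

lemma relation1_paths:
  assumes "adj C i j"
  shows "(i, replicate n (Eps i) @ [Alpha i j], j) \<in> paths C" "(i, Alpha i j # replicate n (Eps j), j) \<in> paths C"
  using assms by (simp_all add: paths_def)

lemma relations_carrier: "relations C \<omega> \<subseteq> carrier A"
proof -
  have "relation1 C i j \<in> carrier A" if "adj C i j" for i j
    unfolding relation1_eq using relation1_paths[OF that] by (intro carrier_diff carrier_single)
  moreover have "relation2 C \<omega> i \<in> carrier A" for i
    unfolding relation2_eq
  proof (intro carrier_sum carrier_single)
    fix j k assume "j \<in> {j. adj C j i}"
    then have "adj C i j" "adj C j i" using adj_sym[of i j] by auto
    then show "(i, replicate k (Eps i) @ [Alpha i j, Alpha j i] @ replicate (nat (- C $ i $ j) - 1 - k) (Eps i), i) \<in> paths C"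
      by (simp add: paths_def)
  qed
  ultimately show ?thesis by (auto simp: relations_def)
qed

lemma ideal_RI: "ideal RI A"
  unfolding relation_ideal_def by (rule ring.genideal_ideal[OF ring_path_algebra relations_carrier])

lemma relation_in_RI: "r \<in> relations C \<omega> \<Longrightarrow> r \<in> RI"
  unfolding relation_ideal_def using ring.genideal_self[OF ring_path_algebra relations_carrier] by blast

sublocale RI: ideal RI A by (rule ideal_RI)

sublocale PA: ring PA unfolding preproj_def by (rule RI.quotient_is_ring)

lemma RI_carrier: "x \<in> RI \<Longrightarrow> x \<in> carrier A"
  by (rule RI.Icarr)

lemma RI_add: "x \<in> RI \<Longrightarrow> y \<in> RI \<Longrightarrow> x + y \<in> RI"
  using additive_subgroup.a_closed[OF RI.additive_subgroup_axioms] by simp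

lemma RI_mult: "x \<in> RI \<Longrightarrow> a \<in> carrier A \<Longrightarrow> path_mult a x \<in> RI" "x \<in> RI \<Longrightarrow> a \<in> carrier A \<Longrightarrow> path_mult x a \<in> RI"
  using RI.I_l_closed RI.I_r_closed by simp_all

lemma RI_zero: "0 \<in> RI"
  using additive_subgroup.zero_closed[OF RI.additive_subgroup_axioms] by simp

lemma A_minus: "x \<in> carrier A \<Longrightarrow> \<ominus>\<^bsub>A\<^esub> x = - x"
  by (rule RI.minus_equality) (auto simp: carrier_uminus)

lemma RI_uminus: "x \<in> RI \<Longrightarrow> - x \<in> RI"
  using additive_subgroup.a_inv_closed[OF RI.additive_subgroup_axioms, of x] A_minus[of x] RI_carrier by simp

lemma cl_mem: "x \<in> carrier A \<Longrightarrow> cl x \<in> carrier PA"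
  unfolding preproj_def preproj_class_def FactRing_def by (auto intro: RI.a_rcosetsI[OF RI.a_subset])

lemma carrier_PA: "carrier PA = cl ` carrier A"
  unfolding preproj_def preproj_class_def FactRing_def by (auto simp: A_RCOSETS_def')

lemma cl_mult: "x \<in> carrier A \<Longrightarrow> y \<in> carrier A \<Longrightarrow> cl x \<otimes>\<^bsub>PA\<^esub> cl y = cl (path_mult x y)"
  using ring_hom_mult[OF RI.rcos_ring_hom, of x y] by (simp add: preproj_def preproj_class_def)

lemma cl_add: "x \<in> carrier A \<Longrightarrow> y \<in> carrier A \<Longrightarrow> cl x \<oplus>\<^bsub>PA\<^esub> cl y = cl (x + y)"
  using ring_hom_add[OF RI.rcos_ring_hom, of x y] by (simp add: preproj_def preproj_class_def)

lemma cl_set: "cl x = {h + x | h. h \<in> RI}"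
  by (auto simp: preproj_class_def a_r_coset_def')

lemma cl_eq: "cl x = cl y \<Longrightarrow> x - y \<in> RI"
proof -
  assume "cl x = cl y"
  moreover have "x \<in> cl x" unfolding cl_set using RI_zero by force
  ultimately obtain h where "h \<in> RI" "x = h + y" unfolding cl_set by blast
  then show ?thesis by simp
qed

lemma cl_eqI: "x - y \<in> RI \<Longrightarrow> cl x = cl y"
proof -
  have *: "cl x \<subseteq> cl y" if "x - y \<in> RI" for x y
  proof
    fix z assume "z \<in> cl x"
    then obtain h where h: "h \<in> RI" "z = h + x" unfolding cl_set by blast
    then have "z = (h + (x - y)) + y" by simp
    then show "z \<in> cl y" unfolding cl_set using RI_add[OF h(1) that] by blast
  qed
  assume "x - y \<in> RI"
  then show ?thesis using *[of x y] *[of y x] RI_uminus[of "x - y"] by simp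
qed

subsection \<open>The quotient by the left ideal generated by the loop\<close>

lemma ee0_carrier: "ee0 \<in> carrier A"
  unfolding gen_e_def by (rule carrier_single) (simp add: paths_def)

lemma gen_e_carrier: "gen_e i \<in> carrier A"
  unfolding gen_e_def by (rule carrier_single) (simp add: paths_def)

lemma ep0_carrier: "ep0 \<in> carrier A"
  unfolding gen_eps_def by (rule carrier_single) (simp add: paths_def)

lemma LI_eq: "LI = (\<lambda>z. cl (path_mult z ep0)) ` carrier A"
  unfolding eps_left_ideal_def carrier_PA image_image
  by (intro image_cong refl) (simp add: cl_mult ep0_carrier)

lemma PA_minus: "x \<in> carrier A \<Longrightarrow> \<ominus>\<^bsub>PA\<^esub> cl x = cl (- x)"
proof (rule PA.minus_equality)
  assume x: "x \<in> carrier A"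
  have "\<zero>\<^bsub>PA\<^esub> = cl 0"
    unfolding preproj_def FactRing_def by (auto simp: cl_set)
  then show "cl (- x) \<oplus>\<^bsub>PA\<^esub> cl x = \<zero>\<^bsub>PA\<^esub>" using x by (simp add: cl_add carrier_uminus)
qed (auto intro: cl_mem carrier_uminus)

lemma PA_zero: "\<zero>\<^bsub>PA\<^esub> = cl 0"
  unfolding preproj_def FactRing_def by (auto simp: cl_set)

lemma abelian_subgroup_LI: "abelian_subgroup LI PA"
proof (rule abelian_subgroupI3)
  show "additive_subgroup LI PA"
  proof (rule additive_subgroupI)
    show "subgroup LI (add_monoid PA)"
    proof (unfold_locales)
      show "LI \<subseteq> carrier (add_monoid PA)"
        unfolding LI_eq by (auto intro: cl_mem carrier_mult ep0_carrier)
      show "x \<otimes>\<^bsub>add_monoid PA\<^esub> y \<in> LI" if xy: "x \<in> LI" "y \<in> LI" for x y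
      proof -
        obtain z z' where z: "z \<in> carrier A" "z' \<in> carrier A" "x = cl (path_mult z ep0)" "y = cl (path_mult z' ep0)"
          using xy unfolding LI_eq by blast
        have "x \<oplus>\<^bsub>PA\<^esub> y = cl (path_mult (z + z') ep0)"
          using z by (simp add: cl_add carrier_mult ep0_carrier path_mult_add_left)
        then show ?thesis unfolding LI_eq using carrier_add[OF z(1,2)] by auto
      qed
      show "\<one>\<^bsub>add_monoid PA\<^esub> \<in> LI"
        unfolding LI_eq using carrier_zero[of C] by (auto simp: PA_zero intro!: image_eqI[of _ _ 0])
      show "inv\<^bsub>add_monoid PA\<^esub> x \<in> LI" if x: "x \<in> LI" for x
      proof -
        obtain z where z: "z \<in> carrier A" "x = cl (path_mult z ep0)" using x unfolding LI_eq by blast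
        have "\<ominus>\<^bsub>PA\<^esub> x = cl (path_mult (- z) ep0)"
          using z by (simp add: PA_minus carrier_mult ep0_carrier path_mult_uminus)
        then show ?thesis unfolding LI_eq a_inv_def using carrier_uminus[OF z(1)] by auto
      qed
    qed
  qed
qed (rule PA.abelian_group_axioms)

sublocale LI: abelian_subgroup LI PA by (rule abelian_subgroup_LI)

definition mod_proj :: "('i path \<Rightarrow>\<^sub>0 'k) \<Rightarrow> ('i path \<Rightarrow>\<^sub>0 'k) set set" where
  "mod_proj x = LI +>\<^bsub>PA\<^esub> cl (path_mult x ee0)"

lemma carrier_MV: "carrier MV = mod_proj ` carrier A"
proof -
  have "carrier MV = {LI +>\<^bsub>PA\<^esub> (x \<otimes>\<^bsub>PA\<^esub> cl ee0) | x. x \<in> carrier PA}"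
    by (simp add: eps_quotient_def Let_def)
  also have "\<dots> = {LI +>\<^bsub>PA\<^esub> (cl y \<otimes>\<^bsub>PA\<^esub> cl ee0) | y. y \<in> carrier A}"
    unfolding carrier_PA by blast
  also have "\<dots> = mod_proj ` carrier A"
    unfolding mod_proj_def image_def by (auto simp: cl_mult ee0_carrier; metis cl_mult ee0_carrier)
  finally show ?thesis .
qed

lemma component_carrier: "path_algebra_component C d u v \<subseteq> carrier A"
  by (auto simp: path_algebra_component_def)

lemma component_MV: "component MV u v = mod_proj ` path_algebra_component C d u v"
proof -
  have "component MV u v = (\<lambda>x. LI +>\<^bsub>PA\<^esub> (cl x \<otimes>\<^bsub>PA\<^esub> cl ee0)) ` path_algebra_component C d u v"
    by (auto simp: eps_quotient_def Let_def)
  also have "\<dots> = mod_proj ` path_algebra_component C d u v"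
    unfolding mod_proj_def using component_carrier[of u v]
    by (intro image_cong refl) (auto simp: cl_mult ee0_carrier subset_iff)
  finally show ?thesis .
qed

lemma cl_me_mem: "x \<in> carrier A \<Longrightarrow> cl (path_mult x ee0) \<in> carrier PA"
  by (intro cl_mem carrier_mult ee0_carrier)

lemma mod_proj_add: "x \<in> carrier A \<Longrightarrow> y \<in> carrier A \<Longrightarrow> mod_proj x \<oplus>\<^bsub>MV\<^esub> mod_proj y = mod_proj (x + y)"
proof -
  assume xy: "x \<in> carrier A" "y \<in> carrier A"
  have "mod_proj x \<oplus>\<^bsub>MV\<^esub> mod_proj y = mod_proj x <+>\<^bsub>PA\<^esub> mod_proj y" by (simp add: eps_quotient_def Let_def)
  also have "\<dots> = LI +>\<^bsub>PA\<^esub> (cl (path_mult x ee0) \<oplus>\<^bsub>PA\<^esub> cl (path_mult y ee0))"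
    unfolding mod_proj_def by (rule LI.a_rcos_sum) (use xy cl_me_mem in auto)
  also have "\<dots> = mod_proj (x + y)"
    using xy by (simp add: mod_proj_def cl_add carrier_mult ee0_carrier path_mult_add_left)
  finally show ?thesis .
qed

lemma mod_proj_cong: "path_mult x ee0 - path_mult y ee0 \<in> RI \<Longrightarrow> mod_proj x = mod_proj y"
  unfolding mod_proj_def using cl_eqI by metis

lemma mod_proj_eqD:
  assumes "x \<in> carrier A" "y \<in> carrier A" "mod_proj x = mod_proj y"
  obtains z where "z \<in> carrier A" "path_mult x ee0 - (path_mult z ep0 + path_mult y ee0) \<in> RI"
proof -
  have "cl (path_mult x ee0) \<in> mod_proj x"
    unfolding mod_proj_def by (rule LI.a_rcos_self) (rule cl_me_mem[OF assms(1)])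
  then have "cl (path_mult x ee0) \<in> LI +>\<^bsub>PA\<^esub> cl (path_mult y ee0)" using assms(3) by (simp add: mod_proj_def)
  then obtain h where h: "h \<in> LI" "cl (path_mult x ee0) = h \<oplus>\<^bsub>PA\<^esub> cl (path_mult y ee0)"
    by (auto simp: a_r_coset_def')
  obtain z where z: "z \<in> carrier A" "h = cl (path_mult z ep0)" using h(1) unfolding LI_eq by blast
  have "cl (path_mult x ee0) = cl (path_mult z ep0 + path_mult y ee0)"
    using h(2) z assms by (simp add: cl_add carrier_mult ep0_carrier ee0_carrier)
  then show ?thesis using that z(1) cl_eq by blast
qed

lemma ep0_ee0: "path_mult ep0 ee0 = ep0"
  by (simp add: gen_eps_def gen_e_def path_mult_single)

lemma ee0_ee0: "path_mult ee0 ee0 = ee0"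
  by (simp add: gen_e_def path_mult_single)

lemma mod_proj_eps: "z \<in> carrier A \<Longrightarrow> mod_proj (path_mult z ep0) = mod_proj 0"
proof -
  assume z: "z \<in> carrier A"
  have "cl (path_mult (path_mult z ep0) ee0) \<in> LI"
    unfolding LI_eq path_mult_assoc ep0_ee0 using z by blast
  then have "mod_proj (path_mult z ep0) = LI" unfolding mod_proj_def by (rule LI.a_rcos_const)
  moreover have "cl (path_mult 0 ee0) \<in> LI"
    unfolding LI_eq using carrier_zero[of C] by (auto intro!: image_eqI[of _ _ 0])
  then have "mod_proj 0 = LI" unfolding mod_proj_def by (rule LI.a_rcos_const)
  ultimately show ?thesis by simp
qed

lemma mod_proj_ee0: "x \<in> carrier A \<Longrightarrow> mod_proj (path_mult x ee0) = mod_proj x"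
  by (rule mod_proj_cong) (simp add: path_mult_assoc ee0_ee0 RI_zero)

lemma mod_proj_RI: "x \<in> RI \<Longrightarrow> mod_proj x = mod_proj 0"
  by (rule mod_proj_cong) (simp add: RI_mult ee0_carrier)

text \<open>The scalar multiplication is a union over representatives; all the cosets occurring in
  it coincide.\<close>

lemma mod_proj_smult: "a \<in> carrier A \<Longrightarrow> x \<in> carrier A \<Longrightarrow> cl a \<odot>\<^bsub>MV\<^esub> mod_proj x = mod_proj (path_mult a x)"
proof -
  assume a: "a \<in> carrier A" and x: "x \<in> carrier A"
  have "LI +>\<^bsub>PA\<^esub> (cl a \<otimes>\<^bsub>PA\<^esub> y) = mod_proj (path_mult a x)" if y: "y \<in> mod_proj x" for y
  proof -
    obtain h where h: "h \<in> LI" "y = h \<oplus>\<^bsub>PA\<^esub> cl (path_mult x ee0)"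
      using y unfolding mod_proj_def by (auto simp: a_r_coset_def')
    obtain z where z: "z \<in> carrier A" "h = cl (path_mult z ep0)" using h(1) unfolding LI_eq by blast
    have "cl a \<otimes>\<^bsub>PA\<^esub> y = cl (path_mult a (path_mult z ep0 + path_mult x ee0))"
      unfolding h(2) z(2) using a x z(1) by (simp add: cl_add cl_mult carrier_mult carrier_add ep0_carrier ee0_carrier)
    also have "\<dots> = cl (path_mult (path_mult a z) ep0) \<oplus>\<^bsub>PA\<^esub> cl (path_mult (path_mult a x) ee0)"
      using a x z(1) by (simp add: cl_add carrier_mult ep0_carrier ee0_carrier path_mult_add_right path_mult_assoc)
    finally have e: "cl a \<otimes>\<^bsub>PA\<^esub> y = cl (path_mult (path_mult a z) ep0) \<oplus>\<^bsub>PA\<^esub> cl (path_mult (path_mult a x) ee0)" .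
    have "cl a \<otimes>\<^bsub>PA\<^esub> y \<in> mod_proj (path_mult a x)"
      unfolding e mod_proj_def a_r_coset_def' LI_eq using carrier_mult[OF a z(1)] by blast
    then show ?thesis unfolding mod_proj_def
      using LI.a_repr_independence'[of "cl a \<otimes>\<^bsub>PA\<^esub> y" "cl (path_mult (path_mult a x) ee0)"]
        cl_me_mem[OF carrier_mult[OF a x]] by simp
  qed
  moreover have "mod_proj x \<noteq> {}"
    unfolding mod_proj_def using LI.a_rcos_self[OF cl_me_mem[OF x]] by blast
  ultimately have "(\<Union>y\<in>mod_proj x. LI +>\<^bsub>PA\<^esub> (cl a \<otimes>\<^bsub>PA\<^esub> y)) = mod_proj (path_mult a x)" by auto
  then show ?thesis by (simp add: eps_quotient_def Let_def)
qed

subsection \<open>The anti-involution fixes the classes of the idempotents\<close>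

lemma walk_opp: "is_walk C i w j \<Longrightarrow> is_walk C j (rev (map opp_arrow w)) i"
proof (induction w arbitrary: i)
  case (Cons x w)
  then show ?case using adj_sym by (cases x) (auto simp: is_walk_append)
qed simp

lemma carrier_anti: "x \<in> carrier A \<Longrightarrow> path_anti_involution x \<in> carrier A"
  unfolding path_anti_involution_def
proof (intro carrier_sum carrier_single)
  fix p assume "x \<in> carrier A" "p \<in> Poly_Mapping.keys x"
  then have "p \<in> paths C" by (auto simp: carrier_path_algebra)
  then show "opp_path p \<in> paths C" by (cases p) (auto simp: paths_def walk_opp)
qed

text \<open>The preimage of the relation ideal is an ideal. The anti-involution exchanges the two
  first relations of an edge up to sign and fixes the second relations, reversing the order of their
  loops.\<close>

lemma anti_RI: "x \<in> RI \<Longrightarrow> path_anti_involution x \<in> RI"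
proof -
  let ?J = "{x \<in> carrier A. path_anti_involution x \<in> RI}"
  have "ideal ?J A"
  proof (rule idealI[OF ring_path_algebra])
    show "subgroup ?J (add_monoid A)"
    proof (unfold_locales)
      show "inv\<^bsub>add_monoid A\<^esub> x \<in> ?J" if x: "x \<in> ?J" for x
      proof -
        have "inv\<^bsub>add_monoid A\<^esub> x = - x" using A_minus[of x] x by (simp add: a_inv_def)
        then show ?thesis using x by (simp add: carrier_uminus anti_uminus RI_uminus)
      qed
    qed (auto simp: carrier_add anti_add RI_add carrier_zero RI_zero)
  next
    fix x a assume "x \<in> ?J" "a \<in> carrier A"
    then show "a \<otimes>\<^bsub>A\<^esub> x \<in> ?J" "x \<otimes>\<^bsub>A\<^esub> a \<in> ?J"
      by (simp_all add: anti_mult carrier_mult RI_mult carrier_anti)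
  qed
  moreover have "relations C \<omega> \<subseteq> ?J"
  proof
    fix r assume r: "r \<in> relations C \<omega>"
    then have rc: "r \<in> carrier A" using relations_carrier by blast
    from r consider i j where "adj C i j" "r = relation1 C i j" | i where "r = relation2 C \<omega> i"
      by (auto simp: relations_def)
    then have "path_anti_involution r \<in> RI"
    proof cases
      case (1 i j)
      have "path_anti_involution r = - relation1 C j i"
        unfolding 1(2) relation1_eq by (simp add: anti_diff)
      moreover have "relation1 C j i \<in> RI" using 1(1) adj_sym by (intro relation_in_RI) (auto simp: relations_def)
      ultimately show ?thesis using RI_uminus by simp
    next
      case (2 i)
      let ?g = "\<lambda>j k. path_single (i, replicate k (Eps i) @ [Alpha i j, Alpha j i] @ replicate (bond i j - 1 - k) (Eps i), i) (\<omega> i j)"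
      have "path_anti_involution r = (\<Sum>j | adj C j i. \<Sum>k<bond i j. ?g j (bond i j - Suc k))"
        unfolding 2 relation2_eq anti_sum bond_def by (intro sum.cong refl) simp
      also have "\<dots> = (\<Sum>j | adj C j i. \<Sum>k<bond i j. ?g j k)"
        by (intro sum.cong refl sum.nat_diff_reindex)
      also have "\<dots> = r" unfolding 2 relation2_eq bond_def ..
      finally show ?thesis using relation_in_RI[OF r] by simp
    qed
    then show "r \<in> ?J" using rc by simp
  qed
  ultimately have "RI \<subseteq> ?J"
    unfolding relation_ideal_def by (rule ring.genideal_minimal[OF ring_path_algebra])
  then show "path_anti_involution x \<in> RI" if "x \<in> RI" using that by blast
qed

lemma anti_cl_gen_e: "path_anti_involution ` cl (gen_e i) = cl (gen_e i)"
proof -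
  have e: "path_anti_involution (gen_e i) = (gen_e i :: 'i path \<Rightarrow>\<^sub>0 'k)" by (simp add: gen_e_def)
  have sub: "path_anti_involution ` cl (gen_e i) \<subseteq> cl (gen_e i)"
    unfolding cl_set using anti_RI by (auto simp: anti_add e)
  moreover have "cl (gen_e i) \<subseteq> path_anti_involution ` cl (gen_e i)"
  proof
    fix x assume x: "x \<in> cl (gen_e i)"
    then have "path_anti_involution x \<in> cl (gen_e i)" using sub by blast
    then show "x \<in> path_anti_involution ` cl (gen_e i)" using anti_anti by (metis image_eqI)
  qed
  ultimately show ?thesis by blast
qed

subsection \<open>The dual module as a space of functions on words\<close>

definition word_functional :: "'i \<Rightarrow> ('i arrow list \<Rightarrow> 'k) \<Rightarrow> 'i path \<Rightarrow> 'k" where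
  "word_functional i g = (\<lambda>(k, w, l). if k = i \<and> l = pt then g w else 0)"

lemma word_functional_simp [simp]: "word_functional i g (k, w, l) = (if k = i \<and> l = pt then g w else 0)"
  by (simp add: word_functional_def)

lemma lin_ext_two_sided: "lin_ext (word_functional i g) (path_mult (path_single (k, w, l) 1) (path_mult (path_single (l', r, m) c) (path_single (n, w', s) 1)))
  = (if l = l' \<and> m = n \<and> k = i \<and> s = pt then c * g (w @ r @ w') else 0)"
  by (simp add: path_mult_single)

lemma relations_path_ann:
  assumes g: "g \<in> dual_level i a" shows "relations C \<omega> \<subseteq> path_ann C (word_functional i g)"
proof
  fix r assume r: "r \<in> relations C \<omega>"
  have "lin_ext (word_functional i g) (path_mult (path_single p 1) (path_mult r (path_single q 1))) = 0" for p q
  proof -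
    obtain k w l n w' s where pq: "p = (k, w, l)" "q = (n, w', s)" by (metis prod_cases3)
    from r consider i j where "adj C i j" "r = relation1 C i j" | i where "r = relation2 C \<omega> i"
      by (auto simp: relations_def)
    then show ?thesis
    proof cases
      case (1 k' l')
      have "g (w @ eps_word k' (bond k' l') @ Alpha k' l' # w') = g (w @ Alpha k' l' # eps_word l' (bond l' k') @ w')"
        using g 1(1) by (simp add: dual_level_def rel1_def)
      then show ?thesis
        unfolding 1(2) relation1_eq path_mult_diff lin_ext_diff pq lin_ext_two_sided bond_def[symmetric] by auto
    next
      case (2 k')
      have "(\<Sum>l | adj C l k'. \<Sum>n<bond k' l. \<omega> k' l * g (w @ (eps_word k' n @ [Alpha k' l, Alpha l k'] @ eps_word k' (bond k' l - 1 - n)) @ w')) = rel2_sum k' w w' g"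
        by (simp add: rel2_sum_def)
      also have "\<dots> = 0" using g by (simp add: dual_level_def)
      finally have z: "(\<Sum>l | adj C l k'. \<Sum>n<bond k' l. \<omega> k' l * g (w @ (eps_word k' n @ [Alpha k' l, Alpha l k'] @ eps_word k' (bond k' l - 1 - n)) @ w')) = 0" .
      note e = 2 relation2_eq path_mult_sum_left path_mult_sum_right lin_ext_sum pq lin_ext_two_sided bond_def[symmetric]
      show ?thesis
      proof (cases "l = k' \<and> k' = n \<and> k = i \<and> s = pt")
        case True
        show ?thesis unfolding e if_P[OF True] by (rule z)
      next
        case False
        show ?thesis unfolding e by (simp only: False if_False sum.neutral_const)
      qed
    qed
  qed
  moreover have "r \<in> carrier A" using r relations_carrier by blast
  ultimately show "r \<in> path_ann C (word_functional i g)" unfolding path_ann_def by blast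
qed

lemma lin_ext_gen_e: "lin_ext (word_functional i g) (path_mult (gen_e i) x) = lin_ext (word_functional i g) x"
proof (induction x rule: path_single_induct)
  case (single p c)
  obtain k w l where "p = (k, w, l)" by (metis prod_cases3)
  then show ?case by (simp add: gen_e_def path_mult_single)
qed (simp_all add: path_mult_add_right lin_ext_add)

lemma lin_ext_ee0: "lin_ext (word_functional i g) (path_mult x ee0) = lin_ext (word_functional i g) x"
proof (induction x rule: path_single_induct)
  case (single p c)
  obtain k w l where "p = (k, w, l)" by (metis prod_cases3)
  then show ?case by (simp add: gen_e_def path_mult_single)
qed (simp_all add: path_mult_add_left lin_ext_add)

lemma lin_ext_ep0: "rel0 g \<Longrightarrow> lin_ext (word_functional i g) (path_mult x ep0) = 0"
proof (induction x rule: path_single_induct)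
  case (single p c)
  obtain k w l where "p = (k, w, l)" by (metis prod_cases3)
  then show ?case using single by (simp add: gen_eps_def path_mult_single rel0_def)
qed (simp_all add: path_mult_add_left lin_ext_add)

lemma lin_ext_scalar: "lin_ext (word_functional i g) (path_mult (path_scalar c) x) = c * lin_ext (word_functional i g) x"
  by (induction x rule: path_single_induct) (simp_all add: path_mult_add_right lin_ext_add path_scalar_single distrib_left)

lemma lin_ext_RI:
  assumes "g \<in> dual_level i a" "x \<in> RI" shows "lin_ext (word_functional i g) x = 0"
proof -
  have "RI \<subseteq> path_ann C (word_functional i g)"
    unfolding relation_ideal_def
    by (rule ring.genideal_minimal[OF ring_path_algebra path_ann_ideal relations_path_ann[OF assms(1)]])
  then have "lin_ext (word_functional i g) (path_mult (gen_e i) (path_mult x ee0)) = 0"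
    using assms(2) unfolding path_ann_def gen_e_def by blast
  then show ?thesis by (simp add: lin_ext_gen_e lin_ext_ee0)
qed

lemma lin_ext_mod_proj:
  assumes "g \<in> dual_level i a" "x \<in> carrier A" "y \<in> carrier A" "mod_proj x = mod_proj y"
  shows "lin_ext (word_functional i g) x = lin_ext (word_functional i g) y"
proof -
  obtain z where "path_mult x ee0 - (path_mult z ep0 + path_mult y ee0) \<in> RI"
    using mod_proj_eqD[OF assms(2-4)] by blast
  from lin_ext_RI[OF assms(1) this] have "lin_ext (word_functional i g) x = lin_ext (word_functional i g) (path_mult z ep0) + lin_ext (word_functional i g) y"
    by (simp add: lin_ext_diff lin_ext_add lin_ext_ee0)
  moreover have "rel0 g" using assms(1) by (simp add: dual_level_def)
  ultimately show ?thesis by (simp add: lin_ext_ep0)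
qed

text \<open>The functional on the quotient module induced by a function on words; by
  \<open>lin_ext_mod_proj\<close> the representative does not matter.\<close>

definition Theta :: "'i \<Rightarrow> ('i arrow list \<Rightarrow> 'k) \<Rightarrow> ('i path \<Rightarrow>\<^sub>0 'k) set set \<Rightarrow> 'k" where
  "Theta i g X = (if X \<in> carrier MV then lin_ext (word_functional i g) (SOME x. x \<in> carrier A \<and> mod_proj x = X) else 0)"

lemma Theta_mod_proj:
  assumes g: "g \<in> dual_level i a" and x: "x \<in> carrier A" shows "Theta i g (mod_proj x) = lin_ext (word_functional i g) x"
proof -
  let ?y = "SOME y. y \<in> carrier A \<and> mod_proj y = mod_proj x"
  have "?y \<in> carrier A \<and> mod_proj ?y = mod_proj x" by (rule someI[of _ x]) (simp add: x)
  then have "lin_ext (word_functional i g) ?y = lin_ext (word_functional i g) x" using lin_ext_mod_proj[OF g _ x] by blast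
  moreover have "mod_proj x \<in> carrier MV" unfolding carrier_MV using x by blast
  ultimately show ?thesis by (simp add: Theta_def)
qed

lemma lin_ext_word_functional_lin_ext: "lin_ext (word_functional i (\<lambda>w. f w + c * g w)) x = lin_ext (word_functional i f) x + c * lin_ext (word_functional i g) x"
proof (induction x rule: path_single_induct)
  case (single p b)
  obtain k w l where "p = (k, w, l)" by (metis prod_cases3)
  then show ?case by (simp add: distrib_left ac_simps)
qed (simp_all add: lin_ext_add distrib_left ac_simps)

lemma linear_Theta: "Vector_Spaces.linear fscale fscale (Theta i)"
  by (rule fs_linearI) (simp add: Theta_def lin_ext_word_functional_lin_ext fun_eq_iff)

lemma path_degree_word: "path_degree d (i, w, j) = (q_degree w, int (alpha_count w))"
proof -
  have "(\<Sum>x\<leftarrow>w. snd (arrow_degree d x)) = int (alpha_count w)" by (induction w rule: alpha_count.induct) simp_all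
  then show ?thesis by (simp add: q_degree_def)
qed

abbreviation "IV \<equiv> Ibar C d \<omega> pt"

lemma IV_component: "component IV u v = {f \<in> functionals (\<lambda>c. cl (path_scalar c)) MV.
    \<forall>u' v'. (u', v') \<noteq> (- u, - v) \<longrightarrow> (\<forall>x\<in>component MV u' v'. f x = 0)}"
  by (simp add: Ibar_def graded_dual_def)

lemma IV_smult: "cl (gen_e i) \<odot>\<^bsub>IV\<^esub> f = (\<lambda>X. if X \<in> carrier MV then f (cl (gen_e i) \<odot>\<^bsub>MV\<^esub> X) else 0)"
proof -
  have "cl (gen_e i) \<odot>\<^bsub>IV\<^esub> f = (\<lambda>X. if X \<in> carrier MV then f ((path_anti_involution ` cl (gen_e i)) \<odot>\<^bsub>MV\<^esub> X) else 0)"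
    by (simp add: Ibar_def graded_dual_def)
  then show ?thesis unfolding anti_cl_gen_e .
qed

lemma Theta_component:
  assumes g: "g \<in> dual_part i a u"
  shows "Theta i g \<in> component IV (- u) (- int a)" "cl (gen_e i) \<odot>\<^bsub>IV\<^esub> Theta i g = Theta i g"
proof -
  have gD: "g \<in> dual_level i a" using g by (simp add: dual_part_def)
  have "Theta i g \<in> functionals (\<lambda>c. cl (path_scalar c)) MV"
  proof -
    have "Theta i g (X \<oplus>\<^bsub>MV\<^esub> Y) = Theta i g X + Theta i g Y" if XY: "X \<in> carrier MV" "Y \<in> carrier MV" for X Y
    proof -
      obtain x y where "X = mod_proj x" "Y = mod_proj y" "x \<in> carrier A" "y \<in> carrier A"
        using XY unfolding carrier_MV by blast
      then show ?thesis by (simp add: mod_proj_add Theta_mod_proj[OF gD] carrier_add lin_ext_add)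
    qed
    moreover have "Theta i g (cl (path_scalar c) \<odot>\<^bsub>MV\<^esub> X) = c * Theta i g X" if X: "X \<in> carrier MV" for c X
    proof -
      obtain x where "X = mod_proj x" "x \<in> carrier A" using X unfolding carrier_MV by blast
      then show ?thesis by (simp add: mod_proj_smult carrier_scalar carrier_mult Theta_mod_proj[OF gD] lin_ext_scalar)
    qed
    moreover have "Theta i g X = 0" if "X \<notin> carrier MV" for X using that by (simp add: Theta_def)
    ultimately show ?thesis unfolding functionals_def by blast
  qed
  moreover have "Theta i g X = 0" if ne: "(u', v') \<noteq> (u, int a)" and X: "X \<in> component MV u' v'" for u' v' X
  proof -
    obtain x where x: "X = mod_proj x" "x \<in> path_algebra_component C d u' v'" using X unfolding component_MV by blast
    then have xc: "x \<in> carrier A" using component_carrier by blast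
    have "Poly_Mapping.lookup x p * word_functional i g p = 0" if p: "p \<in> Poly_Mapping.keys x" for p
    proof -
      obtain k w l where kwl: "p = (k, w, l)" by (metis prod_cases3)
      have "path_degree d p = (u', v')" using x(2) p unfolding path_algebra_component_def by blast
      then have "(q_degree w, int (alpha_count w)) = (u', v')" unfolding kwl path_degree_word .
      then have "(q_degree w, int (alpha_count w)) \<noteq> (u, int a)" using ne by simp
      then have "g w = 0" using g by (auto simp: dual_part_def dual_level_def supported_def)
      then show ?thesis by (simp add: kwl)
    qed
    then have "lin_ext (word_functional i g) x = 0" unfolding lin_ext_def by (rule sum.neutral[rule_format])
    then show ?thesis by (simp add: x(1) Theta_mod_proj[OF gD xc])
  qed
  ultimately show "Theta i g \<in> component IV (- u) (- int a)" unfolding IV_component by simp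
  show "cl (gen_e i) \<odot>\<^bsub>IV\<^esub> Theta i g = Theta i g"
    unfolding IV_smult
  proof
    fix X
    show "(if X \<in> carrier MV then Theta i g (cl (gen_e i) \<odot>\<^bsub>MV\<^esub> X) else 0) = Theta i g X"
    proof (cases "X \<in> carrier MV")
      case True
      then obtain x where x: "X = mod_proj x" "x \<in> carrier A" unfolding carrier_MV by blast
      then show ?thesis
        using True by (simp add: mod_proj_smult gen_e_carrier carrier_mult Theta_mod_proj[OF gD] lin_ext_gen_e)
    qed (simp add: Theta_def)
  qed
qed

lemma carrier_induct [consumes 1, case_names zero single add]:
  assumes "x \<in> carrier A" "P 0" "\<And>p c. p \<in> paths C \<Longrightarrow> P (path_single p c)"
    and "\<And>x y. x \<in> carrier A \<Longrightarrow> y \<in> carrier A \<Longrightarrow> P x \<Longrightarrow> P y \<Longrightarrow> P (x + y)"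
  shows "P x"
proof -
  have "P (\<Sum>p\<in>S. path_single p (Poly_Mapping.lookup x p))" if "finite S" "S \<subseteq> paths C" for S
    using that
  proof (induction S rule: finite_induct)
    case (insert p S)
    then have "p \<in> paths C" "S \<subseteq> paths C" by auto
    moreover from this have "(\<Sum>p\<in>S. path_single p (Poly_Mapping.lookup x p)) \<in> carrier A"
      by (intro carrier_sum carrier_single) auto
    ultimately show ?case using insert assms(3) assms(4)[OF carrier_single] by (simp del: split_paired_All)
  qed (simp add: assms)
  then show ?thesis using path_single_sum[of x] assms(1) by (metis finite_keys carrier_path_algebra)
qed

text \<open>The function \<open>g\<close> reads off the values of \<open>f\<close> on classes of
  walks from \<open>pt\<close> to \<open>i\<close>. No walk has negative level, which explains the
  zero space for positive \<open>v\<close>.\<close>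

lemma component_Theta:
  assumes f: "f \<in> component IV u v"
  obtains g where "g \<in> (if v \<le> 0 then dual_part i (nat (- v)) (- u) else {\<lambda>_. 0})"
    "cl (gen_e i) \<odot>\<^bsub>IV\<^esub> f = Theta i g"
proof -
  define F where "F x = f (mod_proj x)" for x
  have ff: "f \<in> functionals (\<lambda>c. cl (path_scalar c)) MV" using f by (simp add: IV_component)
  have mem: "mod_proj x \<in> carrier MV" if "x \<in> carrier A" for x using that by (simp add: carrier_MV)
  have F_add: "F (x + y) = F x + F y" if "x \<in> carrier A" "y \<in> carrier A" for x y
  proof -
    have "f (mod_proj x \<oplus>\<^bsub>MV\<^esub> mod_proj y) = f (mod_proj x) + f (mod_proj y)"
      using ff mem[OF that(1)] mem[OF that(2)] unfolding functionals_def by blast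
    then show ?thesis unfolding F_def mod_proj_add[OF that] .
  qed
  have F0: "F 0 = 0" using F_add[OF carrier_zero carrier_zero] by (metis add.right_neutral add_left_cancel)
  have F_sum: "F (\<Sum>s\<in>S. h s) = (\<Sum>s\<in>S. F (h s))" if "\<And>s. s \<in> S \<Longrightarrow> h s \<in> carrier A" for S :: "'z set" and h
    using that by (induction S rule: infinite_finite_induct) (simp_all add: F0 F_add carrier_sum)
  have F_scalar: "F (path_mult (path_scalar c) x) = c * F x" if "x \<in> carrier A" for c x
  proof -
    have "f (cl (path_scalar c) \<odot>\<^bsub>MV\<^esub> mod_proj x) = c * f (mod_proj x)"
      using ff mem[OF that] unfolding functionals_def by blast
    then show ?thesis unfolding F_def mod_proj_smult[OF carrier_scalar that] .
  qed
  have F_single: "F (path_single p c) = c * F (path_single p 1)" if "p \<in> paths C" for p c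
    using F_scalar[OF carrier_single[OF that], of c 1] by (simp add: path_scalar_single)
  have F_RI: "F x = 0" if "x \<in> RI" for x
    using mod_proj_RI[OF that] F0 by (simp add: F_def)
  have F_ep0: "F (path_mult z ep0) = 0" if "z \<in> carrier A" for z
    using mod_proj_eps[OF that] F0 by (simp add: F_def)
  define g where "g w = (if is_walk C i w pt then F (path_single (i, w, pt) 1) else 0)" for w
  have deg: "q_degree w = - u \<and> int (alpha_count w) = - v \<and> is_walk C i w pt" if nz: "g w \<noteq> 0" for w
  proof -
    have w: "is_walk C i w pt" and F: "F (path_single (i, w, pt) 1) \<noteq> 0" using nz by (auto simp: g_def split: if_splits)
    then have "path_single (i, w, pt) 1 \<in> path_algebra_component C d (q_degree w) (int (alpha_count w))"
      by (simp add: path_algebra_component_def carrier_path_algebra paths_def path_degree_word del: path_degree.simps)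
    then have "mod_proj (path_single (i, w, pt) 1) \<in> component MV (q_degree w) (int (alpha_count w))"
      unfolding component_MV by (rule imageI)
    then have "(q_degree w, int (alpha_count w)) = (- u, - v)" using f F unfolding IV_component F_def by blast
    then show ?thesis using w by simp
  qed
  have "rel0 g"
    unfolding rel0_def
  proof
    fix w
    show "g (w @ [Eps pt]) = 0"
    proof (cases "is_walk C i w pt")
      case True
      then have "path_single (i, w, pt) 1 \<in> carrier A" by (intro carrier_single) (simp add: paths_def)
      from F_ep0[OF this] show ?thesis by (simp add: g_def gen_eps_def path_mult_single)
    next
      case False
      then show ?thesis by (simp add: g_def is_walk_append)
    qed
  qed
  moreover have "rel1 g"
    unfolding rel1_def
  proof (intro allI impI)
    fix w w' k l assume kl: "adj C k l"
    show "g (w @ eps_word k (bond k l) @ Alpha k l # w') = g (w @ Alpha k l # eps_word l (bond l k) @ w')"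
    proof (cases "is_walk C i w k \<and> is_walk C l w' pt")
      case True
      let ?x = "path_single (i, w, k) (1::'k)" and ?y = "path_single (l, w', pt) (1::'k)"
      have c: "?x \<in> carrier A" "?y \<in> carrier A" using True by (auto intro!: carrier_single simp: paths_def)
      have "relation1 C k l \<in> RI" using kl by (intro relation_in_RI) (auto simp: relations_def)
      then have "path_mult ?x (path_mult (relation1 C k l) ?y) \<in> RI" using c RI_mult by blast
      moreover have "path_mult ?x (path_mult (relation1 C k l) ?y)
        = path_single (i, w @ eps_word k (bond k l) @ Alpha k l # w', pt) (1::'k) - path_single (i, w @ Alpha k l # eps_word l (bond l k) @ w', pt) 1"
        unfolding relation1_eq path_mult_diff by (simp add: path_mult_single bond_def)
      ultimately have *: "F (path_single (i, w @ eps_word k (bond k l) @ Alpha k l # w', pt) 1 - path_single (i, w @ Alpha k l # eps_word l (bond l k) @ w', pt) 1) = 0"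
        using F_RI by simp
      have p: "(i, w @ eps_word k (bond k l) @ Alpha k l # w', pt) \<in> paths C" "(i, w @ Alpha k l # eps_word l (bond l k) @ w', pt) \<in> paths C"
        using True kl by (auto simp: paths_def is_walk_append)
      then have "F (path_single (i, w @ eps_word k (bond k l) @ Alpha k l # w', pt) 1) = F (path_single (i, w @ Alpha k l # eps_word l (bond l k) @ w', pt) 1)"
        using * F_add[OF carrier_diff[OF carrier_single[OF p(1), of 1] carrier_single[OF p(2), of 1]] carrier_single[OF p(2), of 1]]
        by simp
      then show ?thesis using p by (simp add: g_def paths_def)
    next
      case False
      then show ?thesis by (auto simp: g_def is_walk_append is_walk_eps_word_iff)
    qed
  qed
  moreover have "rel2_sum k w w' g = 0" for k w w'
  proof (cases "is_walk C i w k \<and> is_walk C k w' pt")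
    case True
    let ?x = "path_single (i, w, k) (1::'k)" and ?y = "path_single (k, w', pt) (1::'k)"
    let ?q = "\<lambda>l n. (i, w @ eps_word k n @ Alpha k l # Alpha l k # eps_word k (bond k l - 1 - n) @ w', pt)"
    have c: "?x \<in> carrier A" "?y \<in> carrier A" using True by (auto intro!: carrier_single simp: paths_def)
    have q: "?q l n \<in> paths C" if "adj C l k" for l n
    proof -
      have "adj C k l" using that adj_sym by blast
      then have "is_walk C k (eps_word k n @ Alpha k l # Alpha l k # eps_word k (bond k l - 1 - n) @ w') pt" using True that by simp
      moreover have "is_walk C i w k" using True by blast
      ultimately have "is_walk C i (w @ eps_word k n @ Alpha k l # Alpha l k # eps_word k (bond k l - 1 - n) @ w') pt"
        unfolding is_walk_append[of C i w] by blast
      then show ?thesis by (simp add: paths_def)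
    qed
    have "relation2 C \<omega> k \<in> RI" by (intro relation_in_RI) (auto simp: relations_def)
    then have "path_mult ?x (path_mult (relation2 C \<omega> k) ?y) \<in> RI" using c RI_mult by blast
    moreover have "path_mult ?x (path_mult (relation2 C \<omega> k) ?y) = (\<Sum>l | adj C l k. \<Sum>n<bond k l. path_single (?q l n) (\<omega> k l))"
      unfolding relation2_eq path_mult_sum_left path_mult_sum_right by (simp add: path_mult_single bond_def)
    ultimately have "0 = F (\<Sum>l | adj C l k. \<Sum>n<bond k l. path_single (?q l n) (\<omega> k l))" using F_RI by simp
    also have "\<dots> = (\<Sum>l | adj C l k. \<Sum>n<bond k l. F (path_single (?q l n) (\<omega> k l)))"
      using q by (subst F_sum, blast intro: carrier_sum carrier_single) (intro sum.cong refl F_sum carrier_single, blast)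
    also have "\<dots> = rel2_sum k w w' g"
      unfolding rel2_sum_def
    proof (intro sum.cong refl)
      fix l n assume "l \<in> {l. adj C l k}"
      then have "?q l n \<in> paths C" using q by blast
      then show "F (path_single (?q l n) (\<omega> k l)) = \<omega> k l * g (w @ eps_word k n @ Alpha k l # Alpha l k # eps_word k (bond k l - 1 - n) @ w')"
        using F_single[of "?q l n" "\<omega> k l"] by (simp add: g_def paths_def)
    qed
    finally show ?thesis by simp
  next
    case False
    then have "g (w @ eps_word k n @ Alpha k l # Alpha l k # eps_word k m @ w') = 0" for l n m
      by (auto simp: g_def is_walk_append is_walk_eps_word_iff)
    then show ?thesis by (simp add: rel2_sum_def)
  qed
  ultimately have gD: "g \<in> dual_level i a" if "int a = - v" for a
    using deg that unfolding dual_level_def supported_def by fastforce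
  have gm: "g \<in> (if v \<le> 0 then dual_part i (nat (- v)) (- u) else {\<lambda>_. 0})"
  proof (cases "v \<le> 0")
    case True
    then show ?thesis using gD[of "nat (- v)"] deg by (simp add: dual_part_def)
  next
    case False
    then have "g w = 0" for w using deg[of w] by fastforce
    then show ?thesis using False by auto
  qed
  then have gD': "\<exists>a. g \<in> dual_level i a"
    using dual_level_zero by (auto simp: dual_part_def split: if_splits)
  have lin_F: "F (path_mult (gen_e i) (path_mult x ee0)) = lin_ext (word_functional i g) x" if "x \<in> carrier A" for x
    using that
  proof (induction x rule: carrier_induct)
    case (single p c)
    obtain k w l where p: "p = (k, w, l)" by (metis prod_cases3)
    show ?case
    proof (cases "k = i \<and> l = pt")
      case True
      then show ?thesis using F_single[OF single, of c] single by (simp add: p gen_e_def path_mult_single g_def paths_def)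
    next
      case False
      then show ?thesis by (auto simp: p gen_e_def path_mult_single F0)
    qed
  next
    case (add x y)
    then show ?case
      by (simp add: path_mult_add_left path_mult_add_right lin_ext_add F_add carrier_mult gen_e_carrier)
  qed (simp add: F0)
  have "cl (gen_e i) \<odot>\<^bsub>IV\<^esub> f = Theta i g"
    unfolding IV_smult
  proof
    fix X
    show "(if X \<in> carrier MV then f (cl (gen_e i) \<odot>\<^bsub>MV\<^esub> X) else 0) = Theta i g X"
    proof (cases "X \<in> carrier MV")
      case True
      then obtain x where x: "X = mod_proj x" "x \<in> carrier A" unfolding carrier_MV by blast
      have "f (cl (gen_e i) \<odot>\<^bsub>MV\<^esub> X) = F (path_mult (gen_e i) x)"
        using x by (simp add: mod_proj_smult gen_e_carrier F_def)
      also have "\<dots> = F (path_mult (path_mult (gen_e i) x) ee0)"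
        using mod_proj_ee0[OF carrier_mult[OF gen_e_carrier x(2)]] by (simp add: F_def)
      also have "\<dots> = lin_ext (word_functional i g) x" using lin_F[OF x(2)] by (simp add: path_mult_assoc)
      also have "\<dots> = Theta i g X" using gD' Theta_mod_proj x by metis
      finally show ?thesis using True by simp
    qed (simp add: Theta_def)
  qed
  then show ?thesis using that gm by blast
qed

lemma image_component_IV:
  "image_component (cl (gen_e i)) IV u v = Theta i ` (if v \<le> 0 then dual_part i (nat (- v)) (- u) else {\<lambda>_. 0})"
  (is "_ = Theta i ` ?K")
proof (intro equalityI subsetI)
  fix h assume "h \<in> image_component (cl (gen_e i)) IV u v"
  then obtain f where f: "f \<in> component IV u v" "h = cl (gen_e i) \<odot>\<^bsub>IV\<^esub> f"
    unfolding image_component_def by blast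
  obtain g where "g \<in> ?K" "cl (gen_e i) \<odot>\<^bsub>IV\<^esub> f = Theta i g" using component_Theta[OF f(1)] .
  then show "h \<in> Theta i ` ?K" using f(2) by blast
next
  fix h assume "h \<in> Theta i ` ?K"
  then obtain g where g: "g \<in> ?K" "h = Theta i g" by blast
  have "Theta i g \<in> component IV u v \<and> cl (gen_e i) \<odot>\<^bsub>IV\<^esub> Theta i g = Theta i g"
  proof (cases "v \<le> 0")
    case True
    then have "g \<in> dual_part i (nat (- v)) (- u)" using g(1) by simp
    from Theta_component[OF this] True show ?thesis by simp
  next
    case False
    then have g0: "g = (\<lambda>_. 0)" using g(1) by simp
    have "lin_ext (word_functional i g) x = 0" for x by (rule trans[OF _ lin_ext_zero]) (simp add: lin_ext_def g0 word_functional_def case_prod_unfold)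
    then have z: "Theta i g = (\<lambda>_. 0)" by (simp add: Theta_def fun_eq_iff)
    have "(\<lambda>_. 0) \<in> component IV u v" by (simp add: IV_component functionals_def)
    then show ?thesis unfolding z IV_smult by simp
  qed
  then show "h \<in> image_component (cl (gen_e i)) IV u v"
    unfolding image_component_def g(2) by (metis image_eqI)
qed

lemma Theta_inj:
  assumes g: "g \<in> dual_part i a u" and z: "Theta i g = (\<lambda>_. 0)" shows "g = (\<lambda>_. 0)"
proof
  fix w
  have gD: "g \<in> dual_level i a" using g by (simp add: dual_part_def)
  show "g w = 0"
  proof (cases "is_walk C i w pt")
    case True
    then have "path_single (i, w, pt) 1 \<in> carrier A" by (intro carrier_single) (simp add: paths_def)
    from Theta_mod_proj[OF gD this] z show ?thesis by simp
  next
    case False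
    then show ?thesis using gD by (auto simp: dual_level_def supported_def)
  qed
qed

lemma qt_dim_IV: "qt_dim (image_component (cl (gen_e i)) IV) u v
  = (if v \<le> 0 then int (fs.dim (dual_part i (nat (- v)) (- u))) else 0)"
proof (cases "v \<le> 0")
  case True
  have "fs.dim (Theta i ` dual_part i (nat (- v)) (- u)) = fs.dim (dual_part i (nat (- v)) (- u))"
    by (rule dim_injective[OF linear_Theta subspace_dual_part fin_dim_dual_part]) (rule Theta_inj)
  then show ?thesis using True by (simp add: qt_dim_def image_component_IV)
next
  case False
  have "Theta i (\<lambda>_. 0) = (\<lambda>_. 0)"
    using linear_Theta by (simp add: Theta_def fun_eq_iff lin_ext_def word_functional_def case_prod_unfold)
  then show ?thesis using False by (simp add: qt_dim_def image_component_IV dim_trivial)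
qed

end

section \<open>Comparison of coefficients\<close>

lemma qt_coeff_add: "qt_coeff (f + g) u v = qt_coeff f u v + qt_coeff g u v"
  by (simp add: qt_coeff_def)

lemma qt_coeff_sum: "qt_coeff (\<Sum>s\<in>S. f s) u v = (\<Sum>s\<in>S. qt_coeff (f s) u v)"
  by (induction S rule: infinite_finite_induct) (simp_all add: qt_coeff_add, simp_all add: qt_coeff_def)

lemma qt_coeff_of_int: "qt_coeff (of_int c * f) u v = c * qt_coeff f u v"
  by (simp add: qt_coeff_def)

lemma tpow_add: "tpow (a + b) = tpow a * tpow b"
  by (simp only: tpow_def fls_X_intpow_times_fls_X_intpow minus_add_distrib)

theorem corollary3p14:
  fixes C :: "int^'i::finite^'i" and d :: "'i \<Rightarrow> nat"
    and \<omega> :: "'i \<Rightarrow> 'i \<Rightarrow> 'k::field" and i j :: 'i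
  assumes "cartan_matrix_of_simple_type C"
    and "coprime_symmetrizer C d"
    and "sign_choice C \<omega>"
  shows "qt_dim (image_component (preproj_class C \<omega> (gen_e i)) (Ibar C d \<omega> j)) =
    qt_coeff (qpow (- int (d j)) * tpow 1 *
      (\<Sum>u\<in>{0..int (lacing_number C * dual_coxeter_number C)}. \<Sum>v\<in>{0..int (coxeter_number C)}.
         of_int (ctilde C d i j u (- v)) * qpow u * tpow (- v)))"
proof (intro ext)
  fix u v
  interpret simple_cartan C d by (rule simple_cartan.intro) (rule assms)+
  interpret w: word_module C d \<omega> j by unfold_locales (rule assms)
  \<comment> \<open>Each column of the inverse is interpreted by the dual module at its own
    vertex.\<close>
  have nonneg: "fls_nth (qlevel b k l) m \<ge> 0" if "b \<le> cox" for b k l m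
  proof -
    interpret w': word_module C d \<omega> l by unfold_locales (rule assms)
    show ?thesis by (rule w'.qlevel_nonneg_pt[OF that])
  qed
  define M where "M = int (lacing_number C * dual_coxeter_number C)"
  have bounds: "0 \<le> m" "m \<le> M" if "b \<le> cox" "fls_nth (qlevel b i j) m \<noteq> 0" for b m
    using qlevel_bounds[OF nonneg that] by (auto simp: M_def)
  \<comment> \<open>Degree \<open>v\<close> is level \<open>- v\<close>, counted by
    \<open>qlevel\<close> at \<open>1 - v\<close>. The bound by \<open>cox\<close> is essential:
    beyond it the module is 0, while \<open>qlevel\<close> continues with negative
    coefficients.\<close>
  have lhs: "qt_dim (image_component (preproj_class C \<omega> (gen_e i)) (Ibar C d \<omega> j)) u v
    = (if v \<le> 0 \<and> nat (1 - v) \<le> cox then fls_nth (qlevel (nat (1 - v)) i j) (u + int (d j)) else 0)"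
  proof (cases "v \<le> 0")
    case True
    define a where "a = nat (- v)"
    have v: "nat (1 - v) = Suc a" using True by (simp add: a_def)
    have e: "qt_dim (image_component (preproj_class C \<omega> (gen_e i)) (Ibar C d \<omega> j)) u v = int (fs.dim (w.dual_part i a (- u)))"
      unfolding w.qt_dim_IV a_def using True by simp
    show ?thesis
    proof (cases "Suc a \<le> cox")
      case True
      then show ?thesis using \<open>v \<le> 0\<close> w.dim_dual_part[of a i "- u"] unfolding e v by (simp add: D_def add.commute)
    next
      case False
      then show ?thesis using w.dual_part_top[of a i "- u"] unfolding e v by (simp add: dim_trivial)
    qed
  next
    case False
    then show ?thesis by (simp add: w.qt_dim_IV)
  qed
  let ?S = "\<Sum>u\<in>{0..M}. \<Sum>v\<in>{0..int cox}. of_int (ctilde C d i j u (- v)) * qpow u * tpow (- v)"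
  have e: "qpow (u' - int (d j)) = qpow (- int (d j)) * qpow u'" "tpow (1 - v') = tpow 1 * tpow (- v')" for u' v'
    using qpow_add[of "- int (d j)" u'] tpow_add[of 1 "- v'"] by simp_all
  have "qt_coeff (qpow (- int (d j)) * tpow 1 * ?S) u v
    = (\<Sum>u'\<in>{0..M}. \<Sum>v'\<in>{0..int cox}. qt_coeff (of_int (ctilde C d i j u' (- v')) * (qpow (u' - int (d j)) * tpow (1 - v'))) u v)"
    unfolding sum_distrib_left qt_coeff_sum
    by (intro sum.cong refl arg_cong[where f = "\<lambda>x. qt_coeff x u v"])
      (simp only: e ac_simps)
  also have "\<dots> = (\<Sum>u'\<in>{0..M}. \<Sum>v'\<in>{0..int cox}. if u' = u + int (d j) \<and> v' = 1 - v then ctilde C d i j (u + int (d j)) (- (1 - v)) else 0)"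
    unfolding qt_coeff_of_int qt_coeff_monom by (intro sum.cong refl) auto
  also have "\<dots> = (\<Sum>u'\<in>{0..M}. if u' = u + int (d j) then
      \<Sum>v'\<in>{0..int cox}. if v' = 1 - v then ctilde C d i j (u + int (d j)) (- (1 - v)) else 0 else 0)"
    by (intro sum.cong refl) simp
  also have "\<dots> = (if u + int (d j) \<in> {0..M} \<and> 1 - v \<in> {0..int cox} then ctilde C d i j (u + int (d j)) (- (1 - v)) else 0)"
    by simp
  also have "\<dots> = (if v \<le> 0 \<and> nat (1 - v) \<le> cox then fls_nth (qlevel (nat (1 - v)) i j) (u + int (d j)) else 0)"
  proof (cases "1 - v \<in> {0..int cox}")
    case True
    define b where "b = nat (1 - v)"
    have b: "1 - v = int b" "b \<le> cox" using True by (auto simp: b_def)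
    have c: "ctilde C d i j (u + int (d j)) (- (1 - v)) = fls_nth (qlevel b i j) (u + int (d j))"
      unfolding b(1) by (rule ctilde_qlevel)
    have "fls_nth (qlevel b i j) (u + int (d j)) = 0" if "u + int (d j) \<notin> {0..M}"
      using bounds[OF b(2), of "u + int (d j)"] that by auto
    \<comment> \<open>Only \<open>v = 1\<close> is left, the summand of index 0 in \<open>t\<close>,
      whose coefficients vanish.\<close>
    moreover have "fls_nth (qlevel b i j) (u + int (d j)) = 0" if "\<not> v \<le> 0"
    proof -
      have "b = 0" using that b(1) by linarith
      then show ?thesis by simp
    qed
    moreover have "nat (1 - v) = b" by (simp add: b_def)
    ultimately show ?thesis unfolding c using True b(2) by (simp only: simp_thms if_True split: if_split) metis
  next
    case False
    then show ?thesis by auto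
  qed
  finally show "qt_dim (image_component (preproj_class C \<omega> (gen_e i)) (Ibar C d \<omega> j)) u v =
    qt_coeff (qpow (- int (d j)) * tpow 1 *
      (\<Sum>u\<in>{0..int (lacing_number C * dual_coxeter_number C)}. \<Sum>v\<in>{0..int (coxeter_number C)}.
         of_int (ctilde C d i j u (- v)) * qpow u * tpow (- v))) u v"
    unfolding lhs coxeter_number_eq M_def by simp
qed

end
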